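(* Let $k$ be a field, $0\neq q\in k$, and let $m\le n$ be positive integers. Regard $\mathcal{O}_q(M_{mn})$ as a left $\mathcal{O}_q(SL_m)$-comodule algebra via the algebra morphism $\Lambda:\mathcal{O}_q(M_{mn})\to\mathcal{O}_q(SL_m)\otimes\mathcal{O}_q(M_{mn})$, $Z_{ij}\mapsto\sum_{k=1}^m U_{ik}\otimes Z_{kj}$. Then the set of coinvariants is the quantum grassmannian: $$\mathcal{O}_q(M_{mn})^{\mathrm{co}\,\mathcal{O}_q(SL_m)}=\mathcal{G}_q(m,n).$$
   Context: $\mathcal{O}_q(M_{mn})$ is the (unital associative) $k$-algebra generated by $Z_{ij}$, $1\le i\le m$, $1\le j\le n$, subject to the relations, for $1\le i<s\le m$ and $1\le j<l\le n$: $Z_{ij}Z_{il}=qZ_{il}Z_{ij}$, $Z_{ij}Z_{sj}=qZ_{sj}Z_{ij}$, $Z_{il}Z_{sj}=Z_{sj}Z_{il}$, $Z_{ij}Z_{sl}-Z_{sl}Z_{ij}=(q-q^{-1})Z_{il}Z_{sj}$. For an $m$-element subset $J=\{j_1<\dots<j_m\}\subseteq\{1,\dots,n\}$ the maximal quantum minor is $[J]=\sum_{\sigma\in S_m}(-q)^{\ell(\sigma)}Z_{1 j_{\sigma(1)}}\cdots Z_{m j_{\sigma(m)}}$, where $\ell(\sigma)$ is the length of $\sigma$. The quantum grassmannian $\mathcal{G}_q(m,n)$ is the $k$-subalgebra of $\mathcal{O}_q(M_{mn})$ generated by all the $[J]$. $\mathcal{O}_q(M_m)=\mathcal{O}_q(M_{mm})$,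 with generators $T_{ij}$, has the central quantum determinant $D_q=\sum_{\sigma\in S_m}(-q)^{\ell(\sigma)}T_{1\sigma(1)}\cdots T_{m\sigma(m)}$, and $\mathcal{O}_q(SL_m)=\mathcal{O}_q(M_m)/\langle D_q-1\rangle$, a Hopf algebra with comultiplication $U_{ij}\mapsto\sum_l U_{il}\otimes U_{lj}$ and counit $U_{ij}\mapsto\delta_{ij}$, where $U_{ij}$ is the image of $T_{ij}$. For a Hopf algebra $H$ and a left $H$-comodule $\gamma:M\to H\otimes M$, the coinvariants are $M^{\mathrm{co}\,H}=\{x\in M:\gamma(x)=1\otimes x\}$. *)

theory Defs
  imports
    "HOL-Algebra.QuotRing"
    "HOL-Algebra.Module"
    "HOL-Algebra.Subrings"
    "HOL-Library.Poly_Mapping"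
    "HOL-Combinatorics.Permutations"
begin

section \<open>Associative unital algebras over a field\<close>

text \<open>
  The ground field is a type of class \<^class>\<open>field\<close>.  A (noncommutative) algebra over it is
  given by a record of type \<open>('k, 'a) module\<close>, which contains both the ring operations and the
  scalar multiplication.
\<close>

definition alg_hom :: "('k, 'a) module \<Rightarrow> ('k, 'b) module \<Rightarrow> ('a \<Rightarrow> 'b) set" where
  "alg_hom A B =
    {h \<in> ring_hom A B. \<forall>c. \<forall>x \<in> carrier A. h (c \<odot>\<^bsub>A\<^esub> x) = c \<odot>\<^bsub>B\<^esub> h x}"

text \<open>
  The algebra morphism from \<open>A\<close> to \<open>B\<close> with property \<open>P\<close>; below \<open>P\<close> always prescribes the
  values on a set generating \<open>A\<close>.  Extensionality only fixes the values outside the carrier.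
\<close>

definition the_alg_hom ::
    "('k, 'a) module \<Rightarrow> ('k, 'b) module \<Rightarrow> (('a \<Rightarrow> 'b) \<Rightarrow> bool) \<Rightarrow> 'a \<Rightarrow> 'b" where
  "the_alg_hom A B P = (THE h. h \<in> alg_hom A B \<and> h \<in> extensional (carrier A) \<and> P h)"

definition generated_subalgebra :: "('k, 'a) module \<Rightarrow> 'a set \<Rightarrow> 'a set" where
  "generated_subalgebra A X =
    (\<lambda>S. subring S A \<and> (\<forall>c. \<forall>x \<in> S. c \<odot>\<^bsub>A\<^esub> x \<in> S)) hull X"

definition ground_algebra :: "('k::field, 'k) module" where
  "ground_algebra =
    \<lparr>carrier = UNIV, monoid.mult = (*), one = 1, zero = 0, add = (+), smult = (*)\<rparr>"

text \<open>The quotient by \<open>I\<close>, with the elements of the quotient being cosets.\<close>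

definition quotient_algebra :: "('k, 'a) module \<Rightarrow> 'a set \<Rightarrow> ('k, 'a set) module" where
  "quotient_algebra A I =
    \<lparr>carrier = carrier (A Quot I), monoid.mult = monoid.mult (A Quot I), one = one (A Quot I),
     zero = zero (A Quot I), add = add (A Quot I),
     smult = (\<lambda>c X. \<Union>x\<in>X. I +>\<^bsub>A\<^esub> (c \<odot>\<^bsub>A\<^esub> x))\<rparr>"

definition scale_pm :: "'k::field \<Rightarrow> ('x \<Rightarrow>\<^sub>0 'k) \<Rightarrow> ('x \<Rightarrow>\<^sub>0 'k)" where
  "scale_pm c f = Poly_Mapping.map ((*) c) f"

text \<open>
  The monoid algebra of \<open>M\<close>: the vector space with basis \<open>M\<close>, the basis vector of \<open>x\<close> being
  \<^term>\<open>Poly_Mapping.single x 1\<close>, multiplied by bilinear extension of the product of \<open>M\<close>.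
\<close>

definition monoid_algebra :: "('x, 'm) monoid_scheme \<Rightarrow> ('k::field, 'x \<Rightarrow>\<^sub>0 'k) module" where
  "monoid_algebra M =
    \<lparr>carrier = {f. Poly_Mapping.keys f \<subseteq> carrier M},
     monoid.mult = (\<lambda>f g. \<Sum>x\<in>Poly_Mapping.keys f. \<Sum>y\<in>Poly_Mapping.keys g.
               Poly_Mapping.single (x \<otimes>\<^bsub>M\<^esub> y) (Poly_Mapping.lookup f x * Poly_Mapping.lookup g y)),
     one = Poly_Mapping.single \<one>\<^bsub>M\<^esub> 1, zero = 0, add = (+), smult = scale_pm\<rparr>"

definition free_monoid :: "'x set \<Rightarrow> 'x list monoid" where
  "free_monoid X = \<lparr>carrier = lists X, monoid.mult = (@), one = []\<rparr>"

abbreviation free_algebra :: "'x set \<Rightarrow> ('k::field, 'x list \<Rightarrow>\<^sub>0 'k) module" where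
  "free_algebra X \<equiv> monoid_algebra (free_monoid X)"


subsection \<open>Tensor products\<close>

definition bilinear_relations ::
    "('k::field, 'a) module \<Rightarrow> ('k, 'b) module \<Rightarrow> ('a \<times> 'b \<Rightarrow>\<^sub>0 'k) set" where
  "bilinear_relations A B =
    {Poly_Mapping.single (a \<oplus>\<^bsub>A\<^esub> a', b) 1
       - Poly_Mapping.single (a, b) 1 - Poly_Mapping.single (a', b) 1
      | a a' b. a \<in> carrier A \<and> a' \<in> carrier A \<and> b \<in> carrier B} \<union>
    {Poly_Mapping.single (a, b \<oplus>\<^bsub>B\<^esub> b') 1
       - Poly_Mapping.single (a, b) 1 - Poly_Mapping.single (a, b') 1
      | a b b'. a \<in> carrier A \<and> b \<in> carrier B \<and> b' \<in> carrier B} \<union>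
    {Poly_Mapping.single (c \<odot>\<^bsub>A\<^esub> a, b) 1 - Poly_Mapping.single (a, b) c
      | c a b. a \<in> carrier A \<and> b \<in> carrier B} \<union>
    {Poly_Mapping.single (a, c \<odot>\<^bsub>B\<^esub> b) 1 - Poly_Mapping.single (a, b) c
      | c a b. a \<in> carrier A \<and> b \<in> carrier B}"

text \<open>
  The tensor product of two algebras: the vector space with basis \<open>A \<times> B\<close> modulo the subspace
  spanned by the bilinearity relations.  This subspace is stable under multiplication by pairs
  \<open>(a, b)\<close>, hence is an ideal of the monoid algebra of the multiplicative monoid \<open>A \<times> B\<close>, and the
  multiplication of the quotient is \<open>(a \<otimes> b) (a' \<otimes> b') = a a' \<otimes> b b'\<close>.
\<close>

definition tensor_null ::
    "('k::field, 'a) module \<Rightarrow> ('k, 'b) module \<Rightarrow> ('a \<times> 'b \<Rightarrow>\<^sub>0 'k) set" where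
  "tensor_null A B = Modules.module.span scale_pm (bilinear_relations A B)"

definition tensor_algebra ::
    "('k::field, 'a) module \<Rightarrow> ('k, 'b) module \<Rightarrow> ('k, ('a \<times> 'b \<Rightarrow>\<^sub>0 'k) set) module" where
  "tensor_algebra A B = quotient_algebra (monoid_algebra (A \<times>\<times> B)) (tensor_null A B)"

definition pure_tensor ::
    "('k::field, 'a) module \<Rightarrow> ('k, 'b) module \<Rightarrow> 'a \<Rightarrow> 'b \<Rightarrow> ('a \<times> 'b \<Rightarrow>\<^sub>0 'k) set" where
  "pure_tensor A B a b =
    tensor_null A B +>\<^bsub>monoid_algebra (A \<times>\<times> B)\<^esub> Poly_Mapping.single (a, b) 1"

definition tensor_hom ::
    "('k::field, 'a) module \<Rightarrow> ('k, 'b) module \<Rightarrow> ('k, 'c) module \<Rightarrow> ('k, 'd) module \<Rightarrow>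
     ('a \<Rightarrow> 'c) \<Rightarrow> ('b \<Rightarrow> 'd) \<Rightarrow> ('a \<times> 'b \<Rightarrow>\<^sub>0 'k) set \<Rightarrow> ('c \<times> 'd \<Rightarrow>\<^sub>0 'k) set" where
  "tensor_hom A B C D f g =
    the_alg_hom (tensor_algebra A B) (tensor_algebra C D)
      (\<lambda>h. \<forall>a \<in> carrier A. \<forall>b \<in> carrier B.
         h (pure_tensor A B a b) = pure_tensor C D (f a) (g b))"

definition tensor_assoc ::
    "('k::field, 'a) module \<Rightarrow> ('k, 'b) module \<Rightarrow> ('k, 'c) module \<Rightarrow>
     (('a \<times> 'b \<Rightarrow>\<^sub>0 'k) set \<times> 'c \<Rightarrow>\<^sub>0 'k) set \<Rightarrow> ('a \<times> ('b \<times> 'c \<Rightarrow>\<^sub>0 'k) set \<Rightarrow>\<^sub>0 'k) set" where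
  "tensor_assoc A B C =
    the_alg_hom (tensor_algebra (tensor_algebra A B) C) (tensor_algebra A (tensor_algebra B C))
      (\<lambda>h. \<forall>a \<in> carrier A. \<forall>b \<in> carrier B. \<forall>c \<in> carrier C.
         h (pure_tensor (tensor_algebra A B) C (pure_tensor A B a b) c) =
           pure_tensor A (tensor_algebra B C) a (pure_tensor B C b c))"


subsection \<open>Comodule algebras and coinvariants\<close>

text \<open>
  The comodule axioms are coassociativity, \<open>(\<Delta> \<otimes> id) \<circ> \<gamma> = (id \<otimes> \<gamma>) \<circ> \<gamma>\<close> up to the associativity
  isomorphism, and counitality, \<open>(\<epsilon> \<otimes> id) (\<gamma> x) = 1 \<otimes> x\<close> in the tensor product of the ground
  field with \<open>M\<close>.
\<close>

definition left_comodule_algebra ::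
    "('k::field, 'h) module \<Rightarrow> ('h \<Rightarrow> ('h \<times> 'h \<Rightarrow>\<^sub>0 'k) set) \<Rightarrow> ('h \<Rightarrow> 'k) \<Rightarrow>
     ('k, 'a) module \<Rightarrow> ('a \<Rightarrow> ('h \<times> 'a \<Rightarrow>\<^sub>0 'k) set) \<Rightarrow> bool" where
  "left_comodule_algebra H \<Delta> \<epsilon> M \<gamma> \<longleftrightarrow>
    \<gamma> \<in> alg_hom M (tensor_algebra H M) \<and>
    (\<forall>x \<in> carrier M.
      tensor_assoc H H M (tensor_hom H M (tensor_algebra H H) M \<Delta> id (\<gamma> x)) =
        tensor_hom H M H (tensor_algebra H M) id \<gamma> (\<gamma> x)) \<and>
    (\<forall>x \<in> carrier M.
      tensor_hom H M ground_algebra M \<epsilon> id (\<gamma> x) = pure_tensor ground_algebra M 1 x)"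

definition coinvariants ::
    "('k::field, 'h) module \<Rightarrow> ('k, 'a) module \<Rightarrow> ('a \<Rightarrow> ('h \<times> 'a \<Rightarrow>\<^sub>0 'k) set) \<Rightarrow> 'a set" where
  "coinvariants H M \<gamma> = {x \<in> carrier M. \<gamma> x = pure_tensor H M \<one>\<^bsub>H\<^esub> x}"


section \<open>Quantum matrices\<close>

definition index_set :: "nat \<Rightarrow> nat \<Rightarrow> (nat \<times> nat) set" where
  "index_set m n = {1..m} \<times> {1..n}"

definition free_gen :: "nat \<Rightarrow> nat \<Rightarrow> (nat \<times> nat) list \<Rightarrow>\<^sub>0 'k::field" where
  "free_gen i j = Poly_Mapping.single [(i, j)] 1"

text \<open>
  The row relations hold in every row (including the last one) and the column relations in
  every column.
\<close>

definition qmatrix_relations ::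
    "'k::field \<Rightarrow> nat \<Rightarrow> nat \<Rightarrow> ((nat \<times> nat) list \<Rightarrow>\<^sub>0 'k) set" where
  "qmatrix_relations q m n =
    (let F = free_algebra (index_set m n); Z = free_gen in
      {Z i j \<otimes>\<^bsub>F\<^esub> Z i l \<ominus>\<^bsub>F\<^esub> q \<odot>\<^bsub>F\<^esub> (Z i l \<otimes>\<^bsub>F\<^esub> Z i j)
        | i j l. 1 \<le> i \<and> i \<le> m \<and> 1 \<le> j \<and> j < l \<and> l \<le> n} \<union>
      {Z i j \<otimes>\<^bsub>F\<^esub> Z s j \<ominus>\<^bsub>F\<^esub> q \<odot>\<^bsub>F\<^esub> (Z s j \<otimes>\<^bsub>F\<^esub> Z i j)
        | i s j. 1 \<le> i \<and> i < s \<and> s \<le> m \<and> 1 \<le> j \<and> j \<le> n} \<union>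
      {Z i l \<otimes>\<^bsub>F\<^esub> Z s j \<ominus>\<^bsub>F\<^esub> Z s j \<otimes>\<^bsub>F\<^esub> Z i l
        | i s j l. 1 \<le> i \<and> i < s \<and> s \<le> m \<and> 1 \<le> j \<and> j < l \<and> l \<le> n} \<union>
      {(Z i j \<otimes>\<^bsub>F\<^esub> Z s l \<ominus>\<^bsub>F\<^esub> Z s l \<otimes>\<^bsub>F\<^esub> Z i j)
          \<ominus>\<^bsub>F\<^esub> (q - inverse q) \<odot>\<^bsub>F\<^esub> (Z i l \<otimes>\<^bsub>F\<^esub> Z s j)
        | i s j l. 1 \<le> i \<and> i < s \<and> s \<le> m \<and> 1 \<le> j \<and> j < l \<and> l \<le> n})"

definition qmatrix_ideal :: "'k::field \<Rightarrow> nat \<Rightarrow> nat \<Rightarrow> ((nat \<times> nat) list \<Rightarrow>\<^sub>0 'k) set" where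
  "qmatrix_ideal q m n = genideal (free_algebra (index_set m n)) (qmatrix_relations q m n)"

definition Oq_M :: "'k::field \<Rightarrow> nat \<Rightarrow> nat \<Rightarrow> ('k, ((nat \<times> nat) list \<Rightarrow>\<^sub>0 'k) set) module" where
  "Oq_M q m n = quotient_algebra (free_algebra (index_set m n)) (qmatrix_ideal q m n)"

definition Z_gen ::
    "'k::field \<Rightarrow> nat \<Rightarrow> nat \<Rightarrow> nat \<Rightarrow> nat \<Rightarrow> ((nat \<times> nat) list \<Rightarrow>\<^sub>0 'k) set" where
  "Z_gen q m n i j = qmatrix_ideal q m n +>\<^bsub>free_algebra (index_set m n)\<^esub> free_gen i j"

text \<open>The length of a permutation of \<open>{1..m}\<close>, as its number of inversions.\<close>

definition perm_length :: "nat \<Rightarrow> (nat \<Rightarrow> nat) \<Rightarrow> nat" where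
  "perm_length m \<sigma> = card {(i, j). 1 \<le> i \<and> i < j \<and> j \<le> m \<and> \<sigma> j < \<sigma> i}"

text \<open>
  The sum of \<open>(-q)\<^bsup>\<ell>(\<sigma>)\<^esup> Z\<^bsub>1,c(\<sigma>(1))\<^esub> \<cdots> Z\<^bsub>m,c(\<sigma>(m))\<^esub>\<close> over all permutations
  \<open>\<sigma>\<close> of \<open>{1..m}\<close>; the right fold multiplies the factors in this order.
\<close>

definition qminor_cols ::
    "'k::field \<Rightarrow> nat \<Rightarrow> nat \<Rightarrow> (nat \<Rightarrow> nat) \<Rightarrow> ((nat \<times> nat) list \<Rightarrow>\<^sub>0 'k) set" where
  "qminor_cols q m n c =
    (\<Oplus>\<^bsub>Oq_M q m n\<^esub>\<sigma>\<in>{\<sigma>. \<sigma> permutes {1..m}}.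
      (- q) ^ perm_length m \<sigma> \<odot>\<^bsub>Oq_M q m n\<^esub>
        foldr (monoid.mult (Oq_M q m n)) (map (\<lambda>i. Z_gen q m n i (c (\<sigma> i))) [1..<Suc m])
          \<one>\<^bsub>Oq_M q m n\<^esub>)"

text \<open>For \<open>J = {j\<^sub>1 < \<dots> < j\<^sub>m}\<close> the element \<open>j\<^sub>k\<close> is entry \<open>k - 1\<close> of the sorted list of \<open>J\<close>.\<close>

definition max_qminor ::
    "'k::field \<Rightarrow> nat \<Rightarrow> nat \<Rightarrow> nat set \<Rightarrow> ((nat \<times> nat) list \<Rightarrow>\<^sub>0 'k) set" where
  "max_qminor q m n J = qminor_cols q m n (\<lambda>k. sorted_list_of_set J ! (k - 1))"

definition qdet :: "'k::field \<Rightarrow> nat \<Rightarrow> ((nat \<times> nat) list \<Rightarrow>\<^sub>0 'k) set" where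
  "qdet q m = qminor_cols q m m (\<lambda>k. k)"

definition quantum_grassmannian ::
    "'k::field \<Rightarrow> nat \<Rightarrow> nat \<Rightarrow> ((nat \<times> nat) list \<Rightarrow>\<^sub>0 'k) set set" where
  "quantum_grassmannian q m n =
    generated_subalgebra (Oq_M q m n) {max_qminor q m n J | J. J \<subseteq> {1..n} \<and> card J = m}"


subsection \<open>The quantum special linear group and its coaction\<close>

definition qdet_ideal :: "'k::field \<Rightarrow> nat \<Rightarrow> ((nat \<times> nat) list \<Rightarrow>\<^sub>0 'k) set set" where
  "qdet_ideal q m = genideal (Oq_M q m m) {qdet q m \<ominus>\<^bsub>Oq_M q m m\<^esub> \<one>\<^bsub>Oq_M q m m\<^esub>}"

definition Oq_SL :: "'k::field \<Rightarrow> nat \<Rightarrow> ('k, ((nat \<times> nat) list \<Rightarrow>\<^sub>0 'k) set set) module" where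
  "Oq_SL q m = quotient_algebra (Oq_M q m m) (qdet_ideal q m)"

definition U_gen :: "'k::field \<Rightarrow> nat \<Rightarrow> nat \<Rightarrow> nat \<Rightarrow> ((nat \<times> nat) list \<Rightarrow>\<^sub>0 'k) set set" where
  "U_gen q m i j = qdet_ideal q m +>\<^bsub>Oq_M q m m\<^esub> Z_gen q m m i j"

definition SL_comult ::
    "'k::field \<Rightarrow> nat \<Rightarrow> ((nat \<times> nat) list \<Rightarrow>\<^sub>0 'k) set set \<Rightarrow>
     (((nat \<times> nat) list \<Rightarrow>\<^sub>0 'k) set set \<times> ((nat \<times> nat) list \<Rightarrow>\<^sub>0 'k) set set \<Rightarrow>\<^sub>0 'k) set" where
  "SL_comult q m =
    the_alg_hom (Oq_SL q m) (tensor_algebra (Oq_SL q m) (Oq_SL q m))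
      (\<lambda>h. \<forall>i \<in> {1..m}. \<forall>j \<in> {1..m}. h (U_gen q m i j) =
        (\<Oplus>\<^bsub>tensor_algebra (Oq_SL q m) (Oq_SL q m)\<^esub>l\<in>{1..m}.
          pure_tensor (Oq_SL q m) (Oq_SL q m) (U_gen q m i l) (U_gen q m l j)))"

definition SL_counit ::
    "'k::field \<Rightarrow> nat \<Rightarrow> ((nat \<times> nat) list \<Rightarrow>\<^sub>0 'k) set set \<Rightarrow> 'k" where
  "SL_counit q m =
    the_alg_hom (Oq_SL q m) ground_algebra
      (\<lambda>h. \<forall>i \<in> {1..m}. \<forall>j \<in> {1..m}. h (U_gen q m i j) = (if i = j then 1 else 0))"

definition SL_coaction ::
    "'k::field \<Rightarrow> nat \<Rightarrow> nat \<Rightarrow> ((nat \<times> nat) list \<Rightarrow>\<^sub>0 'k) set \<Rightarrow>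
     (((nat \<times> nat) list \<Rightarrow>\<^sub>0 'k) set set \<times> ((nat \<times> nat) list \<Rightarrow>\<^sub>0 'k) set \<Rightarrow>\<^sub>0 'k) set" where
  "SL_coaction q m n =
    the_alg_hom (Oq_M q m n) (tensor_algebra (Oq_SL q m) (Oq_M q m n))
      (\<lambda>h. \<forall>i \<in> {1..m}. \<forall>j \<in> {1..n}. h (Z_gen q m n i j) =
        (\<Oplus>\<^bsub>tensor_algebra (Oq_SL q m) (Oq_M q m n)\<^esub>l\<in>{1..m}.
          pure_tensor (Oq_SL q m) (Oq_M q m n) (U_gen q m i l) (Z_gen q m n l j)))"

end

(* The maximal minors are coinvariant because quantum minors are multiplicative.

   For the converse, represent quantum matrices by products of bidiagonal matrices over a
   quantum torus. There an ordered monomial in the generators has as its leading exponent a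
   sum over lattice paths, and distinct ordered monomials have distinct leading exponents.
   A coinvariant does not change when an upper unipotent matrix acts on the rows i and
   i + 1. Comparing coefficients, the terms which agree with the leading monomial in its
   first columns give rise to a highest weight vector, and the action of a lower unipotent
   matrix shows that its weight is not positive. Together with the action of the diagonal
   torus, these inequalities say that the exponents of the leading monomial form a
   semistandard tableau of rectangular shape. Hence some product of maximal minors has the
   same leading exponent; subtract a multiple of it and induct. *)

theory Submission
  imports Defs "HOL-Library.Product_Lexorder"
begin

section \<open>Algebras on carrier sets: morphisms, generation and quotients\<close>

section \<open>Algebras over a field\<close>

text \<open>The field and \<open>q \<noteq> 0\<close> are arbitrary, so \<open>q\<close> may be a
  root of unity: complete reducibility may fail and q-binomial coefficients may vanish. The proof
  therefore works with extreme terms of expansions, whose coefficients are powers of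
  \<open>q\<close> up to sign. The torus is a domain with a total order on exponents, so leading
  terms multiply, common factors cancel, and ordered monomials are independent because their leading
  exponents differ. The acting matrices get times of their own, 0 for the lower and 2 for the upper
  one, so that the powers of their entries can be read off from a product. Time 1 holds one variable
  that records the degree; the paths use the times from 3 on. Two orders have to match. For equal
  row sums, leading exponents compare columns from the left and, in a column, rows from the last one
  upwards; ordered monomials list their factors in the same order. An upper row operation moves
  factors only from row i to row i + 1. So a monomial whose first columns differ from those of the
  maximal one cannot be moved into agreement, and these columns form a common left factor, which
  cancels.\<close>

locale kalg = ring A for A :: "('k::field, 'a) module" (structure) +
  assumes smult_closed [simp, intro]: "x \<in> carrier A \<Longrightarrow> c \<odot> x \<in> carrier A"
    and smult_l_distr: "x \<in> carrier A \<Longrightarrow> (c + d) \<odot> x = c \<odot> x \<oplus> d \<odot> x"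
    and smult_r_distr: "x \<in> carrier A \<Longrightarrow> y \<in> carrier A \<Longrightarrow> c \<odot> (x \<oplus> y) = c \<odot> x \<oplus> c \<odot> y"
    and smult_assoc1: "x \<in> carrier A \<Longrightarrow> (c * d) \<odot> x = c \<odot> (d \<odot> x)"
    and smult_one [simp]: "x \<in> carrier A \<Longrightarrow> 1 \<odot> x = x"
    and smult_mult_l: "x \<in> carrier A \<Longrightarrow> y \<in> carrier A \<Longrightarrow> (c \<odot> x) \<otimes> y = c \<odot> (x \<otimes> y)"
    and smult_mult_r: "x \<in> carrier A \<Longrightarrow> y \<in> carrier A \<Longrightarrow> x \<otimes> (c \<odot> y) = c \<odot> (x \<otimes> y)"
begin

lemma smult_l_null [simp]: "x \<in> carrier A \<Longrightarrow> 0 \<odot> x = \<zero>"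
  using smult_l_distr[of x 0 0] by (metis add.l_cancel_one' add.right_neutral smult_closed)

lemma smult_r_null [simp]: "c \<odot> \<zero> = \<zero>"
  using smult_r_distr[of \<zero> \<zero> c] by (metis add.l_cancel_one' l_zero smult_closed zero_closed)

lemma smult_minus: "x \<in> carrier A \<Longrightarrow> (- c) \<odot> x = \<ominus> (c \<odot> x)"
proof -
  assume x: "x \<in> carrier A"
  have "(- c) \<odot> x \<oplus> c \<odot> x = \<zero>" using smult_l_distr[OF x, of "-c" c] x by simp
  then show ?thesis using x by (simp add: minus_equality)
qed

lemma smult_minus_one: "x \<in> carrier A \<Longrightarrow> (- 1) \<odot> x = \<ominus> x"
  by (simp add: smult_minus)

lemma smult_r_minus: "x \<in> carrier A \<Longrightarrow> c \<odot> (\<ominus> x) = \<ominus> (c \<odot> x)"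
  by (metis smult_assoc1 smult_minus smult_minus_one mult_minus1_right)

lemma smult_diff: "x \<in> carrier A \<Longrightarrow> y \<in> carrier A \<Longrightarrow> c \<odot> (x \<ominus> y) = c \<odot> x \<ominus> c \<odot> y"
  by (simp add: a_minus_def smult_r_distr smult_r_minus)

lemma finsum_smult:
  "f \<in> S \<rightarrow> carrier A \<Longrightarrow> c \<odot> (\<Oplus>i\<in>S. f i) = (\<Oplus>i\<in>S. c \<odot> f i)"
proof (induction S rule: infinite_finite_induct)
  case (insert x F)
  then have *: "f x \<in> carrier A" "f \<in> F \<rightarrow> carrier A" by auto
  then have "(\<lambda>i. c \<odot> f i) \<in> F \<rightarrow> carrier A" by auto
  with insert * show ?case by (simp add: finsum_insert smult_r_distr)
qed auto

text \<open>Scalars act through the central elements \<open>c \<odot> \<one>\<close>, so every ring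
  ideal is a subspace. This is why \<open>genideal\<close>, which knows nothing of scalars, yields
  quotient algebras.\<close>

lemma ideal_smult:
  assumes "ideal I A" "x \<in> I"
  shows "c \<odot> x \<in> I"
proof -
  interpret ideal I A by fact
  have "x \<in> carrier A" using assms(2) by (rule Icarr)
  then have "c \<odot> x = (c \<odot> \<one>) \<otimes> x" by (simp add: smult_mult_l)
  then show ?thesis using assms(2) by (simp add: I_l_closed)
qed

end

lemma kalgI:
  assumes "ring A"
    and "\<And>c x. x \<in> carrier A \<Longrightarrow> c \<odot>\<^bsub>A\<^esub> x \<in> carrier A"
    and "\<And>c d x. x \<in> carrier A \<Longrightarrow> (c + d) \<odot>\<^bsub>A\<^esub> x = c \<odot>\<^bsub>A\<^esub> x \<oplus>\<^bsub>A\<^esub> d \<odot>\<^bsub>A\<^esub> x"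
    and "\<And>c x y. x \<in> carrier A \<Longrightarrow> y \<in> carrier A \<Longrightarrow> c \<odot>\<^bsub>A\<^esub> (x \<oplus>\<^bsub>A\<^esub> y) = c \<odot>\<^bsub>A\<^esub> x \<oplus>\<^bsub>A\<^esub> c \<odot>\<^bsub>A\<^esub> y"
    and "\<And>c d x. x \<in> carrier A \<Longrightarrow> (c * d) \<odot>\<^bsub>A\<^esub> x = c \<odot>\<^bsub>A\<^esub> (d \<odot>\<^bsub>A\<^esub> x)"
    and "\<And>x. x \<in> carrier A \<Longrightarrow> 1 \<odot>\<^bsub>A\<^esub> x = x"
    and "\<And>c x y. x \<in> carrier A \<Longrightarrow> y \<in> carrier A \<Longrightarrow> (c \<odot>\<^bsub>A\<^esub> x) \<otimes>\<^bsub>A\<^esub> y = c \<odot>\<^bsub>A\<^esub> (x \<otimes>\<^bsub>A\<^esub> y)"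
    and "\<And>c x y. x \<in> carrier A \<Longrightarrow> y \<in> carrier A \<Longrightarrow> x \<otimes>\<^bsub>A\<^esub> (c \<odot>\<^bsub>A\<^esub> y) = c \<odot>\<^bsub>A\<^esub> (x \<otimes>\<^bsub>A\<^esub> y)"
  shows "kalg (A :: ('k::field, 'a) module)"
  using assms by (simp add: kalg_def kalg_axioms_def)


subsection \<open>Homomorphisms\<close>

lemma alg_homI:
  assumes "\<And>x. x \<in> carrier A \<Longrightarrow> h x \<in> carrier B"
    and "\<And>x y. x \<in> carrier A \<Longrightarrow> y \<in> carrier A \<Longrightarrow> h (x \<otimes>\<^bsub>A\<^esub> y) = h x \<otimes>\<^bsub>B\<^esub> h y"
    and "\<And>x y. x \<in> carrier A \<Longrightarrow> y \<in> carrier A \<Longrightarrow> h (x \<oplus>\<^bsub>A\<^esub> y) = h x \<oplus>\<^bsub>B\<^esub> h y"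
    and "h \<one>\<^bsub>A\<^esub> = \<one>\<^bsub>B\<^esub>"
    and "\<And>c x. x \<in> carrier A \<Longrightarrow> h (c \<odot>\<^bsub>A\<^esub> x) = c \<odot>\<^bsub>B\<^esub> h x"
  shows "h \<in> alg_hom A B"
  using assms by (auto simp: alg_hom_def intro: ring_hom_memI)

lemma alg_homD:
  assumes "h \<in> alg_hom A B"
  shows "x \<in> carrier A \<Longrightarrow> h x \<in> carrier B"
    and "x \<in> carrier A \<Longrightarrow> y \<in> carrier A \<Longrightarrow> h (x \<otimes>\<^bsub>A\<^esub> y) = h x \<otimes>\<^bsub>B\<^esub> h y"
    and "x \<in> carrier A \<Longrightarrow> y \<in> carrier A \<Longrightarrow> h (x \<oplus>\<^bsub>A\<^esub> y) = h x \<oplus>\<^bsub>B\<^esub> h y"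
    and "h \<one>\<^bsub>A\<^esub> = \<one>\<^bsub>B\<^esub>"
    and "x \<in> carrier A \<Longrightarrow> h (c \<odot>\<^bsub>A\<^esub> x) = c \<odot>\<^bsub>B\<^esub> h x"
  using assms by (auto simp: alg_hom_def ring_hom_closed ring_hom_mult ring_hom_add ring_hom_one)

lemma alg_hom_comp:
  "f \<in> alg_hom A B \<Longrightarrow> g \<in> alg_hom B C \<Longrightarrow> (\<lambda>x. g (f x)) \<in> alg_hom A C"
  by (rule alg_homI) (simp_all add: alg_homD)

lemma alg_hom_id: "id \<in> alg_hom A A"
  by (rule alg_homI) auto

lemma alg_hom_zero:
  assumes "h \<in> alg_hom A B" "kalg A" "kalg B" shows "h \<zero>\<^bsub>A\<^esub> = \<zero>\<^bsub>B\<^esub>"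
  using assms ring_hom_zero by (auto simp: alg_hom_def kalg_def)

lemma alg_hom_minus:
  assumes h: "h \<in> alg_hom A B" and A: "kalg A" and B: "kalg B"
    and x: "x \<in> carrier A" and y: "y \<in> carrier A"
  shows "h (x \<ominus>\<^bsub>A\<^esub> y) = h x \<ominus>\<^bsub>B\<^esub> h y"
proof -
  interpret A: kalg A by fact
  interpret B: kalg B by fact
  have "x \<ominus>\<^bsub>A\<^esub> y = x \<oplus>\<^bsub>A\<^esub> (- 1) \<odot>\<^bsub>A\<^esub> y" using y by (simp add: A.smult_minus_one a_minus_def)
  moreover have "h x \<ominus>\<^bsub>B\<^esub> h y = h x \<oplus>\<^bsub>B\<^esub> (- 1) \<odot>\<^bsub>B\<^esub> h y"
    using alg_homD(1)[OF h] y by (simp add: B.smult_minus_one a_minus_def)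
  ultimately show ?thesis using x y by (simp add: alg_homD[OF h])
qed

lemma alg_hom_finsum:
  assumes h: "h \<in> alg_hom A B" and A: "kalg A" and B: "kalg B"
    and f: "f \<in> S \<rightarrow> carrier A"
  shows "h (finsum A f S) = finsum B (\<lambda>i. h (f i)) S"
proof -
  interpret A: kalg A by fact
  interpret B: kalg B by fact
  show ?thesis using f
  proof (induction S rule: infinite_finite_induct)
    case (insert x F)
    then have *: "f x \<in> carrier A" "f \<in> F \<rightarrow> carrier A" by auto
    then have "(\<lambda>i. h (f i)) \<in> F \<rightarrow> carrier B" using alg_homD(1)[OF h] by auto
    with insert * show ?case by (simp add: A.finsum_insert B.finsum_insert alg_homD[OF h])
  qed (simp_all add: alg_hom_zero[OF h A B])
qed

lemma alg_hom_foldr: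
  assumes h: "h \<in> alg_hom A B" and A: "kalg A" and f: "set xs \<subseteq> carrier A"
  shows "h (foldr (monoid.mult A) xs \<one>\<^bsub>A\<^esub>) = foldr (monoid.mult B) (map h xs) \<one>\<^bsub>B\<^esub>"
proof -
  interpret A: kalg A by fact
  have "foldr (monoid.mult A) xs \<one>\<^bsub>A\<^esub> \<in> carrier A \<and>
    h (foldr (monoid.mult A) xs \<one>\<^bsub>A\<^esub>) = foldr (monoid.mult B) (map h xs) \<one>\<^bsub>B\<^esub>"
    using f by (induction xs) (simp_all add: alg_homD[OF h])
  then show ?thesis by simp
qed

text \<open>\<open>THE\<close> needs uniqueness everywhere: on the carrier it comes from
  \<open>P\<close>, outside from extensionality. Existence passes from \<open>h0\<close> to its
  restriction, so \<open>P\<close> may depend only on values on the carrier, which is the content of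
  \<open>cong\<close>.\<close>

lemma the_alg_hom_works:
  assumes A: "kalg A"
    and ex: "h0 \<in> alg_hom A B" "P h0"
    and cong: "\<And>h h'. (\<And>x. x \<in> carrier A \<Longrightarrow> h x = h' x) \<Longrightarrow> P h \<Longrightarrow> P h'"
    and uniq: "\<And>h h' x. h \<in> alg_hom A B \<Longrightarrow> h' \<in> alg_hom A B \<Longrightarrow> P h \<Longrightarrow> P h' \<Longrightarrow>
                 x \<in> carrier A \<Longrightarrow> h x = h' x"
  shows "the_alg_hom A B P \<in> alg_hom A B" "P (the_alg_hom A B P)"
proof -
  interpret A: kalg A by fact
  let ?Q = "\<lambda>h. h \<in> alg_hom A B \<and> h \<in> extensional (carrier A) \<and> P h"
  have "restrict h0 (carrier A) \<in> alg_hom A B"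
    by (rule alg_homI) (auto simp: alg_homD[OF ex(1)])
  then have "?Q (restrict h0 (carrier A))"
    using ex cong[of h0 "restrict h0 (carrier A)"] by auto
  moreover have "h = h'" if "?Q h" "?Q h'" for h h'
    using that uniq by (intro extensionalityI[of _ "carrier A"]) auto
  ultimately have "\<exists>!h. ?Q h" by (intro ex1I) auto
  then have "?Q (THE h. ?Q h)" by (rule theI')
  then show "the_alg_hom A B P \<in> alg_hom A B" "P (the_alg_hom A B P)"
    unfolding the_alg_hom_def by auto
qed


subsection \<open>Generation\<close>

definition subalgebra :: "('k::field, 'a) module \<Rightarrow> 'a set \<Rightarrow> bool" where
  "subalgebra A S \<longleftrightarrow> subring S A \<and> (\<forall>c. \<forall>x \<in> S. c \<odot>\<^bsub>A\<^esub> x \<in> S)"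

lemma (in kalg) subalgebraI:
  assumes "S \<subseteq> carrier A" "\<one> \<in> S" "\<And>x y. x \<in> S \<Longrightarrow> y \<in> S \<Longrightarrow> x \<otimes> y \<in> S"
    "\<And>x y. x \<in> S \<Longrightarrow> y \<in> S \<Longrightarrow> x \<oplus> y \<in> S" "\<And>c x. x \<in> S \<Longrightarrow> c \<odot> x \<in> S"
  shows "subalgebra A S"
  unfolding subalgebra_def
proof (intro conjI allI ballI subringI)
  fix x assume "x \<in> S"
  then show "\<ominus> x \<in> S" using assms(1) assms(5)[of x "-1"] by (simp add: smult_minus_one subset_eq)
qed (use assms in auto)

text \<open>Quantifying over all subalgebras gives an induction principle at once and is easy to
  transport to quotients and tensor products.\<close>

definition generates :: "('k::field, 'a) module \<Rightarrow> 'a set \<Rightarrow> bool" where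
  "generates A X \<longleftrightarrow> X \<subseteq> carrier A \<and> (\<forall>S. subalgebra A S \<longrightarrow> X \<subseteq> S \<longrightarrow> carrier A \<subseteq> S)"

lemma generates_induct [consumes 3, case_names gen one mult add smult]:
  assumes "kalg A" "generates A X" "x \<in> carrier A"
    and "\<And>x. x \<in> X \<Longrightarrow> P x" "P \<one>\<^bsub>A\<^esub>"
    and "\<And>x y. x \<in> carrier A \<Longrightarrow> y \<in> carrier A \<Longrightarrow> P x \<Longrightarrow> P y \<Longrightarrow> P (x \<otimes>\<^bsub>A\<^esub> y)"
    and "\<And>x y. x \<in> carrier A \<Longrightarrow> y \<in> carrier A \<Longrightarrow> P x \<Longrightarrow> P y \<Longrightarrow> P (x \<oplus>\<^bsub>A\<^esub> y)"
    and "\<And>c x. x \<in> carrier A \<Longrightarrow> P x \<Longrightarrow> P (c \<odot>\<^bsub>A\<^esub> x)"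
  shows "P x"
proof -
  interpret kalg A by fact
  have "subalgebra A {x \<in> carrier A. P x}"
    using assms(5-8) by (intro subalgebraI) auto
  moreover have "X \<subseteq> {x \<in> carrier A. P x}" using assms(2,4) by (auto simp: generates_def)
  ultimately show ?thesis using assms(2,3) unfolding generates_def by blast
qed

lemma alg_hom_eqI:
  assumes "kalg A" "generates A X" "h \<in> alg_hom A B" "h' \<in> alg_hom A B"
    "\<And>x. x \<in> X \<Longrightarrow> h x = h' x" "x \<in> carrier A"
  shows "h x = h' x"
  using assms(1,2,6)
proof (induction rule: generates_induct)
  case (gen x) then show ?case by (rule assms(5))
qed (simp_all add: alg_homD[OF assms(3)] alg_homD[OF assms(4)])

text \<open>The elements whose images commute with a fixed element form a subalgebra. This is used
  twice: first for a fixed generator of \<open>A\<close> and variable \<open>y\<close>, then for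
  fixed \<open>y\<close> and variable \<open>x\<close>.\<close>

lemma commute_from_generators:
  assumes A: "kalg A" and B: "kalg B" and R: "kalg R"
    and gA: "generates A X" and gB: "generates B Y"
    and f: "f \<in> alg_hom A R" and g: "g \<in> alg_hom B R"
    and comm: "\<And>x y. x \<in> X \<Longrightarrow> y \<in> Y \<Longrightarrow> f x \<otimes>\<^bsub>R\<^esub> g y = g y \<otimes>\<^bsub>R\<^esub> f x"
    and x: "x \<in> carrier A" and y: "y \<in> carrier B"
  shows "f x \<otimes>\<^bsub>R\<^esub> g y = g y \<otimes>\<^bsub>R\<^esub> f x"
proof -
  interpret R: kalg R by fact
  interpret A: kalg A by fact
  interpret B: kalg B by fact
  note [simp] = alg_homD[OF f] alg_homD[OF g]
  have *: "f x \<otimes>\<^bsub>R\<^esub> g y = g y \<otimes>\<^bsub>R\<^esub> f x" if x: "x \<in> X" and y: "y \<in> carrier B" for x y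
    using B gB y
  proof (induction rule: generates_induct)
    case (gen y) then show ?case using comm x by auto
  next
    case (mult y y')
    have fx: "f x \<in> carrier R" using x gA by (auto simp: generates_def)
    have "f x \<otimes>\<^bsub>R\<^esub> (g y \<otimes>\<^bsub>R\<^esub> g y') = (f x \<otimes>\<^bsub>R\<^esub> g y) \<otimes>\<^bsub>R\<^esub> g y'"
      using mult(1,2) fx by (simp add: R.m_assoc)
    also have "\<dots> = g y \<otimes>\<^bsub>R\<^esub> (f x \<otimes>\<^bsub>R\<^esub> g y')" unfolding mult(3) using mult(1,2) fx by (simp add: R.m_assoc)
    also have "\<dots> = g (y \<otimes>\<^bsub>B\<^esub> y') \<otimes>\<^bsub>R\<^esub> f x" unfolding mult(4) using mult(1,2) fx by (simp add: R.m_assoc)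
    finally show ?case using mult(1,2) by simp
  qed (use x gA in \<open>auto simp: generates_def R.l_distr R.r_distr R.smult_mult_l R.smult_mult_r subset_eq\<close>)
  show ?thesis using A gA x
  proof (induction rule: generates_induct)
    case (gen x) then show ?case using * y by auto
  next
    case (mult x x')
    have gy: "g y \<in> carrier R" using y by auto
    have "(f x \<otimes>\<^bsub>R\<^esub> f x') \<otimes>\<^bsub>R\<^esub> g y = f x \<otimes>\<^bsub>R\<^esub> (f x' \<otimes>\<^bsub>R\<^esub> g y)"
      using mult(1,2) gy by (simp add: R.m_assoc)
    also have "\<dots> = (f x \<otimes>\<^bsub>R\<^esub> g y) \<otimes>\<^bsub>R\<^esub> f x'" unfolding mult(4) using mult(1,2) gy by (simp add: R.m_assoc)
    also have "\<dots> = g y \<otimes>\<^bsub>R\<^esub> f (x \<otimes>\<^bsub>A\<^esub> x')" unfolding mult(3) using mult(1,2) gy by (simp add: R.m_assoc)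
    finally show ?case using mult(1,2) by simp
  qed (use y in \<open>auto simp: R.l_distr R.r_distr R.smult_mult_l R.smult_mult_r\<close>)
qed


subsection \<open>Quotient algebras\<close>

lemma quotient_algebra_simps:
  "carrier (quotient_algebra A I) = carrier (A Quot I)"
  "monoid.mult (quotient_algebra A I) = monoid.mult (A Quot I)"
  "one (quotient_algebra A I) = one (A Quot I)"
  "zero (quotient_algebra A I) = zero (A Quot I)"
  "add (quotient_algebra A I) = add (A Quot I)"
  by (simp_all add: quotient_algebra_def)

lemma ring_from_ring_ops:
  assumes "ring R" "carrier S = carrier R" "monoid.mult S = monoid.mult R" "one S = one R"
    "zero S = zero R" "add S = add R"
  shows "ring S"
proof -
  interpret R: ring R by fact
  show ?thesis
  proof (rule ringI)
    show "abelian_group S"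
    proof (rule abelian_groupI)
      show "\<And>x. x \<in> carrier S \<Longrightarrow> \<exists>y\<in>carrier S. y \<oplus>\<^bsub>S\<^esub> x = \<zero>\<^bsub>S\<^esub>"
        using R.l_neg R.a_inv_closed by (metis assms(2,5,6))
    qed (simp_all add: assms R.a_assoc, simp add: R.a_comm)
    show "monoid S"
      by (rule monoidI) (simp_all add: assms R.m_assoc)
  qed (simp_all add: assms R.l_distr R.r_distr)
qed

context
  fixes A :: "('k::field, 'a) module" and I :: "'a set"
  assumes A: "kalg A" and I: "ideal I A"
begin

interpretation A: kalg A by (rule A)
interpretation I: ideal I A by (rule I)

lemma quotient_carrier:
  "X \<in> carrier (quotient_algebra A I) \<longleftrightarrow> (\<exists>x\<in>carrier A. X = I +>\<^bsub>A\<^esub> x)"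
  by (auto simp: quotient_algebra_simps FactRing_def A_RCOSETS_def')

lemma quotient_eq_iff:
  assumes "x \<in> carrier A" "y \<in> carrier A"
  shows "I +>\<^bsub>A\<^esub> x = I +>\<^bsub>A\<^esub> y \<longleftrightarrow> x \<ominus>\<^bsub>A\<^esub> y \<in> I"
  using A.quotient_eq_iff_same_a_r_cos[OF I assms] by simp

lemma quotient_ops:
  assumes "x \<in> carrier A" "y \<in> carrier A"
  shows "(I +>\<^bsub>A\<^esub> x) \<otimes>\<^bsub>quotient_algebra A I\<^esub> (I +>\<^bsub>A\<^esub> y) = I +>\<^bsub>A\<^esub> (x \<otimes>\<^bsub>A\<^esub> y)"
    and "(I +>\<^bsub>A\<^esub> x) \<oplus>\<^bsub>quotient_algebra A I\<^esub> (I +>\<^bsub>A\<^esub> y) = I +>\<^bsub>A\<^esub> (x \<oplus>\<^bsub>A\<^esub> y)"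
    and "c \<odot>\<^bsub>quotient_algebra A I\<^esub> (I +>\<^bsub>A\<^esub> x) = I +>\<^bsub>A\<^esub> (c \<odot>\<^bsub>A\<^esub> x)"
proof -
  show "(I +>\<^bsub>A\<^esub> x) \<otimes>\<^bsub>quotient_algebra A I\<^esub> (I +>\<^bsub>A\<^esub> y) = I +>\<^bsub>A\<^esub> (x \<otimes>\<^bsub>A\<^esub> y)"
    using assms by (simp add: quotient_algebra_simps FactRing_def I.rcoset_mult_add)
  show "(I +>\<^bsub>A\<^esub> x) \<oplus>\<^bsub>quotient_algebra A I\<^esub> (I +>\<^bsub>A\<^esub> y) = I +>\<^bsub>A\<^esub> (x \<oplus>\<^bsub>A\<^esub> y)"
    using assms by (simp add: quotient_algebra_simps FactRing_def I.a_rcos_sum)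
  \<comment> \<open>The scalar multiple of a coset is defined as a union over all its
    representatives; all the cosets in this union coincide.\<close>
  have *: "I +>\<^bsub>A\<^esub> (c \<odot>\<^bsub>A\<^esub> z) = I +>\<^bsub>A\<^esub> (c \<odot>\<^bsub>A\<^esub> x)" if z: "z \<in> I +>\<^bsub>A\<^esub> x" for z
  proof -
    have zc: "z \<in> carrier A" using z assms(1) I.a_subset A.a_r_coset_subset_G by blast
    have "I +>\<^bsub>A\<^esub> z = I +>\<^bsub>A\<^esub> x" using I.a_repr_independence'[OF z] assms by simp
    then have "z \<ominus>\<^bsub>A\<^esub> x \<in> I" using quotient_eq_iff zc assms by simp
    then have "c \<odot>\<^bsub>A\<^esub> (z \<ominus>\<^bsub>A\<^esub> x) \<in> I" by (rule A.ideal_smult[OF I])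
    then show ?thesis using zc assms by (simp add: quotient_eq_iff A.smult_diff)
  qed
  have "(\<Union>z\<in>I +>\<^bsub>A\<^esub> x. I +>\<^bsub>A\<^esub> (c \<odot>\<^bsub>A\<^esub> z)) = I +>\<^bsub>A\<^esub> (c \<odot>\<^bsub>A\<^esub> x)"
    by (rule UN_constant_eq[OF I.a_rcos_self[OF assms(1)]]) (use * in blast)
  then show "c \<odot>\<^bsub>quotient_algebra A I\<^esub> (I +>\<^bsub>A\<^esub> x) = I +>\<^bsub>A\<^esub> (c \<odot>\<^bsub>A\<^esub> x)"
    by (simp add: quotient_algebra_def)
qed

lemma quotient_one: "\<one>\<^bsub>quotient_algebra A I\<^esub> = I +>\<^bsub>A\<^esub> \<one>\<^bsub>A\<^esub>"
  by (simp add: quotient_algebra_simps FactRing_def)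

lemma quotient_kalg: "kalg (quotient_algebra A I)"
proof (rule kalgI)
  show "ring (quotient_algebra A I)"
    by (rule ring_from_ring_ops[OF I.quotient_is_ring]) (simp_all add: quotient_algebra_simps)
qed (auto simp: quotient_carrier quotient_ops A.smult_l_distr A.smult_r_distr A.smult_assoc1
      A.smult_mult_l A.smult_mult_r)

lemma quotient_proj: "(\<lambda>x. I +>\<^bsub>A\<^esub> x) \<in> alg_hom A (quotient_algebra A I)"
  by (rule alg_homI) (auto simp: quotient_carrier quotient_ops quotient_one)

lemma quotient_generates:
  assumes "generates A X"
  shows "generates (quotient_algebra A I) ((\<lambda>x. I +>\<^bsub>A\<^esub> x) ` X)"
  unfolding generates_def
proof (intro conjI allI impI)
  interpret Q: kalg "quotient_algebra A I" by (rule quotient_kalg)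
  show "(\<lambda>x. I +>\<^bsub>A\<^esub> x) ` X \<subseteq> carrier (quotient_algebra A I)"
    using assms by (auto simp: quotient_carrier generates_def subset_eq)
  fix S assume S: "subalgebra (quotient_algebra A I) S" and X: "(\<lambda>x. I +>\<^bsub>A\<^esub> x) ` X \<subseteq> S"
  then have sr: "subring S (quotient_algebra A I)" by (simp add: subalgebra_def)
  have "I +>\<^bsub>A\<^esub> x \<in> S" if "x \<in> carrier A" for x
    using A assms that
  proof (induction rule: generates_induct)
    case (gen x) then show ?case using X by auto
  next
    case one then show ?case using subringE(3)[OF sr] by (simp add: quotient_one)
  next
    case (mult x y) then show ?case using subringE(6)[OF sr, of "I +>\<^bsub>A\<^esub> x" "I +>\<^bsub>A\<^esub> y"]
      by (simp add: quotient_ops)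
  next
    case (add x y) then show ?case using subringE(7)[OF sr, of "I +>\<^bsub>A\<^esub> x" "I +>\<^bsub>A\<^esub> y"]
      by (simp add: quotient_ops)
  next
    case (smult c x)
    then have "c \<odot>\<^bsub>quotient_algebra A I\<^esub> (I +>\<^bsub>A\<^esub> x) \<in> S" using S by (auto simp: subalgebra_def)
    then show ?case using smult by (simp add: quotient_ops)
  qed
  then show "carrier (quotient_algebra A I) \<subseteq> S" by (auto simp: quotient_carrier)
qed

lemma quotient_lift:
  assumes B: "kalg B" and h: "h \<in> alg_hom A B" and ker: "\<And>x. x \<in> I \<Longrightarrow> h x = \<zero>\<^bsub>B\<^esub>"
  obtains h' where "h' \<in> alg_hom (quotient_algebra A I) B"
    "\<And>x. x \<in> carrier A \<Longrightarrow> h' (I +>\<^bsub>A\<^esub> x) = h x"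
proof -
  interpret B: kalg B by fact
  \<comment> \<open>Any representative in the carrier will do, since \<open>h\<close> is constant on
    cosets of \<open>I\<close>.\<close>
  define h' where "h' X = h (SOME x. x \<in> X \<and> x \<in> carrier A)" for X
  have h': "h' (I +>\<^bsub>A\<^esub> x) = h x" if x: "x \<in> carrier A" for x
  proof -
    let ?y = "SOME y. y \<in> I +>\<^bsub>A\<^esub> x \<and> y \<in> carrier A"
    have "?y \<in> I +>\<^bsub>A\<^esub> x \<and> ?y \<in> carrier A"
      by (rule someI[of _ x]) (use x I.a_rcos_self in auto)
    then have y: "?y \<in> I +>\<^bsub>A\<^esub> x" "?y \<in> carrier A" by auto
    have "I +>\<^bsub>A\<^esub> ?y = I +>\<^bsub>A\<^esub> x" using I.a_repr_independence'[OF y(1)] x by simp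
    then have "h (?y \<ominus>\<^bsub>A\<^esub> x) = \<zero>\<^bsub>B\<^esub>" using ker quotient_eq_iff y x by simp
    then have "h ?y \<ominus>\<^bsub>B\<^esub> h x = \<zero>\<^bsub>B\<^esub>" using alg_hom_minus[OF h A B y(2) x] by simp
    then show ?thesis unfolding h'_def using B.r_right_minus_eq[OF alg_homD(1)[OF h y(2)] alg_homD(1)[OF h x]] by simp
  qed
  show ?thesis
  proof (rule that[OF _ h'])
    show "h' \<in> alg_hom (quotient_algebra A I) B"
      by (rule alg_homI) (auto simp: quotient_carrier quotient_ops quotient_one h' alg_homD[OF h])
  qed
qed

end

lemma alg_hom_kernel_ideal:
  assumes A: "kalg A" and B: "kalg B" and h: "h \<in> alg_hom A B"
  shows "ideal {x \<in> carrier A. h x = \<zero>\<^bsub>B\<^esub>} A"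
proof -
  interpret A: kalg A by fact
  interpret B: kalg B by fact
  have "ring_hom_ring A B h"
    using h by (intro ring_hom_ringI2 A.ring_axioms B.ring_axioms) (simp add: alg_hom_def)
  then show ?thesis using ring_hom_ring.kernel_is_ideal by (fastforce simp: a_kernel_def')
qed

lemma genideal_lift:
  assumes A: "kalg A" and B: "kalg B" and h: "h \<in> alg_hom A B" and X: "X \<subseteq> carrier A"
    and ker: "\<And>x. x \<in> X \<Longrightarrow> h x = \<zero>\<^bsub>B\<^esub>"
  obtains h' where "h' \<in> alg_hom (quotient_algebra A (genideal A X)) B"
    "\<And>x. x \<in> carrier A \<Longrightarrow> h' (genideal A X +>\<^bsub>A\<^esub> x) = h x"
proof -
  interpret A: kalg A by fact
  have "genideal A X \<subseteq> {x \<in> carrier A. h x = \<zero>\<^bsub>B\<^esub>}"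
    using X ker by (intro A.genideal_minimal[OF alg_hom_kernel_ideal[OF A B h]]) auto
  then have "\<And>x. x \<in> genideal A X \<Longrightarrow> h x = \<zero>\<^bsub>B\<^esub>" by auto
  then show ?thesis using quotient_lift[OF A A.genideal_ideal[OF X] B h] that by metis
qed


section \<open>Twisted monoid algebras and linear extension from a basis\<close>

section \<open>Twisted monoid algebras\<close>

abbreviation "lookup \<equiv> Poly_Mapping.lookup"
abbreviation "keys \<equiv> Poly_Mapping.keys"
abbreviation "single \<equiv> Poly_Mapping.single"

lemma lookup_scale_pm [simp]: "lookup (scale_pm c f) x = c * lookup f x"
  by (simp add: scale_pm_def map.rep_eq when_def)

lemma keys_scale_pm: "keys (scale_pm c f) \<subseteq> keys f"
  by (auto simp: in_keys_iff)

lemma scale_pm_single [simp]: "scale_pm c (single x d) = single x (c * d)"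
  by (rule poly_mapping_eqI) (simp add: lookup_single when_def)

interpretation pm: vector_space "scale_pm :: 'k::field \<Rightarrow> ('x \<Rightarrow>\<^sub>0 'k) \<Rightarrow> _"
  by unfold_locales (auto intro!: poly_mapping_eqI simp: lookup_add algebra_simps)

lemma poly_mapping_carrier_induct [consumes 1, case_names zero single add]:
  fixes f :: "'x \<Rightarrow>\<^sub>0 'k::comm_monoid_add"
  assumes "keys f \<subseteq> C" "P 0" "\<And>x c. x \<in> C \<Longrightarrow> P (single x c)"
    "\<And>f g. keys f \<subseteq> C \<Longrightarrow> keys g \<subseteq> C \<Longrightarrow> P f \<Longrightarrow> P g \<Longrightarrow> P (f + g)"
  shows "P f"
proof -
  have rep: "f = (\<Sum>x\<in>keys f. single x (lookup f x))"
    by (rule poly_mapping_eqI) (simp add: lookup_sum lookup_single when_def in_keys_iff)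
  have "keys (\<Sum>x\<in>X. single x (lookup f x)) \<subseteq> C \<and>
      P (\<Sum>x\<in>X. single x (lookup f x))" if "finite X" "X \<subseteq> C" for X
    using that
  proof (induction X rule: finite_induct)
    case (insert x X)
    let ?s = "\<Sum>x\<in>X. single x (lookup f x)" and ?t = "single x (lookup f x)"
    have "keys ?t \<subseteq> C" using insert by auto
    moreover have "keys (?t + ?s) \<subseteq> keys ?t \<union> keys ?s" by (rule keys_add)
    ultimately show ?case using insert assms(3,4) by auto
  qed (simp add: assms(2))
  from this[of "keys f"] show ?thesis using assms(1) rep by simp
qed

text \<open>The product is deformed by a weight \<open>w\<close>, to be a 2-cocycle. The constant
  weight gives free algebras and the algebras behind tensor products; a power of \<open>q\<close>
  given by a bilinear form gives the quantum torus.\<close>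

definition twisted_algebra ::
    "('x, 'm) monoid_scheme \<Rightarrow> ('x \<Rightarrow> 'x \<Rightarrow> 'k::field) \<Rightarrow> ('k, 'x \<Rightarrow>\<^sub>0 'k) module" where
  "twisted_algebra M w =
    \<lparr>carrier = {f. keys f \<subseteq> carrier M},
     monoid.mult = (\<lambda>f g. \<Sum>x\<in>keys f. \<Sum>y\<in>keys g.
               single (x \<otimes>\<^bsub>M\<^esub> y) (lookup f x * lookup g y * w x y)),
     one = single \<one>\<^bsub>M\<^esub> 1, zero = 0, add = (+), smult = scale_pm\<rparr>"

lemma monoid_algebra_twisted: "monoid_algebra M = twisted_algebra M (\<lambda>_ _. 1)"
  by (simp add: monoid_algebra_def twisted_algebra_def)

lemma twisted_algebra_simps:
  "carrier (twisted_algebra M w) = {f. keys f \<subseteq> carrier M}"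
  "one (twisted_algebra M w) = single \<one>\<^bsub>M\<^esub> 1"
  "zero (twisted_algebra M w) = 0"
  "add (twisted_algebra M w) = (+)"
  "smult (twisted_algebra M w) = scale_pm"
  by (simp_all add: twisted_algebra_def)

text \<open>Supports may shrink by cancellation when elements are added. Summing over a common
  superset lets both sides of a distributive law run over the same indices.\<close>

lemma twisted_mult_superset:
  assumes "finite X" "finite Y" "keys f \<subseteq> X" "keys g \<subseteq> Y"
  shows "f \<otimes>\<^bsub>twisted_algebra M w\<^esub> g =
    (\<Sum>x\<in>X. \<Sum>y\<in>Y. single (x \<otimes>\<^bsub>M\<^esub> y) (lookup f x * lookup g y * w x y))"
proof -
  have "(\<Sum>y\<in>keys g. single (x \<otimes>\<^bsub>M\<^esub> y) (lookup f x * lookup g y * w x y)) =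
      (\<Sum>y\<in>Y. single (x \<otimes>\<^bsub>M\<^esub> y) (lookup f x * lookup g y * w x y))" for x
    using assms by (intro sum.mono_neutral_left) (auto simp: in_keys_iff)
  moreover have "(\<Sum>x\<in>keys f. \<Sum>y\<in>Y. single (x \<otimes>\<^bsub>M\<^esub> y) (lookup f x * lookup g y * w x y)) =
      (\<Sum>x\<in>X. \<Sum>y\<in>Y. single (x \<otimes>\<^bsub>M\<^esub> y) (lookup f x * lookup g y * w x y))"
    using assms by (intro sum.mono_neutral_left) (auto simp: in_keys_iff)
  ultimately show ?thesis by (simp add: twisted_algebra_def)
qed

lemma twisted_mult_single:
  "single x a \<otimes>\<^bsub>twisted_algebra M w\<^esub> single y b =
    single (x \<otimes>\<^bsub>M\<^esub> y) (a * b * w x y)"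
  by (subst twisted_mult_superset[of "{x}" "{y}"]) auto

lemma twisted_mult_add_left:
  "(f + f') \<otimes>\<^bsub>twisted_algebra M w\<^esub> g = f \<otimes>\<^bsub>twisted_algebra M w\<^esub> g + f' \<otimes>\<^bsub>twisted_algebra M w\<^esub> g"
proof -
  let ?X = "keys f \<union> keys f'" and ?Y = "keys g"
  have "keys (f + f') \<subseteq> ?X" by (rule keys_add)
  then show ?thesis
    by (subst (1 2 3) twisted_mult_superset[of ?X ?Y])
      (auto simp: lookup_add distrib_right single_add sum.distrib)
qed

lemma twisted_mult_add_right:
  "g \<otimes>\<^bsub>twisted_algebra M w\<^esub> (f + f') = g \<otimes>\<^bsub>twisted_algebra M w\<^esub> f + g \<otimes>\<^bsub>twisted_algebra M w\<^esub> f'"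
proof -
  let ?X = "keys f \<union> keys f'" and ?Y = "keys g"
  have "keys (f + f') \<subseteq> ?X" by (rule keys_add)
  then show ?thesis
    by (subst (1 2 3) twisted_mult_superset[of ?Y ?X])
      (auto simp: lookup_add distrib_right distrib_left single_add sum.distrib)
qed

lemma scale_pm_sum: "scale_pm c (sum f S) = (\<Sum>x\<in>S. scale_pm c (f x))"
  by (rule pm.scale_sum_right)

lemma twisted_mult_scale:
  "scale_pm c f \<otimes>\<^bsub>twisted_algebra M w\<^esub> g = scale_pm c (f \<otimes>\<^bsub>twisted_algebra M w\<^esub> g)"
  "f \<otimes>\<^bsub>twisted_algebra M w\<^esub> scale_pm c g = scale_pm c (f \<otimes>\<^bsub>twisted_algebra M w\<^esub> g)"
  by (subst (1 2) twisted_mult_superset[of "keys f" "keys g"];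
      simp add: keys_scale_pm scale_pm_sum mult_ac)+

lemma twisted_mult_zero [simp]:
  "0 \<otimes>\<^bsub>twisted_algebra M w\<^esub> g = 0" "f \<otimes>\<^bsub>twisted_algebra M w\<^esub> 0 = 0"
  by (simp_all add: twisted_algebra_def)

lemma keys_sum_subset: "(\<And>x. x \<in> S \<Longrightarrow> keys (f x) \<subseteq> C) \<Longrightarrow> keys (sum f S) \<subseteq> C"
proof (induction S rule: infinite_finite_induct)
  case (insert x F)
  then show ?case using keys_add[of "f x" "sum f F"] by (simp, blast)
qed auto

lemma keys_twisted_mult:
  assumes "k \<in> keys (f \<otimes>\<^bsub>twisted_algebra M w\<^esub> g)"
  obtains x y where "x \<in> keys f" "y \<in> keys g" "k = x \<otimes>\<^bsub>M\<^esub> y"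
proof -
  have "keys (f \<otimes>\<^bsub>twisted_algebra M w\<^esub> g) \<subseteq> {x \<otimes>\<^bsub>M\<^esub> y | x y. x \<in> keys f \<and> y \<in> keys g}"
    unfolding twisted_algebra_def by (auto intro!: keys_sum_subset split: if_splits) blast
  then show ?thesis using assms that by blast
qed

text \<open>On basis vectors, associativity is exactly the cocycle identity and the unit laws are
  its normalisation; bilinearity does the rest.\<close>

lemma twisted_algebra_kalg:
  assumes M: "monoid M"
    and w: "\<And>x y z. x \<in> carrier M \<Longrightarrow> y \<in> carrier M \<Longrightarrow> z \<in> carrier M \<Longrightarrow>
      w x y * w (x \<otimes>\<^bsub>M\<^esub> y) z = w x (y \<otimes>\<^bsub>M\<^esub> z) * w y z"
    and w1: "\<And>x. x \<in> carrier M \<Longrightarrow> w \<one>\<^bsub>M\<^esub> x = 1" "\<And>x. x \<in> carrier M \<Longrightarrow> w x \<one>\<^bsub>M\<^esub> = 1"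
  shows "kalg (twisted_algebra M w)"
proof -
  interpret M: monoid M by fact
  let ?T = "twisted_algebra M w"
  have assoc: "(f \<otimes>\<^bsub>?T\<^esub> g) \<otimes>\<^bsub>?T\<^esub> h = f \<otimes>\<^bsub>?T\<^esub> (g \<otimes>\<^bsub>?T\<^esub> h)"
    if "keys f \<subseteq> carrier M" "keys g \<subseteq> carrier M" "keys h \<subseteq> carrier M" for f g h
    using that(1)
  proof (induction rule: poly_mapping_carrier_induct)
    case (single x a)
    from that(2) show ?case
    proof (induction rule: poly_mapping_carrier_induct)
      case (single y b)
      from that(3) show ?case
      proof (induction rule: poly_mapping_carrier_induct)
        case (single z c)
        then show ?case using w[of x y z] \<open>x \<in> carrier M\<close> \<open>y \<in> carrier M\<close>
          by (simp add: twisted_mult_single M.m_assoc mult_ac)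
      qed (simp_all add: twisted_mult_add_left twisted_mult_add_right)
    qed (simp_all add: twisted_mult_add_left twisted_mult_add_right)
  qed (simp_all add: twisted_mult_add_left twisted_mult_add_right)
  have closed: "keys (f \<otimes>\<^bsub>?T\<^esub> g) \<subseteq> carrier M" if "keys f \<subseteq> carrier M" "keys g \<subseteq> carrier M" for f g
    using that by (auto elim!: keys_twisted_mult)
  have one: "single \<one>\<^bsub>M\<^esub> 1 \<otimes>\<^bsub>?T\<^esub> f = f" "f \<otimes>\<^bsub>?T\<^esub> single \<one>\<^bsub>M\<^esub> 1 = f"
    if "keys f \<subseteq> carrier M" for f
    using that
    by (induction rule: poly_mapping_carrier_induct; simp add: twisted_mult_single w1
        twisted_mult_add_left twisted_mult_add_right)+
  have "ring ?T"
  proof (rule ringI)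
    show "abelian_group ?T"
    proof (rule abelian_groupI)
      fix f assume "f \<in> carrier ?T"
      then show "\<exists>g\<in>carrier ?T. g \<oplus>\<^bsub>?T\<^esub> f = \<zero>\<^bsub>?T\<^esub>"
        by (intro bexI[of _ "- f"]) (auto simp: twisted_algebra_simps in_keys_iff subset_eq)
    qed (auto simp: twisted_algebra_simps add_ac dest: keys_add[THEN subsetD])
    show "monoid ?T"
      by (rule monoidI) (use assoc closed one in \<open>auto simp: twisted_algebra_simps\<close>)
  qed (simp_all add: twisted_algebra_simps twisted_mult_add_left twisted_mult_add_right)
  then show ?thesis
    by (rule kalgI) (auto simp: twisted_algebra_simps pm.scale_left_distrib pm.scale_right_distrib
        twisted_mult_scale in_keys_iff subset_eq)
qed

lemma finsum_twisted:
  assumes "kalg (twisted_algebra M w)" "\<And>x. x \<in> S \<Longrightarrow> keys (f x) \<subseteq> carrier M"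
  shows "finsum (twisted_algebra M w) f S = sum f S"
proof -
  interpret kalg "twisted_algebra M w" by fact
  show ?thesis using assms(2)
    by (induction S rule: infinite_finite_induct)
      (simp_all add: Pi_def finsum_insert, simp_all add: twisted_algebra_simps)
qed

lemma monoid_algebra_kalg: "monoid M \<Longrightarrow> kalg (monoid_algebra M)"
  by (simp add: monoid_algebra_twisted twisted_algebra_kalg)

lemma monoid_algebra_simps:
  "carrier (monoid_algebra M) = {f. keys f \<subseteq> carrier M}"
  "one (monoid_algebra M) = single \<one>\<^bsub>M\<^esub> 1"
  "zero (monoid_algebra M) = 0"
  "add (monoid_algebra M) = (+)"
  "smult (monoid_algebra M) = scale_pm"
  by (simp_all add: monoid_algebra_def)

lemma monoid_algebra_mult_single:
  "single x a \<otimes>\<^bsub>monoid_algebra M\<^esub> single y b =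
    single (x \<otimes>\<^bsub>M\<^esub> y) (a * b)"
  by (simp add: monoid_algebra_twisted twisted_mult_single)

lemma monoid_algebra_minus:
  assumes "monoid M" "f \<in> carrier (monoid_algebra M)" "g \<in> carrier (monoid_algebra M)"
  shows "f \<ominus>\<^bsub>monoid_algebra M\<^esub> g = f - g"
proof -
  interpret kalg "monoid_algebra M" using assms(1) by (rule monoid_algebra_kalg)
  have "- g \<in> carrier (monoid_algebra M)"
    using assms(3) by (auto simp: monoid_algebra_simps in_keys_iff subset_eq)
  then have "\<ominus>\<^bsub>monoid_algebra M\<^esub> g = - g"
    using assms(3) by (intro minus_equality) (auto simp: monoid_algebra_simps)
  then show ?thesis by (simp add: a_minus_def monoid_algebra_simps)
qed


subsection \<open>Linear extension\<close>

text \<open>Serves two purposes: to define algebra morphisms out of monoid algebras, and to write an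
  element as a finite combination of ordered monomials.\<close>

definition lin_ext :: "('k::field, 'a) module \<Rightarrow> ('x \<Rightarrow> 'a) \<Rightarrow> ('x \<Rightarrow>\<^sub>0 'k) \<Rightarrow> 'a" where
  "lin_ext R g f = finsum R (\<lambda>x. lookup f x \<odot>\<^bsub>R\<^esub> g x) (keys f)"

context
  fixes R :: "('k::field, 'a) module" and g :: "'x \<Rightarrow> 'a" and C :: "'x set"
  assumes R: "kalg R" and g: "\<And>x. x \<in> C \<Longrightarrow> g x \<in> carrier R"
begin

interpretation R: kalg R by (rule R)

lemma lin_ext_superset:
  assumes "finite X" "keys f \<subseteq> X" "X \<subseteq> C"
  shows "lin_ext R g f = finsum R (\<lambda>x. lookup f x \<odot>\<^bsub>R\<^esub> g x) X"
  unfolding lin_ext_def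
proof (rule R.add.finprod_mono_neutral_cong_left)
  fix x assume "x \<in> X - keys f"
  then show "lookup f x \<odot>\<^bsub>R\<^esub> g x = \<zero>\<^bsub>R\<^esub>" using assms g by (auto simp: in_keys_iff)
qed (use assms g in auto)

lemma lin_ext_closed: "keys f \<subseteq> C \<Longrightarrow> lin_ext R g f \<in> carrier R"
  unfolding lin_ext_def using g by (intro R.finsum_closed) auto

lemma lin_ext_single: "x \<in> C \<Longrightarrow> lin_ext R g (single x c) = c \<odot>\<^bsub>R\<^esub> g x"
  using lin_ext_superset[of "{x}" "single x c"] g by (simp add: R.finsum_insert)

lemma lin_ext_zero: "lin_ext R g 0 = \<zero>\<^bsub>R\<^esub>"
  by (simp add: lin_ext_def)

lemma lin_ext_add:
  assumes "keys f \<subseteq> C" "keys f' \<subseteq> C"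
  shows "lin_ext R g (f + f') = lin_ext R g f \<oplus>\<^bsub>R\<^esub> lin_ext R g f'"
proof -
  let ?X = "keys f \<union> keys f'"
  have X: "?X \<subseteq> C" "finite ?X" "keys (f + f') \<subseteq> ?X" using assms keys_add[of f f'] by auto
  have "(\<lambda>x. lookup f x \<odot>\<^bsub>R\<^esub> g x) \<in> ?X \<rightarrow> carrier R" "(\<lambda>x. lookup f' x \<odot>\<^bsub>R\<^esub> g x) \<in> ?X \<rightarrow> carrier R"
    using X g by auto
  moreover have "finsum R (\<lambda>x. lookup (f + f') x \<odot>\<^bsub>R\<^esub> g x) ?X =
    finsum R (\<lambda>x. lookup f x \<odot>\<^bsub>R\<^esub> g x \<oplus>\<^bsub>R\<^esub> lookup f' x \<odot>\<^bsub>R\<^esub> g x) ?X"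
    using X g by (intro R.finsum_cong') (auto simp: lookup_add R.smult_l_distr subset_eq)
  ultimately show ?thesis using X by (simp add: lin_ext_superset[of ?X] R.finsum_addf)
qed

lemma lin_ext_scale:
  assumes "keys f \<subseteq> C"
  shows "lin_ext R g (scale_pm c f) = c \<odot>\<^bsub>R\<^esub> lin_ext R g f"
proof -
  have "lin_ext R g (scale_pm c f) = finsum R (\<lambda>x. c \<odot>\<^bsub>R\<^esub> (lookup f x \<odot>\<^bsub>R\<^esub> g x)) (keys f)"
    using assms g keys_scale_pm[of c f]
    by (subst lin_ext_superset[of "keys f"])
      (auto intro!: R.finsum_cong' simp: R.smult_assoc1 subset_eq)
  also have "\<dots> = c \<odot>\<^bsub>R\<^esub> lin_ext R g f"
    unfolding lin_ext_def using assms g by (intro R.finsum_smult[symmetric]) auto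
  finally show ?thesis .
qed

end

text \<open>Both sides of multiplicativity are bilinear, so it need only be checked on basis
  vectors, where it is \<open>gm\<close>.\<close>

lemma lin_ext_alg_hom:
  assumes M: "monoid M" and R: "kalg R"
    and g: "\<And>x. x \<in> carrier M \<Longrightarrow> g x \<in> carrier R"
    and gm: "\<And>x y. x \<in> carrier M \<Longrightarrow> y \<in> carrier M \<Longrightarrow> g (x \<otimes>\<^bsub>M\<^esub> y) = g x \<otimes>\<^bsub>R\<^esub> g y"
    and g1: "g \<one>\<^bsub>M\<^esub> = \<one>\<^bsub>R\<^esub>"
  shows "lin_ext R g \<in> alg_hom (monoid_algebra M) R"
proof -
  interpret M: monoid M by fact
  interpret R: kalg R by fact
  interpret MA: kalg "monoid_algebra M" using M by (rule monoid_algebra_kalg)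
  note [simp] = lin_ext_single[of R "carrier M", OF R g] lin_ext_add[of R "carrier M", OF R g]
    lin_ext_closed[of R "carrier M", OF R g] lin_ext_scale[of R "carrier M", OF R g]
    lin_ext_zero[of R "carrier M", OF R g]
  let ?h = "lin_ext R g"
  have keys: "keys (f \<otimes>\<^bsub>monoid_algebra M\<^esub> f') \<subseteq> carrier M"
    if "keys f \<subseteq> carrier M" "keys f' \<subseteq> carrier M" for f f'
    using that MA.m_closed[of f f'] by (simp add: monoid_algebra_simps)
  have mult: "?h (f \<otimes>\<^bsub>monoid_algebra M\<^esub> f') = ?h f \<otimes>\<^bsub>R\<^esub> ?h f'"
    if "keys f \<subseteq> carrier M" "keys f' \<subseteq> carrier M" for f f'
    using that(1)
  proof (induction rule: poly_mapping_carrier_induct)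
    case zero
    then show ?case using that g by (simp add: monoid_algebra_twisted)
  next
    case (single x a)
    from that(2) show ?case
    proof (induction rule: poly_mapping_carrier_induct)
      case zero
      then show ?case using single g by (simp add: monoid_algebra_twisted)
    next
      case (single y b)
      then show ?case using \<open>x \<in> carrier M\<close> g
        by (simp add: monoid_algebra_mult_single gm R.smult_mult_l R.smult_mult_r mult.commute[of a b] R.smult_assoc1)
    next
      case (add f1 f2)
      have s: "keys (single x a) \<subseteq> carrier M" using single by auto
      have "single x a \<otimes>\<^bsub>monoid_algebra M\<^esub> (f1 + f2) =
        single x a \<otimes>\<^bsub>monoid_algebra M\<^esub> f1 + single x a \<otimes>\<^bsub>monoid_algebra M\<^esub> f2"
        by (simp add: monoid_algebra_twisted twisted_mult_add_right)
      then show ?case using add keys[OF s add(1)] keys[OF s add(2)] single g by (simp add: R.r_distr)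
    qed
  next
    case (add f1 f2)
    have "(f1 + f2) \<otimes>\<^bsub>monoid_algebra M\<^esub> f' = f1 \<otimes>\<^bsub>monoid_algebra M\<^esub> f' + f2 \<otimes>\<^bsub>monoid_algebra M\<^esub> f'"
      by (simp add: monoid_algebra_twisted twisted_mult_add_left)
    then show ?case using add keys[OF add(1) that(2)] keys[OF add(2) that(2)] that by (simp add: R.l_distr)
  qed
  show ?thesis
    by (rule alg_homI) (auto simp: monoid_algebra_simps mult g1 R.smult_one)
qed


section \<open>Free algebras\<close>

lemma free_monoid_monoid: "monoid (free_monoid X)"
  by (rule monoidI) (auto simp: free_monoid_def)

lemma free_monoid_simps:
  "carrier (free_monoid X) = lists X" "monoid.mult (free_monoid X) = (@)" "one (free_monoid X) = []"
  by (simp_all add: free_monoid_def)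

lemma free_algebra_kalg: "kalg (free_algebra X)"
  by (rule monoid_algebra_kalg[OF free_monoid_monoid])

lemma free_algebra_lift:
  assumes R: "kalg R" and g: "\<And>x. x \<in> X \<Longrightarrow> g x \<in> carrier R"
  obtains h where "h \<in> alg_hom (free_algebra X) R"
    "\<And>x. x \<in> X \<Longrightarrow> h (single [x] 1) = g x"
proof -
  interpret R: kalg R by fact
  let ?g = "\<lambda>w. foldr (monoid.mult R) (map g w) \<one>\<^bsub>R\<^esub>"
  have cl: "?g w \<in> carrier R" if "w \<in> lists X" for w
    using that by (induction w) (auto simp: g)
  have "?g (v @ w) = ?g v \<otimes>\<^bsub>R\<^esub> ?g w" if "v \<in> lists X" "w \<in> lists X" for v w
    using that(1)
  proof (induction v)
    case Nil then show ?case using cl[OF that(2)] by simp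
  next
    case (Cons x v) then show ?case using cl[of v] cl[OF that(2)] g by (simp add: R.m_assoc)
  qed
  then have hom: "lin_ext R ?g \<in> alg_hom (free_algebra X) R"
    using cl by (intro lin_ext_alg_hom[OF free_monoid_monoid R]) (auto simp: free_monoid_simps)
  have "lin_ext R ?g (single [x] 1) = g x" if "x \<in> X" for x
    using that g lin_ext_single[of R "lists X" ?g "[x]" 1, OF R cl] by simp
  then show ?thesis using hom that by blast
qed

lemma free_algebra_generates:
  "generates (free_algebra X) {single [x] (1::'k::field) | x. x \<in> X}"
  unfolding generates_def
proof (intro conjI allI impI subsetI)
  let ?F = "free_algebra X :: ('k, _) module"
  fix S f assume S: "subalgebra ?F S" and X: "{single [x] 1 | x. x \<in> X} \<subseteq> S"
    and "f \<in> carrier ?F"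
  then have sr: "subring S ?F" and sm: "\<And>c x. x \<in> S \<Longrightarrow> scale_pm c x \<in> S"
    by (auto simp: subalgebra_def monoid_algebra_simps)
  have word: "single w (1::'k) \<in> S" if "w \<in> lists X" for w
    using that
  proof (induction w)
    case Nil
    then show ?case using subringE(3)[OF sr] by (simp add: monoid_algebra_simps free_monoid_simps)
  next
    case (Cons x w)
    then have "single [x] 1 \<otimes>\<^bsub>?F\<^esub> single w 1 \<in> S"
      using X by (intro subringE(6)[OF sr]) auto
    then show ?case by (simp add: monoid_algebra_mult_single free_monoid_simps)
  qed
  have "keys f \<subseteq> lists X" using \<open>f \<in> carrier ?F\<close> by (simp add: monoid_algebra_simps free_monoid_simps)
  then show "f \<in> S"
  proof (induction rule: poly_mapping_carrier_induct)
    case zero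
    then show ?case using subringE(2)[OF sr] by (simp add: monoid_algebra_simps)
  next
    case (single x c)
    then show ?case using sm[OF word, of x c] by simp
  next
    case (add f g)
    then show ?case using subringE(7)[OF sr, of f g] by (simp add: monoid_algebra_simps)
  qed
qed (auto simp: monoid_algebra_simps free_monoid_simps)


section \<open>The tensor product algebra and its universal property\<close>

section \<open>Tensor products of algebras\<close>

context
  fixes A :: "('k::field, 'a) module" and B :: "('k, 'b) module"
  assumes A: "kalg A" and B: "kalg B"
begin

interpretation A: kalg A by (rule A)
interpretation B: kalg B by (rule B)

lemma tensor_monoid: "monoid (A \<times>\<times> B)"
  by (rule DirProd_monoid) unfold_locales

interpretation MA: kalg "monoid_algebra (A \<times>\<times> B) :: ('k, _) module"
  by (rule monoid_algebra_kalg[OF tensor_monoid])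

abbreviation (input) "MAB \<equiv> monoid_algebra (A \<times>\<times> B)"

lemma bilinear_relations_cases:
  assumes "x \<in> bilinear_relations A B"
  obtains (1) u u' v where "x = single (u \<oplus>\<^bsub>A\<^esub> u', v) 1
       - single (u, v) 1 - single (u', v) 1"
       "u \<in> carrier A" "u' \<in> carrier A" "v \<in> carrier B"
    | (2) u v v' where "x = single (u, v \<oplus>\<^bsub>B\<^esub> v') 1
       - single (u, v) 1 - single (u, v') 1"
       "u \<in> carrier A" "v \<in> carrier B" "v' \<in> carrier B"
    | (3) c u v where "x = single (c \<odot>\<^bsub>A\<^esub> u, v) 1 - single (u, v) c"
       "u \<in> carrier A" "v \<in> carrier B"
    | (4) c u v where "x = single (u, c \<odot>\<^bsub>B\<^esub> v) 1 - single (u, v) c"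
       "u \<in> carrier A" "v \<in> carrier B"
  using assms unfolding bilinear_relations_def by blast

lemma bilinear_relations_carrier:
  assumes "x \<in> bilinear_relations A B"
  shows "keys x \<subseteq> carrier A \<times> carrier B"
  using assms by (cases rule: bilinear_relations_cases) (auto dest!: keys_diff[THEN subsetD] split: if_splits)

lemma tensor_null_subspace: "pm.subspace (tensor_null A B)"
  unfolding tensor_null_def by (rule pm.subspace_span)

lemma tensor_null_base: "x \<in> bilinear_relations A B \<Longrightarrow> x \<in> tensor_null A B"
  unfolding tensor_null_def by (rule pm.span_base)

lemma tensor_null_carrier: "x \<in> tensor_null A B \<Longrightarrow> keys x \<subseteq> carrier A \<times> carrier B"
  unfolding tensor_null_def
proof (induction rule: pm.span_induct_alt)
  case (step c x y)
  then have "keys x \<subseteq> carrier A \<times> carrier B" by (simp add: bilinear_relations_carrier)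
  with step show ?case using keys_add[of "scale_pm c x" y] keys_scale_pm[of c x] by blast
qed simp

text \<open>Multiplication by a pair is linear in each component, so each of the four kinds of
  relation goes to a relation of the same kind. Hence their span is an ideal.\<close>

lemma bilinear_relations_mult:
  assumes x: "x \<in> bilinear_relations A B" and a: "a \<in> carrier A" and b: "b \<in> carrier B"
  shows "x \<otimes>\<^bsub>MAB\<^esub> single (a, b) 1 \<in> bilinear_relations A B"
    and "single (a, b) 1 \<otimes>\<^bsub>MAB\<^esub> x \<in> bilinear_relations A B"
proof -
  have diffl: "(f - f') \<otimes>\<^bsub>MAB\<^esub> g =
    f \<otimes>\<^bsub>MAB\<^esub> g - f' \<otimes>\<^bsub>MAB\<^esub> g"
    and diffr: "g \<otimes>\<^bsub>MAB\<^esub> (f - f') =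
    g \<otimes>\<^bsub>MAB\<^esub> f - g \<otimes>\<^bsub>MAB\<^esub> f'" for f f' g :: "_ \<Rightarrow>\<^sub>0 'k"
    using twisted_mult_add_left[of "A \<times>\<times> B" "\<lambda>_ _. 1" "f - f'" f' g]
      twisted_mult_add_right[of "A \<times>\<times> B" "\<lambda>_ _. 1" g "f - f'" f']
    by (simp_all add: monoid_algebra_twisted eq_diff_eq)
  note s = diffl diffr monoid_algebra_mult_single
  from x have "x \<otimes>\<^bsub>MAB\<^esub> single (a, b) 1 \<in> bilinear_relations A B \<and>
    single (a, b) 1 \<otimes>\<^bsub>MAB\<^esub> x \<in> bilinear_relations A B"
  proof (cases rule: bilinear_relations_cases)
    case (1 u u' v)
    have "x \<otimes>\<^bsub>MAB\<^esub> single (a, b) 1 =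
      single (u \<otimes>\<^bsub>A\<^esub> a \<oplus>\<^bsub>A\<^esub> u' \<otimes>\<^bsub>A\<^esub> a, v \<otimes>\<^bsub>B\<^esub> b) 1
       - single (u \<otimes>\<^bsub>A\<^esub> a, v \<otimes>\<^bsub>B\<^esub> b) 1 - single (u' \<otimes>\<^bsub>A\<^esub> a, v \<otimes>\<^bsub>B\<^esub> b) 1"
      "single (a, b) 1 \<otimes>\<^bsub>MAB\<^esub> x =
      single (a \<otimes>\<^bsub>A\<^esub> u \<oplus>\<^bsub>A\<^esub> a \<otimes>\<^bsub>A\<^esub> u', b \<otimes>\<^bsub>B\<^esub> v) 1
       - single (a \<otimes>\<^bsub>A\<^esub> u, b \<otimes>\<^bsub>B\<^esub> v) 1 - single (a \<otimes>\<^bsub>A\<^esub> u', b \<otimes>\<^bsub>B\<^esub> v) 1"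
      using 1 a b by (simp_all add: s A.l_distr A.r_distr)
    then show ?thesis using 1 a b unfolding bilinear_relations_def by blast
  next
    case (2 u v v')
    have "x \<otimes>\<^bsub>MAB\<^esub> single (a, b) 1 =
      single (u \<otimes>\<^bsub>A\<^esub> a, v \<otimes>\<^bsub>B\<^esub> b \<oplus>\<^bsub>B\<^esub> v' \<otimes>\<^bsub>B\<^esub> b) 1
       - single (u \<otimes>\<^bsub>A\<^esub> a, v \<otimes>\<^bsub>B\<^esub> b) 1 - single (u \<otimes>\<^bsub>A\<^esub> a, v' \<otimes>\<^bsub>B\<^esub> b) 1"
      "single (a, b) 1 \<otimes>\<^bsub>MAB\<^esub> x =
      single (a \<otimes>\<^bsub>A\<^esub> u, b \<otimes>\<^bsub>B\<^esub> v \<oplus>\<^bsub>B\<^esub> b \<otimes>\<^bsub>B\<^esub> v') 1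
       - single (a \<otimes>\<^bsub>A\<^esub> u, b \<otimes>\<^bsub>B\<^esub> v) 1 - single (a \<otimes>\<^bsub>A\<^esub> u, b \<otimes>\<^bsub>B\<^esub> v') 1"
      using 2 a b by (simp_all add: s B.l_distr B.r_distr)
    then show ?thesis using 2 a b unfolding bilinear_relations_def by blast
  next
    case (3 c u v)
    have "x \<otimes>\<^bsub>MAB\<^esub> single (a, b) 1 =
      single (c \<odot>\<^bsub>A\<^esub> (u \<otimes>\<^bsub>A\<^esub> a), v \<otimes>\<^bsub>B\<^esub> b) 1 - single (u \<otimes>\<^bsub>A\<^esub> a, v \<otimes>\<^bsub>B\<^esub> b) c"
      "single (a, b) 1 \<otimes>\<^bsub>MAB\<^esub> x =
      single (c \<odot>\<^bsub>A\<^esub> (a \<otimes>\<^bsub>A\<^esub> u), b \<otimes>\<^bsub>B\<^esub> v) 1 - single (a \<otimes>\<^bsub>A\<^esub> u, b \<otimes>\<^bsub>B\<^esub> v) c"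
      using 3 a b by (simp_all add: s A.smult_mult_l A.smult_mult_r)
    then show ?thesis using 3 a b unfolding bilinear_relations_def by blast
  next
    case (4 c u v)
    have "x \<otimes>\<^bsub>MAB\<^esub> single (a, b) 1 =
      single (u \<otimes>\<^bsub>A\<^esub> a, c \<odot>\<^bsub>B\<^esub> (v \<otimes>\<^bsub>B\<^esub> b)) 1 - single (u \<otimes>\<^bsub>A\<^esub> a, v \<otimes>\<^bsub>B\<^esub> b) c"
      "single (a, b) 1 \<otimes>\<^bsub>MAB\<^esub> x =
      single (a \<otimes>\<^bsub>A\<^esub> u, c \<odot>\<^bsub>B\<^esub> (b \<otimes>\<^bsub>B\<^esub> v)) 1 - single (a \<otimes>\<^bsub>A\<^esub> u, b \<otimes>\<^bsub>B\<^esub> v) c"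
      using 4 a b by (simp_all add: s B.smult_mult_l B.smult_mult_r)
    then show ?thesis using 4 a b unfolding bilinear_relations_def by blast
  qed
  then show "x \<otimes>\<^bsub>MAB\<^esub> single (a, b) 1 \<in> bilinear_relations A B"
    and "single (a, b) 1 \<otimes>\<^bsub>MAB\<^esub> x \<in> bilinear_relations A B" by auto
qed

lemma tensor_null_mult:
  assumes "x \<in> tensor_null A B" "keys f \<subseteq> carrier A \<times> carrier B"
  shows "x \<otimes>\<^bsub>MAB\<^esub> f \<in> tensor_null A B \<and>
    f \<otimes>\<^bsub>MAB\<^esub> x \<in> tensor_null A B"
  using assms(2)
proof (induction rule: poly_mapping_carrier_induct)
  case zero
  then show ?case using pm.subspace_0[OF tensor_null_subspace] by (simp add: monoid_algebra_twisted)
next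
  case (single y c)
  obtain a b where y: "y = (a, b)" "a \<in> carrier A" "b \<in> carrier B" using single by auto
  have 1: "x \<otimes>\<^bsub>MAB\<^esub> single y 1 \<in> tensor_null A B \<and>
    single y 1 \<otimes>\<^bsub>MAB\<^esub> x \<in> tensor_null A B"
    using assms(1) unfolding tensor_null_def[of A B]
  proof (induction rule: pm.span_induct_alt)
    case base
    then show ?case by (simp add: monoid_algebra_twisted pm.span_zero)
  next
    case (step c x z)
    note mem = bilinear_relations_mult[OF step(1) y(2,3)]
    from step(2) show ?case unfolding y monoid_algebra_twisted twisted_mult_add_left twisted_mult_add_right
        twisted_mult_scale
      using mem unfolding monoid_algebra_twisted
      by (auto intro!: pm.span_add pm.span_scale intro: pm.span_base simp: y)
  qed
  have "single y c = scale_pm c (single y 1)" by simp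
  then show ?case using 1 pm.subspace_scale[OF tensor_null_subspace]
    by (simp del: scale_pm_single add: monoid_algebra_twisted twisted_mult_scale)
next
  case (add f g)
  then show ?case using pm.subspace_add[OF tensor_null_subspace]
    by (simp add: monoid_algebra_twisted twisted_mult_add_left twisted_mult_add_right)
qed

lemma tensor_null_ideal: "ideal (tensor_null A B) MAB"
proof (rule idealI[OF MA.ring_axioms])
  show "subgroup (tensor_null A B) (add_monoid MAB)"
  proof (rule MA.add.subgroupI)
    show "tensor_null A B \<subseteq> carrier MAB"
      using tensor_null_carrier by (auto simp: monoid_algebra_simps)
    show "tensor_null A B \<noteq> {}" using pm.subspace_0[OF tensor_null_subspace] by auto
  next
    fix x assume x: "x \<in> tensor_null A B"
    then have "x \<in> carrier MAB"
      using tensor_null_carrier by (auto simp: monoid_algebra_simps)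
    then have "\<ominus>\<^bsub>MAB\<^esub> x = - x"
      using monoid_algebra_minus[OF tensor_monoid, of "0" x]
      by (simp add: monoid_algebra_simps a_minus_def)
    then show "\<ominus>\<^bsub>MAB\<^esub> x \<in> tensor_null A B"
      using x pm.subspace_neg[OF tensor_null_subspace] by simp
  qed (use pm.subspace_add[OF tensor_null_subspace] in \<open>auto simp: monoid_algebra_simps\<close>)
qed (use tensor_null_mult in \<open>auto simp: monoid_algebra_simps\<close>)

lemma tensor_kalg: "kalg (tensor_algebra A B)"
  unfolding tensor_algebra_def by (rule quotient_kalg[OF MA.kalg_axioms tensor_null_ideal])

lemma tensor_single_carrier:
  "a \<in> carrier A \<Longrightarrow> b \<in> carrier B \<Longrightarrow>
    single (a, b) c \<in> carrier MAB"
  by (auto simp: monoid_algebra_simps)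

lemma pure_tensor_closed:
  "a \<in> carrier A \<Longrightarrow> b \<in> carrier B \<Longrightarrow> pure_tensor A B a b \<in> carrier (tensor_algebra A B)"
  unfolding tensor_algebra_def pure_tensor_def
  using alg_homD(1)[OF quotient_proj[OF MA.kalg_axioms tensor_null_ideal] tensor_single_carrier] .

lemma pure_tensor_mult:
  assumes "a \<in> carrier A" "b \<in> carrier B" "a' \<in> carrier A" "b' \<in> carrier B"
  shows "pure_tensor A B a b \<otimes>\<^bsub>tensor_algebra A B\<^esub> pure_tensor A B a' b' =
    pure_tensor A B (a \<otimes>\<^bsub>A\<^esub> a') (b \<otimes>\<^bsub>B\<^esub> b')"
  unfolding tensor_algebra_def pure_tensor_def
  using quotient_ops(1)[OF MA.kalg_axioms tensor_null_ideal tensor_single_carrier tensor_single_carrier,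
      OF assms, of 1 1]
  by (simp add: monoid_algebra_mult_single)

lemma pure_tensor_one: "\<one>\<^bsub>tensor_algebra A B\<^esub> = pure_tensor A B \<one>\<^bsub>A\<^esub> \<one>\<^bsub>B\<^esub>"
  unfolding tensor_algebra_def pure_tensor_def
  by (subst quotient_one[OF MA.kalg_axioms tensor_null_ideal]) (simp add: monoid_algebra_simps)

lemma tensor_coset_eqI:
  assumes "x - y \<in> tensor_null A B" "x \<in> carrier MAB"
    "y \<in> carrier MAB"
  shows "tensor_null A B +>\<^bsub>MAB\<^esub> x = tensor_null A B +>\<^bsub>MAB\<^esub> y"
  using quotient_eq_iff[OF MA.kalg_axioms tensor_null_ideal assms(2,3)] assms
  by (simp add: monoid_algebra_minus[OF tensor_monoid])

lemma pure_tensor_smult: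
  assumes "a \<in> carrier A" "b \<in> carrier B"
  shows "c \<odot>\<^bsub>tensor_algebra A B\<^esub> pure_tensor A B a b =
    tensor_null A B +>\<^bsub>MAB\<^esub> single (a, b) c"
  unfolding tensor_algebra_def pure_tensor_def
  using quotient_ops(3)[OF MA.kalg_axioms tensor_null_ideal tensor_single_carrier tensor_single_carrier,
      OF assms assms, of c 1] by (simp add: monoid_algebra_simps)

lemma pure_tensor_smult_l:
  assumes "a \<in> carrier A" "b \<in> carrier B"
  shows "pure_tensor A B (c \<odot>\<^bsub>A\<^esub> a) b = c \<odot>\<^bsub>tensor_algebra A B\<^esub> pure_tensor A B a b"
  unfolding pure_tensor_smult[OF assms] unfolding pure_tensor_def[of A B]
  using assms by (intro tensor_coset_eqI tensor_null_base)
    (auto simp: bilinear_relations_def monoid_algebra_simps)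

lemma pure_tensor_smult_r:
  assumes "a \<in> carrier A" "b \<in> carrier B"
  shows "pure_tensor A B a (c \<odot>\<^bsub>B\<^esub> b) = c \<odot>\<^bsub>tensor_algebra A B\<^esub> pure_tensor A B a b"
  unfolding pure_tensor_smult[OF assms] unfolding pure_tensor_def[of A B]
  using assms by (intro tensor_coset_eqI tensor_null_base)
    (auto simp: bilinear_relations_def monoid_algebra_simps)

lemma pure_tensor_plus:
  assumes "a \<in> carrier A" "b \<in> carrier B" "a' \<in> carrier A" "b' \<in> carrier B"
  shows "pure_tensor A B a b \<oplus>\<^bsub>tensor_algebra A B\<^esub> pure_tensor A B a' b' =
    tensor_null A B +>\<^bsub>MAB\<^esub>
      (single (a, b) 1 + single (a', b') 1)"
  unfolding tensor_algebra_def pure_tensor_def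
  using quotient_ops(2)[OF MA.kalg_axioms tensor_null_ideal tensor_single_carrier tensor_single_carrier,
      OF assms, of 1 1] by (simp add: monoid_algebra_simps)

lemma pure_tensor_add_l:
  assumes "a \<in> carrier A" "a' \<in> carrier A" "b \<in> carrier B"
  shows "pure_tensor A B (a \<oplus>\<^bsub>A\<^esub> a') b =
    pure_tensor A B a b \<oplus>\<^bsub>tensor_algebra A B\<^esub> pure_tensor A B a' b"
  unfolding pure_tensor_plus[OF assms(1,3,2,3)] unfolding pure_tensor_def[of A B]
proof (rule tensor_coset_eqI)
  have "single (a \<oplus>\<^bsub>A\<^esub> a', b) 1 -
     single (a, b) 1 - single (a', b) (1::'k) \<in> tensor_null A B"
    using assms by (intro tensor_null_base) (auto simp: bilinear_relations_def)
  then show "single (a \<oplus>\<^bsub>A\<^esub> a', b) 1 -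
     (single (a, b) 1 + single (a', b) 1) \<in> tensor_null A B"
    by (simp add: diff_diff_eq)
  show "single (a, b) 1 + single (a', b) (1::'k) \<in> carrier MAB"
    using MA.a_closed[OF tensor_single_carrier tensor_single_carrier, OF assms(1,3,2,3), of 1 1]
    by (simp add: monoid_algebra_simps)
qed (use assms in \<open>auto simp: monoid_algebra_simps\<close>)

lemma pure_tensor_add_r:
  assumes "a \<in> carrier A" "b \<in> carrier B" "b' \<in> carrier B"
  shows "pure_tensor A B a (b \<oplus>\<^bsub>B\<^esub> b') =
    pure_tensor A B a b \<oplus>\<^bsub>tensor_algebra A B\<^esub> pure_tensor A B a b'"
  unfolding pure_tensor_plus[OF assms(1,2,1,3)] unfolding pure_tensor_def[of A B]
proof (rule tensor_coset_eqI)
  have "single (a, b \<oplus>\<^bsub>B\<^esub> b') 1 -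
     single (a, b) 1 - single (a, b') (1::'k) \<in> tensor_null A B"
    using assms by (intro tensor_null_base) (auto simp: bilinear_relations_def)
  then show "single (a, b \<oplus>\<^bsub>B\<^esub> b') 1 -
     (single (a, b) 1 + single (a, b') 1) \<in> tensor_null A B"
    by (simp add: diff_diff_eq)
  show "single (a, b) 1 + single (a, b') (1::'k) \<in> carrier MAB"
    using MA.a_closed[OF tensor_single_carrier tensor_single_carrier, OF assms(1,2,1,3), of 1 1]
    by (simp add: monoid_algebra_simps)
qed (use assms in \<open>auto simp: monoid_algebra_simps\<close>)

lemma tensor_inl: "(\<lambda>a. pure_tensor A B a \<one>\<^bsub>B\<^esub>) \<in> alg_hom A (tensor_algebra A B)"
  by (rule alg_homI)
    (simp_all add: pure_tensor_closed pure_tensor_mult pure_tensor_add_l pure_tensor_one pure_tensor_smult_l)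

lemma tensor_inr: "(\<lambda>b. pure_tensor A B \<one>\<^bsub>A\<^esub> b) \<in> alg_hom B (tensor_algebra A B)"
  by (rule alg_homI)
    (simp_all add: pure_tensor_closed pure_tensor_mult pure_tensor_add_r pure_tensor_one pure_tensor_smult_r)

text \<open>Reduces statements about the tensor product to the two algebra morphisms
  \<open>tensor_inl\<close> and \<open>tensor_inr\<close>, whose images commute.\<close>

lemma pure_tensor_factor:
  assumes "a \<in> carrier A" "b \<in> carrier B"
  shows "pure_tensor A B a b = pure_tensor A B a \<one>\<^bsub>B\<^esub> \<otimes>\<^bsub>tensor_algebra A B\<^esub> pure_tensor A B \<one>\<^bsub>A\<^esub> b"
    and "pure_tensor A B a b = pure_tensor A B \<one>\<^bsub>A\<^esub> b \<otimes>\<^bsub>tensor_algebra A B\<^esub> pure_tensor A B a \<one>\<^bsub>B\<^esub>"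
  using assms by (simp_all add: pure_tensor_mult)

lemma pure_tensor_finsum_l:
  assumes "f \<in> S \<rightarrow> carrier A" "b \<in> carrier B"
  shows "pure_tensor A B (finsum A f S) b =
    finsum (tensor_algebra A B) (\<lambda>i. pure_tensor A B (f i) b) S"
proof -
  interpret T: kalg "tensor_algebra A B" by (rule tensor_kalg)
  have *: "finsum A f S \<in> carrier A" using assms by (intro A.finsum_closed)
  have f: "f i \<in> carrier A" if "i \<in> S" for i using assms that by auto
  have "pure_tensor A B (finsum A f S) b =
    finsum (tensor_algebra A B) (\<lambda>i. pure_tensor A B (f i) \<one>\<^bsub>B\<^esub>) S \<otimes>\<^bsub>tensor_algebra A B\<^esub> pure_tensor A B \<one>\<^bsub>A\<^esub> b"
    using pure_tensor_factor(1)[OF * assms(2)] alg_hom_finsum[OF tensor_inl A tensor_kalg assms(1)] by simp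
  also have "\<dots> = finsum (tensor_algebra A B) (\<lambda>i. pure_tensor A B (f i) \<one>\<^bsub>B\<^esub> \<otimes>\<^bsub>tensor_algebra A B\<^esub> pure_tensor A B \<one>\<^bsub>A\<^esub> b) S"
  proof (cases "finite S")
    case True
    then show ?thesis using assms(2) f
      by (intro T.finsum_ldistr) (auto intro!: pure_tensor_closed)
  next
    case False
    then show ?thesis using assms by (simp add: pure_tensor_closed)
  qed
  also have "\<dots> = finsum (tensor_algebra A B) (\<lambda>i. pure_tensor A B (f i) b) S"
    using assms(2) f
    by (intro T.finsum_cong' refl) (simp_all add: Pi_def pure_tensor_closed pure_tensor_mult)
  finally show ?thesis .
qed

lemma pure_tensor_finsum_r:
  assumes "f \<in> S \<rightarrow> carrier B" "a \<in> carrier A"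
  shows "pure_tensor A B a (finsum B f S) =
    finsum (tensor_algebra A B) (\<lambda>i. pure_tensor A B a (f i)) S"
proof -
  interpret T: kalg "tensor_algebra A B" by (rule tensor_kalg)
  have *: "finsum B f S \<in> carrier B" using assms by (intro B.finsum_closed)
  have f: "f i \<in> carrier B" if "i \<in> S" for i using assms that by auto
  have "pure_tensor A B a (finsum B f S) =
    finsum (tensor_algebra A B) (\<lambda>i. pure_tensor A B \<one>\<^bsub>A\<^esub> (f i)) S \<otimes>\<^bsub>tensor_algebra A B\<^esub> pure_tensor A B a \<one>\<^bsub>B\<^esub>"
    using pure_tensor_factor(2)[OF assms(2) *] alg_hom_finsum[OF tensor_inr B tensor_kalg assms(1)] by simp
  also have "\<dots> = finsum (tensor_algebra A B) (\<lambda>i. pure_tensor A B \<one>\<^bsub>A\<^esub> (f i) \<otimes>\<^bsub>tensor_algebra A B\<^esub> pure_tensor A B a \<one>\<^bsub>B\<^esub>) S"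
  proof (cases "finite S")
    case True
    then show ?thesis using assms(2) f
      by (intro T.finsum_ldistr) (auto intro!: pure_tensor_closed)
  next
    case False
    then show ?thesis using assms by (simp add: pure_tensor_closed)
  qed
  also have "\<dots> = finsum (tensor_algebra A B) (\<lambda>i. pure_tensor A B a (f i)) S"
    using assms(2) f
    by (intro T.finsum_cong' refl) (simp_all add: Pi_def pure_tensor_closed pure_tensor_mult)
  finally show ?thesis .
qed

lemma tensor_generates:
  assumes gA: "generates A X" and gB: "generates B Y"
  shows "generates (tensor_algebra A B)
    ((\<lambda>a. pure_tensor A B a \<one>\<^bsub>B\<^esub>) ` X \<union> (\<lambda>b. pure_tensor A B \<one>\<^bsub>A\<^esub> b) ` Y)"
  unfolding generates_def
proof (intro conjI allI impI)
  interpret T: kalg "tensor_algebra A B" by (rule tensor_kalg)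
  show "(\<lambda>a. pure_tensor A B a \<one>\<^bsub>B\<^esub>) ` X \<union> (\<lambda>b. pure_tensor A B \<one>\<^bsub>A\<^esub> b) ` Y \<subseteq> carrier (tensor_algebra A B)"
    using gA gB by (auto intro!: pure_tensor_closed simp: generates_def)
  fix S assume S: "subalgebra (tensor_algebra A B) S"
    and XY: "(\<lambda>a. pure_tensor A B a \<one>\<^bsub>B\<^esub>) ` X \<union> (\<lambda>b. pure_tensor A B \<one>\<^bsub>A\<^esub> b) ` Y \<subseteq> S"
  then have sr: "subring S (tensor_algebra A B)"
    and sm: "\<And>c x. x \<in> S \<Longrightarrow> c \<odot>\<^bsub>tensor_algebra A B\<^esub> x \<in> S" by (auto simp: subalgebra_def)
  have l: "pure_tensor A B a \<one>\<^bsub>B\<^esub> \<in> S" if "a \<in> carrier A" for a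
    using A gA that
  proof (induction rule: generates_induct)
    case one then show ?case using subringE(3)[OF sr] by (simp add: pure_tensor_one)
  next
    case (mult x y) then show ?case using subringE(6)[OF sr] by (simp add: alg_homD[OF tensor_inl])
  next
    case (add x y) then show ?case using subringE(7)[OF sr] by (simp add: alg_homD[OF tensor_inl])
  next
    case (smult c x) then show ?case using sm by (simp add: alg_homD[OF tensor_inl])
  qed (use XY in auto)
  have r: "pure_tensor A B \<one>\<^bsub>A\<^esub> b \<in> S" if "b \<in> carrier B" for b
    using B gB that
  proof (induction rule: generates_induct)
    case one then show ?case using subringE(3)[OF sr] by (simp add: pure_tensor_one)
  next
    case (mult x y) then show ?case using subringE(6)[OF sr] by (simp add: alg_homD[OF tensor_inr])
  next
    case (add x y) then show ?case using subringE(7)[OF sr] by (simp add: alg_homD[OF tensor_inr])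
  next
    case (smult c x) then show ?case using sm by (simp add: alg_homD[OF tensor_inr])
  qed (use XY in auto)
  have p: "pure_tensor A B a b \<in> S" if "a \<in> carrier A" "b \<in> carrier B" for a b
    using subringE(6)[OF sr l[OF that(1)] r[OF that(2)]] pure_tensor_factor(1)[OF that] by simp
  let ?c = "\<lambda>f. tensor_null A B +>\<^bsub>MAB\<^esub> f"
  note proj = quotient_proj[OF MA.kalg_axioms tensor_null_ideal, folded tensor_algebra_def]
  have "?c f \<in> S" if "keys f \<subseteq> carrier A \<times> carrier B" for f
    using that
  proof (induction rule: poly_mapping_carrier_induct)
    case zero
    then show ?case
      using subringE(2)[OF sr] alg_hom_zero[OF proj MA.kalg_axioms tensor_kalg]
      by (simp add: monoid_algebra_simps)
  next
    case (single x c)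
    then show ?case using sm[OF p] by (auto simp: pure_tensor_smult[symmetric])
  next
    case (add f g)
    then show ?case using subringE(7)[OF sr add(3,4)] alg_homD(3)[OF proj, of f g]
      by (simp add: monoid_algebra_simps)
  qed
  then show "carrier (tensor_algebra A B) \<subseteq> S"
    using quotient_carrier[OF MA.kalg_axioms tensor_null_ideal, folded tensor_algebra_def]
    by (auto simp: monoid_algebra_simps)
qed

text \<open>The universal property of the tensor product. On pairs, multiplicativity needs one
  exchange of \<open>g b\<close> with \<open>f a'\<close>; the bilinearity relations are killed
  because \<open>f\<close> and \<open>g\<close> are linear.\<close>

lemma tensor_lift:
  assumes R: "kalg R" and f: "f \<in> alg_hom A R" and g: "g \<in> alg_hom B R"
    and comm: "\<And>a b. a \<in> carrier A \<Longrightarrow> b \<in> carrier B \<Longrightarrow> f a \<otimes>\<^bsub>R\<^esub> g b = g b \<otimes>\<^bsub>R\<^esub> f a"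
  obtains h where "h \<in> alg_hom (tensor_algebra A B) R"
    "\<And>a b. a \<in> carrier A \<Longrightarrow> b \<in> carrier B \<Longrightarrow> h (pure_tensor A B a b) = f a \<otimes>\<^bsub>R\<^esub> g b"
proof -
  interpret R: kalg R by fact
  note [simp] = alg_homD[OF f] alg_homD[OF g]
  let ?g = "\<lambda>(a, b). f a \<otimes>\<^bsub>R\<^esub> g b"
  have cl: "?g x \<in> carrier R" if "x \<in> carrier (A \<times>\<times> B)" for x using that by auto
  have hom: "lin_ext R ?g \<in> alg_hom MAB R"
  proof (rule lin_ext_alg_hom[OF tensor_monoid R cl])
    fix x y assume xy: "x \<in> carrier (A \<times>\<times> B)" "y \<in> carrier (A \<times>\<times> B)"
    obtain a b a' b' where e: "x = (a, b)" "y = (a', b')" by fastforce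
    have m: "a \<in> carrier A" "b \<in> carrier B" "a' \<in> carrier A" "b' \<in> carrier B" using xy e by auto
    have "(f a \<otimes>\<^bsub>R\<^esub> f a') \<otimes>\<^bsub>R\<^esub> (g b \<otimes>\<^bsub>R\<^esub> g b') = f a \<otimes>\<^bsub>R\<^esub> (f a' \<otimes>\<^bsub>R\<^esub> g b) \<otimes>\<^bsub>R\<^esub> g b'"
      using m by (simp add: R.m_assoc)
    also have "\<dots> = (f a \<otimes>\<^bsub>R\<^esub> g b) \<otimes>\<^bsub>R\<^esub> (f a' \<otimes>\<^bsub>R\<^esub> g b')"
      using m comm[of a' b] by (simp add: R.m_assoc)
    finally show "?g (x \<otimes>\<^bsub>A \<times>\<times> B\<^esub> y) = ?g x \<otimes>\<^bsub>R\<^esub> ?g y" using m e by simp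
  qed auto
  note lin = lin_ext_single[of R "carrier A \<times> carrier B" ?g, OF R]
  have sing: "lin_ext R ?g (single (a, b) c) = c \<odot>\<^bsub>R\<^esub> (f a \<otimes>\<^bsub>R\<^esub> g b)"
    if "a \<in> carrier A" "b \<in> carrier B" for a b c
    using that by (subst lin) auto
  have minus: "lin_ext R ?g (x - y) = lin_ext R ?g x \<ominus>\<^bsub>R\<^esub> lin_ext R ?g y"
    if "keys x \<subseteq> carrier A \<times> carrier B" "keys y \<subseteq> carrier A \<times> carrier B" for x y
    using alg_hom_minus[OF hom MA.kalg_axioms R, of x y] that
    by (simp add: monoid_algebra_simps monoid_algebra_minus[OF tensor_monoid])
  have kd: "keys (single x c - single y d) \<subseteq> carrier A \<times> carrier B"
    if "x \<in> carrier A \<times> carrier B" "y \<in> carrier A \<times> carrier B" for x y and c d :: 'k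
    using keys_diff[of "single x c" "single y d"] that
    by (auto split: if_splits)
  have ks: "keys (single x c) \<subseteq> carrier A \<times> carrier B"
    if "x \<in> carrier A \<times> carrier B" for x and c :: 'k
    using that by auto
  have canc: "X \<oplus>\<^bsub>R\<^esub> Y \<ominus>\<^bsub>R\<^esub> X \<ominus>\<^bsub>R\<^esub> Y = \<zero>\<^bsub>R\<^esub>" if "X \<in> carrier R" "Y \<in> carrier R" for X Y
  proof -
    have "X \<oplus>\<^bsub>R\<^esub> Y \<ominus>\<^bsub>R\<^esub> X = Y"
      using that by (simp add: a_minus_def R.a_comm[of X Y] R.a_assoc R.r_neg)
    then show ?thesis using that by (simp add: R.r_right_minus_eq)
  qed
  have rel: "lin_ext R ?g x = \<zero>\<^bsub>R\<^esub>" if "x \<in> bilinear_relations A B" for x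
    using that
  proof (cases rule: bilinear_relations_cases)
    case (1 u u' v)
    then show ?thesis using canc[of "f u \<otimes>\<^bsub>R\<^esub> g v" "f u' \<otimes>\<^bsub>R\<^esub> g v"]
      by (simp add: minus[OF kd ks] minus[OF ks ks] sing R.l_distr)
  next
    case (2 u v v')
    then show ?thesis using canc[of "f u \<otimes>\<^bsub>R\<^esub> g v" "f u \<otimes>\<^bsub>R\<^esub> g v'"]
      by (simp add: minus[OF kd ks] minus[OF ks ks] sing R.r_distr)
  next
    case (3 c u v)
    then show ?thesis by (simp add: minus[OF ks ks] sing R.smult_mult_l)
  next
    case (4 c u v)
    then show ?thesis by (simp add: minus[OF ks ks] sing R.smult_mult_r)
  qed
  have null: "lin_ext R ?g x = \<zero>\<^bsub>R\<^esub>" if "x \<in> tensor_null A B" for x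
  proof -
    have "keys x \<subseteq> carrier A \<times> carrier B \<and> lin_ext R ?g x = \<zero>\<^bsub>R\<^esub>"
      using that unfolding tensor_null_def
    proof (induction rule: pm.span_induct_alt)
      case base
      then show ?case by (simp add: lin_ext_def)
    next
      case (step c x y)
      have y: "y \<in> carrier MAB"
        using step(2) by (simp add: monoid_algebra_simps)
      have x: "x \<in> carrier MAB"
        using bilinear_relations_carrier[OF step(1)] by (simp add: monoid_algebra_simps)
      have cx: "scale_pm c x \<in> carrier MAB"
        using MA.smult_closed[OF x] by (simp add: monoid_algebra_simps)
      show ?case
        using MA.a_closed[OF cx y] alg_homD(3)[OF hom cx y] alg_homD(5)[OF hom x, of c]
          rel[OF step(1)] step(2) by (simp add: monoid_algebra_simps)
    qed
    then show ?thesis by simp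
  qed
  obtain h where h: "h \<in> alg_hom (tensor_algebra A B) R"
    "\<And>x. x \<in> carrier MAB \<Longrightarrow>
       h (tensor_null A B +>\<^bsub>MAB\<^esub> x) = lin_ext R ?g x"
    using quotient_lift[OF MA.kalg_axioms tensor_null_ideal R hom null, folded tensor_algebra_def] by metis
  show ?thesis
    by (rule that[OF h(1)]) (simp add: pure_tensor_def h(2) tensor_single_carrier sing)
qed

end

lemma tensor_hom_eqI:
  assumes A: "kalg A" and B: "kalg B"
    and h: "h \<in> alg_hom (tensor_algebra A B) R" "h' \<in> alg_hom (tensor_algebra A B) R"
    and eq: "\<And>a b. a \<in> carrier A \<Longrightarrow> b \<in> carrier B \<Longrightarrow> h (pure_tensor A B a b) = h' (pure_tensor A B a b)"
    and x: "x \<in> carrier (tensor_algebra A B)"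
  shows "h x = h' x"
proof -
  interpret A: kalg A by fact
  interpret B: kalg B by fact
  note g = tensor_generates[OF A B, of "carrier A" "carrier B"]
  show ?thesis
    by (rule alg_hom_eqI[OF tensor_kalg[OF A B] g h _ x]) (auto simp: generates_def eq)
qed


section \<open>Quantum matrices over an arbitrary algebra, in R-matrix form\<close>

section \<open>Quantum matrices in an algebra\<close>

lemma (in abelian_monoid) finsum_swap:
  assumes "finite S" "finite T" "\<And>a b. a \<in> S \<Longrightarrow> b \<in> T \<Longrightarrow> f a b \<in> carrier G"
  shows "(\<Oplus>a\<in>S. \<Oplus>b\<in>T. f a b) = (\<Oplus>b\<in>T. \<Oplus>a\<in>S. f a b)"
  using assms(1,3)
proof (induction S rule: finite_induct)
  case (insert x F)
  have "(\<Oplus>a\<in>insert x F. \<Oplus>b\<in>T. f a b) = (\<Oplus>b\<in>T. f x b) \<oplus> (\<Oplus>b\<in>T. \<Oplus>a\<in>F. f a b)"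
    using insert by (subst finsum_insert) (auto intro!: finsum_closed)
  also have "\<dots> = (\<Oplus>b\<in>T. f x b \<oplus> (\<Oplus>a\<in>F. f a b))"
    using insert by (subst finsum_addf) (auto intro!: finsum_closed)
  also have "\<dots> = (\<Oplus>b\<in>T. \<Oplus>a\<in>insert x F. f a b)"
    using insert by (intro finsum_cong' refl) (auto simp: finsum_insert Pi_def intro!: finsum_closed a_closed)
  finally show ?case .
qed simp

lemma (in abelian_monoid) finsum_Times:
  assumes "finite S" "finite T" "\<And>a b. a \<in> S \<Longrightarrow> b \<in> T \<Longrightarrow> f (a, b) \<in> carrier G"
  shows "(\<Oplus>p\<in>S \<times> T. f p) = (\<Oplus>a\<in>S. \<Oplus>b\<in>T. f (a, b))"
  using assms(1,3)
proof (induction S rule: finite_induct)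
  case (insert x F)
  have "insert x F \<times> T = (\<lambda>b. (x, b)) ` T \<union> F \<times> T" by auto
  moreover have "(\<Oplus>p\<in>(\<lambda>b. (x, b)) ` T \<union> F \<times> T. f p) = (\<Oplus>p\<in>(\<lambda>b. (x, b)) ` T. f p) \<oplus> (\<Oplus>p\<in>F \<times> T. f p)"
    using insert assms(2) by (intro finsum_Un_disjoint) auto
  moreover have "(\<Oplus>p\<in>(\<lambda>b. (x, b)) ` T. f p) = (\<Oplus>b\<in>T. f (x, b))"
    using insert by (intro finsum_reindex) (auto intro: inj_onI)
  ultimately show ?case using insert by (simp add: finsum_insert Pi_def finsum_closed)
qed simp

lemma (in semiring) finsum_mult_finsum:
  assumes "finite S" "finite T" "\<And>a. a \<in> S \<Longrightarrow> f a \<in> carrier R" "\<And>b. b \<in> T \<Longrightarrow> g b \<in> carrier R"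
  shows "(\<Oplus>a\<in>S. f a) \<otimes> (\<Oplus>b\<in>T. g b) = (\<Oplus>a\<in>S. \<Oplus>b\<in>T. f a \<otimes> g b)"
proof -
  have "(\<Oplus>a\<in>S. f a) \<otimes> (\<Oplus>b\<in>T. g b) = (\<Oplus>a\<in>S. f a \<otimes> (\<Oplus>b\<in>T. g b))"
    using assms by (intro finsum_ldistr) (auto intro!: finsum_closed)
  also have "\<dots> = (\<Oplus>a\<in>S. \<Oplus>b\<in>T. f a \<otimes> g b)"
    using assms by (intro finsum_cong' refl) (auto intro!: finsum_closed simp: finsum_rdistr Pi_def)
  finally show ?thesis .
qed

text \<open>\<open>rdiag\<close> and \<open>roff\<close> are the entries of the R-matrix of type A:
  q or 1 on the diagonal, and q - 1/q off the diagonal for one of the two orders of the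
  indices.\<close>

definition rdiag :: "'k::field \<Rightarrow> nat \<Rightarrow> nat \<Rightarrow> 'k" where
  "rdiag q i s = (if i = s then q else 1)"

definition roff :: "'k::field \<Rightarrow> nat \<Rightarrow> nat \<Rightarrow> 'k" where
  "roff q s i = (if s < i then q - inverse q else 0)"

text \<open>
  The defining relations in the uniform shape \<open>R T\<^sub>1 T\<^sub>2 = T\<^sub>2 T\<^sub>1 R\<close>.
\<close>

definition qmat :: "'k::field \<Rightarrow> nat set \<Rightarrow> nat set \<Rightarrow> ('k, 'a) module \<Rightarrow> (nat \<Rightarrow> nat \<Rightarrow> 'a) \<Rightarrow> bool" where
  "qmat q I J R Z \<longleftrightarrow> (\<forall>i\<in>I. \<forall>j\<in>J. Z i j \<in> carrier R) \<and>
    (\<forall>i\<in>I. \<forall>s\<in>I. \<forall>j\<in>J. \<forall>l\<in>J.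
      rdiag q i s \<odot>\<^bsub>R\<^esub> (Z i j \<otimes>\<^bsub>R\<^esub> Z s l) \<oplus>\<^bsub>R\<^esub> roff q s i \<odot>\<^bsub>R\<^esub> (Z s j \<otimes>\<^bsub>R\<^esub> Z i l) =
      rdiag q j l \<odot>\<^bsub>R\<^esub> (Z s l \<otimes>\<^bsub>R\<^esub> Z i j) \<oplus>\<^bsub>R\<^esub> roff q j l \<odot>\<^bsub>R\<^esub> (Z s j \<otimes>\<^bsub>R\<^esub> Z i l))"

lemma qmat_closed: "qmat q I J R Z \<Longrightarrow> i \<in> I \<Longrightarrow> j \<in> J \<Longrightarrow> Z i j \<in> carrier R"
  by (simp add: qmat_def)

lemma qmat_RTT:
  "qmat q I J R Z \<Longrightarrow> i \<in> I \<Longrightarrow> s \<in> I \<Longrightarrow> j \<in> J \<Longrightarrow> l \<in> J \<Longrightarrow>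
      rdiag q i s \<odot>\<^bsub>R\<^esub> (Z i j \<otimes>\<^bsub>R\<^esub> Z s l) \<oplus>\<^bsub>R\<^esub> roff q s i \<odot>\<^bsub>R\<^esub> (Z s j \<otimes>\<^bsub>R\<^esub> Z i l) =
      rdiag q j l \<odot>\<^bsub>R\<^esub> (Z s l \<otimes>\<^bsub>R\<^esub> Z i j) \<oplus>\<^bsub>R\<^esub> roff q j l \<odot>\<^bsub>R\<^esub> (Z s j \<otimes>\<^bsub>R\<^esub> Z i l)"
  unfolding qmat_def by blast

lemma qmat_cong:
  assumes "\<And>i j. i \<in> I \<Longrightarrow> j \<in> J \<Longrightarrow> Z i j = Z' i j"
  shows "qmat q I J R Z \<longleftrightarrow> qmat q I J R Z'"
  unfolding qmat_def using assms by (intro conj_cong ball_cong refl) simp_all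

text \<open>The relations depend only on the order of the indices. This lemma places the columns of
  \<open>path_mat\<close> at the positions \<open>m + j\<close> of the path network.\<close>

lemma qmat_reindex:
  assumes Z: "qmat q I J R Z" and f: "strict_mono_on I' f" "f ` I' \<subseteq> I"
    and g: "strict_mono_on J' g" "g ` J' \<subseteq> J"
  shows "qmat q I' J' R (\<lambda>i j. Z (f i) (g j))"
proof -
  have 1: "rdiag q (f i) (f s) = rdiag q i s" "roff q (f i) (f s) = roff q i s" if "i \<in> I'" "s \<in> I'" for i s
    using that strict_mono_on_eqD[OF f(1)] strict_mono_on_less[OF f(1)]
    by (auto simp: rdiag_def roff_def)
  have 2: "rdiag q (g i) (g s) = rdiag q i s" "roff q (g i) (g s) = roff q i s" if "i \<in> J'" "s \<in> J'" for i s
    using that strict_mono_on_eqD[OF g(1)] strict_mono_on_less[OF g(1)]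
    by (auto simp: rdiag_def roff_def)
  show ?thesis unfolding qmat_def
  proof (intro conjI ballI)
    fix i j assume "i \<in> I'" "j \<in> J'"
    then show "Z (f i) (g j) \<in> carrier R" using f g by (intro qmat_closed[OF Z]) auto
  next
    fix i s j l assume a: "i \<in> I'" "s \<in> I'" "j \<in> J'" "l \<in> J'"
    then have "f i \<in> I" "f s \<in> I" "g j \<in> J" "g l \<in> J" using f g by auto
    from qmat_RTT[OF Z this] a show
      "rdiag q i s \<odot>\<^bsub>R\<^esub> (Z (f i) (g j) \<otimes>\<^bsub>R\<^esub> Z (f s) (g l)) \<oplus>\<^bsub>R\<^esub> roff q s i \<odot>\<^bsub>R\<^esub> (Z (f s) (g j) \<otimes>\<^bsub>R\<^esub> Z (f i) (g l)) =
       rdiag q j l \<odot>\<^bsub>R\<^esub> (Z (f s) (g l) \<otimes>\<^bsub>R\<^esub> Z (f i) (g j)) \<oplus>\<^bsub>R\<^esub> roff q j l \<odot>\<^bsub>R\<^esub> (Z (f s) (g j) \<otimes>\<^bsub>R\<^esub> Z (f i) (g l))"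
      by (simp add: 1 2)
  qed
qed

lemma qmat_alg_hom:
  assumes Z: "qmat q I J R Z" and R: "kalg R" and h: "h \<in> alg_hom R S"
  shows "qmat q I J S (\<lambda>i j. h (Z i j))"
  unfolding qmat_def
proof (intro conjI ballI)
  interpret R: kalg R by fact
  fix i s j l assume a: "i \<in> I" "s \<in> I" "j \<in> J" "l \<in> J"
  show "rdiag q i s \<odot>\<^bsub>S\<^esub> (h (Z i j) \<otimes>\<^bsub>S\<^esub> h (Z s l)) \<oplus>\<^bsub>S\<^esub> roff q s i \<odot>\<^bsub>S\<^esub> (h (Z s j) \<otimes>\<^bsub>S\<^esub> h (Z i l)) =
       rdiag q j l \<odot>\<^bsub>S\<^esub> (h (Z s l) \<otimes>\<^bsub>S\<^esub> h (Z i j)) \<oplus>\<^bsub>S\<^esub> roff q j l \<odot>\<^bsub>S\<^esub> (h (Z s j) \<otimes>\<^bsub>S\<^esub> h (Z i l))"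
    using arg_cong[where f = h, OF qmat_RTT[OF Z a]] a qmat_closed[OF Z]
    by (simp add: alg_homD[OF h])
qed (simp add: alg_homD[OF h] qmat_closed[OF Z])

locale qalg = kalg R for R :: "('k::field, 'a) module" (structure) +
  fixes q :: 'k
  assumes q_nz: "q \<noteq> 0"
begin

lemma smult_lin:
  assumes "x \<in> carrier R"
  shows "c \<odot> x \<oplus> d \<odot> x = (c + d) \<odot> x"
  using assms by (simp add: smult_l_distr)

text \<open>In matrix form, R M1 M2 N1 N2 = M2 M1 R N1 N2 = M2 M1 N2 N1 R, once the entries of
  \<open>M\<close> have been moved past those of \<open>N\<close>. Both sides of the claim are
  brought to the middle expression, which is \<open>?X \<oplus> ?Y\<close>.\<close>

lemma qmat_product:
  assumes M: "qmat q I L R M" and N: "qmat q L J R N" and L: "finite L"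
    and comm: "\<And>i a b j. i \<in> I \<Longrightarrow> a \<in> L \<Longrightarrow> b \<in> L \<Longrightarrow> j \<in> J \<Longrightarrow> M i a \<otimes> N b j = N b j \<otimes> M i a"
  shows "qmat q I J R (\<lambda>i j. \<Oplus>a\<in>L. M i a \<otimes> N a j)"
  unfolding qmat_def
proof (intro conjI ballI)
  fix i j assume "i \<in> I" "j \<in> J"
  then show "(\<Oplus>a\<in>L. M i a \<otimes> N a j) \<in> carrier R"
    using qmat_closed[OF M] qmat_closed[OF N] by (intro finsum_closed) auto
next
  let ?W = "\<lambda>i j. \<Oplus>a\<in>L. M i a \<otimes> N a j"
  fix i s j l assume a: "i \<in> I" "s \<in> I" "j \<in> J" "l \<in> J"
  note [simp] = qmat_closed[OF M] qmat_closed[OF N]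
  have W: "?W i j \<otimes> ?W s l = (\<Oplus>a\<in>L. \<Oplus>b\<in>L. (M i a \<otimes> M s b) \<otimes> (N a j \<otimes> N b l))"
    if "i \<in> I" "s \<in> I" "j \<in> J" "l \<in> J" for i s j l
  proof -
    have "?W i j \<otimes> ?W s l = (\<Oplus>a\<in>L. \<Oplus>b\<in>L. (M i a \<otimes> N a j) \<otimes> (M s b \<otimes> N b l))"
      using that L by (intro finsum_mult_finsum) auto
    also have "\<dots> = (\<Oplus>a\<in>L. \<Oplus>b\<in>L. (M i a \<otimes> M s b) \<otimes> (N a j \<otimes> N b l))"
    proof (intro finsum_cong' refl)
      fix a b assume "a \<in> L" "b \<in> L"
      with that have "(M i a \<otimes> N a j) \<otimes> (M s b \<otimes> N b l) = M i a \<otimes> (N a j \<otimes> M s b) \<otimes> N b l"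
        by (simp add: m_assoc)
      also have "\<dots> = M i a \<otimes> (M s b \<otimes> N a j) \<otimes> N b l"
        using that \<open>a \<in> L\<close> \<open>b \<in> L\<close> by (simp add: comm)
      finally show "(M i a \<otimes> N a j) \<otimes> (M s b \<otimes> N b l) = (M i a \<otimes> M s b) \<otimes> (N a j \<otimes> N b l)"
        using that \<open>a \<in> L\<close> \<open>b \<in> L\<close> by (simp add: m_assoc)
    qed (use that in \<open>auto intro!: finsum_closed\<close>)
    finally show ?thesis .
  qed
  have sm: "c \<odot> (\<Oplus>a\<in>L. \<Oplus>b\<in>L. f a b) = (\<Oplus>a\<in>L. \<Oplus>b\<in>L. c \<odot> f a b)"
    if "\<And>a b. a \<in> L \<Longrightarrow> b \<in> L \<Longrightarrow> f a b \<in> carrier R" for c f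
    using that by (subst finsum_smult) (auto intro!: finsum_closed finsum_cong' simp: finsum_smult Pi_def)
  have ad: "(\<Oplus>a\<in>L. \<Oplus>b\<in>L. f a b) \<oplus> (\<Oplus>a\<in>L. \<Oplus>b\<in>L. g a b) = (\<Oplus>a\<in>L. \<Oplus>b\<in>L. f a b \<oplus> g a b)"
    if "\<And>a b. a \<in> L \<Longrightarrow> b \<in> L \<Longrightarrow> f a b \<in> carrier R" "\<And>a b. a \<in> L \<Longrightarrow> b \<in> L \<Longrightarrow> g a b \<in> carrier R" for f g
  proof -
    have "(\<Oplus>a\<in>L. \<Oplus>b\<in>L. f a b \<oplus> g a b) = (\<Oplus>a\<in>L. (\<Oplus>b\<in>L. f a b) \<oplus> (\<Oplus>b\<in>L. g a b))"
      using that by (intro finsum_cong' refl) (auto intro!: finsum_closed finsum_addf)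
    also have "\<dots> = (\<Oplus>a\<in>L. \<Oplus>b\<in>L. f a b) \<oplus> (\<Oplus>a\<in>L. \<Oplus>b\<in>L. g a b)"
      using that by (intro finsum_addf) (auto intro!: finsum_closed)
    finally show ?thesis ..
  qed
  have cong: "(\<Oplus>a\<in>L. \<Oplus>b\<in>L. f a b) = (\<Oplus>a\<in>L. \<Oplus>b\<in>L. g a b)"
    if "\<And>a b. a \<in> L \<Longrightarrow> b \<in> L \<Longrightarrow> f a b = g a b" "\<And>a b. a \<in> L \<Longrightarrow> b \<in> L \<Longrightarrow> g a b \<in> carrier R" for f g
    using that by (intro finsum_cong' refl) (auto intro!: finsum_closed)
  let ?X = "\<Oplus>a\<in>L. \<Oplus>b\<in>L. rdiag q a b \<odot> ((M s b \<otimes> M i a) \<otimes> (N a j \<otimes> N b l))"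
  let ?Y = "\<Oplus>a\<in>L. \<Oplus>b\<in>L. roff q a b \<odot> ((M s a \<otimes> M i b) \<otimes> (N a j \<otimes> N b l))"
  have "rdiag q i s \<odot> (?W i j \<otimes> ?W s l) \<oplus> roff q s i \<odot> (?W s j \<otimes> ?W i l) =
    (\<Oplus>a\<in>L. \<Oplus>b\<in>L. rdiag q i s \<odot> ((M i a \<otimes> M s b) \<otimes> (N a j \<otimes> N b l)) \<oplus>
       roff q s i \<odot> ((M s a \<otimes> M i b) \<otimes> (N a j \<otimes> N b l)))"
    unfolding W[OF a] W[OF a(2,1,3,4)] using a by (simp add: sm ad)
  also have "\<dots> = (\<Oplus>a\<in>L. \<Oplus>b\<in>L. rdiag q a b \<odot> ((M s b \<otimes> M i a) \<otimes> (N a j \<otimes> N b l)) \<oplus>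
       roff q a b \<odot> ((M s a \<otimes> M i b) \<otimes> (N a j \<otimes> N b l)))"
  proof (rule cong)
    fix b c assume bc: "b \<in> L" "c \<in> L"
    have "rdiag q i s \<odot> ((M i b \<otimes> M s c) \<otimes> (N b j \<otimes> N c l)) \<oplus> roff q s i \<odot> ((M s b \<otimes> M i c) \<otimes> (N b j \<otimes> N c l)) =
      (rdiag q i s \<odot> (M i b \<otimes> M s c) \<oplus> roff q s i \<odot> (M s b \<otimes> M i c)) \<otimes> (N b j \<otimes> N c l)"
      using a bc by (simp add: l_distr smult_mult_l)
    also have "\<dots> = rdiag q b c \<odot> ((M s c \<otimes> M i b) \<otimes> (N b j \<otimes> N c l)) \<oplus>
       roff q b c \<odot> ((M s b \<otimes> M i c) \<otimes> (N b j \<otimes> N c l))"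
      unfolding qmat_RTT[OF M a(1,2) bc] using a bc by (simp add: l_distr smult_mult_l)
    finally show "rdiag q i s \<odot> ((M i b \<otimes> M s c) \<otimes> (N b j \<otimes> N c l)) \<oplus> roff q s i \<odot> ((M s b \<otimes> M i c) \<otimes> (N b j \<otimes> N c l)) =
      rdiag q b c \<odot> ((M s c \<otimes> M i b) \<otimes> (N b j \<otimes> N c l)) \<oplus> roff q b c \<odot> ((M s b \<otimes> M i c) \<otimes> (N b j \<otimes> N c l))" .
  qed (use a in auto)
  also have "\<dots> = ?X \<oplus> ?Y" using a by (subst ad) auto
  finally have 1: "rdiag q i s \<odot> (?W i j \<otimes> ?W s l) \<oplus> roff q s i \<odot> (?W s j \<otimes> ?W i l) = ?X \<oplus> ?Y" .
  have "?W s j \<otimes> ?W i l = (\<Oplus>a\<in>L. \<Oplus>b\<in>L. (M s a \<otimes> M i b) \<otimes> (N a j \<otimes> N b l))"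
    by (rule W) (use a in auto)
  then have "rdiag q j l \<odot> (?W s l \<otimes> ?W i j) \<oplus> roff q j l \<odot> (?W s j \<otimes> ?W i l) =
    (\<Oplus>b\<in>L. \<Oplus>a\<in>L. rdiag q j l \<odot> ((M s b \<otimes> M i a) \<otimes> (N b l \<otimes> N a j)) \<oplus>
       roff q j l \<odot> ((M s b \<otimes> M i a) \<otimes> (N b j \<otimes> N a l)))"
    unfolding W[OF a(2,1,4,3)] using a by (simp add: sm ad)
  also have "\<dots> = (\<Oplus>b\<in>L. \<Oplus>a\<in>L. rdiag q a b \<odot> ((M s b \<otimes> M i a) \<otimes> (N a j \<otimes> N b l)) \<oplus>
       roff q b a \<odot> ((M s b \<otimes> M i a) \<otimes> (N b j \<otimes> N a l)))"
  proof (rule cong)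
    fix c b assume bc: "c \<in> L" "b \<in> L"
    have "rdiag q j l \<odot> ((M s c \<otimes> M i b) \<otimes> (N c l \<otimes> N b j)) \<oplus> roff q j l \<odot> ((M s c \<otimes> M i b) \<otimes> (N c j \<otimes> N b l)) =
      (M s c \<otimes> M i b) \<otimes> (rdiag q j l \<odot> (N c l \<otimes> N b j) \<oplus> roff q j l \<odot> (N c j \<otimes> N b l))"
      using a bc by (simp add: r_distr smult_mult_r)
    also have "\<dots> = (M s c \<otimes> M i b) \<otimes> (rdiag q b c \<odot> (N b j \<otimes> N c l) \<oplus> roff q c b \<odot> (N c j \<otimes> N b l))"
      unfolding qmat_RTT[OF N bc(2,1) a(3,4)] ..
    also have "\<dots> = rdiag q b c \<odot> ((M s c \<otimes> M i b) \<otimes> (N b j \<otimes> N c l)) \<oplus>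
       roff q c b \<odot> ((M s c \<otimes> M i b) \<otimes> (N c j \<otimes> N b l))"
      using a bc by (simp add: r_distr smult_mult_r)
    finally show "rdiag q j l \<odot> ((M s c \<otimes> M i b) \<otimes> (N c l \<otimes> N b j)) \<oplus> roff q j l \<odot> ((M s c \<otimes> M i b) \<otimes> (N c j \<otimes> N b l)) =
      rdiag q b c \<odot> ((M s c \<otimes> M i b) \<otimes> (N b j \<otimes> N c l)) \<oplus> roff q c b \<odot> ((M s c \<otimes> M i b) \<otimes> (N c j \<otimes> N b l))" .
  qed (use a in auto)
  also have "\<dots> = (\<Oplus>b\<in>L. \<Oplus>a\<in>L. rdiag q a b \<odot> ((M s b \<otimes> M i a) \<otimes> (N a j \<otimes> N b l))) \<oplus> ?Y"
    using a by (subst ad) auto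
  also have "(\<Oplus>b\<in>L. \<Oplus>a\<in>L. rdiag q a b \<odot> ((M s b \<otimes> M i a) \<otimes> (N a j \<otimes> N b l))) = ?X"
    using a L by (intro finsum_swap) auto
  finally show "rdiag q i s \<odot> (?W i j \<otimes> ?W s l) \<oplus> roff q s i \<odot> (?W s j \<otimes> ?W i l) =
    rdiag q j l \<odot> (?W s l \<otimes> ?W i j) \<oplus> roff q j l \<odot> (?W s j \<otimes> ?W i l)" using 1 by simp
qed

lemma
  assumes Z: "qmat q I J R Z"
  shows qmat_row: "i \<in> I \<Longrightarrow> j \<in> J \<Longrightarrow> l \<in> J \<Longrightarrow> j < l \<Longrightarrow> Z i j \<otimes> Z i l = q \<odot> (Z i l \<otimes> Z i j)"
    and qmat_col: "i \<in> I \<Longrightarrow> s \<in> I \<Longrightarrow> j \<in> J \<Longrightarrow> i < s \<Longrightarrow> Z i j \<otimes> Z s j = q \<odot> (Z s j \<otimes> Z i j)"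
    and qmat_anti: "i \<in> I \<Longrightarrow> s \<in> I \<Longrightarrow> j \<in> J \<Longrightarrow> l \<in> J \<Longrightarrow> i < s \<Longrightarrow> j < l \<Longrightarrow>
       Z i l \<otimes> Z s j = Z s j \<otimes> Z i l"
    and qmat_diag: "i \<in> I \<Longrightarrow> s \<in> I \<Longrightarrow> j \<in> J \<Longrightarrow> l \<in> J \<Longrightarrow> i < s \<Longrightarrow> j < l \<Longrightarrow>
       Z i j \<otimes> Z s l = Z s l \<otimes> Z i j \<oplus> (q - inverse q) \<odot> (Z i l \<otimes> Z s j)"
proof -
  note [simp] = qmat_closed[OF Z]
  note rtt = qmat_RTT[OF Z]
  show R3: "Z i l \<otimes> Z s j = Z s j \<otimes> Z i l" if "i \<in> I" "s \<in> I" "j \<in> J" "l \<in> J" "i < s" "j < l" for i s j l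
    using rtt[of i s l j] that by (simp add: rdiag_def roff_def)
  show "Z i j \<otimes> Z s l = Z s l \<otimes> Z i j \<oplus> (q - inverse q) \<odot> (Z i l \<otimes> Z s j)"
    if "i \<in> I" "s \<in> I" "j \<in> J" "l \<in> J" "i < s" "j < l"
    using rtt[of i s j l] R3[OF that] that by (simp add: rdiag_def roff_def)
  show "Z i j \<otimes> Z s j = q \<odot> (Z s j \<otimes> Z i j)" if "i \<in> I" "s \<in> I" "j \<in> J" "i < s"
    using rtt[of i s j j] that by (simp add: rdiag_def roff_def)
  show "Z i j \<otimes> Z i l = q \<odot> (Z i l \<otimes> Z i j)" if "i \<in> I" "j \<in> J" "l \<in> J" "j < l"
    using rtt[of i i l j] that by (simp add: rdiag_def roff_def)
qed

text \<open>The uniform relation is demanded for all pairs of positions, hence nine cases by the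
  relative order of rows and columns. Where both orders of a product within one row or column occur,
  it comes down to \<open>1 + (q - inverse q) * q = q * q\<close>.\<close>

lemma qmatI:
  assumes cl: "\<And>i j. i \<in> I \<Longrightarrow> j \<in> J \<Longrightarrow> Z i j \<in> carrier R"
    and R1: "\<And>i j l. i \<in> I \<Longrightarrow> j \<in> J \<Longrightarrow> l \<in> J \<Longrightarrow> j < l \<Longrightarrow> Z i j \<otimes> Z i l = q \<odot> (Z i l \<otimes> Z i j)"
    and R2: "\<And>i j s. i \<in> I \<Longrightarrow> s \<in> I \<Longrightarrow> j \<in> J \<Longrightarrow> i < s \<Longrightarrow> Z i j \<otimes> Z s j = q \<odot> (Z s j \<otimes> Z i j)"
    and R3: "\<And>i j s l. i \<in> I \<Longrightarrow> s \<in> I \<Longrightarrow> j \<in> J \<Longrightarrow> l \<in> J \<Longrightarrow> i < s \<Longrightarrow> j < l \<Longrightarrow>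
       Z i l \<otimes> Z s j = Z s j \<otimes> Z i l"
    and R4: "\<And>i j s l. i \<in> I \<Longrightarrow> s \<in> I \<Longrightarrow> j \<in> J \<Longrightarrow> l \<in> J \<Longrightarrow> i < s \<Longrightarrow> j < l \<Longrightarrow>
       Z i j \<otimes> Z s l = Z s l \<otimes> Z i j \<oplus> (q - inverse q) \<odot> (Z i l \<otimes> Z s j)"
  shows "qmat q I J R Z"
  unfolding qmat_def
proof (intro conjI ballI)
  note [simp] = cl
    fix i s j l assume a: "i \<in> I" "s \<in> I" "j \<in> J" "l \<in> J"
    consider "i = s" "j = l" | "i = s" "j < l" | "i = s" "l < j" | "i < s" "j = l" | "i < s" "j < l"
      | "i < s" "l < j" | "s < i" "j = l" | "s < i" "j < l" | "s < i" "l < j" by linarith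
    then show "rdiag q i s \<odot> (Z i j \<otimes> Z s l) \<oplus> roff q s i \<odot> (Z s j \<otimes> Z i l) =
      rdiag q j l \<odot> (Z s l \<otimes> Z i j) \<oplus> roff q j l \<odot> (Z s j \<otimes> Z i l)"
    proof cases
      case 2
      then have e: "Z i j \<otimes> Z i l = q \<odot> (Z i l \<otimes> Z i j)" using a R1[of i j l] by auto
      have "1 + (q - inverse q) * q = q * q" using q_nz by (simp add: field_simps)
      moreover have "Z i l \<otimes> Z i j \<oplus> ((q - inverse q) * q) \<odot> (Z i l \<otimes> Z i j) =
          (1 + (q - inverse q) * q) \<odot> (Z i l \<otimes> Z i j)"
        using a by (simp add: smult_l_distr)
      ultimately show ?thesis using 2 a by (simp add: rdiag_def roff_def e[unfolded 2(1)] smult_assoc1[symmetric])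
    next
      case 3
      then have e: "Z i l \<otimes> Z i j = q \<odot> (Z i j \<otimes> Z i l)" using a R1[of i l j] by auto
      show ?thesis using 3 a by (simp add: rdiag_def roff_def e[unfolded 3(1)])
    next
      case 4
      then have e: "Z i j \<otimes> Z s j = q \<odot> (Z s j \<otimes> Z i j)" using a R2[of i s j] by auto
      show ?thesis using 4 a by (simp add: rdiag_def roff_def e[unfolded 4(2)])
    next
      case 5
      then have e: "Z i j \<otimes> Z s l = Z s l \<otimes> Z i j \<oplus> (q - inverse q) \<odot> (Z i l \<otimes> Z s j)"
        "Z i l \<otimes> Z s j = Z s j \<otimes> Z i l" using a by (blast intro: R3 R4)+
      show ?thesis using 5 a by (simp add: rdiag_def roff_def e)
    next
      case 6
      then have e: "Z i j \<otimes> Z s l = Z s l \<otimes> Z i j" using a R3[of i s l j] by auto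
      show ?thesis using 6 a by (simp add: rdiag_def roff_def e)
    next
      case 7
      then have e: "Z s j \<otimes> Z i j = q \<odot> (Z i j \<otimes> Z s j)" using a R2[of s i j] by auto
      have "1 + (q - inverse q) * q = q * q" using q_nz by (simp add: field_simps)
      moreover have "Z i j \<otimes> Z s j \<oplus> ((q - inverse q) * q) \<odot> (Z i j \<otimes> Z s j) =
          (1 + (q - inverse q) * q) \<odot> (Z i j \<otimes> Z s j)"
        using a by (simp add: smult_l_distr)
      ultimately show ?thesis using 7 a by (simp add: rdiag_def roff_def e[unfolded 7(2)] smult_assoc1[symmetric])
    next
      case 8
      then have e: "Z s l \<otimes> Z i j = Z i j \<otimes> Z s l" using a R3[of s i j l] by auto
      show ?thesis using 8 a by (simp add: rdiag_def roff_def e)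
    next
      case 9
      then have e: "Z s l \<otimes> Z i j = Z i j \<otimes> Z s l \<oplus> (q - inverse q) \<odot> (Z s j \<otimes> Z i l)" using a R4[of s i l j] by auto
      show ?thesis using 9 a by (simp add: rdiag_def roff_def e)
    qed (simp add: rdiag_def roff_def)
qed (rule cl)

text \<open>Later turns an upper block matrix into a lower one.\<close>

lemma qmat_transpose:
  assumes "qmat q I J R Z"
  shows "qmat q J I R (\<lambda>i j. Z j i)"
proof (rule qmatI)
  fix i j s l assume a: "i \<in> J" "s \<in> J" "j \<in> I" "l \<in> I" "i < s" "j < l"
  show "Z l i \<otimes> Z j s = Z j s \<otimes> Z l i" using qmat_anti[OF assms, of j l i s] a by simp
  show "Z j i \<otimes> Z l s = Z l s \<otimes> Z j i \<oplus> (q - inverse q) \<odot> (Z l i \<otimes> Z j s)"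
    using qmat_anti[OF assms, of j l i s] qmat_diag[OF assms, of j l i s] a by simp
qed (simp_all add: qmat_closed[OF assms] qmat_row[OF assms] qmat_col[OF assms])

text \<open>
  The exchange of two adjacent rows in a quantum minor; both sides are the same quantum
  \<open>2 \<times> 2\<close> minor up to the factor \<open>- q\<close>.
\<close>

lemma qmat_row_exchange:
  assumes Z: "qmat q I J R Z" and a: "r \<in> I" "s \<in> I" "j \<in> J" "l \<in> J" "s < r" "j < l"
  shows "Z r j \<otimes> Z s l \<oplus> (- q) \<odot> (Z r l \<otimes> Z s j) =
    (- q) \<odot> (Z s j \<otimes> Z r l \<oplus> (- q) \<odot> (Z s l \<otimes> Z r j))"
proof -
  note [simp] = qmat_closed[OF Z]
  have c: "Z s l \<otimes> Z r j = Z r j \<otimes> Z s l"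
    and d: "Z s j \<otimes> Z r l = Z r l \<otimes> Z s j \<oplus> (q - inverse q) \<odot> (Z s l \<otimes> Z r j)"
    using qmat_anti[OF Z, of s r j l] qmat_diag[OF Z, of s r j l] a by simp_all
  let ?X = "Z r j \<otimes> Z s l" and ?Y = "Z r l \<otimes> Z s j"
  have "?Y \<oplus> (q - inverse q) \<odot> ?X \<oplus> (- q) \<odot> ?X = ?Y \<oplus> (- inverse q) \<odot> ?X"
    using a smult_lin[of ?X "q - inverse q" "- q"] by (simp add: a_assoc)
  then have "(- q) \<odot> (Z s j \<otimes> Z r l \<oplus> (- q) \<odot> (Z s l \<otimes> Z r j)) = (- q) \<odot> (?Y \<oplus> (- inverse q) \<odot> ?X)"
    unfolding d c by simp
  also have "\<dots> = (- q) \<odot> ?Y \<oplus> ?X"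
    using a q_nz by (simp add: smult_r_distr smult_assoc1[symmetric])
  finally show ?thesis using a by (simp add: a_comm)
qed

lemma qmat_row_repeat:
  assumes Z: "qmat q I J R Z" and a: "r \<in> I" "j \<in> J" "l \<in> J" "j < l"
  shows "Z r j \<otimes> Z r l \<oplus> (- q) \<odot> (Z r l \<otimes> Z r j) = \<zero>"
proof -
  have "Z r j \<otimes> Z r l = q \<odot> (Z r l \<otimes> Z r j)" using a by (intro qmat_row[OF Z])
  then show ?thesis using smult_lin[of "Z r l \<otimes> Z r j" q "- q"] a qmat_closed[OF Z] by simp
qed


subsection \<open>Quantum minors\<close>

declare upt_Suc [simp del]

definition lprod :: "'a list \<Rightarrow> 'a" where
  "lprod xs = foldr (\<otimes>) xs \<one>"

lemma lprod_simps [simp]: "lprod [] = \<one>" "lprod (x # xs) = x \<otimes> lprod xs"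
  by (simp_all add: lprod_def)

lemma lprod_closed [simp, intro]: "set xs \<subseteq> carrier R \<Longrightarrow> lprod xs \<in> carrier R"
  by (induction xs) auto

lemma lprod_append: "set xs \<subseteq> carrier R \<Longrightarrow> set ys \<subseteq> carrier R \<Longrightarrow> lprod (xs @ ys) = lprod xs \<otimes> lprod ys"
  by (induction xs) (auto simp: m_assoc)

definition qminor :: "nat \<Rightarrow> (nat \<Rightarrow> nat \<Rightarrow> 'a) \<Rightarrow> (nat \<Rightarrow> nat) \<Rightarrow> 'a" where
  "qminor m Z c = (\<Oplus>\<sigma>\<in>{\<sigma>. \<sigma> permutes {1..m}}.
     (- q) ^ perm_length m \<sigma> \<odot> lprod (map (\<lambda>i. Z i (c (\<sigma> i))) [1..<Suc m]))"

text \<open>Choice functions for the expansion of a product of sums. Being the identity outside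
  \<open>{1..m}\<close> makes permutations of \<open>{1..m}\<close> members and lets
  \<open>id\<close> be recognised.\<close>

definition fn_set :: "nat \<Rightarrow> nat set \<Rightarrow> (nat \<Rightarrow> nat) set" where
  "fn_set m L = {f. (\<forall>i\<in>{1..m}. f i \<in> L) \<and> (\<forall>i. i \<notin> {1..m} \<longrightarrow> f i = i)}"

lemma fn_set_0: "fn_set 0 L = {id}"
  by (auto simp: fn_set_def)

lemma fn_set_Suc: "fn_set (Suc m) L = (\<lambda>(f, l). f(Suc m := l)) ` (fn_set m L \<times> L)"
proof
  show "fn_set (Suc m) L \<subseteq> (\<lambda>(f, l). f(Suc m := l)) ` (fn_set m L \<times> L)"
  proof
    fix f assume f: "f \<in> fn_set (Suc m) L"
    then have "f = (\<lambda>(f, l). f(Suc m := l)) (f(Suc m := Suc m), f (Suc m))"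
      "(f(Suc m := Suc m), f (Suc m)) \<in> fn_set m L \<times> L"
      by (auto simp: fn_set_def)
    then show "f \<in> (\<lambda>(f, l). f(Suc m := l)) ` (fn_set m L \<times> L)" by blast
  qed
qed (auto simp: fn_set_def)

lemma fn_set_inj: "inj_on (\<lambda>(f, l). f(Suc m := l)) (fn_set m L \<times> L)"
proof (rule inj_onI, clarify)
  fix f l f' l' assume "f \<in> fn_set m L" "f' \<in> fn_set m L" "f(Suc m := l) = f'(Suc m := l')"
  then have "\<And>i. (f(Suc m := l)) i = (f'(Suc m := l')) i" "f (Suc m) = f' (Suc m)"
    by (auto simp: fn_set_def)
  then show "f = f' \<and> l = l'" by (metis ext fun_upd_apply)
qed

lemma fn_set_finite: "finite L \<Longrightarrow> finite (fn_set m L)"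
  by (induction m) (auto simp: fn_set_0 fn_set_Suc)

text \<open>Expanding the product selects an index \<open>f i\<close> in each factor. As all entries
  of \<open>M\<close> commute with all entries of \<open>N\<close>, the selected entries of
  \<open>M\<close> can be collected on the left.\<close>

lemma lprod_expand:
  assumes L: "finite L"
    and M: "\<And>i a. i \<in> {1..m} \<Longrightarrow> a \<in> L \<Longrightarrow> M i a \<in> carrier R"
    and N: "\<And>i a. i \<in> {1..m} \<Longrightarrow> a \<in> L \<Longrightarrow> N a (c i) \<in> carrier R"
    and comm: "\<And>i s a b. i \<in> {1..m} \<Longrightarrow> s \<in> {1..m} \<Longrightarrow> a \<in> L \<Longrightarrow> b \<in> L \<Longrightarrow>
       M i a \<otimes> N b (c s) = N b (c s) \<otimes> M i a"
  shows "lprod (map (\<lambda>i. \<Oplus>a\<in>L. M i a \<otimes> N a (c i)) [1..<Suc m]) =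
    (\<Oplus>f\<in>fn_set m L. lprod (map (\<lambda>i. M i (f i)) [1..<Suc m]) \<otimes> lprod (map (\<lambda>i. N (f i) (c i)) [1..<Suc m]))"
  using M N comm
proof (induction m)
  case 0
  then show ?case by (simp add: fn_set_0)
next
  case (Suc m)
  let ?P = "\<lambda>m f. lprod (map (\<lambda>i. M i (f i)) [1..<Suc m])"
  let ?Q = "\<lambda>m f. lprod (map (\<lambda>i. N (f i) (c i)) [1..<Suc m])"
  have cl: "?P m f \<in> carrier R" "?Q m f \<in> carrier R" if "f \<in> fn_set m L" for f
    using that Suc.prems(1,2) by (auto intro!: lprod_closed simp: fn_set_def)
  have x: "M (Suc m) l \<in> carrier R" "N l (c (Suc m)) \<in> carrier R" if "l \<in> L" for l
    using that Suc.prems by auto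
  have split: "[1..<Suc (Suc m)] = [1..<Suc m] @ [Suc m]" by (simp add: upt_Suc)
  \<comment> \<open>The new entry of \<open>M\<close> has to pass all the entries of
    \<open>N\<close> collected so far.\<close>
  have cmQ: "?Q m f \<otimes> M (Suc m) l = M (Suc m) l \<otimes> ?Q m f" if "f \<in> fn_set m L" "l \<in> L" for f l
  proof -
    have "lprod (map (\<lambda>i. N (f i) (c i)) is) \<otimes> M (Suc m) l = M (Suc m) l \<otimes> lprod (map (\<lambda>i. N (f i) (c i)) is)
       \<and> lprod (map (\<lambda>i. N (f i) (c i)) is) \<in> carrier R"
      if "set is \<subseteq> {1..m}" for "is"
      using that
    proof (induction "is")
      case Nil then show ?case using x[OF \<open>l \<in> L\<close>] by simp
    next
      case (Cons i "is")
      then have i: "i \<in> {1..m}" by simp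
      then have fi: "f i \<in> L" using \<open>f \<in> fn_set m L\<close> by (simp add: fn_set_def)
      have n: "N (f i) (c i) \<in> carrier R" using Suc.prems(2) i fi by simp
      have cm: "M (Suc m) l \<otimes> N (f i) (c i) = N (f i) (c i) \<otimes> M (Suc m) l"
        using Suc.prems(3) i fi \<open>l \<in> L\<close> by simp
      have IH: "lprod (map (\<lambda>i. N (f i) (c i)) is) \<otimes> M (Suc m) l = M (Suc m) l \<otimes> lprod (map (\<lambda>i. N (f i) (c i)) is)"
        "lprod (map (\<lambda>i. N (f i) (c i)) is) \<in> carrier R"
        using Cons by auto
      have "N (f i) (c i) \<otimes> lprod (map (\<lambda>i. N (f i) (c i)) is) \<otimes> M (Suc m) l =
        N (f i) (c i) \<otimes> M (Suc m) l \<otimes> lprod (map (\<lambda>i. N (f i) (c i)) is)"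
        using n IH x[OF \<open>l \<in> L\<close>] by (simp add: m_assoc)
      then show ?case using n IH(2) x[OF \<open>l \<in> L\<close>] by (simp add: cm[symmetric] m_assoc)
    qed
    from this[of "[1..<Suc m]"] show ?thesis by (simp add: atLeastLessThanSuc_atLeastAtMost)
  qed
  have P: "?P (Suc m) (f(Suc m := l)) = ?P m f \<otimes> M (Suc m) l" if "f \<in> fn_set m L" "l \<in> L" for f l
  proof -
    have e: "map (\<lambda>i. M i ((f(Suc m := l)) i)) [1..<Suc m] = map (\<lambda>i. M i (f i)) [1..<Suc m]" by simp
    show ?thesis unfolding split map_append e using that x Suc.prems(1)
      by (subst lprod_append) (auto simp: fn_set_def)
  qed
  have Q: "?Q (Suc m) (f(Suc m := l)) = ?Q m f \<otimes> N l (c (Suc m))" if "f \<in> fn_set m L" "l \<in> L" for f l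
  proof -
    have e: "map (\<lambda>i. N ((f(Suc m := l)) i) (c i)) [1..<Suc m] = map (\<lambda>i. N (f i) (c i)) [1..<Suc m]" by simp
    show ?thesis unfolding split map_append e using that x Suc.prems(2)
      by (subst lprod_append) (auto simp: fn_set_def)
  qed
  have PQ: "?P m f \<otimes> ?Q m f \<otimes> (M (Suc m) l \<otimes> N l (c (Suc m))) =
    ?P (Suc m) (f(Suc m := l)) \<otimes> ?Q (Suc m) (f(Suc m := l))" if fl: "f \<in> fn_set m L" "l \<in> L" for f l
  proof -
    have "?P m f \<otimes> ?Q m f \<otimes> (M (Suc m) l \<otimes> N l (c (Suc m))) =
      ?P m f \<otimes> (?Q m f \<otimes> M (Suc m) l) \<otimes> N l (c (Suc m))"
      using cl[OF fl(1)] x[OF fl(2)] by (simp add: m_assoc)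
    also have "\<dots> = (?P m f \<otimes> M (Suc m) l) \<otimes> (?Q m f \<otimes> N l (c (Suc m)))"
      unfolding cmQ[OF fl] using cl[OF fl(1)] x[OF fl(2)] by (simp add: m_assoc)
    finally show ?thesis unfolding P[OF fl] Q[OF fl] .
  qed
  have "lprod (map (\<lambda>i. \<Oplus>a\<in>L. M i a \<otimes> N a (c i)) [1..<Suc (Suc m)]) =
    lprod (map (\<lambda>i. \<Oplus>a\<in>L. M i a \<otimes> N a (c i)) [1..<Suc m]) \<otimes> (\<Oplus>a\<in>L. M (Suc m) a \<otimes> N a (c (Suc m)))"
    unfolding split map_append using Suc.prems(1,2)
    by (subst lprod_append) (auto intro!: finsum_closed r_one)
  also have "\<dots> = (\<Oplus>f\<in>fn_set m L. ?P m f \<otimes> ?Q m f) \<otimes> (\<Oplus>a\<in>L. M (Suc m) a \<otimes> N a (c (Suc m)))"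
    using Suc by simp
  also have "\<dots> = (\<Oplus>f\<in>fn_set m L. \<Oplus>l\<in>L. ?P m f \<otimes> ?Q m f \<otimes> (M (Suc m) l \<otimes> N l (c (Suc m))))"
    using cl x L fn_set_finite by (intro finsum_mult_finsum) auto
  also have "\<dots> = (\<Oplus>p\<in>fn_set m L \<times> L. (\<lambda>(f, l). ?P m f \<otimes> ?Q m f \<otimes> (M (Suc m) l \<otimes> N l (c (Suc m)))) p)"
    using cl x L fn_set_finite by (subst finsum_Times) auto
  also have "\<dots> = (\<Oplus>p\<in>fn_set m L \<times> L. (\<lambda>f. ?P (Suc m) f \<otimes> ?Q (Suc m) f) ((\<lambda>(f, l). f(Suc m := l)) p))"
    using cl x by (intro finsum_cong' refl) (auto simp: PQ[symmetric] simp del: fun_upd_apply One_nat_def)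
  also have "\<dots> = (\<Oplus>f\<in>fn_set (Suc m) L. ?P (Suc m) f \<otimes> ?Q (Suc m) f)"
    unfolding fn_set_Suc using cl x
    by (intro finsum_reindex[symmetric] fn_set_inj) (auto simp: PQ[symmetric] simp del: fun_upd_apply One_nat_def)
  finally show ?case .
qed

end


declare One_nat_def [simp del]

lemma perm_mem:
  "\<sigma> permutes {1..m} \<Longrightarrow> i \<in> {1..m} \<Longrightarrow> \<sigma> i \<in> {1..m}"
  "\<sigma> permutes {1..m} \<Longrightarrow> 1 \<le> i \<Longrightarrow> i \<le> m \<Longrightarrow> 1 \<le> \<sigma> i"
  "\<sigma> permutes {1..m} \<Longrightarrow> 1 \<le> i \<Longrightarrow> i \<le> m \<Longrightarrow> \<sigma> i \<le> m"
  using permutes_in_image[of \<sigma> "{1..m}" i] by auto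

text \<open>Applying the transposition to both members of a pair matches the inversions of
  \<open>f\<close> with those of the composite, apart from the new one at \<open>(i, Suc i)\<close>.
  An arbitrary \<open>f\<close> is allowed since row functions are sorted with this count as well as
  permutations.\<close>

lemma perm_length_transpose:
  assumes i: "1 \<le> i" "i < m" and f: "f i < f (Suc i)"
  shows "perm_length m (f \<circ> transpose i (Suc i)) = Suc (perm_length m f)"
proof -
  let ?s = "transpose i (Suc i)"
  let ?I = "\<lambda>f. {(i, j). 1 \<le> i \<and> i < j \<and> j \<le> m \<and> f j < (f i :: nat)}"
  have s: "?s x = (if x = i then Suc i else if x = Suc i then i else x)" for x
    by (auto simp: transpose_def)
  have fin: "finite (?I f)" by (rule finite_subset[of _ "{1..m} \<times> {1..m}"]) auto
  have inj: "inj_on (map_prod ?s ?s) (?I f)"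
    by (rule inj_onI) (auto simp: s split: if_splits)
  have nin: "(i, Suc i) \<notin> map_prod ?s ?s ` ?I f"
    by (auto simp: s split: if_splits)
  have "?I (f \<circ> ?s) = insert (i, Suc i) (map_prod ?s ?s ` ?I f)"
  proof (intro equalityI subsetI)
    fix x assume x: "x \<in> ?I (f \<circ> ?s)"
    obtain a b where ab: "x = (a, b)" by fastforce
    show "x \<in> insert (i, Suc i) (map_prod ?s ?s ` ?I f)"
    proof (cases "x = (i, Suc i)")
      case False
      then have "(?s a, ?s b) \<in> ?I f" using x ab i by (auto simp: s split: if_splits)
      then have "map_prod ?s ?s (?s a, ?s b) \<in> map_prod ?s ?s ` ?I f" by (rule imageI)
      then show ?thesis by (simp add: ab)
    qed simp
  next
    fix x assume "x \<in> insert (i, Suc i) (map_prod ?s ?s ` ?I f)"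
    then show "x \<in> ?I (f \<circ> ?s)" using i f by (auto simp: s split: if_splits)
  qed
  then show ?thesis unfolding perm_length_def
    using fin nin card_image[OF inj] by simp
qed

lemma perm_length_id: "perm_length m id = 0" "perm_length m (\<lambda>k. k) = 0"
  by (auto simp: perm_length_def card_eq_0_iff)

text \<open>Strict growth gives \<open>f j + k \<le> f (j + k)\<close>. Applied from
  \<open>i\<close> to \<open>m\<close> and from 1 to \<open>i\<close>, this squeezes
  \<open>f i\<close> from both sides.\<close>

lemma strictly_increasing_self_map:
  fixes f :: "nat \<Rightarrow> nat"
  assumes f: "\<And>i. i \<in> {1..m} \<Longrightarrow> f i \<in> {1..m}" and inc: "\<And>i. 1 \<le> i \<Longrightarrow> i < m \<Longrightarrow> f i < f (Suc i)"
    and i: "i \<in> {1..m}"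
  shows "f i = i"
proof -
  have step: "f j + k \<le> f (j + k)" if "1 \<le> j" "j + k \<le> m" for j k
    using that
  proof (induction k)
    case (Suc k)
    then show ?case using inc[of "j + k"] by simp
  qed simp
  have "f i + (m - i) \<le> f (i + (m - i))" using i by (intro step) auto
  moreover have "f m \<le> m" using f[of m] i by auto
  ultimately have "f i \<le> i" using i by auto
  moreover have "i \<le> f i" using step[of 1 "i - 1"] f[of 1] i by auto
  ultimately show ?thesis by simp
qed

section \<open>Quantum minors are q-alternating in the rows and multiplicative\<close>

context qalg
begin

lemma lprod_split_at:
  assumes i: "1 \<le> i" "i < m" and F: "\<And>k. k \<in> {1..m} \<Longrightarrow> F k \<in> carrier R"
  shows "lprod (map F [1..<Suc m]) =
    lprod (map F [1..<i]) \<otimes> (F i \<otimes> F (Suc i)) \<otimes> lprod (map F [Suc (Suc i)..<Suc m])"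
proof -
  have "[1..<Suc m] = [1..<i] @ [i, Suc i] @ [Suc (Suc i)..<Suc m]"
    using i upt_add_eq_append[of 1 i "Suc m - i"] by (simp add: upt_conv_Cons)
  moreover have "set (map F [1..<i]) \<subseteq> carrier R" "set (map F [Suc (Suc i)..<Suc m]) \<subseteq> carrier R"
    using i F by auto
  ultimately show ?thesis using i F by (simp add: lprod_append m_assoc)
qed

lemma lprod_zero:
  assumes "set xs \<subseteq> carrier R" "\<zero> \<in> set xs"
  shows "lprod xs = \<zero>"
  using assms by (induction xs) auto

definition minor_term :: "nat \<Rightarrow> (nat \<Rightarrow> nat \<Rightarrow> 'a) \<Rightarrow> (nat \<Rightarrow> nat) \<Rightarrow> (nat \<Rightarrow> nat) \<Rightarrow> (nat \<Rightarrow> nat) \<Rightarrow> 'a" where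
  "minor_term m N c f \<sigma> = lprod (map (\<lambda>k. N (f k) (c (\<sigma> k))) [1..<Suc m])"

text \<open>A minor with rows \<open>f 1\<close>, ..., \<open>f m\<close> in any order and with
  repetitions. It is the cofactor of a product of entries of \<open>M\<close> when a minor of a
  product matrix is expanded.\<close>

definition row_minor :: "nat \<Rightarrow> (nat \<Rightarrow> nat \<Rightarrow> 'a) \<Rightarrow> (nat \<Rightarrow> nat) \<Rightarrow> (nat \<Rightarrow> nat) \<Rightarrow> 'a" where
  "row_minor m N c f = (\<Oplus>\<sigma>\<in>{\<sigma>. \<sigma> permutes {1..m}}. (- q) ^ perm_length m \<sigma> \<odot> minor_term m N c f \<sigma>)"

context
  fixes N :: "nat \<Rightarrow> nat \<Rightarrow> 'a" and m :: nat and J :: "nat set" and c :: "nat \<Rightarrow> nat"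
  assumes N: "qmat q {1..m} J R N"
    and c: "\<And>k. k \<in> {1..m} \<Longrightarrow> c k \<in> J" and c_mono: "\<And>k l. k \<in> {1..m} \<Longrightarrow> l \<in> {1..m} \<Longrightarrow> k < l \<Longrightarrow> c k < c l"
begin

lemma minor_entry_closed:
  "f \<in> fn_set m {1..m} \<Longrightarrow> \<sigma> permutes {1..m} \<Longrightarrow> k \<in> {1..m} \<Longrightarrow> N (f k) (c (\<sigma> k)) \<in> carrier R"
  using qmat_closed[OF N, of "f k" "c (\<sigma> k)"] c[OF perm_mem(1)]
  by (simp add: fn_set_def)

lemma minor_term_closed:
  "f \<in> fn_set m {1..m} \<Longrightarrow> \<sigma> permutes {1..m} \<Longrightarrow> minor_term m N c f \<sigma> \<in> carrier R"
  unfolding minor_term_def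
  by (intro lprod_closed) (auto simp: minor_entry_closed less_Suc_eq_le)

lemma row_minor_closed: "f \<in> fn_set m {1..m} \<Longrightarrow> row_minor m N c f \<in> carrier R"
  unfolding row_minor_def by (intro finsum_closed) (auto simp: minor_term_closed)

lemma fn_set_transpose:
  assumes "f \<in> fn_set m L" "1 \<le> i" "i < m"
  shows "f \<circ> transpose i (Suc i) \<in> fn_set m L"
  using assms by (auto simp: fn_set_def transpose_def)

text \<open>Permutations are paired by exchanging their values at \<open>i\<close> and
  \<open>Suc i\<close>. The members of a pair share all outer factors, and their middle factors
  combine to a 2 x 2 quantum minor of the rows \<open>f i\<close> and
  \<open>f (Suc i)\<close>.\<close>

lemma row_minor_pairs:
  assumes f: "f \<in> fn_set m {1..m}" and i: "1 \<le> i" "i < m"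
  shows "row_minor m N c f = (\<Oplus>\<sigma>\<in>{\<sigma>. \<sigma> permutes {1..m} \<and> \<sigma> i < \<sigma> (Suc i)}.
    (- q) ^ perm_length m \<sigma> \<odot>
      (lprod (map (\<lambda>k. N (f k) (c (\<sigma> k))) [1..<i]) \<otimes>
       (N (f i) (c (\<sigma> i)) \<otimes> N (f (Suc i)) (c (\<sigma> (Suc i))) \<oplus>
         (- q) \<odot> (N (f i) (c (\<sigma> (Suc i))) \<otimes> N (f (Suc i)) (c (\<sigma> i)))) \<otimes>
       lprod (map (\<lambda>k. N (f k) (c (\<sigma> k))) [Suc (Suc i)..<Suc m])))"
proof -
  let ?s = "transpose i (Suc i)"
  let ?P = "{\<sigma>. \<sigma> permutes {1..m} \<and> \<sigma> i < \<sigma> (Suc i)}"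
  let ?t = "\<lambda>\<sigma>. (- q) ^ perm_length m \<sigma> \<odot> minor_term m N c f \<sigma>"
  have sp: "?s permutes {1..m}" using i by (intro permutes_swap_id) auto
  have fin: "finite {\<sigma>. \<sigma> permutes {1..m}}" by (simp add: finite_permutations)
  have ss: "?s \<circ> ?s = id" by simp
  have all: "{\<sigma>. \<sigma> permutes {1..m}} = ?P \<union> (\<lambda>\<sigma>. \<sigma> \<circ> ?s) ` ?P"
  proof (intro equalityI subsetI)
    fix \<sigma> assume a: "\<sigma> \<in> {\<sigma>. \<sigma> permutes {1..m}}"
    have ne: "\<sigma> i \<noteq> \<sigma> (Suc i)" using a permutes_inj[of \<sigma> "{1..m}"] by (simp add: inj_eq)
    show "\<sigma> \<in> ?P \<union> (\<lambda>\<sigma>. \<sigma> \<circ> ?s) ` ?P"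
    proof (cases "\<sigma> i < \<sigma> (Suc i)")
      case False
      then have "\<sigma> \<circ> ?s \<in> ?P" using a ne permutes_compose[OF sp] by simp
      moreover have "\<sigma> = (\<sigma> \<circ> ?s) \<circ> ?s" by (simp add: comp_assoc)
      ultimately show ?thesis by blast
    qed (use a in simp)
  qed (use permutes_compose[OF sp] in auto)
  have inj: "inj_on (\<lambda>\<sigma>. \<sigma> \<circ> ?s) ?P"
  proof (rule inj_onI)
    fix \<sigma> \<sigma>' assume "\<sigma> \<circ> ?s = \<sigma>' \<circ> ?s"
    then have "(\<sigma> \<circ> ?s) \<circ> ?s = (\<sigma>' \<circ> ?s) \<circ> ?s" by simp
    then show "\<sigma> = \<sigma>'" by (simp add: comp_assoc)
  qed
  have tc: "?t \<sigma> \<in> carrier R" if "\<sigma> permutes {1..m}" for \<sigma>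
    using minor_term_closed[OF f that] by simp
  have finP: "finite ?P" by (rule finite_subset[OF _ fin]) auto
  have "row_minor m N c f = (\<Oplus>\<sigma>\<in>?P \<union> (\<lambda>\<sigma>. \<sigma> \<circ> ?s) ` ?P. ?t \<sigma>)"
    unfolding row_minor_def all[symmetric] ..
  also have "\<dots> = (\<Oplus>\<sigma>\<in>?P. ?t \<sigma>) \<oplus> (\<Oplus>\<sigma>\<in>(\<lambda>\<sigma>. \<sigma> \<circ> ?s) ` ?P. ?t \<sigma>)"
    using finP tc permutes_compose[OF sp] by (intro finsum_Un_disjoint) auto
  also have "(\<Oplus>\<sigma>\<in>(\<lambda>\<sigma>. \<sigma> \<circ> ?s) ` ?P. ?t \<sigma>) = (\<Oplus>\<sigma>\<in>?P. ?t (\<sigma> \<circ> ?s))"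
    using tc permutes_compose[OF sp] inj by (intro finsum_reindex) auto
  also have "(\<Oplus>\<sigma>\<in>?P. ?t \<sigma>) \<oplus> (\<Oplus>\<sigma>\<in>?P. ?t (\<sigma> \<circ> ?s)) = (\<Oplus>\<sigma>\<in>?P. ?t \<sigma> \<oplus> ?t (\<sigma> \<circ> ?s))"
    using tc permutes_compose[OF sp] by (intro finsum_addf[symmetric]) auto
  also have "\<dots> = (\<Oplus>\<sigma>\<in>?P. (- q) ^ perm_length m \<sigma> \<odot>
      (lprod (map (\<lambda>k. N (f k) (c (\<sigma> k))) [1..<i]) \<otimes>
       (N (f i) (c (\<sigma> i)) \<otimes> N (f (Suc i)) (c (\<sigma> (Suc i))) \<oplus>
         (- q) \<odot> (N (f i) (c (\<sigma> (Suc i))) \<otimes> N (f (Suc i)) (c (\<sigma> i)))) \<otimes>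
       lprod (map (\<lambda>k. N (f k) (c (\<sigma> k))) [Suc (Suc i)..<Suc m])))"
    (is "_ = (\<Oplus>\<sigma>\<in>?P. ?r \<sigma>)")
  proof -
    have eq: "?t \<sigma> \<oplus> ?t (\<sigma> \<circ> ?s) = ?r \<sigma> \<and> ?r \<sigma> \<in> carrier R" if "\<sigma> \<in> ?P" for \<sigma>
    proof -
      have \<sigma>: "\<sigma> permutes {1..m}" "\<sigma> i < \<sigma> (Suc i)" using that by auto
      have \<sigma>s: "(\<sigma> \<circ> ?s) permutes {1..m}" using permutes_compose[OF sp \<sigma>(1)] .
      let ?A = "lprod (map (\<lambda>k. N (f k) (c (\<sigma> k))) [1..<i])"
      let ?B = "lprod (map (\<lambda>k. N (f k) (c (\<sigma> k))) [Suc (Suc i)..<Suc m])"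
      have A: "?A \<in> carrier R" "?B \<in> carrier R"
        using minor_entry_closed[OF f \<sigma>(1)] i by (auto intro!: lprod_closed)
      let ?X = "N (f i) (c (\<sigma> i)) \<otimes> N (f (Suc i)) (c (\<sigma> (Suc i)))"
      let ?Y = "N (f i) (c (\<sigma> (Suc i))) \<otimes> N (f (Suc i)) (c (\<sigma> i))"
      have XY: "?X \<in> carrier R" "?Y \<in> carrier R"
        using minor_entry_closed[OF f \<sigma>(1)] minor_entry_closed[OF f \<sigma>s, of i]
          minor_entry_closed[OF f \<sigma>s, of "Suc i"] i by auto
      have 1: "minor_term m N c f \<sigma> = ?A \<otimes> ?X \<otimes> ?B"
        unfolding minor_term_def using minor_entry_closed[OF f \<sigma>(1)] i by (intro lprod_split_at) auto
      have "minor_term m N c f (\<sigma> \<circ> ?s) =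
        lprod (map (\<lambda>k. N (f k) (c ((\<sigma> \<circ> ?s) k))) [1..<i]) \<otimes> ?Y \<otimes>
        lprod (map (\<lambda>k. N (f k) (c ((\<sigma> \<circ> ?s) k))) [Suc (Suc i)..<Suc m])"
        unfolding minor_term_def using minor_entry_closed[OF f \<sigma>s] i by (subst lprod_split_at) auto
      moreover have "map (\<lambda>k. N (f k) (c ((\<sigma> \<circ> ?s) k))) [1..<i] = map (\<lambda>k. N (f k) (c (\<sigma> k))) [1..<i]"
        "map (\<lambda>k. N (f k) (c ((\<sigma> \<circ> ?s) k))) [Suc (Suc i)..<Suc m] = map (\<lambda>k. N (f k) (c (\<sigma> k))) [Suc (Suc i)..<Suc m]"
        by (auto simp: transpose_def)
      ultimately have 2: "minor_term m N c f (\<sigma> \<circ> ?s) = ?A \<otimes> ?Y \<otimes> ?B" by (simp only:)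
      have 3: "perm_length m (\<sigma> \<circ> ?s) = Suc (perm_length m \<sigma>)"
        by (rule perm_length_transpose[OF i \<sigma>(2)])
      have "?t (\<sigma> \<circ> ?s) = (- q) ^ perm_length m \<sigma> \<odot> (?A \<otimes> ((- q) \<odot> ?Y) \<otimes> ?B)"
        unfolding 2 3 using A XY by (simp add: smult_mult_l smult_mult_r smult_assoc1[symmetric] mult.commute)
      then have "?t \<sigma> \<oplus> ?t (\<sigma> \<circ> ?s) = (- q) ^ perm_length m \<sigma> \<odot> (?A \<otimes> ?X \<otimes> ?B \<oplus> ?A \<otimes> ((- q) \<odot> ?Y) \<otimes> ?B)"
        unfolding 1 using A XY by (simp add: smult_r_distr)
      also have "\<dots> = ?r \<sigma>" using A XY by (simp add: l_distr r_distr)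
      finally show ?thesis using A XY by simp
    qed
    then show ?thesis by (intro finsum_cong' refl) auto
  qed
  finally show ?thesis .
qed

lemma row_minor_repeat:
  assumes f: "f \<in> fn_set m {1..m}" and i: "1 \<le> i" "i < m" and eq: "f i = f (Suc i)"
  shows "row_minor m N c f = \<zero>"
  unfolding row_minor_pairs[OF f i]
proof (rule add.finprod_one_eqI)
  fix \<sigma> assume "\<sigma> \<in> {\<sigma>. \<sigma> permutes {1..m} \<and> \<sigma> i < \<sigma> (Suc i)}"
  then have \<sigma>: "\<sigma> permutes {1..m}" "\<sigma> i < \<sigma> (Suc i)" by auto
  have m: "\<sigma> i \<in> {1..m}" "\<sigma> (Suc i) \<in> {1..m}" "i \<in> {1..m}" "Suc i \<in> {1..m}"
    using permutes_in_image[OF \<sigma>(1)] i by auto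
  have "N (f i) (c (\<sigma> i)) \<otimes> N (f i) (c (\<sigma> (Suc i))) \<oplus> (- q) \<odot> (N (f i) (c (\<sigma> (Suc i))) \<otimes> N (f i) (c (\<sigma> i))) = \<zero>"
    using f m c c_mono[OF m(1,2) \<sigma>(2)] by (intro qmat_row_repeat[OF N]) (auto simp: fn_set_def)
  moreover have "lprod (map (\<lambda>k. N (f k) (c (\<sigma> k))) [1..<i]) \<in> carrier R"
    "lprod (map (\<lambda>k. N (f k) (c (\<sigma> k))) [Suc (Suc i)..<Suc m]) \<in> carrier R"
    using minor_entry_closed[OF f \<sigma>(1)] i by (auto intro!: lprod_closed)
  ultimately show "(- q) ^ perm_length m \<sigma> \<odot>
      (lprod (map (\<lambda>k. N (f k) (c (\<sigma> k))) [1..<i]) \<otimes>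
       (N (f i) (c (\<sigma> i)) \<otimes> N (f (Suc i)) (c (\<sigma> (Suc i))) \<oplus>
         (- q) \<odot> (N (f i) (c (\<sigma> (Suc i))) \<otimes> N (f (Suc i)) (c (\<sigma> i)))) \<otimes>
       lprod (map (\<lambda>k. N (f k) (c (\<sigma> k))) [Suc (Suc i)..<Suc m])) = \<zero>"
    by (simp add: eq[symmetric])
qed

lemma row_minor_descent:
  assumes f: "f \<in> fn_set m {1..m}" and i: "1 \<le> i" "i < m" and gt: "f (Suc i) < f i"
  shows "row_minor m N c f = (- q) \<odot> row_minor m N c (f \<circ> transpose i (Suc i))"
proof -
  let ?f = "f \<circ> transpose i (Suc i)"
  let ?P = "{\<sigma>. \<sigma> permutes {1..m} \<and> \<sigma> i < \<sigma> (Suc i)}"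
  let ?r = "\<lambda>f \<sigma>. (- q) ^ perm_length m \<sigma> \<odot>
      (lprod (map (\<lambda>k. N (f k) (c (\<sigma> k))) [1..<i]) \<otimes>
       (N (f i) (c (\<sigma> i)) \<otimes> N (f (Suc i)) (c (\<sigma> (Suc i))) \<oplus>
         (- q) \<odot> (N (f i) (c (\<sigma> (Suc i))) \<otimes> N (f (Suc i)) (c (\<sigma> i)))) \<otimes>
       lprod (map (\<lambda>k. N (f k) (c (\<sigma> k))) [Suc (Suc i)..<Suc m]))"
  have f': "?f \<in> fn_set m {1..m}" by (rule fn_set_transpose[OF f i])
  have eq: "?r f \<sigma> = (- q) \<odot> ?r ?f \<sigma> \<and> ?r ?f \<sigma> \<in> carrier R" if "\<sigma> \<in> ?P" for \<sigma>
  proof -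
    have \<sigma>: "\<sigma> permutes {1..m}" "\<sigma> i < \<sigma> (Suc i)" using that by auto
    have m: "\<sigma> i \<in> {1..m}" "\<sigma> (Suc i) \<in> {1..m}" "i \<in> {1..m}" "Suc i \<in> {1..m}"
      using permutes_in_image[OF \<sigma>(1)] i by auto
    have fm: "f i \<in> {1..m}" "f (Suc i) \<in> {1..m}" using f m by (auto simp: fn_set_def)
    let ?A = "lprod (map (\<lambda>k. N (f k) (c (\<sigma> k))) [1..<i])"
    let ?B = "lprod (map (\<lambda>k. N (f k) (c (\<sigma> k))) [Suc (Suc i)..<Suc m])"
    have A: "?A \<in> carrier R" "?B \<in> carrier R"
      using minor_entry_closed[OF f \<sigma>(1)] i by (auto intro!: lprod_closed)
    have AB: "map (\<lambda>k. N (?f k) (c (\<sigma> k))) [1..<i] = map (\<lambda>k. N (f k) (c (\<sigma> k))) [1..<i]"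
      "map (\<lambda>k. N (?f k) (c (\<sigma> k))) [Suc (Suc i)..<Suc m] = map (\<lambda>k. N (f k) (c (\<sigma> k))) [Suc (Suc i)..<Suc m]"
      by (auto simp: transpose_def)
    let ?Y = "N (f (Suc i)) (c (\<sigma> i)) \<otimes> N (f i) (c (\<sigma> (Suc i))) \<oplus>
         (- q) \<odot> (N (f (Suc i)) (c (\<sigma> (Suc i))) \<otimes> N (f i) (c (\<sigma> i)))"
    have cl: "N (f a) (c (\<sigma> b)) \<in> carrier R" if "a \<in> {i, Suc i}" "b \<in> {i, Suc i}" for a b
      using that fm m c by (auto intro!: qmat_closed[OF N])
    have Y: "?Y \<in> carrier R" using cl by simp
    have ex: "N (f i) (c (\<sigma> i)) \<otimes> N (f (Suc i)) (c (\<sigma> (Suc i))) \<oplus>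
         (- q) \<odot> (N (f i) (c (\<sigma> (Suc i))) \<otimes> N (f (Suc i)) (c (\<sigma> i))) = (- q) \<odot> ?Y"
      using fm m c gt c_mono[OF m(1,2) \<sigma>(2)] by (intro qmat_row_exchange[OF N]) auto
    have "?r f \<sigma> = (- q) ^ perm_length m \<sigma> \<odot> (?A \<otimes> ((- q) \<odot> ?Y) \<otimes> ?B)" unfolding ex ..
    also have "\<dots> = (- q) \<odot> ((- q) ^ perm_length m \<sigma> \<odot> (?A \<otimes> ?Y \<otimes> ?B))"
      using A Y by (simp add: smult_mult_l smult_mult_r smult_assoc1[symmetric] mult.commute del: a_closed)
    also have "(- q) ^ perm_length m \<sigma> \<odot> (?A \<otimes> ?Y \<otimes> ?B) = ?r ?f \<sigma>" unfolding AB by simp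
    finally have "?r f \<sigma> = (- q) \<odot> ?r ?f \<sigma>" .
    moreover have "?r ?f \<sigma> \<in> carrier R" unfolding AB using A Y by simp
    ultimately show ?thesis by blast
  qed
  have "row_minor m N c f = (\<Oplus>\<sigma>\<in>?P. (- q) \<odot> ?r ?f \<sigma>)"
    unfolding row_minor_pairs[OF f i] using eq by (intro finsum_cong' refl) auto
  also have "\<dots> = (- q) \<odot> (\<Oplus>\<sigma>\<in>?P. ?r ?f \<sigma>)" using eq by (intro finsum_smult[symmetric]) auto
  finally show ?thesis unfolding row_minor_pairs[OF f' i] .
qed

text \<open>Bubble sort on \<open>f\<close>, by induction on its number of inversions: a descent
  yields a factor \<open>- q\<close>, an adjacent repetition gives 0, and a strictly increasing
  self-map is the identity.\<close>

lemma row_minor_eq: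
  assumes "f \<in> fn_set m {1..m}"
  shows "row_minor m N c f =
    (if inj_on f {1..m} then (- q) ^ perm_length m f \<odot> row_minor m N c id else \<zero>)"
  using assms
proof (induction "perm_length m f" arbitrary: f rule: less_induct)
  case less
  have idf: "id \<in> fn_set m {1..m}" by (simp add: fn_set_def)
  consider i where "1 \<le> i" "i < m" "f (Suc i) < f i" | i where "1 \<le> i" "i < m" "f i = f (Suc i)"
    | "\<And>i. 1 \<le> i \<Longrightarrow> i < m \<Longrightarrow> f i < f (Suc i)" by (meson linorder_less_linear)
  then show ?case
  proof cases
    case (1 i)
    let ?s = "transpose i (Suc i)"
    have g: "f \<circ> ?s \<in> fn_set m {1..m}" by (rule fn_set_transpose[OF less.prems 1(1,2)])
    have "perm_length m ((f \<circ> ?s) \<circ> ?s) = Suc (perm_length m (f \<circ> ?s))"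
      by (rule perm_length_transpose[OF 1(1,2)]) (simp add: 1)
    then have len: "perm_length m f = Suc (perm_length m (f \<circ> ?s))" by (simp add: comp_assoc)
    have sp: "?s permutes {1..m}" using 1 by (intro permutes_swap_id) auto
    have "inj_on (f \<circ> ?s) {1..m} \<longleftrightarrow> inj_on f {1..m}"
      using comp_inj_on_iff[of ?s "{1..m}" f] permutes_inj_on[OF sp] permutes_image[OF sp] by simp
    then show ?thesis
      unfolding row_minor_descent[OF less.prems 1] using less.hyps[OF _ g] len row_minor_closed[OF idf]
      by (simp add: smult_assoc1[symmetric])
  next
    case (2 i)
    then have "\<not> inj_on f {1..m}" by (auto dest!: inj_onD[of _ _ i "Suc i"])
    then show ?thesis using row_minor_repeat[OF less.prems 2] by simp
  next
    case 3
    have "f x = x" if "x \<in> {1..m}" for x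
      by (rule strictly_increasing_self_map[of m f]) (use less.prems 3 that in \<open>auto simp: fn_set_def\<close>)
    moreover have "f x = x" if "x \<notin> {1..m}" for x using less.prems that by (auto simp: fn_set_def)
    ultimately have "f = id" by (auto simp: fun_eq_iff)
    then show ?thesis using row_minor_closed[OF idf] by (simp add: perm_length_id)
  qed
qed

text \<open>The expansion runs over all choice functions, and \<open>row_minor_eq\<close> kills
  those that are not permutations. For a permutation it supplies precisely the coefficient with
  which its product occurs in the minor of \<open>M\<close>.\<close>

lemma qminor_mult:
  assumes M: "\<And>i a. i \<in> {1..m} \<Longrightarrow> a \<in> {1..m} \<Longrightarrow> M i a \<in> carrier R"
    and comm: "\<And>i a b j. i \<in> {1..m} \<Longrightarrow> a \<in> {1..m} \<Longrightarrow> b \<in> {1..m} \<Longrightarrow> j \<in> J \<Longrightarrow> M i a \<otimes> N b j = N b j \<otimes> M i a"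
  shows "qminor m (\<lambda>i j. \<Oplus>a\<in>{1..m}. M i a \<otimes> N a j) c = qminor m M (\<lambda>k. k) \<otimes> qminor m N c"
proof -
  let ?S = "{\<sigma>. \<sigma> permutes {1..m}}"
  let ?F = "fn_set m {1..m}"
  let ?P = "\<lambda>f. lprod (map (\<lambda>i. M i (f i)) [1..<Suc m])"
  have fin: "finite ?S" "finite ?F" by (simp_all add: finite_permutations fn_set_finite)
  have idf: "id \<in> ?F" by (simp add: fn_set_def)
  have P: "?P f \<in> carrier R" if "f \<in> ?F" for f
    using that M by (auto intro!: lprod_closed simp: fn_set_def)
  have SF: "?S \<subseteq> ?F" by (auto simp: fn_set_def perm_mem intro: permutes_not_in)
  have "qminor m (\<lambda>i j. \<Oplus>a\<in>{1..m}. M i a \<otimes> N a j) c =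
    (\<Oplus>\<sigma>\<in>?S. (- q) ^ perm_length m \<sigma> \<odot> (\<Oplus>f\<in>?F. ?P f \<otimes> minor_term m N c f \<sigma>))"
    unfolding qminor_def
  proof (intro finsum_cong' refl)
    fix \<sigma> assume "\<sigma> \<in> ?S"
    then have \<sigma>: "\<sigma> i \<in> {1..m}" if "i \<in> {1..m}" for i using that by (simp add: perm_mem)
    show "(- q) ^ perm_length m \<sigma> \<odot> lprod (map (\<lambda>i. \<Oplus>a\<in>{1..m}. M i a \<otimes> N a (c (\<sigma> i))) [1..<Suc m]) =
        (- q) ^ perm_length m \<sigma> \<odot> (\<Oplus>f\<in>?F. ?P f \<otimes> minor_term m N c f \<sigma>)"
      unfolding minor_term_def using \<sigma> M qmat_closed[OF N] comm c
      by (intro arg_cong2[where f = "(\<odot>)"] refl lprod_expand) auto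
  qed (auto intro!: smult_closed finsum_closed P minor_term_closed)
  also have "\<dots> = (\<Oplus>\<sigma>\<in>?S. \<Oplus>f\<in>?F. ?P f \<otimes> ((- q) ^ perm_length m \<sigma> \<odot> minor_term m N c f \<sigma>))"
  proof (intro finsum_cong' refl)
    fix \<sigma> assume "\<sigma> \<in> ?S"
    then have t: "minor_term m N c f \<sigma> \<in> carrier R" if "f \<in> ?F" for f
      using minor_term_closed[OF that] by blast
    have "(- q) ^ perm_length m \<sigma> \<odot> (\<Oplus>f\<in>?F. ?P f \<otimes> minor_term m N c f \<sigma>) =
      (\<Oplus>f\<in>?F. (- q) ^ perm_length m \<sigma> \<odot> (?P f \<otimes> minor_term m N c f \<sigma>))"
      using P t by (intro finsum_smult) auto
    also have "\<dots> = (\<Oplus>f\<in>?F. ?P f \<otimes> ((- q) ^ perm_length m \<sigma> \<odot> minor_term m N c f \<sigma>))"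
      using P t by (intro finsum_cong' refl) (auto simp: smult_mult_r)
    finally show "(- q) ^ perm_length m \<sigma> \<odot> (\<Oplus>f\<in>?F. ?P f \<otimes> minor_term m N c f \<sigma>) =
      (\<Oplus>f\<in>?F. ?P f \<otimes> ((- q) ^ perm_length m \<sigma> \<odot> minor_term m N c f \<sigma>))" .
  qed (auto intro!: finsum_closed m_closed P minor_term_closed smult_closed)
  also have "\<dots> = (\<Oplus>f\<in>?F. \<Oplus>\<sigma>\<in>?S. ?P f \<otimes> ((- q) ^ perm_length m \<sigma> \<odot> minor_term m N c f \<sigma>))"
    using fin by (intro finsum_swap) (auto intro!: P minor_term_closed m_closed smult_closed)
  also have "\<dots> = (\<Oplus>f\<in>?F. ?P f \<otimes> row_minor m N c f)"
    unfolding row_minor_def using fin P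
    by (intro finsum_cong' refl) (auto simp: finsum_rdistr Pi_def minor_term_closed intro!: finsum_closed)
  also have "\<dots> = (\<Oplus>f\<in>?S. ?P f \<otimes> row_minor m N c f)"
  proof (rule add.finprod_mono_neutral_cong_right[OF fin(2) SF])
    fix f assume f: "f \<in> ?F - ?S"
    \<comment> \<open>An injective self-map of a finite set is a permutation, and members of
      \<open>fn_set\<close> are the identity elsewhere.\<close>
    have "\<not> inj_on f {1..m}"
    proof
      assume i: "inj_on f {1..m}"
      have sub: "f ` {1..m} \<subseteq> {1..m}" using f by (auto simp: fn_set_def)
      have "bij_betw f {1..m} {1..m}"
        using i sub by (simp add: bij_betw_def endo_inj_surj)
      then have "f permutes {1..m}"
        by (rule bij_imp_permutes) (use f in \<open>simp add: fn_set_def\<close>)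
      then show False using f by simp
    qed
    then show "?P f \<otimes> row_minor m N c f = \<zero>" using f P by (simp add: row_minor_eq)
  qed (auto intro!: P row_minor_closed m_closed)
  also have "\<dots> = (\<Oplus>f\<in>?S. ((- q) ^ perm_length m f \<odot> ?P f) \<otimes> row_minor m N c id)"
  proof (intro finsum_cong' refl)
    fix f assume f: "f \<in> ?S"
    then have fF: "f \<in> ?F" using SF by auto
    have "inj_on f {1..m}" using f by (simp add: permutes_inj_on)
    then show "?P f \<otimes> row_minor m N c f = ((- q) ^ perm_length m f \<odot> ?P f) \<otimes> row_minor m N c id"
      using P[OF fF] row_minor_closed[OF idf] row_minor_eq[OF fF] by (simp add: smult_mult_l smult_mult_r)
  qed (use SF P row_minor_closed[OF idf] in auto)
  also have "\<dots> = (\<Oplus>f\<in>?S. (- q) ^ perm_length m f \<odot> ?P f) \<otimes> row_minor m N c id"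
    using fin SF P row_minor_closed[OF idf] by (intro finsum_ldistr[symmetric]) auto
  finally show ?thesis by (simp add: qminor_def row_minor_def minor_term_def)
qed

end

lemma qminor_closed:
  assumes "\<And>i j. i \<in> {1..m} \<Longrightarrow> j \<in> {1..m} \<Longrightarrow> Z i (c j) \<in> carrier R"
  shows "qminor m Z c \<in> carrier R"
  unfolding qminor_def using assms
  by (auto intro!: finsum_closed smult_closed lprod_closed simp: perm_mem less_Suc_eq_le)

lemma qminor_cong:
  assumes "\<And>i j. i \<in> {1..m} \<Longrightarrow> j \<in> {1..m} \<Longrightarrow> Z i (c j) = Z' i (c' j)"
    and "\<And>i j. i \<in> {1..m} \<Longrightarrow> j \<in> {1..m} \<Longrightarrow> Z' i (c' j) \<in> carrier R"
  shows "qminor m Z c = qminor m Z' c'"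
  unfolding qminor_def
proof (intro finsum_cong' refl)
  fix \<sigma> assume "\<sigma> \<in> {\<sigma>. \<sigma> permutes {1..m}}"
  then have "\<sigma> i \<in> {1..m}" if "i \<in> {1..m}" for i using that by (simp add: perm_mem)
  then have "map (\<lambda>i. Z i (c (\<sigma> i))) [1..<Suc m] = map (\<lambda>i. Z' i (c' (\<sigma> i))) [1..<Suc m]"
    using assms by (intro map_cong) auto
  then show "(- q) ^ perm_length m \<sigma> \<odot> lprod (map (\<lambda>i. Z i (c (\<sigma> i))) [1..<Suc m]) =
    (- q) ^ perm_length m \<sigma> \<odot> lprod (map (\<lambda>i. Z' i (c' (\<sigma> i))) [1..<Suc m])" by (simp only:)
qed (use assms in \<open>auto intro!: smult_closed lprod_closed simp: perm_mem less_Suc_eq_le\<close>)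

text \<open>A permutation other than the identity has some \<open>\<sigma> i < i\<close>, and there
  its product meets a zero entry.\<close>

lemma qminor_triangular:
  assumes U: "\<And>i j. i \<in> {1..m} \<Longrightarrow> j \<in> {1..m} \<Longrightarrow> U i j \<in> carrier R"
    and tri: "\<And>i j. i \<in> {1..m} \<Longrightarrow> j \<in> {1..m} \<Longrightarrow> j < i \<Longrightarrow> U i j = \<zero>"
  shows "qminor m U (\<lambda>k. k) = lprod (map (\<lambda>i. U i i) [1..<Suc m])"
proof -
  let ?S = "{\<sigma>. \<sigma> permutes {1..m}}"
  let ?t = "\<lambda>\<sigma>. (- q) ^ perm_length m \<sigma> \<odot> lprod (map (\<lambda>i. U i (\<sigma> i)) [1..<Suc m])"
  have cl: "lprod (map (\<lambda>i. U i (\<sigma> i)) [1..<Suc m]) \<in> carrier R" if "\<sigma> \<in> ?S" for \<sigma>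
    using that U by (auto intro!: lprod_closed simp: perm_mem less_Suc_eq_le)
  have "qminor m U (\<lambda>k. k) = (\<Oplus>\<sigma>\<in>{id}. ?t \<sigma>)"
    unfolding qminor_def
  proof (rule add.finprod_mono_neutral_cong_right)
    show "{id} \<subseteq> ?S" by (auto simp: permutes_id)
    fix \<sigma> assume \<sigma>: "\<sigma> \<in> ?S - {id}"
    then have p: "\<sigma> permutes {1..m}" "\<sigma> \<noteq> id" by auto
    have "\<exists>i\<in>{1..m}. \<sigma> i < i"
    proof (rule ccontr)
      assume "\<not> (\<exists>i\<in>{1..m}. \<sigma> i < i)"
      then have "\<forall>i\<in>{1..m}. i \<le> \<sigma> i" by (simp add: linorder_not_less)
      then have "\<sigma> = id" by (rule permutes_natset_ge[OF p(1)])
      then show False using p(2) by blast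
    qed
    then obtain i where i: "i \<in> {1..m}" "\<sigma> i < i" by blast
    have "U i (\<sigma> i) = \<zero>" using i \<sigma> by (intro tri) (auto simp: perm_mem)
    moreover have "i \<in> set [1..<Suc m]" using i(1) by auto
    then have "U i (\<sigma> i) \<in> set (map (\<lambda>i. U i (\<sigma> i)) [1..<Suc m])" unfolding set_map by (rule imageI)
    ultimately have "\<zero> \<in> set (map (\<lambda>i. U i (\<sigma> i)) [1..<Suc m])" by metis
    then have "lprod (map (\<lambda>i. U i (\<sigma> i)) [1..<Suc m]) = \<zero>"
      using \<sigma> U by (intro lprod_zero) (auto simp: perm_mem less_Suc_eq_le)
    then show "?t \<sigma> = \<zero>" by simp
  qed (use cl finite_permutations in auto)
  also have "\<dots> = lprod (map (\<lambda>i. U i i) [1..<Suc m])"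
    using cl[of id] by (simp add: perm_length_id permutes_id)
  finally show ?thesis .
qed

end

lemma qalgI: "kalg R \<Longrightarrow> q \<noteq> 0 \<Longrightarrow> qalg R q"
  by (simp add: qalg_def qalg_axioms_def)

lemma qminor_alg_hom:
  assumes R: "qalg R q" and S: "qalg S q" and h: "h \<in> alg_hom R S"
    and Z: "\<And>i j. i \<in> {1..m} \<Longrightarrow> j \<in> {1..m} \<Longrightarrow> Z i (c j) \<in> carrier R"
  shows "h (qalg.qminor R q m Z c) = qalg.qminor S q m (\<lambda>i j. h (Z i j)) c"
proof -
  interpret R: qalg R q by fact
  interpret S: qalg S q by fact
  have cl: "set (map (\<lambda>i. Z i (c (\<sigma> i))) [1..<Suc m]) \<subseteq> carrier R" if "\<sigma> permutes {1..m}" for \<sigma>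
    using that Z by (auto simp: perm_mem less_Suc_eq_le)
  have "h (R.qminor m Z c) = (\<Oplus>\<^bsub>S\<^esub>\<sigma>\<in>{\<sigma>. \<sigma> permutes {1..m}}.
     h ((- q) ^ perm_length m \<sigma> \<odot>\<^bsub>R\<^esub> R.lprod (map (\<lambda>i. Z i (c (\<sigma> i))) [1..<Suc m])))"
    unfolding R.qminor_def using cl
    by (intro alg_hom_finsum[OF h R.kalg_axioms S.kalg_axioms]) auto
  also have "\<dots> = S.qminor m (\<lambda>i j. h (Z i j)) c"
    unfolding S.qminor_def
  proof (intro S.finsum_cong' refl)
    fix \<sigma> assume "\<sigma> \<in> {\<sigma>. \<sigma> permutes {1..m}}"
    then have c: "set (map (\<lambda>i. Z i (c (\<sigma> i))) [1..<Suc m]) \<subseteq> carrier R" using cl by blast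
    have "h (R.lprod (map (\<lambda>i. Z i (c (\<sigma> i))) [1..<Suc m])) = S.lprod (map (\<lambda>i. h (Z i (c (\<sigma> i)))) [1..<Suc m])"
      unfolding R.lprod_def S.lprod_def alg_hom_foldr[OF h R.kalg_axioms c] by (simp add: comp_def)
    then show "h ((- q) ^ perm_length m \<sigma> \<odot>\<^bsub>R\<^esub> R.lprod (map (\<lambda>i. Z i (c (\<sigma> i))) [1..<Suc m])) =
      (- q) ^ perm_length m \<sigma> \<odot>\<^bsub>S\<^esub> S.lprod (map (\<lambda>i. h (Z i (c (\<sigma> i)))) [1..<Suc m])"
      using R.lprod_closed[OF c] by (simp add: alg_homD[OF h])
  qed (use Z in \<open>auto intro!: S.smult_closed S.lprod_closed simp: perm_mem less_Suc_eq_le alg_homD[OF h]\<close>)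
  finally show ?thesis .
qed


section \<open>The quantum special linear group, its coaction, and coinvariance of the maximal
  minors\<close>

section \<open>Quantum matrix algebras and the coaction\<close>

abbreviation "Fr m n \<equiv> free_algebra (index_set m n)"

lemma free_gen_carrier:
  "i \<in> {1..m} \<Longrightarrow> j \<in> {1..n} \<Longrightarrow> free_gen i j \<in> carrier (Fr m n)"
  by (auto simp: free_gen_def index_set_def monoid_algebra_simps free_monoid_simps)

lemma qmatrix_relations_carrier:
  "qmatrix_relations q m n \<subseteq> carrier (Fr m n :: ('k::field, _) module)"
proof -
  interpret F: kalg "Fr m n :: ('k, _) module" by (rule free_algebra_kalg)
  note [simp] = free_gen_carrier[where 'a = 'k]
  show ?thesis unfolding qmatrix_relations_def Let_def by auto
qed

lemma qmatrix_ideal_ideal: "ideal (qmatrix_ideal q m n) (Fr m n :: ('k::field, _) module)"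
proof -
  interpret F: kalg "Fr m n :: ('k, _) module" by (rule free_algebra_kalg)
  show ?thesis unfolding qmatrix_ideal_def by (rule F.genideal_ideal[OF qmatrix_relations_carrier])
qed

lemma Oq_M_kalg: "kalg (Oq_M q m n)"
  unfolding Oq_M_def by (rule quotient_kalg[OF free_algebra_kalg qmatrix_ideal_ideal])

lemma Oq_M_proj: "(\<lambda>x. qmatrix_ideal q m n +>\<^bsub>Fr m n\<^esub> x) \<in> alg_hom (Fr m n) (Oq_M q m n)"
  unfolding Oq_M_def by (rule quotient_proj[OF free_algebra_kalg qmatrix_ideal_ideal])

lemma Z_gen_closed: "i \<in> {1..m} \<Longrightarrow> j \<in> {1..n} \<Longrightarrow> Z_gen q m n i j \<in> carrier (Oq_M q m n)"
  unfolding Z_gen_def using alg_homD(1)[OF Oq_M_proj] free_gen_carrier by blast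

lemma Oq_M_generates: "generates (Oq_M q m n) {Z_gen q m n i j | i j. i \<in> {1..m} \<and> j \<in> {1..n}}"
proof -
  have e: "(\<lambda>x. qmatrix_ideal q m n +>\<^bsub>Fr m n\<^esub> x) ` {single [x] 1 | x. x \<in> index_set m n} =
    {Z_gen q m n i j | i j. i \<in> {1..m} \<and> j \<in> {1..n}}"
    by (auto simp: Z_gen_def free_gen_def index_set_def)
  show ?thesis
    using quotient_generates[OF free_algebra_kalg qmatrix_ideal_ideal[where q = q and m = m and n = n] free_algebra_generates]
    unfolding e Oq_M_def .
qed

lemma Oq_M_eqI:
  fixes q :: "'k::field"
  assumes "x \<in> carrier (Fr m n)" "y \<in> carrier (Fr m n)"
    and "x \<ominus>\<^bsub>Fr m n\<^esub> y \<in> qmatrix_relations q m n"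
  shows "qmatrix_ideal q m n +>\<^bsub>Fr m n\<^esub> x = qmatrix_ideal q m n +>\<^bsub>Fr m n\<^esub> y"
proof -
  interpret F: kalg "Fr m n :: ('k, _) module" by (rule free_algebra_kalg)
  have "qmatrix_relations q m n \<subseteq> qmatrix_ideal q m n"
    unfolding qmatrix_ideal_def by (rule F.genideal_self[OF qmatrix_relations_carrier])
  then show ?thesis
    using quotient_eq_iff[OF free_algebra_kalg qmatrix_ideal_ideal assms(1,2)] assms(3) by blast
qed

lemma qalg_Oq_M: "q \<noteq> 0 \<Longrightarrow> qalg (Oq_M q m n) q"
  by (rule qalgI[OF Oq_M_kalg])

lemma Z_gen_qmat:
  fixes q :: "'k::field"
  assumes q: "q \<noteq> 0"
  shows "qmat q {1..m} {1..n} (Oq_M q m n) (Z_gen q m n)"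
proof -
  interpret F: kalg "Fr m n :: ('k, _) module" by (rule free_algebra_kalg)
  interpret A: qalg "Oq_M q m n" q by (rule qalg_Oq_M[OF q])
  note pr = alg_homD[OF Oq_M_proj[where q = q and m = m and n = n]]
  note cl [simp] = free_gen_carrier[where 'a = 'k]
  show ?thesis
  proof (rule A.qmatI)
    show "Z_gen q m n i j \<in> carrier (Oq_M q m n)" if "i \<in> {1..m}" "j \<in> {1..n}" for i j
      using that by (rule Z_gen_closed)
  next
    fix i j l assume a: "i \<in> {1..m}" "j \<in> {1..n}" "l \<in> {1..n}" "j < l"
    have "free_gen i j \<otimes>\<^bsub>Fr m n\<^esub> free_gen i l \<ominus>\<^bsub>Fr m n\<^esub> q \<odot>\<^bsub>Fr m n\<^esub> (free_gen i l \<otimes>\<^bsub>Fr m n\<^esub> free_gen i j)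
        \<in> qmatrix_relations q m n"
      unfolding qmatrix_relations_def Let_def using a
      by (intro UnI1 CollectI exI[of _ i] exI[of _ j] exI[of _ l]) auto
    note mem = this
    show "Z_gen q m n i j \<otimes>\<^bsub>Oq_M q m n\<^esub> Z_gen q m n i l =
      q \<odot>\<^bsub>Oq_M q m n\<^esub> (Z_gen q m n i l \<otimes>\<^bsub>Oq_M q m n\<^esub> Z_gen q m n i j)"
      unfolding Z_gen_def using a by (simp add: pr(2,3,5)[symmetric] Oq_M_eqI[OF _ _ mem])
  next
    fix i j s assume a: "i \<in> {1..m}" "s \<in> {1..m}" "j \<in> {1..n}" "i < s"
    have "free_gen i j \<otimes>\<^bsub>Fr m n\<^esub> free_gen s j \<ominus>\<^bsub>Fr m n\<^esub> q \<odot>\<^bsub>Fr m n\<^esub> (free_gen s j \<otimes>\<^bsub>Fr m n\<^esub> free_gen i j)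
        \<in> qmatrix_relations q m n"
      unfolding qmatrix_relations_def Let_def using a
      by (rule_tac UnI1, rule_tac UnI1, intro UnI2 CollectI exI[of _ i] exI[of _ s] exI[of _ j]) auto
    note mem = this
    show "Z_gen q m n i j \<otimes>\<^bsub>Oq_M q m n\<^esub> Z_gen q m n s j =
      q \<odot>\<^bsub>Oq_M q m n\<^esub> (Z_gen q m n s j \<otimes>\<^bsub>Oq_M q m n\<^esub> Z_gen q m n i j)"
      unfolding Z_gen_def using a by (simp add: pr(2,3,5)[symmetric] Oq_M_eqI[OF _ _ mem])
  next
    fix i j s l assume a: "i \<in> {1..m}" "s \<in> {1..m}" "j \<in> {1..n}" "l \<in> {1..n}" "i < s" "j < l"
    have "free_gen i l \<otimes>\<^bsub>Fr m n\<^esub> free_gen s j \<ominus>\<^bsub>Fr m n\<^esub> free_gen s j \<otimes>\<^bsub>Fr m n\<^esub> free_gen i l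
        \<in> qmatrix_relations q m n"
      unfolding qmatrix_relations_def Let_def using a
      by (rule_tac UnI1, intro UnI2 CollectI exI[of _ i] exI[of _ s] exI[of _ j] exI[of _ l]) auto
    note mem = this
    show "Z_gen q m n i l \<otimes>\<^bsub>Oq_M q m n\<^esub> Z_gen q m n s j =
      Z_gen q m n s j \<otimes>\<^bsub>Oq_M q m n\<^esub> Z_gen q m n i l"
      unfolding Z_gen_def using a by (simp add: pr(2,3,5)[symmetric] Oq_M_eqI[OF _ _ mem])
    let ?x = "free_gen i j \<otimes>\<^bsub>Fr m n\<^esub> free_gen s l" and ?y = "free_gen s l \<otimes>\<^bsub>Fr m n\<^esub> free_gen i j"
      and ?z = "(q - inverse q) \<odot>\<^bsub>Fr m n\<^esub> (free_gen i l \<otimes>\<^bsub>Fr m n\<^esub> free_gen s j)"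
    \<comment> \<open>The defining relation subtracts two terms one after the other, whereas
      equality of cosets needs the difference of two elements.\<close>
    have "?x \<ominus>\<^bsub>Fr m n\<^esub> (?y \<oplus>\<^bsub>Fr m n\<^esub> ?z) = (?x \<ominus>\<^bsub>Fr m n\<^esub> ?y) \<ominus>\<^bsub>Fr m n\<^esub> ?z"
      using a by (simp add: a_minus_def F.minus_add F.a_assoc)
    moreover have "(?x \<ominus>\<^bsub>Fr m n\<^esub> ?y) \<ominus>\<^bsub>Fr m n\<^esub> ?z \<in> qmatrix_relations q m n"
      unfolding qmatrix_relations_def Let_def using a
      by (intro UnI2 CollectI exI[of _ i] exI[of _ s] exI[of _ j] exI[of _ l]) auto
    ultimately have "?x \<ominus>\<^bsub>Fr m n\<^esub> (?y \<oplus>\<^bsub>Fr m n\<^esub> ?z) \<in> qmatrix_relations q m n" by (simp only:)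
    note mem = this
    show "Z_gen q m n i j \<otimes>\<^bsub>Oq_M q m n\<^esub> Z_gen q m n s l = Z_gen q m n s l \<otimes>\<^bsub>Oq_M q m n\<^esub> Z_gen q m n i j
        \<oplus>\<^bsub>Oq_M q m n\<^esub> (q - inverse q) \<odot>\<^bsub>Oq_M q m n\<^esub> (Z_gen q m n i l \<otimes>\<^bsub>Oq_M q m n\<^esub> Z_gen q m n s j)"
      unfolding Z_gen_def using a by (simp add: pr(2,3,5)[symmetric] Oq_M_eqI[OF _ _ mem])
  qed
qed

text \<open>Every morphism out of \<open>Oq_M\<close>, from the coaction to the torus
  representations, is obtained from a quantum matrix by this universal property.\<close>

lemma Oq_M_lift:
  fixes q :: "'k::field"
  assumes R: "qalg R q" and N: "qmat q {1..m} {1..n} R N"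
  obtains h where "h \<in> alg_hom (Oq_M q m n) R"
    "\<And>i j. i \<in> {1..m} \<Longrightarrow> j \<in> {1..n} \<Longrightarrow> h (Z_gen q m n i j) = N i j"
proof -
  interpret R: qalg R q by fact
  interpret F: kalg "Fr m n :: ('k, _) module" by (rule free_algebra_kalg)
  note Ncl [simp] = qmat_closed[OF N]
  obtain h0 where h0: "h0 \<in> alg_hom (Fr m n) R"
    "\<And>x. x \<in> index_set m n \<Longrightarrow> h0 (single [x] 1) = (\<lambda>(i, j). N i j) x"
    by (rule free_algebra_lift[OF R.kalg_axioms, of "index_set m n" "\<lambda>(i, j). N i j"])
      (auto simp: index_set_def)
  have hg: "h0 (free_gen i j) = N i j" if "i \<in> {1..m}" "j \<in> {1..n}" for i j
    using that h0(2)[of "(i, j)"] by (simp add: free_gen_def index_set_def)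
  note [simp] = free_gen_carrier[where 'a = 'k] hg alg_homD[OF h0(1)]
    alg_hom_minus[OF h0(1) F.kalg_axioms R.kalg_axioms]
  have ker: "h0 x = \<zero>\<^bsub>R\<^esub>" if "x \<in> qmatrix_relations q m n" for x
    using that unfolding qmatrix_relations_def Let_def
  proof (elim UnE CollectE exE conjE, goal_cases)
    case (1 i j l)
    then show ?case using R.qmat_row[OF N, of i j l] by simp
  next
    case (2 i s j)
    then show ?case using R.qmat_col[OF N, of i s j] by simp
  next
    case (3 i s j l)
    then show ?case using R.qmat_anti[OF N, of i s j l] by simp
  next
    case (4 i s j l)
    then have "N i j \<otimes>\<^bsub>R\<^esub> N s l = N s l \<otimes>\<^bsub>R\<^esub> N i j \<oplus>\<^bsub>R\<^esub> (q - inverse q) \<odot>\<^bsub>R\<^esub> (N i l \<otimes>\<^bsub>R\<^esub> N s j)"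
      by (intro R.qmat_diag[OF N]) auto
    moreover have "N s l \<otimes>\<^bsub>R\<^esub> N i j \<oplus>\<^bsub>R\<^esub> (q - inverse q) \<odot>\<^bsub>R\<^esub> (N i l \<otimes>\<^bsub>R\<^esub> N s j) \<ominus>\<^bsub>R\<^esub> N s l \<otimes>\<^bsub>R\<^esub> N i j =
       (q - inverse q) \<odot>\<^bsub>R\<^esub> (N i l \<otimes>\<^bsub>R\<^esub> N s j)"
      using 4 by (simp add: a_minus_def R.a_comm[of "N s l \<otimes>\<^bsub>R\<^esub> N i j"] R.a_assoc R.r_neg)
    ultimately show ?case using 4 by simp
  qed
  obtain h where "h \<in> alg_hom (Oq_M q m n) R"
    "\<And>x. x \<in> carrier (Fr m n) \<Longrightarrow> h (qmatrix_ideal q m n +>\<^bsub>Fr m n\<^esub> x) = h0 x"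
    by (rule genideal_lift[OF F.kalg_axioms R.kalg_axioms h0(1) qmatrix_relations_carrier[of q] ker,
          folded qmatrix_ideal_def, folded Oq_M_def]) (assumption, rule that)
  then show ?thesis using that by (simp add: Z_gen_def)
qed

lemma Oq_M_hom_eqI:
  assumes "h \<in> alg_hom (Oq_M q m n) R" "h' \<in> alg_hom (Oq_M q m n) R"
    and "\<And>i j. i \<in> {1..m} \<Longrightarrow> j \<in> {1..n} \<Longrightarrow> h (Z_gen q m n i j) = h' (Z_gen q m n i j)"
    and "x \<in> carrier (Oq_M q m n)"
  shows "h x = h' x"
  by (rule alg_hom_eqI[OF Oq_M_kalg Oq_M_generates assms(1,2) _ assms(4)]) (use assms(3) in auto)

lemma qminor_cols_qminor:
  assumes "q \<noteq> 0"
  shows "qminor_cols q m n c = qalg.qminor (Oq_M q m n) q m (Z_gen q m n) c"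
proof -
  interpret A: qalg "Oq_M q m n" q by (rule qalg_Oq_M[OF assms])
  show ?thesis unfolding qminor_cols_def A.qminor_def A.lprod_def ..
qed


subsection \<open>The quantum special linear group\<close>

context
  fixes q :: "'k::field" and m :: nat
  assumes q: "q \<noteq> 0"
begin

interpretation M: qalg "Oq_M q m m" q by (rule qalg_Oq_M[OF q])

lemma qdet_closed: "qdet q m \<in> carrier (Oq_M q m m)"
  unfolding qdet_def qminor_cols_qminor[OF q] by (rule M.qminor_closed) (rule Z_gen_closed)

lemma qdet_ideal_ideal: "ideal (qdet_ideal q m) (Oq_M q m m)"
  unfolding qdet_ideal_def by (rule M.genideal_ideal) (simp add: qdet_closed)

lemma Oq_SL_kalg: "kalg (Oq_SL q m)"
  unfolding Oq_SL_def by (rule quotient_kalg[OF M.kalg_axioms qdet_ideal_ideal])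

lemma qalg_Oq_SL: "qalg (Oq_SL q m) q"
  by (rule qalgI[OF Oq_SL_kalg q])

lemma Oq_SL_proj: "(\<lambda>x. qdet_ideal q m +>\<^bsub>Oq_M q m m\<^esub> x) \<in> alg_hom (Oq_M q m m) (Oq_SL q m)"
  unfolding Oq_SL_def by (rule quotient_proj[OF M.kalg_axioms qdet_ideal_ideal])

lemma U_gen_qmat: "qmat q {1..m} {1..m} (Oq_SL q m) (U_gen q m)"
  using qmat_alg_hom[OF Z_gen_qmat[OF q] M.kalg_axioms Oq_SL_proj]
  unfolding U_gen_def .

lemma U_gen_closed: "i \<in> {1..m} \<Longrightarrow> j \<in> {1..m} \<Longrightarrow> U_gen q m i j \<in> carrier (Oq_SL q m)"
  by (rule qmat_closed[OF U_gen_qmat])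

lemma Oq_SL_generates: "generates (Oq_SL q m) {U_gen q m i j | i j. i \<in> {1..m} \<and> j \<in> {1..m}}"
proof -
  have e: "(\<lambda>x. qdet_ideal q m +>\<^bsub>Oq_M q m m\<^esub> x) ` {Z_gen q m m i j | i j. i \<in> {1..m} \<and> j \<in> {1..m}} =
    {U_gen q m i j | i j. i \<in> {1..m} \<and> j \<in> {1..m}}"
    by (auto simp: U_gen_def)
  show ?thesis
    using quotient_generates[OF M.kalg_axioms qdet_ideal_ideal Oq_M_generates]
    unfolding e Oq_SL_def .
qed

lemma U_gen_qminor: "qalg.qminor (Oq_SL q m) q m (U_gen q m) (\<lambda>k. k) = \<one>\<^bsub>Oq_SL q m\<^esub>"
proof -
  have "qalg.qminor (Oq_SL q m) q m (U_gen q m) (\<lambda>k. k) = qdet_ideal q m +>\<^bsub>Oq_M q m m\<^esub> qdet q m"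
    unfolding qdet_def qminor_cols_qminor[OF q]
    by (subst qminor_alg_hom[OF M.qalg_axioms qalg_Oq_SL Oq_SL_proj])
      (simp_all add: Z_gen_closed U_gen_def[abs_def])
  also have "\<dots> = qdet_ideal q m +>\<^bsub>Oq_M q m m\<^esub> \<one>\<^bsub>Oq_M q m m\<^esub>"
    using M.genideal_self[of "{qdet q m \<ominus>\<^bsub>Oq_M q m m\<^esub> \<one>\<^bsub>Oq_M q m m\<^esub>}"] qdet_closed
    by (subst quotient_eq_iff[OF M.kalg_axioms qdet_ideal_ideal]) (simp_all add: qdet_ideal_def)
  also have "\<dots> = \<one>\<^bsub>Oq_SL q m\<^esub>" using alg_homD(4)[OF Oq_SL_proj] by simp
  finally show ?thesis .
qed

lemma Oq_SL_lift:
  assumes R: "qalg R q" and N: "qmat q {1..m} {1..m} R N"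
    and det: "qalg.qminor R q m N (\<lambda>k. k) = \<one>\<^bsub>R\<^esub>"
  obtains h where "h \<in> alg_hom (Oq_SL q m) R"
    "\<And>i j. i \<in> {1..m} \<Longrightarrow> j \<in> {1..m} \<Longrightarrow> h (U_gen q m i j) = N i j"
proof -
  interpret R: qalg R q by fact
  obtain h0 where h0: "h0 \<in> alg_hom (Oq_M q m m) R"
    "\<And>i j. i \<in> {1..m} \<Longrightarrow> j \<in> {1..m} \<Longrightarrow> h0 (Z_gen q m m i j) = N i j"
    by (rule Oq_M_lift[OF R N]) (rule that)
  have "h0 (qdet q m) = R.qminor m (\<lambda>i j. h0 (Z_gen q m m i j)) (\<lambda>k. k)"
    unfolding qdet_def qminor_cols_qminor[OF q]
    by (rule qminor_alg_hom[OF M.qalg_axioms R h0(1)]) (rule Z_gen_closed)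
  also have "\<dots> = R.qminor m N (\<lambda>k. k)"
    by (rule R.qminor_cong) (simp_all add: h0 qmat_closed[OF N])
  finally have "h0 (qdet q m \<ominus>\<^bsub>Oq_M q m m\<^esub> \<one>\<^bsub>Oq_M q m m\<^esub>) = \<zero>\<^bsub>R\<^esub>"
    using det qdet_closed alg_hom_minus[OF h0(1) M.kalg_axioms R.kalg_axioms, of "qdet q m" "\<one>\<^bsub>Oq_M q m m\<^esub>"]
    by (simp add: alg_homD[OF h0(1)])
  then have ker: "\<And>x. x \<in> {qdet q m \<ominus>\<^bsub>Oq_M q m m\<^esub> \<one>\<^bsub>Oq_M q m m\<^esub>} \<Longrightarrow> h0 x = \<zero>\<^bsub>R\<^esub>" by simp
  have sub: "{qdet q m \<ominus>\<^bsub>Oq_M q m m\<^esub> \<one>\<^bsub>Oq_M q m m\<^esub>} \<subseteq> carrier (Oq_M q m m)" using qdet_closed by simp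
  obtain h where "h \<in> alg_hom (Oq_SL q m) R"
    "\<And>x. x \<in> carrier (Oq_M q m m) \<Longrightarrow> h (qdet_ideal q m +>\<^bsub>Oq_M q m m\<^esub> x) = h0 x"
    by (rule genideal_lift[OF M.kalg_axioms R.kalg_axioms h0(1) sub ker,
          folded qdet_ideal_def, folded Oq_SL_def]) (assumption, rule that)
  then show ?thesis using that h0(2) by (simp add: U_gen_def Z_gen_closed)
qed

end


subsection \<open>Morphisms of tensor products\<close>

lemma the_alg_hom_spec:
  assumes "kalg A" "h0 \<in> alg_hom A B" "P h0"
    and "\<forall>h h'. (\<forall>x \<in> carrier A. h x = h' x) \<longrightarrow> P h \<longrightarrow> P h'"
    and "\<forall>h h'. h \<in> alg_hom A B \<longrightarrow> h' \<in> alg_hom A B \<longrightarrow> P h \<longrightarrow> P h' \<longrightarrow> (\<forall>x \<in> carrier A. h x = h' x)"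
  shows "the_alg_hom A B P \<in> alg_hom A B \<and> P (the_alg_hom A B P)"
  by (intro conjI; rule the_alg_hom_works[of A h0 B P]; use assms in blast)

lemma tensor_hom_works:
  assumes A: "kalg A" and B: "kalg B" and C: "kalg C" and D: "kalg D"
    and f: "f \<in> alg_hom A C" and g: "g \<in> alg_hom B D"
  shows "tensor_hom A B C D f g \<in> alg_hom (tensor_algebra A B) (tensor_algebra C D)"
    and "a \<in> carrier A \<Longrightarrow> b \<in> carrier B \<Longrightarrow>
      tensor_hom A B C D f g (pure_tensor A B a b) = pure_tensor C D (f a) (g b)"
proof -
  let ?P = "\<lambda>h. \<forall>a \<in> carrier A. \<forall>b \<in> carrier B.
         h (pure_tensor A B a b) = pure_tensor C D (f a) (g b)"
  interpret C: kalg C by fact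
  interpret D: kalg D by fact
  note [simp] = alg_homD[OF f] alg_homD[OF g]
  obtain h0 where h0: "h0 \<in> alg_hom (tensor_algebra A B) (tensor_algebra C D)" "?P h0"
  proof (rule tensor_lift[OF A B tensor_kalg[OF C D] alg_hom_comp[OF f tensor_inl[OF C D]]
        alg_hom_comp[OF g tensor_inr[OF C D]]])
    fix a b assume ab: "a \<in> carrier A" "b \<in> carrier B"
    then show "pure_tensor C D (f a) \<one>\<^bsub>D\<^esub> \<otimes>\<^bsub>tensor_algebra C D\<^esub> pure_tensor C D \<one>\<^bsub>C\<^esub> (g b) =
      pure_tensor C D \<one>\<^bsub>C\<^esub> (g b) \<otimes>\<^bsub>tensor_algebra C D\<^esub> pure_tensor C D (f a) \<one>\<^bsub>D\<^esub>"
      by (simp add: pure_tensor_mult[OF C D])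
  next
    fix h assume "h \<in> alg_hom (tensor_algebra A B) (tensor_algebra C D)"
      "\<And>a b. a \<in> carrier A \<Longrightarrow> b \<in> carrier B \<Longrightarrow> h (pure_tensor A B a b) =
        pure_tensor C D (f a) \<one>\<^bsub>D\<^esub> \<otimes>\<^bsub>tensor_algebra C D\<^esub> pure_tensor C D \<one>\<^bsub>C\<^esub> (g b)"
    then show ?thesis by (intro that) (auto simp: pure_tensor_mult[OF C D])
  qed
  have cong: "\<forall>h h'. (\<forall>x \<in> carrier (tensor_algebra A B). h x = h' x) \<longrightarrow> ?P h \<longrightarrow> ?P h'"
    by (auto simp: pure_tensor_closed[OF A B])
  have uniq: "\<forall>h h'. h \<in> alg_hom (tensor_algebra A B) (tensor_algebra C D) \<longrightarrow>
      h' \<in> alg_hom (tensor_algebra A B) (tensor_algebra C D) \<longrightarrow> ?P h \<longrightarrow> ?P h' \<longrightarrow>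
      (\<forall>x \<in> carrier (tensor_algebra A B). h x = h' x)"
    by (intro allI impI ballI) (rule tensor_hom_eqI[OF A B], auto)
  have "tensor_hom A B C D f g \<in> alg_hom (tensor_algebra A B) (tensor_algebra C D)"
    "?P (tensor_hom A B C D f g)"
    using the_alg_hom_spec[where P = ?P, OF tensor_kalg[OF A B] h0 cong uniq]
    unfolding tensor_hom_def by blast+
  then show "tensor_hom A B C D f g \<in> alg_hom (tensor_algebra A B) (tensor_algebra C D)"
    and "a \<in> carrier A \<Longrightarrow> b \<in> carrier B \<Longrightarrow>
      tensor_hom A B C D f g (pure_tensor A B a b) = pure_tensor C D (f a) (g b)" by auto
qed

text \<open>Existence is \<open>tensor_lift\<close> applied twice. The second application needs the
  image of the first two factors to commute with the third, which is checked on generators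
  only.\<close>

lemma tensor_assoc_works:
  assumes A: "kalg A" and B: "kalg B" and C: "kalg C"
  shows "tensor_assoc A B C \<in>
      alg_hom (tensor_algebra (tensor_algebra A B) C) (tensor_algebra A (tensor_algebra B C))"
    and "a \<in> carrier A \<Longrightarrow> b \<in> carrier B \<Longrightarrow> c \<in> carrier C \<Longrightarrow>
      tensor_assoc A B C (pure_tensor (tensor_algebra A B) C (pure_tensor A B a b) c) =
           pure_tensor A (tensor_algebra B C) a (pure_tensor B C b c)"
proof -
  let ?AB = "tensor_algebra A B" and ?BC = "tensor_algebra B C"
  let ?T = "tensor_algebra A ?BC"
  let ?P = "\<lambda>h. \<forall>a \<in> carrier A. \<forall>b \<in> carrier B. \<forall>c \<in> carrier C.
         h (pure_tensor ?AB C (pure_tensor A B a b) c) = pure_tensor A ?BC a (pure_tensor B C b c)"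
  interpret A: kalg A by fact
  interpret B: kalg B by fact
  interpret C: kalg C by fact
  have AB: "kalg ?AB" and BC: "kalg ?BC" by (rule tensor_kalg A B C)+
  have T: "kalg ?T" by (rule tensor_kalg[OF A BC])
  interpret AB: kalg ?AB by (rule AB)
  interpret BC: kalg ?BC by (rule BC)
  interpret T: kalg ?T by (rule T)
  note pm = pure_tensor_mult[OF A BC] pure_tensor_mult[OF B C] pure_tensor_mult[OF A B]
    pure_tensor_one[OF B C] pure_tensor_one[OF A B] pure_tensor_closed[OF B C] pure_tensor_closed[OF A B]
  obtain h1 where h1: "h1 \<in> alg_hom ?AB ?T"
    "\<And>a b. a \<in> carrier A \<Longrightarrow> b \<in> carrier B \<Longrightarrow>
       h1 (pure_tensor A B a b) = pure_tensor A ?BC a (pure_tensor B C b \<one>\<^bsub>C\<^esub>)"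
  proof (rule tensor_lift[OF A B T tensor_inl[OF A BC] alg_hom_comp[OF tensor_inl[OF B C] tensor_inr[OF A BC]]])
    fix a b assume "a \<in> carrier A" "b \<in> carrier B"
    then show "pure_tensor A ?BC a \<one>\<^bsub>?BC\<^esub> \<otimes>\<^bsub>?T\<^esub> pure_tensor A ?BC \<one>\<^bsub>A\<^esub> (pure_tensor B C b \<one>\<^bsub>C\<^esub>) =
      pure_tensor A ?BC \<one>\<^bsub>A\<^esub> (pure_tensor B C b \<one>\<^bsub>C\<^esub>) \<otimes>\<^bsub>?T\<^esub> pure_tensor A ?BC a \<one>\<^bsub>?BC\<^esub>"
      by (simp add: pm)
  next
    fix h assume "h \<in> alg_hom ?AB ?T" "\<And>a b. a \<in> carrier A \<Longrightarrow> b \<in> carrier B \<Longrightarrow> h (pure_tensor A B a b) =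
      pure_tensor A ?BC a \<one>\<^bsub>?BC\<^esub> \<otimes>\<^bsub>?T\<^esub> pure_tensor A ?BC \<one>\<^bsub>A\<^esub> (pure_tensor B C b \<one>\<^bsub>C\<^esub>)"
    then show ?thesis by (intro that) (auto simp: pm)
  qed
  let ?i = "\<lambda>c. pure_tensor A ?BC \<one>\<^bsub>A\<^esub> (pure_tensor B C \<one>\<^bsub>B\<^esub> c)"
  have i: "?i \<in> alg_hom C ?T" by (rule alg_hom_comp[OF tensor_inr[OF B C] tensor_inr[OF A BC]])
  have gAB: "generates ?AB ((\<lambda>a. pure_tensor A B a \<one>\<^bsub>B\<^esub>) ` carrier A \<union> (\<lambda>b. pure_tensor A B \<one>\<^bsub>A\<^esub> b) ` carrier B)"
    by (rule tensor_generates[OF A B]) (simp_all add: generates_def)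
  have comm: "h1 t \<otimes>\<^bsub>?T\<^esub> ?i c = ?i c \<otimes>\<^bsub>?T\<^esub> h1 t" if "t \<in> carrier ?AB" "c \<in> carrier C" for t c
    by (rule commute_from_generators[OF AB C T gAB _ h1(1) i _ that, of "carrier C"])
      (auto simp: generates_def h1(2) pm)
  obtain h0 where h0: "h0 \<in> alg_hom (tensor_algebra ?AB C) ?T" "?P h0"
  proof (rule tensor_lift[OF AB C T h1(1) i comm])
    fix h assume "h \<in> alg_hom (tensor_algebra ?AB C) ?T"
      "\<And>t c. t \<in> carrier ?AB \<Longrightarrow> c \<in> carrier C \<Longrightarrow> h (pure_tensor ?AB C t c) = h1 t \<otimes>\<^bsub>?T\<^esub> ?i c"
    then show ?thesis by (intro that) (auto simp: pm h1(2))
  qed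
  \<comment> \<open>Values are prescribed on triple pure tensors only. Uniqueness is therefore shown
    in two stages: on tensors of \<open>t\<close> with 1, then on tensors of 1 with
    \<open>c\<close>.\<close>
  have un: "h x = h' x" if h: "h \<in> alg_hom (tensor_algebra ?AB C) ?T" "h' \<in> alg_hom (tensor_algebra ?AB C) ?T"
    "?P h" "?P h'" and x: "x \<in> carrier (tensor_algebra ?AB C)" for h h' x
  proof (rule tensor_hom_eqI[OF AB C h(1,2) _ x])
    fix t c assume t: "t \<in> carrier ?AB" and c: "c \<in> carrier C"
    have "h (pure_tensor ?AB C t \<one>\<^bsub>C\<^esub>) = h' (pure_tensor ?AB C t \<one>\<^bsub>C\<^esub>)"
      by (rule tensor_hom_eqI[OF A B alg_hom_comp[OF tensor_inl[OF AB C] h(1)]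
            alg_hom_comp[OF tensor_inl[OF AB C] h(2)] _ t]) (use h in simp)
    moreover have "h (pure_tensor ?AB C \<one>\<^bsub>?AB\<^esub> c) = h' (pure_tensor ?AB C \<one>\<^bsub>?AB\<^esub> c)"
      using h(3,4) c by (simp add: pure_tensor_one[OF A B])
    ultimately show "h (pure_tensor ?AB C t c) = h' (pure_tensor ?AB C t c)"
      using t c unfolding pure_tensor_factor(1)[OF AB C t c]
      by (simp add: alg_homD[OF h(1)] alg_homD[OF h(2)] pure_tensor_closed[OF AB C])
  qed
  have uniq: "\<forall>h h'. h \<in> alg_hom (tensor_algebra ?AB C) ?T \<longrightarrow>
      h' \<in> alg_hom (tensor_algebra ?AB C) ?T \<longrightarrow> ?P h \<longrightarrow> ?P h' \<longrightarrow>
      (\<forall>x \<in> carrier (tensor_algebra ?AB C). h x = h' x)"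
    by (intro allI impI ballI) (rule un)
  have cong: "\<forall>h h'. (\<forall>x \<in> carrier (tensor_algebra ?AB C). h x = h' x) \<longrightarrow> ?P h \<longrightarrow> ?P h'"
    by (auto simp: pure_tensor_closed[OF A B] pure_tensor_closed[OF AB C])
  have "tensor_assoc A B C \<in> alg_hom (tensor_algebra ?AB C) ?T" "?P (tensor_assoc A B C)"
    using the_alg_hom_spec[where P = ?P, OF tensor_kalg[OF AB C] h0 cong uniq]
    unfolding tensor_assoc_def by blast+
  then show "tensor_assoc A B C \<in> alg_hom (tensor_algebra ?AB C) ?T"
    and "a \<in> carrier A \<Longrightarrow> b \<in> carrier B \<Longrightarrow> c \<in> carrier C \<Longrightarrow>
      tensor_assoc A B C (pure_tensor ?AB C (pure_tensor A B a b) c) =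
           pure_tensor A ?BC a (pure_tensor B C b c)" by auto
qed


subsection \<open>The comodule algebra\<close>

lemma ground_algebra_kalg: "kalg (ground_algebra :: ('k::field, 'k) module)"
proof (rule kalgI)
  show "ring (ground_algebra :: ('k, 'k) module)"
  proof (rule ringI)
    show "abelian_group (ground_algebra :: ('k, 'k) module)"
    proof (rule abelian_groupI)
      show "\<exists>y\<in>carrier ground_algebra. y \<oplus>\<^bsub>ground_algebra\<^esub> x = \<zero>\<^bsub>ground_algebra\<^esub>" for x :: 'k
        by (rule bexI[of _ "- x"]) (simp_all add: ground_algebra_def)
    qed (simp_all add: ground_algebra_def add_ac)
    show "monoid (ground_algebra :: ('k, 'k) module)"
      by (rule monoidI) (simp_all add: ground_algebra_def mult_ac)
  qed (simp_all add: ground_algebra_def algebra_simps)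
qed (simp_all add: ground_algebra_def algebra_simps)

context
  fixes q :: "'k::field" and m :: nat
  assumes q: "q \<noteq> 0"
begin

abbreviation (input) "H \<equiv> Oq_SL q m"
abbreviation (input) "HH \<equiv> tensor_algebra H H"

interpretation H: qalg H q by (rule qalg_Oq_SL[OF q])
interpretation HH: qalg HH q by (rule qalgI[OF tensor_kalg[OF H.kalg_axioms H.kalg_axioms] q])

text \<open>The matrix is a product of two commuting quantum matrices, and \<open>U\<close> has
  quantum determinant 1. With the quantum special linear group for \<open>B\<close> this gives the
  comultiplication, with the quantum matrix algebra both the coaction and the coinvariance of the
  maximal minors.\<close>

lemma U_left_right:
  fixes B :: "('k, 'b) module" and N :: "nat \<Rightarrow> nat \<Rightarrow> 'b"
  assumes B: "qalg B q" and N: "qmat q {1..m} J B N"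
  shows "qmat q {1..m} J (tensor_algebra H B)
      (\<lambda>i j. \<Oplus>\<^bsub>tensor_algebra H B\<^esub>l\<in>{1..m}. pure_tensor H B (U_gen q m i l) (N l j))"
    and "(\<And>k. k \<in> {1..m} \<Longrightarrow> c k \<in> J) \<Longrightarrow> (\<And>k l. k \<in> {1..m} \<Longrightarrow> l \<in> {1..m} \<Longrightarrow> k < l \<Longrightarrow> c k < c l) \<Longrightarrow>
      qalg.qminor (tensor_algebra H B) q m
        (\<lambda>i j. \<Oplus>\<^bsub>tensor_algebra H B\<^esub>l\<in>{1..m}. pure_tensor H B (U_gen q m i l) (N l j)) c =
      pure_tensor H B \<one>\<^bsub>H\<^esub> (qalg.qminor B q m N c)"
proof -
  interpret B: qalg B q by fact
  let ?T = "tensor_algebra H B"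
  note HB = H.kalg_axioms B.kalg_axioms
  interpret T: qalg ?T q by (rule qalgI[OF tensor_kalg[OF HB] q])
  let ?L = "\<lambda>i l. pure_tensor H B (U_gen q m i l) \<one>\<^bsub>B\<^esub>"
  let ?R = "\<lambda>l j. pure_tensor H B \<one>\<^bsub>H\<^esub> (N l j)"
  let ?W = "\<lambda>i j. \<Oplus>\<^bsub>?T\<^esub>l\<in>{1..m}. pure_tensor H B (U_gen q m i l) (N l j)"
  let ?W' = "\<lambda>i j. \<Oplus>\<^bsub>?T\<^esub>l\<in>{1..m}. ?L i l \<otimes>\<^bsub>?T\<^esub> ?R l j"
  note [simp] = qmat_closed[OF N] U_gen_closed[OF q]
  have L: "qmat q {1..m} {1..m} ?T ?L"
    by (rule qmat_alg_hom[OF U_gen_qmat[OF q] H.kalg_axioms tensor_inl[OF HB]])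
  have R: "qmat q {1..m} J ?T ?R"
    by (rule qmat_alg_hom[OF N B.kalg_axioms tensor_inr[OF HB]])
  have comm: "?L i a \<otimes>\<^bsub>?T\<^esub> ?R b j = ?R b j \<otimes>\<^bsub>?T\<^esub> ?L i a"
    if "i \<in> {1..m}" "a \<in> {1..m}" "b \<in> {1..m}" "j \<in> J" for i a b j
    using that by (simp add: pure_tensor_mult[OF HB])
  have W: "?W i j = ?W' i j" if "i \<in> {1..m}" "j \<in> J" for i j
    using that by (intro T.finsum_cong' refl)
      (auto simp: pure_tensor_mult[OF HB] intro!: pure_tensor_closed[OF HB] T.m_closed)
  have W': "qmat q {1..m} J ?T ?W'" by (rule T.qmat_product[OF L R _ comm]) auto
  show "qmat q {1..m} J ?T ?W" using W' W qmat_cong[of "{1..m}" J ?W ?W' q ?T] by blast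
  assume c: "\<And>k. k \<in> {1..m} \<Longrightarrow> c k \<in> J" "\<And>k l. k \<in> {1..m} \<Longrightarrow> l \<in> {1..m} \<Longrightarrow> k < l \<Longrightarrow> c k < c l"
  have "T.qminor m ?W c = T.qminor m ?W' c"
    by (rule T.qminor_cong) (use W c qmat_closed[OF W'] in auto)
  also have "\<dots> = T.qminor m ?L (\<lambda>k. k) \<otimes>\<^bsub>?T\<^esub> T.qminor m ?R c"
    by (rule T.qminor_mult[OF R c]) (use comm qmat_closed[OF L] in auto)
  also have "T.qminor m ?L (\<lambda>k. k) = pure_tensor H B (H.qminor m (U_gen q m) (\<lambda>k. k)) \<one>\<^bsub>B\<^esub>"
    by (rule qminor_alg_hom[symmetric, OF H.qalg_axioms T.qalg_axioms tensor_inl[OF HB]]) simp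
  also have "\<dots> = \<one>\<^bsub>?T\<^esub>" by (simp add: U_gen_qminor[OF q] pure_tensor_one[OF HB])
  also have "T.qminor m ?R c = pure_tensor H B \<one>\<^bsub>H\<^esub> (B.qminor m N c)"
    by (rule qminor_alg_hom[symmetric, OF B.qalg_axioms T.qalg_axioms tensor_inr[OF HB]]) (use c in simp)
  also have "\<one>\<^bsub>?T\<^esub> \<otimes>\<^bsub>?T\<^esub> pure_tensor H B \<one>\<^bsub>H\<^esub> (B.qminor m N c) = pure_tensor H B \<one>\<^bsub>H\<^esub> (B.qminor m N c)"
    using c by (intro T.l_one pure_tensor_closed[OF HB] B.qminor_closed) auto
  finally show "T.qminor m ?W c = pure_tensor H B \<one>\<^bsub>H\<^esub> (B.qminor m N c)" .
qed

lemma Oq_SL_hom_eqI: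
  assumes "h \<in> alg_hom H R" "h' \<in> alg_hom H R"
    and "\<And>i j. i \<in> {1..m} \<Longrightarrow> j \<in> {1..m} \<Longrightarrow> h (U_gen q m i j) = h' (U_gen q m i j)"
    and "x \<in> carrier H"
  shows "h x = h' x"
  by (rule alg_hom_eqI[OF H.kalg_axioms Oq_SL_generates[OF q] assms(1,2) _ assms(4)]) (use assms(3) in auto)

lemma SL_comult_works:
  "SL_comult q m \<in> alg_hom H HH"
  "i \<in> {1..m} \<Longrightarrow> j \<in> {1..m} \<Longrightarrow>
    SL_comult q m (U_gen q m i j) = (\<Oplus>\<^bsub>HH\<^esub>l\<in>{1..m}. pure_tensor H H (U_gen q m i l) (U_gen q m l j))"
proof -
  let ?W = "\<lambda>i j. \<Oplus>\<^bsub>HH\<^esub>l\<in>{1..m}. pure_tensor H H (U_gen q m i l) (U_gen q m l j)"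
  let ?P = "\<lambda>h. \<forall>i \<in> {1..m}. \<forall>j \<in> {1..m}. h (U_gen q m i j) = ?W i j"
  have "HH.qminor m ?W (\<lambda>k. k) = \<one>\<^bsub>HH\<^esub>"
    using U_left_right(2)[OF H.qalg_axioms U_gen_qmat[OF q], of "\<lambda>k. k"]
    by (simp add: U_gen_qminor[OF q] pure_tensor_one[OF H.kalg_axioms H.kalg_axioms])
  then obtain h0 where h0: "h0 \<in> alg_hom H HH"
    "\<And>i j. i \<in> {1..m} \<Longrightarrow> j \<in> {1..m} \<Longrightarrow> h0 (U_gen q m i j) = ?W i j"
    using Oq_SL_lift[OF q HH.qalg_axioms U_left_right(1)[OF H.qalg_axioms U_gen_qmat[OF q]]] by blast
  have "SL_comult q m \<in> alg_hom H HH \<and> ?P (SL_comult q m)"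
    unfolding SL_comult_def
  proof (rule the_alg_hom_spec[where P = ?P, OF H.kalg_axioms h0(1)])
    show "\<forall>h h'. h \<in> alg_hom H HH \<longrightarrow> h' \<in> alg_hom H HH \<longrightarrow> ?P h \<longrightarrow> ?P h' \<longrightarrow> (\<forall>x\<in>carrier H. h x = h' x)"
      by (intro allI impI ballI) (rule Oq_SL_hom_eqI, auto)
  qed (use h0(2) U_gen_closed[OF q] in auto)
  then show "SL_comult q m \<in> alg_hom H HH"
    "i \<in> {1..m} \<Longrightarrow> j \<in> {1..m} \<Longrightarrow> SL_comult q m (U_gen q m i j) = ?W i j" by auto
qed

lemma SL_counit_works:
  "SL_counit q m \<in> alg_hom H ground_algebra"
  "i \<in> {1..m} \<Longrightarrow> j \<in> {1..m} \<Longrightarrow> SL_counit q m (U_gen q m i j) = (if i = j then 1 else 0)"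
proof -
  interpret G: qalg "ground_algebra :: ('k, 'k) module" q by (rule qalgI[OF ground_algebra_kalg q])
  let ?W = "\<lambda>i j. if i = j then 1 else 0 :: 'k"
  let ?P = "\<lambda>h. \<forall>i \<in> {1..m}. \<forall>j \<in> {1..m}. h (U_gen q m i j) = ?W i j"
  have W: "qmat q {1..m} {1..m} ground_algebra ?W"
    by (rule G.qmatI) (auto simp: ground_algebra_def)
  have "G.qminor m ?W (\<lambda>k. k) = G.lprod (map (\<lambda>i. ?W i i) [1..<Suc m])"
    by (rule G.qminor_triangular) (auto simp: ground_algebra_def)
  also have "\<dots> = \<one>\<^bsub>ground_algebra\<^esub>"
  proof -
    have "G.lprod (map (\<lambda>i. 1) xs) = 1" for xs :: "nat list"
      by (induction xs) (auto simp: ground_algebra_def G.lprod_simps[unfolded ground_algebra_def, simplified])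
    then show ?thesis by (simp add: ground_algebra_def)
  qed
  finally obtain h0 where h0: "h0 \<in> alg_hom H ground_algebra"
    "\<And>i j. i \<in> {1..m} \<Longrightarrow> j \<in> {1..m} \<Longrightarrow> h0 (U_gen q m i j) = ?W i j"
    using Oq_SL_lift[OF q G.qalg_axioms W] by blast
  have "SL_counit q m \<in> alg_hom H ground_algebra \<and> ?P (SL_counit q m)"
    unfolding SL_counit_def
  proof (rule the_alg_hom_spec[where P = ?P, OF H.kalg_axioms h0(1)])
    show "\<forall>h h'. h \<in> alg_hom H ground_algebra \<longrightarrow> h' \<in> alg_hom H ground_algebra \<longrightarrow> ?P h \<longrightarrow> ?P h' \<longrightarrow>
      (\<forall>x\<in>carrier H. h x = h' x)"
      by (intro allI impI ballI) (rule Oq_SL_hom_eqI, auto)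
  qed (use h0(2) U_gen_closed[OF q] in auto)
  then show "SL_counit q m \<in> alg_hom H ground_algebra"
    "i \<in> {1..m} \<Longrightarrow> j \<in> {1..m} \<Longrightarrow> SL_counit q m (U_gen q m i j) = (if i = j then 1 else 0)" by auto
qed

context
  fixes n :: nat
begin

abbreviation (input) "A \<equiv> Oq_M q m n"
abbreviation (input) "HA \<equiv> tensor_algebra H A"

interpretation A: qalg A q by (rule qalg_Oq_M[OF q])
interpretation HA: qalg HA q by (rule qalgI[OF tensor_kalg[OF H.kalg_axioms A.kalg_axioms] q])

lemma SL_coaction_works:
  "SL_coaction q m n \<in> alg_hom A HA"
  "i \<in> {1..m} \<Longrightarrow> j \<in> {1..n} \<Longrightarrow>
    SL_coaction q m n (Z_gen q m n i j) = (\<Oplus>\<^bsub>HA\<^esub>l\<in>{1..m}. pure_tensor H A (U_gen q m i l) (Z_gen q m n l j))"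
proof -
  let ?W = "\<lambda>i j. \<Oplus>\<^bsub>HA\<^esub>l\<in>{1..m}. pure_tensor H A (U_gen q m i l) (Z_gen q m n l j)"
  let ?P = "\<lambda>h. \<forall>i \<in> {1..m}. \<forall>j \<in> {1..n}. h (Z_gen q m n i j) = ?W i j"
  obtain h0 where h0: "h0 \<in> alg_hom A HA"
    "\<And>i j. i \<in> {1..m} \<Longrightarrow> j \<in> {1..n} \<Longrightarrow> h0 (Z_gen q m n i j) = ?W i j"
    using Oq_M_lift[OF HA.qalg_axioms U_left_right(1)[OF A.qalg_axioms Z_gen_qmat[OF q]]] by blast
  have "SL_coaction q m n \<in> alg_hom A HA \<and> ?P (SL_coaction q m n)"
    unfolding SL_coaction_def
  proof (rule the_alg_hom_spec[where P = ?P, OF A.kalg_axioms h0(1)])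
    show "\<forall>h h'. h \<in> alg_hom A HA \<longrightarrow> h' \<in> alg_hom A HA \<longrightarrow> ?P h \<longrightarrow> ?P h' \<longrightarrow> (\<forall>x\<in>carrier A. h x = h' x)"
      by (intro allI impI ballI) (rule Oq_M_hom_eqI, auto)
    show "?P h0" using h0(2) by blast
    show "\<forall>h h'. (\<forall>x\<in>carrier A. h x = h' x) \<longrightarrow> ?P h \<longrightarrow> ?P h'"
    proof (intro allI impI ballI)
      fix h h' i j assume a: "\<forall>x\<in>carrier A. h x = h' x" "?P h" and ij: "i \<in> {1..m}" "j \<in> {1..n}"
      have "h (Z_gen q m n i j) = h' (Z_gen q m n i j)" by (rule bspec[OF a(1) Z_gen_closed[OF ij]])
      then show "h' (Z_gen q m n i j) = ?W i j" using a(2) ij by simp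
    qed
  qed
  then show "SL_coaction q m n \<in> alg_hom A HA"
    "i \<in> {1..m} \<Longrightarrow> j \<in> {1..n} \<Longrightarrow> SL_coaction q m n (Z_gen q m n i j) = ?W i j" by auto
qed

text \<open>Both sides of each axiom are algebra morphisms in \<open>x\<close>, so comparing them on
  generators suffices. There coassociativity is associativity of matrix multiplication.\<close>

theorem SL_comodule_algebra:
  "left_comodule_algebra H (SL_comult q m) (SL_counit q m) A (SL_coaction q m n)"
  unfolding left_comodule_algebra_def
proof (intro conjI ballI)
  let ?\<Delta> = "SL_comult q m" and ?\<epsilon> = "SL_counit q m" and ?\<gamma> = "SL_coaction q m n"
  let ?U = "U_gen q m" and ?Z = "Z_gen q m n"
  note kH = H.kalg_axioms and kA = A.kalg_axioms and kHH = HH.kalg_axioms and kHA = HA.kalg_axioms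
  note kG = ground_algebra_kalg[where 'k = 'k]
  interpret HHA: kalg "tensor_algebra HH A" by (rule tensor_kalg[OF kHH kA])
  interpret HHA': kalg "tensor_algebra H HA" by (rule tensor_kalg[OF kH kHA])
  interpret GA: kalg "tensor_algebra (ground_algebra :: ('k, 'k) module) A" by (rule tensor_kalg[OF kG kA])
  note [simp] = U_gen_closed[OF q] Z_gen_closed pure_tensor_closed[OF kH kA] pure_tensor_closed[OF kH kH]
    pure_tensor_closed[OF kHH kA] pure_tensor_closed[OF kH kHA]
  show \<gamma>: "?\<gamma> \<in> alg_hom A HA" by (rule SL_coaction_works)
  note \<Delta>i = tensor_hom_works[OF kH kA kHH kA SL_comult_works(1) alg_hom_id]
  note i\<gamma> = tensor_hom_works[OF kH kA kH kHA alg_hom_id \<gamma>]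
  note as = tensor_assoc_works[OF kH kH kA]
  note \<epsilon>i = tensor_hom_works[OF kH kA kG kA SL_counit_works(1) alg_hom_id]
  show "tensor_assoc H H A (tensor_hom H A HH A ?\<Delta> id (?\<gamma> x)) = tensor_hom H A H HA id ?\<gamma> (?\<gamma> x)"
    if x: "x \<in> carrier A" for x
  proof (rule Oq_M_hom_eqI[OF _ _ _ x])
    show "(\<lambda>x. tensor_assoc H H A (tensor_hom H A HH A ?\<Delta> id (?\<gamma> x))) \<in> alg_hom A (tensor_algebra H HA)"
      by (rule alg_hom_comp[OF alg_hom_comp[OF \<gamma> \<Delta>i(1)] as(1)])
    show "(\<lambda>x. tensor_hom H A H HA id ?\<gamma> (?\<gamma> x)) \<in> alg_hom A (tensor_algebra H HA)"
      by (rule alg_hom_comp[OF \<gamma> i\<gamma>(1)])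
    fix i j assume ij: "i \<in> {1..m}" "j \<in> {1..n}"
    have "tensor_hom H A HH A ?\<Delta> id (?\<gamma> (?Z i j)) =
      (\<Oplus>\<^bsub>tensor_algebra HH A\<^esub>l\<in>{1..m}. tensor_hom H A HH A ?\<Delta> id (pure_tensor H A (?U i l) (?Z l j)))"
      unfolding SL_coaction_works(2)[OF ij]
      using ij by (intro alg_hom_finsum[OF \<Delta>i(1) kHA HHA.kalg_axioms]) auto
    also have "\<dots> = (\<Oplus>\<^bsub>tensor_algebra HH A\<^esub>l\<in>{1..m}. \<Oplus>\<^bsub>tensor_algebra HH A\<^esub>k\<in>{1..m}.
        pure_tensor HH A (pure_tensor H H (?U i k) (?U k l)) (?Z l j))"
    proof (intro HHA.finsum_cong' refl)
      fix l assume l: "l \<in> {1..m}"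
      have "tensor_hom H A HH A ?\<Delta> id (pure_tensor H A (?U i l) (?Z l j)) =
        pure_tensor HH A (\<Oplus>\<^bsub>HH\<^esub>k\<in>{1..m}. pure_tensor H H (?U i k) (?U k l)) (?Z l j)"
        using ij l by (simp add: \<Delta>i(2) SL_comult_works(2))
      also have "\<dots> = (\<Oplus>\<^bsub>tensor_algebra HH A\<^esub>k\<in>{1..m}.
        pure_tensor HH A (pure_tensor H H (?U i k) (?U k l)) (?Z l j))"
        using ij l by (intro pure_tensor_finsum_l[OF kHH kA]) auto
      finally show "tensor_hom H A HH A ?\<Delta> id (pure_tensor H A (?U i l) (?Z l j)) =
        (\<Oplus>\<^bsub>tensor_algebra HH A\<^esub>k\<in>{1..m}. pure_tensor HH A (pure_tensor H H (?U i k) (?U k l)) (?Z l j))" .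
    qed (use ij in \<open>auto intro!: HHA.finsum_closed\<close>)
    finally have "tensor_assoc H H A (tensor_hom H A HH A ?\<Delta> id (?\<gamma> (?Z i j))) =
      tensor_assoc H H A (\<Oplus>\<^bsub>tensor_algebra HH A\<^esub>l\<in>{1..m}. \<Oplus>\<^bsub>tensor_algebra HH A\<^esub>k\<in>{1..m}.
        pure_tensor HH A (pure_tensor H H (?U i k) (?U k l)) (?Z l j))" by simp
    also have "\<dots> = (\<Oplus>\<^bsub>tensor_algebra H HA\<^esub>l\<in>{1..m}. tensor_assoc H H A (\<Oplus>\<^bsub>tensor_algebra HH A\<^esub>k\<in>{1..m}.
        pure_tensor HH A (pure_tensor H H (?U i k) (?U k l)) (?Z l j)))"
      using ij by (intro alg_hom_finsum[OF as(1) HHA.kalg_axioms HHA'.kalg_axioms]) (auto intro!: HHA.finsum_closed)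
    also have "\<dots> = (\<Oplus>\<^bsub>tensor_algebra H HA\<^esub>l\<in>{1..m}. \<Oplus>\<^bsub>tensor_algebra H HA\<^esub>k\<in>{1..m}.
        pure_tensor H HA (?U i k) (pure_tensor H A (?U k l) (?Z l j)))"
    proof (intro HHA'.finsum_cong' refl)
      fix l assume l: "l \<in> {1..m}"
      have "tensor_assoc H H A (\<Oplus>\<^bsub>tensor_algebra HH A\<^esub>k\<in>{1..m}.
          pure_tensor HH A (pure_tensor H H (?U i k) (?U k l)) (?Z l j)) =
        (\<Oplus>\<^bsub>tensor_algebra H HA\<^esub>k\<in>{1..m}. tensor_assoc H H A
          (pure_tensor HH A (pure_tensor H H (?U i k) (?U k l)) (?Z l j)))"
        using ij l by (intro alg_hom_finsum[OF as(1) HHA.kalg_axioms HHA'.kalg_axioms]) auto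
      also have "\<dots> = (\<Oplus>\<^bsub>tensor_algebra H HA\<^esub>k\<in>{1..m}.
        pure_tensor H HA (?U i k) (pure_tensor H A (?U k l) (?Z l j)))"
        using ij l by (intro HHA'.finsum_cong' refl) (auto simp: as(2))
      finally show "tensor_assoc H H A (\<Oplus>\<^bsub>tensor_algebra HH A\<^esub>k\<in>{1..m}.
          pure_tensor HH A (pure_tensor H H (?U i k) (?U k l)) (?Z l j)) =
        (\<Oplus>\<^bsub>tensor_algebra H HA\<^esub>k\<in>{1..m}. pure_tensor H HA (?U i k) (pure_tensor H A (?U k l) (?Z l j)))" .
    qed (use ij in \<open>auto intro!: HHA'.finsum_closed\<close>)
    \<comment> \<open>The two iterated coactions sum over the same pairs of indices in opposite
      orders.\<close>
    also have "\<dots> = (\<Oplus>\<^bsub>tensor_algebra H HA\<^esub>k\<in>{1..m}. \<Oplus>\<^bsub>tensor_algebra H HA\<^esub>l\<in>{1..m}.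
        pure_tensor H HA (?U i k) (pure_tensor H A (?U k l) (?Z l j)))"
      using ij by (intro HHA'.finsum_swap) auto
    also have "\<dots> = (\<Oplus>\<^bsub>tensor_algebra H HA\<^esub>k\<in>{1..m}. tensor_hom H A H HA id ?\<gamma> (pure_tensor H A (?U i k) (?Z k j)))"
    proof (intro HHA'.finsum_cong' refl)
      fix k assume k: "k \<in> {1..m}"
      have "tensor_hom H A H HA id ?\<gamma> (pure_tensor H A (?U i k) (?Z k j)) =
        pure_tensor H HA (?U i k) (\<Oplus>\<^bsub>HA\<^esub>l\<in>{1..m}. pure_tensor H A (?U k l) (?Z l j))"
        using ij k by (simp add: i\<gamma>(2) SL_coaction_works(2))
      also have "\<dots> = (\<Oplus>\<^bsub>tensor_algebra H HA\<^esub>l\<in>{1..m}.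
        pure_tensor H HA (?U i k) (pure_tensor H A (?U k l) (?Z l j)))"
        using ij k by (intro pure_tensor_finsum_r[OF kH kHA]) auto
      finally show "(\<Oplus>\<^bsub>tensor_algebra H HA\<^esub>l\<in>{1..m}.
          pure_tensor H HA (?U i k) (pure_tensor H A (?U k l) (?Z l j))) =
        tensor_hom H A H HA id ?\<gamma> (pure_tensor H A (?U i k) (?Z k j))" by simp
    qed (use ij in \<open>auto intro!: alg_homD(1)[OF i\<gamma>(1)]\<close>)
    also have "\<dots> = tensor_hom H A H HA id ?\<gamma> (?\<gamma> (?Z i j))"
      unfolding SL_coaction_works(2)[OF ij]
      using ij by (intro alg_hom_finsum[symmetric, OF i\<gamma>(1) kHA HHA'.kalg_axioms]) auto
    finally show "tensor_assoc H H A (tensor_hom H A HH A ?\<Delta> id (?\<gamma> (?Z i j))) =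
      tensor_hom H A H HA id ?\<gamma> (?\<gamma> (?Z i j))" .
  qed
  show "tensor_hom H A ground_algebra A ?\<epsilon> id (?\<gamma> x) = pure_tensor ground_algebra A 1 x"
    if x: "x \<in> carrier A" for x
  proof (rule Oq_M_hom_eqI[OF _ _ _ x])
    let ?GA = "tensor_algebra (ground_algebra :: ('k, 'k) module) A"
    have g1: "\<one>\<^bsub>ground_algebra\<^esub> = (1::'k)" by (simp add: ground_algebra_def)
    have gc: "y \<in> carrier ground_algebra" for y :: 'k by (simp add: ground_algebra_def)
    show "(\<lambda>x. tensor_hom H A ground_algebra A ?\<epsilon> id (?\<gamma> x)) \<in> alg_hom A ?GA"
      by (rule alg_hom_comp[OF \<gamma> \<epsilon>i(1)])
    show inr: "(\<lambda>x. pure_tensor ground_algebra A 1 x) \<in> alg_hom A ?GA"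
      using tensor_inr[OF kG kA] unfolding g1 .
    fix i j assume ij: "i \<in> {1..m}" "j \<in> {1..n}"
    have "tensor_hom H A ground_algebra A ?\<epsilon> id (?\<gamma> (?Z i j)) =
      (\<Oplus>\<^bsub>?GA\<^esub>l\<in>{1..m}. tensor_hom H A ground_algebra A ?\<epsilon> id (pure_tensor H A (?U i l) (?Z l j)))"
      unfolding SL_coaction_works(2)[OF ij]
      using ij by (intro alg_hom_finsum[OF \<epsilon>i(1) kHA GA.kalg_axioms]) auto
    also have "\<dots> = (\<Oplus>\<^bsub>?GA\<^esub>l\<in>{1..m}. if i = l then pure_tensor ground_algebra A 1 (?Z l j) else \<zero>\<^bsub>?GA\<^esub>)"
    proof (intro GA.finsum_cong' refl)
      fix l assume l: "l \<in> {1..m}"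
      \<comment> \<open>A tensor with first component 0 vanishes; this 0 is written as a scalar
        multiple of 1 in order to pull it out.\<close>
      have "pure_tensor ground_algebra A (0 \<odot>\<^bsub>ground_algebra\<^esub> (1::'k)) (?Z l j) = \<zero>\<^bsub>?GA\<^esub>"
        using l ij gc by (subst pure_tensor_smult_l[OF kG kA])
          (auto intro!: GA.smult_l_null pure_tensor_closed[OF kG kA])
      then have "pure_tensor ground_algebra A (0::'k) (?Z l j) = \<zero>\<^bsub>?GA\<^esub>" by (simp add: ground_algebra_def)
      then show "tensor_hom H A ground_algebra A ?\<epsilon> id (pure_tensor H A (?U i l) (?Z l j)) =
        (if i = l then pure_tensor ground_algebra A 1 (?Z l j) else \<zero>\<^bsub>?GA\<^esub>)"
        using ij l by (simp add: \<epsilon>i(2) SL_counit_works(2))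
    qed (use ij gc in \<open>auto intro!: pure_tensor_closed[OF kG kA]\<close>)
    also have "\<dots> = pure_tensor ground_algebra A 1 (?Z i j)"
      using ij gc by (intro GA.finsum_singleton) (auto intro!: pure_tensor_closed[OF kG kA])
    finally show "tensor_hom H A ground_algebra A ?\<epsilon> id (?\<gamma> (?Z i j)) = pure_tensor ground_algebra A 1 (?Z i j)" .
  qed
qed

lemma max_qminor_cols:
  assumes J: "J \<subseteq> {1..n}" "card J = m"
  defines "c \<equiv> (\<lambda>k. sorted_list_of_set J ! (k - 1))"
  shows "k \<in> {1..m} \<Longrightarrow> c k \<in> J"
    and "k \<in> {1..m} \<Longrightarrow> l \<in> {1..m} \<Longrightarrow> k < l \<Longrightarrow> c k < c l"
proof -
  have fin: "finite J" using J(1) finite_subset by blast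
  have len: "length (sorted_list_of_set J) = m" using fin J by simp
  have set: "set (sorted_list_of_set J) = J" using fin by simp
  show "k \<in> {1..m} \<Longrightarrow> c k \<in> J"
  proof -
    assume "k \<in> {1..m}"
    then have "k - 1 < length (sorted_list_of_set J)" unfolding len by auto
    from nth_mem[OF this] show ?thesis unfolding c_def set .
  qed
  have "sorted_wrt (<) (sorted_list_of_set J)" by simp
  then show "k \<in> {1..m} \<Longrightarrow> l \<in> {1..m} \<Longrightarrow> k < l \<Longrightarrow> c k < c l"
    unfolding c_def using len by (intro sorted_wrt_nth_less[of "(<)"]) auto
qed

lemma max_qminor_qminor:
  "max_qminor q m n J = A.qminor m (Z_gen q m n) (\<lambda>k. sorted_list_of_set J ! (k - 1))"
  by (simp add: max_qminor_def qminor_cols_qminor[OF q])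

lemma max_qminor_closed: "J \<subseteq> {1..n} \<Longrightarrow> card J = m \<Longrightarrow> max_qminor q m n J \<in> carrier A"
  unfolding max_qminor_qminor using max_qminor_cols(1) by (intro A.qminor_closed Z_gen_closed) blast+

lemma max_qminor_coinvariant:
  assumes J: "J \<subseteq> {1..n}" "card J = m"
  shows "SL_coaction q m n (max_qminor q m n J) = pure_tensor H A \<one>\<^bsub>H\<^esub> (max_qminor q m n J)"
proof -
  let ?c = "\<lambda>k. sorted_list_of_set J ! (k - 1)"
  let ?W = "\<lambda>i j. \<Oplus>\<^bsub>HA\<^esub>l\<in>{1..m}. pure_tensor H A (U_gen q m i l) (Z_gen q m n l j)"
  have c: "?c k \<in> {1..n}" if "k \<in> {1..m}" for k using max_qminor_cols(1)[OF J that] J(1) by blast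
  note U = U_left_right[OF A.qalg_axioms Z_gen_qmat[OF q]]
  have "SL_coaction q m n (max_qminor q m n J) =
    HA.qminor m (\<lambda>i j. SL_coaction q m n (Z_gen q m n i j)) ?c"
    unfolding max_qminor_qminor
    by (rule qminor_alg_hom[OF A.qalg_axioms HA.qalg_axioms SL_coaction_works(1)]) (rule Z_gen_closed, use c in auto)
  also have "\<dots> = HA.qminor m ?W ?c"
    by (rule HA.qminor_cong) (use c SL_coaction_works(2) qmat_closed[OF U(1)] in auto)
  also have "\<dots> = pure_tensor H A \<one>\<^bsub>H\<^esub> (max_qminor q m n J)"
    unfolding max_qminor_qminor by (rule U(2)) (use c max_qminor_cols(2)[OF J] in auto)
  finally show ?thesis .
qed

text \<open>Equaliser of two algebra morphisms, the coaction and \<open>tensor_inr\<close>.\<close>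

lemma coinvariants_subalgebra: "subalgebra A (coinvariants H A (SL_coaction q m n))"
proof (rule A.subalgebraI)
  note \<gamma> = alg_homD[OF SL_coaction_works(1)]
  note \<iota> = alg_homD[OF tensor_inr[OF H.kalg_axioms A.kalg_axioms]]
  have iff: "x \<in> coinvariants H A (SL_coaction q m n) \<longleftrightarrow>
    x \<in> carrier A \<and> SL_coaction q m n x = pure_tensor H A \<one>\<^bsub>H\<^esub> x" for x
    by (simp add: coinvariants_def)
  show "coinvariants H A (SL_coaction q m n) \<subseteq> carrier A" by (auto simp: coinvariants_def)
  show "\<one>\<^bsub>A\<^esub> \<in> coinvariants H A (SL_coaction q m n)" by (simp add: iff \<gamma>(4) \<iota>(4))
  fix x y c
  assume "x \<in> coinvariants H A (SL_coaction q m n)"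
  then have x: "x \<in> carrier A" "SL_coaction q m n x = pure_tensor H A \<one>\<^bsub>H\<^esub> x" by (simp_all add: iff)
  show "c \<odot>\<^bsub>A\<^esub> x \<in> coinvariants H A (SL_coaction q m n)"
    unfolding iff using x by (simp only: \<gamma>(5) \<iota>(5) A.smult_closed simp_thms)
  assume "y \<in> coinvariants H A (SL_coaction q m n)"
  then have y: "y \<in> carrier A" "SL_coaction q m n y = pure_tensor H A \<one>\<^bsub>H\<^esub> y" by (simp_all add: iff)
  show "x \<otimes>\<^bsub>A\<^esub> y \<in> coinvariants H A (SL_coaction q m n)"
    unfolding iff using x y by (simp only: \<gamma>(2) \<iota>(2) A.m_closed simp_thms)
  show "x \<oplus>\<^bsub>A\<^esub> y \<in> coinvariants H A (SL_coaction q m n)"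
    unfolding iff using x y by (simp only: \<gamma>(3) \<iota>(3) A.a_closed simp_thms)
qed

lemma generated_subalgebra_minimal:
  "subalgebra B S \<Longrightarrow> X \<subseteq> S \<Longrightarrow> generated_subalgebra B X \<subseteq> S"
  unfolding generated_subalgebra_def subalgebra_def by (rule hull_minimal)

theorem quantum_grassmannian_subset:
  "quantum_grassmannian q m n \<subseteq> coinvariants H A (SL_coaction q m n)"
proof -
  have "{max_qminor q m n J | J. J \<subseteq> {1..n} \<and> card J = m} \<subseteq> coinvariants H A (SL_coaction q m n)"
  proof clarify
    fix J assume J: "J \<subseteq> {1..n}" "m = card J"
    then show "max_qminor q (card J) n J \<in> coinvariants (Oq_SL q (card J)) (Oq_M q (card J) n) (SL_coaction q (card J) n)"
      using max_qminor_closed[OF J(1) J(2)[symmetric]] max_qminor_coinvariant[OF J(1) J(2)[symmetric]]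
      by (simp add: coinvariants_def)
  qed
  then show ?thesis unfolding quantum_grassmannian_def
    by (rule generated_subalgebra_minimal[OF coinvariants_subalgebra])
qed

end

end


section \<open>Laurent polynomials in q-commuting variables, leading exponents, and lattice
  paths\<close>

section \<open>A quantum torus\<close>

text \<open>
  A variable \<open>(p, t, f)\<close> sits at position \<open>p\<close> and time \<open>t\<close>; variables of different times
  commute.  At each time the variables \<open>(p, t, 1)\<close> and \<open>(p, t, 0)\<close> are the diagonal and
  superdiagonal entries of a bidiagonal quantum matrix.
\<close>

type_synonym tvar = "nat \<times> nat \<times> nat"
type_synonym texp = "tvar \<Rightarrow>\<^sub>0 int"

text \<open>Only one order of each noncommuting pair gets a nonzero value. Thus x y = q y x holds
  without a square root of \<open>q\<close>, which an antisymmetric form would require. The two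
  cases are the row relation and the column relation of a bidiagonal matrix.\<close>

definition vform :: "tvar \<Rightarrow> tvar \<Rightarrow> int" where
  "vform x y = (case x of (p, t, f) \<Rightarrow> case y of (p', t', f') \<Rightarrow>
     if t = t' \<and> (p' = p \<and> f = 1 \<and> f' = 0 \<or> p' = Suc p \<and> f = 0 \<and> f' = 1) then 1 else 0)"

definition eform :: "texp \<Rightarrow> texp \<Rightarrow> int" where
  "eform u v = (\<Sum>x\<in>keys u. \<Sum>y\<in>keys v. lookup u x * lookup v y * vform x y)"

lemma eform_superset:
  assumes "finite X" "finite Y" "keys u \<subseteq> X" "keys v \<subseteq> Y"
  shows "eform u v = (\<Sum>x\<in>X. \<Sum>y\<in>Y. lookup u x * lookup v y * vform x y)"
proof -
  have "(\<Sum>y\<in>keys v. lookup u x * lookup v y * vform x y) = (\<Sum>y\<in>Y. lookup u x * lookup v y * vform x y)" for x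
    using assms by (intro sum.mono_neutral_left) (auto simp: in_keys_iff)
  moreover have "(\<Sum>x\<in>keys u. \<Sum>y\<in>Y. lookup u x * lookup v y * vform x y) =
      (\<Sum>x\<in>X. \<Sum>y\<in>Y. lookup u x * lookup v y * vform x y)"
    using assms by (intro sum.mono_neutral_left) (auto simp: in_keys_iff)
  ultimately show ?thesis by (simp add: eform_def)
qed

lemma eform_add_left: "eform (u + u') v = eform u v + eform u' v"
proof -
  have "keys (u + u') \<subseteq> keys u \<union> keys u'" by (rule keys_add)
  then show ?thesis
    by (subst (1 2 3) eform_superset[of "keys u \<union> keys u'" "keys v"])
      (auto simp: lookup_add distrib_right sum.distrib)
qed

lemma eform_add_right: "eform u (v + v') = eform u v + eform u v'"
proof -
  have "keys (v + v') \<subseteq> keys v \<union> keys v'" by (rule keys_add)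
  then show ?thesis
    by (subst (1 2 3) eform_superset[of "keys u" "keys v \<union> keys v'"])
      (auto simp: lookup_add distrib_right distrib_left sum.distrib)
qed

lemma eform_zero [simp]: "eform 0 v = 0" "eform u 0 = 0"
  by (simp_all add: eform_def)

lemma eform_single:
  "eform (single x a) (single y b) = a * b * vform x y"
  by (subst eform_superset[of "{x}" "{y}"]) auto

definition exp_monoid :: "texp monoid" where
  "exp_monoid = \<lparr>carrier = UNIV, monoid.mult = (+), one = 0\<rparr>"

definition torus :: "'k::field \<Rightarrow> ('k, texp \<Rightarrow>\<^sub>0 'k) module" where
  "torus q = twisted_algebra exp_monoid (\<lambda>u v. q powi (eform u v))"

lemma exp_monoid_simps [simp]:
  "carrier exp_monoid = UNIV" "monoid.mult exp_monoid = (+)" "one exp_monoid = 0"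
  by (simp_all add: exp_monoid_def)

lemma torus_simps [simp]:
  "carrier (torus q) = UNIV" "one (torus q) = single 0 1" "zero (torus q) = 0"
  "add (torus q) = (+)" "smult (torus q) = scale_pm"
  by (simp_all add: torus_def twisted_algebra_simps)

lemma torus_mult_single:
  "single u a \<otimes>\<^bsub>torus q\<^esub> single v b =
    single (u + v) (a * b * q powi (eform u v))"
  by (simp add: torus_def twisted_mult_single)

lemma torus_kalg:
  assumes "q \<noteq> 0" shows "kalg (torus q)"
  unfolding torus_def
proof (rule twisted_algebra_kalg)
  show "monoid exp_monoid" by (rule monoidI) (auto simp: add_ac)
qed (use assms in \<open>auto simp: eform_add_left eform_add_right power_int_add\<close>)

lemma torus_qalg: "q \<noteq> 0 \<Longrightarrow> qalg (torus q) q"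
  by (rule qalgI[OF torus_kalg])

lemma lookup_torus_mult:
  "lookup (f \<otimes>\<^bsub>torus q\<^esub> g) k =
    (\<Sum>x\<in>keys f. \<Sum>y\<in>keys g. if x + y = k then lookup f x * lookup g y * q powi (eform x y) else 0)"
  unfolding torus_def twisted_algebra_def
  by (simp add: lookup_sum lookup_single when_def)

lemma lookup_single_mult:
  assumes "q \<noteq> 0"
  shows "lookup (single u c \<otimes>\<^bsub>torus q\<^esub> f) (u + v) = c * lookup f v * q powi (eform u v)"
proof (cases "c = 0")
  case False
  have "lookup (single u c \<otimes>\<^bsub>torus q\<^esub> f) (u + v) =
    (\<Sum>y\<in>keys f. if y = v then c * lookup f y * q powi (eform u y) else 0)"
    unfolding lookup_torus_mult using False by simp
  also have "\<dots> = c * lookup f v * q powi (eform u v)"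
    by (simp add: sum.delta in_keys_iff)
  finally show ?thesis .
qed (simp add: torus_def)

lemma keys_torus_mult:
  assumes "k \<in> keys (f \<otimes>\<^bsub>torus q\<^esub> g)"
  obtains x y where "x \<in> keys f" "y \<in> keys g" "k = x + y"
  using assms unfolding torus_def by (elim keys_twisted_mult) auto

lemma torus_lr_distr:
  "(f + f') \<otimes>\<^bsub>torus q\<^esub> g = f \<otimes>\<^bsub>torus q\<^esub> g + f' \<otimes>\<^bsub>torus q\<^esub> g"
  "g \<otimes>\<^bsub>torus q\<^esub> (f + f') = g \<otimes>\<^bsub>torus q\<^esub> f + g \<otimes>\<^bsub>torus q\<^esub> f'"
  "scale_pm c f \<otimes>\<^bsub>torus q\<^esub> g = scale_pm c (f \<otimes>\<^bsub>torus q\<^esub> g)"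
  "f \<otimes>\<^bsub>torus q\<^esub> scale_pm c g = scale_pm c (f \<otimes>\<^bsub>torus q\<^esub> g)"
  "0 \<otimes>\<^bsub>torus q\<^esub> g = 0" "f \<otimes>\<^bsub>torus q\<^esub> 0 = 0"
  by (simp_all add: torus_def twisted_mult_add_left twisted_mult_add_right twisted_mult_scale)

lemma torus_finsum: "q \<noteq> 0 \<Longrightarrow> finsum (torus q) f S = sum f S"
  unfolding torus_def by (rule finsum_twisted[OF torus_kalg[unfolded torus_def]]) auto

lemma torus_commute_keys:
  assumes "\<And>u v. u \<in> keys f \<Longrightarrow> v \<in> keys g \<Longrightarrow> eform u v = eform v u"
  shows "f \<otimes>\<^bsub>torus q\<^esub> g = g \<otimes>\<^bsub>torus q\<^esub> f"
proof -
  have "f \<otimes>\<^bsub>torus q\<^esub> g = (\<Sum>x\<in>keys f. \<Sum>y\<in>keys g. single (x + y) (lookup f x * lookup g y * q powi (eform x y)))"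
    by (simp add: torus_def twisted_algebra_def)
  also have "\<dots> = (\<Sum>x\<in>keys f. \<Sum>y\<in>keys g. single (y + x) (lookup g y * lookup f x * q powi (eform y x)))"
    by (intro sum.cong refl) (subst assms, assumption, assumption, simp only: ac_simps)
  also have "\<dots> = (\<Sum>y\<in>keys g. \<Sum>x\<in>keys f. single (y + x) (lookup g y * lookup f x * q powi (eform y x)))"
    by (rule sum.swap)
  also have "\<dots> = g \<otimes>\<^bsub>torus q\<^esub> f" by (simp add: torus_def twisted_algebra_def)
  finally show ?thesis .
qed


subsection \<open>Leading exponents\<close>

text \<open>Exponents are compared at the smallest variable where they differ, and variables
  lexicographically: by position, then time, then the third component. So small variables outrank
  large ones, and position 0 outranks all path variables.\<close>

definition lead :: "(texp \<Rightarrow>\<^sub>0 'k::zero) \<Rightarrow> texp \<Rightarrow> bool" where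
  "lead f u \<longleftrightarrow> u \<in> keys f \<and> (\<forall>v\<in>keys f. v \<le> u)"

lemma lead_exists: "f \<noteq> 0 \<Longrightarrow> \<exists>u. lead f u"
  unfolding lead_def
  by (intro exI[of _ "Max (keys f)"] conjI ballI Max_in Max_ge) (auto simp: keys_eq_empty)

lemma lead_unique: "lead f u \<Longrightarrow> lead f v \<Longrightarrow> u = v"
  by (auto simp: lead_def intro: antisym)

lemma lead_nonzero: "lead f u \<Longrightarrow> f \<noteq> 0"
  by (auto simp: lead_def)

lemma lead_single: "c \<noteq> 0 \<Longrightarrow> lead (single u c) u"
  by (simp add: lead_def)

lemma lead_scale: "lead f u \<Longrightarrow> c \<noteq> 0 \<Longrightarrow> lead (scale_pm c f) u" for c :: "'k::field"
  by (auto simp: lead_def in_keys_iff)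

lemma lead_add:
  assumes "lead f u" "\<And>v. v \<in> keys g \<Longrightarrow> v < u"
  shows "lead (f + g) u"
proof -
  have "lookup g u = 0" using assms(2)[of u] by (auto simp: in_keys_iff)
  then have "u \<in> keys (f + g)" using assms(1) by (simp add: lead_def in_keys_iff lookup_add)
  moreover have "v \<le> u" if "v \<in> keys (f + g)" for v
  proof -
    have "v \<in> keys f \<or> v \<in> keys g" using that keys_add[of f g] by blast
    then show ?thesis using assms(1) assms(2)[of v] by (auto simp: lead_def)
  qed
  ultimately show ?thesis by (simp add: lead_def)
qed

text \<open>The order on exponents is invariant under translation, so the sum of the leading
  exponents arises in one way only. Its coefficient is a product of nonzero scalars and a power of
  \<open>q\<close>.\<close>

lemma lead_mult:
  assumes q: "(q::'k::field) \<noteq> 0" and f: "lead f u" and g: "lead g v"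
  shows "lead (f \<otimes>\<^bsub>torus q\<^esub> g) (u + v)"
proof -
  have le: "x \<le> u" "y \<le> v" if "x \<in> keys f" "y \<in> keys g" for x y
    using f g that by (auto simp: lead_def)
  have eq: "x + y = u + v \<longleftrightarrow> x = u \<and> y = v" if "x \<in> keys f" "y \<in> keys g" for x y
  proof
    assume e: "x + y = u + v"
    have "\<not> x < u"
    proof
      assume "x < u"
      then have "x + y < u + v" using le(2)[OF that] by (rule add_less_le_mono)
      then show False using e by simp
    qed
    then have "x = u" using le(1)[OF that] by (simp add: order.antisym linorder_not_less)
    then show "x = u \<and> y = v" using e by simp
  qed simp
  have "lookup (f \<otimes>\<^bsub>torus q\<^esub> g) (u + v) =
    (\<Sum>x\<in>keys f. \<Sum>y\<in>keys g. if x = u \<and> y = v then lookup f x * lookup g y * q powi (eform x y) else 0)"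
    unfolding lookup_torus_mult by (intro sum.cong refl if_cong) (use eq in auto)
  also have "\<dots> = (\<Sum>x\<in>keys f. if x = u then (\<Sum>y\<in>keys g. if y = v then lookup f x * lookup g y * q powi (eform x y) else 0) else 0)"
    by (intro sum.cong) auto
  also have "\<dots> = lookup f u * lookup g v * q powi (eform u v)"
    using f g by (simp add: sum.delta lead_def)
  finally have "u + v \<in> keys (f \<otimes>\<^bsub>torus q\<^esub> g)"
    using f g q by (simp add: in_keys_iff lead_def)
  then show ?thesis unfolding lead_def using le by (auto elim!: keys_torus_mult intro: add_mono)
qed

lemma torus_no_zero_divisors:
  assumes "q \<noteq> 0" "f \<otimes>\<^bsub>torus q\<^esub> g = 0" shows "f = 0 \<or> g = 0"
  using lead_exists[of f] lead_exists[of g] lead_mult[OF assms(1)] assms(2) lead_nonzero by metis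

lemma torus_cancel:
  assumes "q \<noteq> 0" "h \<noteq> 0" "h \<otimes>\<^bsub>torus q\<^esub> f = h \<otimes>\<^bsub>torus q\<^esub> g" shows "f = g"
proof -
  have "h \<otimes>\<^bsub>torus q\<^esub> (f + scale_pm (- 1) g) = 0"
    unfolding torus_lr_distr using assms(3) by simp
  then have "f + scale_pm (- 1) g = 0" using torus_no_zero_divisors[OF assms(1)] assms(2) by blast
  then show ?thesis by simp
qed

text \<open>Distinct leading exponents cannot cancel each other, so a nonzero combination is led by
  the largest one among its terms.\<close>

lemma lead_span:
  assumes g: "\<And>e. e \<in> X \<Longrightarrow> lead (g e) (V e)" and V: "inj_on V X"
    and x: "x \<in> pm.span (g ` X)" "x \<noteq> (0 :: texp \<Rightarrow>\<^sub>0 'k::field)"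
  shows "\<exists>e\<in>X. lead x (V e)"
proof -
  obtain S c where S: "finite S" "S \<subseteq> g ` X" "x = (\<Sum>s\<in>S. scale_pm (c s) s)"
    using x(1) unfolding pm.span_explicit by auto
  \<comment> \<open>Terms with coefficient 0 are dropped, so that the maximum below is attained by a
    term that is really there.\<close>
  let ?S = "{s \<in> S. c s \<noteq> 0}"
  have x': "x = (\<Sum>s\<in>?S. scale_pm (c s) s)"
    unfolding S(3) using S(1) by (intro sum.mono_neutral_right) auto
  have ne: "?S \<noteq> {}"
  proof
    assume e: "?S = {}"
    have "x = 0" unfolding x' e by simp
    then show False using x(2) by blast
  qed
  have "\<forall>s\<in>?S. \<exists>d. d \<in> X \<and> s = g d" using S(2) by auto
  from bchoice[OF this] obtain e where "\<forall>s\<in>?S. e s \<in> X \<and> s = g (e s)" ..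
  then have e: "e s \<in> X" "s = g (e s)" if "s \<in> ?S" for s using that by blast+
  let ?M = "Max ((\<lambda>s. V (e s)) ` ?S)"
  have "?M \<in> (\<lambda>s. V (e s)) ` ?S" using S(1) ne by (intro Max_in) auto
  then obtain s0 where s0: "s0 \<in> ?S" "?M = V (e s0)" by auto
  have le: "V (e s) < V (e s0)" if "s \<in> ?S - {s0}" for s
  proof -
    have "V (e s) \<le> ?M" using S(1) that by (intro Max_ge) auto
    moreover have "V (e s) \<noteq> V (e s0)"
    proof
      assume "V (e s) = V (e s0)"
      then have "e s = e s0" using that s0(1) by (intro inj_onD[OF V]) (auto intro: e(1))
      then show False using e(2)[of s] e(2)[OF s0(1)] that by auto
    qed
    ultimately show ?thesis using s0(2) by simp
  qed
  have "x = scale_pm (c s0) s0 + (\<Sum>s\<in>?S - {s0}. scale_pm (c s) s)"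
    unfolding x' using S(1) s0(1) by (simp add: sum.remove)
  moreover have "lead (scale_pm (c s0) s0) (V (e s0))"
    using g[OF e(1)[OF s0(1)]] e(2)[OF s0(1)] s0(1) by (intro lead_scale) auto
  moreover have "v < V (e s0)" if v: "v \<in> keys (\<Sum>s\<in>?S - {s0}. scale_pm (c s) s)" for v
  proof -
    obtain s where s: "s \<in> ?S - {s0}" "v \<in> keys (scale_pm (c s) s)"
      using v keys_sum_subset[of "?S - {s0}" "\<lambda>s. scale_pm (c s) s"
          "\<Union>s\<in>?S - {s0}. keys (scale_pm (c s) s)"] by blast
    then have "v \<in> keys s" using keys_scale_pm[of "c s" s] by blast
    moreover have "lead s (V (e s))"
    proof -
      have "s \<in> ?S" using s(1) by blast
      from g[OF e(1)[OF this]] e(2)[OF this, symmetric] show ?thesis by (rule back_subst[of "\<lambda>z. lead z (V (e s))"])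
    qed
    ultimately have "v \<le> V (e s)" by (simp add: lead_def)
    then show ?thesis using le[OF s(1)] by simp
  qed
  ultimately have "lead x (V (e s0))" by (simp add: lead_add)
  then show ?thesis using e(1)[OF s0(1)] by blast
qed

text \<open>Linear independence in the form used for comparing coefficients: an equation between
  combinations over disjoint index sets forces both sides to vanish.\<close>

lemma lead_span_disjoint:
  assumes g: "\<And>e. e \<in> X \<union> Y \<Longrightarrow> lead (g e) (V e)" and V: "inj_on V (X \<union> Y)" and XY: "X \<inter> Y = {}"
    and x: "x \<in> pm.span (g ` X)" and y: "y \<in> pm.span (g ` Y)" and eq: "x = (y :: texp \<Rightarrow>\<^sub>0 'k::field)"
  shows "x = 0"
proof (rule ccontr)
  assume nz: "x \<noteq> 0"
  have "inj_on V X" "inj_on V Y" using V by (auto simp: inj_on_Un)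
  then obtain d e where "d \<in> X" "lead x (V d)" "e \<in> Y" "lead x (V e)"
    using lead_span[of X g V x] lead_span[of Y g V x] g x y eq nz by auto
  then show False using lead_unique[of x] inj_onD[OF V, of d e] XY by auto
qed


subsection \<open>Supports\<close>

text \<open>Knowing the times that occur is enough for commutation: elements with disjoint sets of
  times commute, and this meets the hypothesis of \<open>qmat_product\<close> for torus
  matrices.\<close>

definition tsupp :: "nat set \<Rightarrow> (texp \<Rightarrow>\<^sub>0 'k::zero) set" where
  "tsupp S = {f. \<forall>u\<in>keys f. \<forall>x\<in>keys u. fst (snd x) \<in> S}"

lemma tsupp_mono: "S \<subseteq> S' \<Longrightarrow> f \<in> tsupp S \<Longrightarrow> f \<in> tsupp S'"
  by (auto simp: tsupp_def)

lemma tsupp_mult: "f \<in> tsupp S \<Longrightarrow> g \<in> tsupp S \<Longrightarrow> f \<otimes>\<^bsub>torus q\<^esub> g \<in> tsupp S"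
  unfolding tsupp_def by (auto elim!: keys_torus_mult dest!: keys_add[THEN subsetD])

lemma tsupp_add: "f \<in> tsupp S \<Longrightarrow> g \<in> tsupp S \<Longrightarrow> f + g \<in> tsupp S"
  unfolding tsupp_def by (auto dest!: keys_add[THEN subsetD])

lemma tsupp_zero: "0 \<in> tsupp S"
  by (simp add: tsupp_def)

lemma tsupp_scale: "f \<in> tsupp S \<Longrightarrow> scale_pm c f \<in> tsupp S"
  unfolding tsupp_def using keys_scale_pm[of c f] by blast

lemma tsupp_single: "keys u \<subseteq> {x. fst (snd x) \<in> S} \<Longrightarrow> single u c \<in> tsupp S"
  by (auto simp: tsupp_def)

lemma eform_disjoint_times:
  assumes "\<forall>x\<in>keys u. fst (snd x) \<in> S" "\<forall>x\<in>keys v. fst (snd x) \<in> S'" "S \<inter> S' = {}"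
  shows "eform u v = 0"
proof -
  have "vform x y = 0" if "x \<in> keys u" "y \<in> keys v" for x y
  proof -
    have "fst (snd x) \<noteq> fst (snd y)" using assms that by (metis disjoint_iff)
    then show ?thesis by (auto simp: vform_def split: prod.splits)
  qed
  then show ?thesis by (simp add: eform_def)
qed

lemma tsupp_commute:
  assumes "f \<in> tsupp S" "g \<in> tsupp S'" "S \<inter> S' = {}"
  shows "f \<otimes>\<^bsub>torus q\<^esub> g = g \<otimes>\<^bsub>torus q\<^esub> f"
proof (rule torus_commute_keys)
  fix u v assume "u \<in> keys f" "v \<in> keys g"
  then have a: "\<forall>x\<in>keys u. fst (snd x) \<in> S" "\<forall>x\<in>keys v. fst (snd x) \<in> S'"
    using assms by (auto simp: tsupp_def)
  have "eform u v = 0" by (rule eform_disjoint_times[OF a assms(3)])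
  moreover have "eform v u = 0" using assms(3) by (intro eform_disjoint_times[OF a(2,1)]) auto
  ultimately show "eform u v = eform v u" by simp
qed


subsection \<open>Bidiagonal quantum matrices and their products\<close>

text \<open>For i < s and j < l, one of the entries at (i, l) and (s, j) of a bidiagonal matrix is
  0. So the correction term of the diagonal relation disappears, and what remains are the relations
  of neighbouring entries and commutation of all others.\<close>

lemma (in qalg) qmat_bidiagonal:
  assumes cl: "\<And>p. \<alpha> p \<in> carrier R" "\<And>p. \<beta> p \<in> carrier R"
    and ab: "\<And>p. \<alpha> p \<otimes> \<beta> p = q \<odot> (\<beta> p \<otimes> \<alpha> p)"
    and ba: "\<And>p. \<beta> p \<otimes> \<alpha> (Suc p) = q \<odot> (\<alpha> (Suc p) \<otimes> \<beta> p)"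
    and aa: "\<And>p p'. p < p' \<Longrightarrow> \<alpha> p \<otimes> \<alpha> p' = \<alpha> p' \<otimes> \<alpha> p"
    and bb: "\<And>p p'. p < p' \<Longrightarrow> \<beta> p \<otimes> \<beta> p' = \<beta> p' \<otimes> \<beta> p"
    and comm: "\<And>p p'. p < p' \<Longrightarrow> \<alpha> p \<otimes> \<beta> p' = \<beta> p' \<otimes> \<alpha> p"
    and comm': "\<And>p p'. Suc p < p' \<Longrightarrow> \<beta> p \<otimes> \<alpha> p' = \<alpha> p' \<otimes> \<beta> p"
  shows "qmat q I J R (\<lambda>i j. if j = i then \<alpha> i else if j = Suc i then \<beta> i else \<zero>)"
  by (rule qmatI) (auto simp: cl ab ba intro: aa bb comm comm')

definition tmon :: "tvar \<Rightarrow> int \<Rightarrow> (texp \<Rightarrow>\<^sub>0 'k::field)" where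
  "tmon x c = single (single x c) 1"

lemma tmon_mult:
  "tmon x a \<otimes>\<^bsub>torus q\<^esub> tmon y b =
    single (single x a + single y b) (q powi (a * b * vform x y))"
  by (simp add: tmon_def torus_mult_single eform_single)

lemma tmon_q_commute:
  assumes "q \<noteq> 0" "a * b * vform x y = c + a * b * vform y x"
  shows "tmon x a \<otimes>\<^bsub>torus q\<^esub> tmon y b = scale_pm (q powi c) (tmon y b \<otimes>\<^bsub>torus q\<^esub> tmon x a)"
  using assms by (simp add: tmon_mult power_int_add add.commute mult.commute)

lemma tmon_commute:
  assumes "vform x y = vform y x"
  shows "tmon x a \<otimes>\<^bsub>torus q\<^esub> tmon y b = tmon y b \<otimes>\<^bsub>torus q\<^esub> tmon x a"
  using assms by (simp add: tmon_mult add.commute mult.commute)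

lemma tmon_tsupp: "fst (snd x) \<in> S \<Longrightarrow> tmon x a \<in> tsupp S"
  unfolding tmon_def by (rule tsupp_single) auto

lemma tmon_inverse:
  "tmon x a \<otimes>\<^bsub>torus q\<^esub> tmon x (- a) = single 0 1"
proof -
  have "vform x x = 0" by (auto simp: vform_def split: prod.splits)
  then show ?thesis by (simp add: tmon_mult single_add[symmetric])
qed

definition bidiag :: "nat \<Rightarrow> nat \<Rightarrow> nat \<Rightarrow> (texp \<Rightarrow>\<^sub>0 'k::field)" where
  "bidiag t i j = (if j = i then tmon (i, t, 1) 1 else if j = Suc i then tmon (i, t, 0) 1 else 0)"

lemma bidiag_qmat:
  assumes q: "q \<noteq> 0"
  shows "qmat q I J (torus q) (bidiag t)"
proof -
  interpret T: qalg "torus q" q by (rule torus_qalg[OF q])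
  have "qmat q I J (torus q) (\<lambda>i j. if j = i then tmon (i, t, 1) 1 else if j = Suc i then tmon (i, t, 0) 1 else \<zero>\<^bsub>torus q\<^esub>)"
  proof (rule T.qmat_bidiagonal)
    show "tmon (p, t, 1) 1 \<otimes>\<^bsub>torus q\<^esub> tmon (p, t, 0) 1 = q \<odot>\<^bsub>torus q\<^esub> (tmon (p, t, 0) 1 \<otimes>\<^bsub>torus q\<^esub> tmon (p, t, 1) 1)" for p
      using tmon_q_commute[OF q, of 1 1 "(p, t, 1)" "(p, t, 0)" 1] by (simp add: vform_def)
    show "tmon (p, t, 0) 1 \<otimes>\<^bsub>torus q\<^esub> tmon (Suc p, t, 1) 1 = q \<odot>\<^bsub>torus q\<^esub> (tmon (Suc p, t, 1) 1 \<otimes>\<^bsub>torus q\<^esub> tmon (p, t, 0) 1)" for p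
      using tmon_q_commute[OF q, of 1 1 "(p, t, 0)" "(Suc p, t, 1)" 1] by (simp add: vform_def)
  qed (auto intro!: tmon_commute simp: vform_def)
  then show ?thesis unfolding bidiag_def[abs_def] torus_simps .
qed

lemma bidiag_tsupp: "bidiag t i j \<in> tsupp {t}"
  by (auto simp: bidiag_def tsupp_zero intro: tmon_tsupp)

text \<open>
  The product of the first \<open>k\<close> bidiagonal matrices, at the times \<open>3, \<dots>, k + 2\<close>; its entries are
  sums over lattice paths which at each time either stay or move up by one.  Times below \<open>3\<close> are
  reserved.
\<close>

fun net :: "'k::field \<Rightarrow> nat \<Rightarrow> nat \<Rightarrow> nat \<Rightarrow> (texp \<Rightarrow>\<^sub>0 'k)" where
  "net q 0 i c = (if c = i then single 0 1 else 0)"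
| "net q (Suc k) i c = net q k i c \<otimes>\<^bsub>torus q\<^esub> tmon (c, k + 3, 1) 1 +
     (if c = 0 then 0 else net q k i (c - 1) \<otimes>\<^bsub>torus q\<^esub> tmon (c - 1, k + 3, 0) 1)"

lemma net_tsupp: "net q k i c \<in> tsupp {3..<k + 3}"
proof (induction k arbitrary: c)
  case 0
  then show ?case by (simp add: tsupp_def)
next
  case (Suc k)
  have "net q k i c \<in> tsupp {3..<Suc k + 3}" for c
    by (rule tsupp_mono[OF _ Suc.IH]) auto
  then show ?case by (auto intro!: tsupp_add tsupp_mult tmon_tsupp tsupp_zero)
qed

text \<open>Each new factor lives at a new time, so its entries commute with those of the product so
  far and \<open>qmat_product\<close> applies.\<close>

lemma net_qmat:
  assumes q: "q \<noteq> 0"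
  shows "qmat q {..N} {..N} (torus q) (net q k)"
proof (induction k)
  case 0
  interpret T: qalg "torus q" q by (rule torus_qalg[OF q])
  \<comment> \<open>The identity matrix is bidiagonal with superdiagonal 0.\<close>
  have "qmat q {..N} {..N} (torus q) (\<lambda>i j. if j = i then \<one>\<^bsub>torus q\<^esub> else if j = Suc i then \<zero>\<^bsub>torus q\<^esub> else \<zero>\<^bsub>torus q\<^esub>)"
    by (rule T.qmat_bidiagonal) (auto simp: torus_lr_distr)
  moreover have "(\<lambda>i j. if j = i then \<one>\<^bsub>torus q\<^esub> else if j = Suc i then \<zero>\<^bsub>torus q\<^esub> else \<zero>\<^bsub>torus q\<^esub>) = net q 0"
    by (intro ext) simp
  ultimately show ?case by (simp only:)
next
  case (Suc k)
  interpret T: qalg "torus q" q by (rule torus_qalg[OF q])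
  let ?W = "\<lambda>i j. \<Oplus>\<^bsub>torus q\<^esub>l\<in>{..N}. net q k i l \<otimes>\<^bsub>torus q\<^esub> bidiag (k + 3) l j"
  have W: "qmat q {..N} {..N} (torus q) ?W"
    by (rule T.qmat_product[OF Suc bidiag_qmat[OF q]]) (auto intro!: tsupp_commute[OF net_tsupp bidiag_tsupp])
  have "?W i j = net q (Suc k) i j" if "j \<in> {..N}" for i j
  proof -
    have "?W i j = (\<Sum>l\<in>{..N}. net q k i l \<otimes>\<^bsub>torus q\<^esub> bidiag (k + 3) l j)" by (rule torus_finsum[OF q])
    also have "\<dots> = (\<Sum>l\<in>{l. l = j \<or> Suc l = j}. net q k i l \<otimes>\<^bsub>torus q\<^esub> bidiag (k + 3) l j)"
      using that by (intro sum.mono_neutral_right) (auto simp: bidiag_def torus_lr_distr)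
    also have "\<dots> = net q (Suc k) i j"
    proof (cases j)
      case 0
      then have "{l. l = j \<or> Suc l = j} = {j}" by auto
      then show ?thesis using 0 by (simp add: bidiag_def)
    next
      case (Suc j')
      then have "{l. l = j \<or> Suc l = j} = {j, j'}" by auto
      then show ?thesis using Suc by (simp add: bidiag_def)
    qed
    finally show ?thesis .
  qed
  then show ?case using W qmat_cong[of "{..N}" "{..N}" ?W "net q (Suc k)" q "torus q"] by blast
qed

text \<open>The exponent of the path which moves up as early as possible.\<close>

definition path_exp :: "nat \<Rightarrow> nat \<Rightarrow> nat \<Rightarrow> texp" where
  "path_exp k i c = (\<Sum>t<k. single (if t < c - i then (i + t, t + 3, 0) else (c, t + 3, 1)) 1)"

lemma path_exp_Suc:
  "path_exp (Suc k) i c = path_exp k i c +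
    single (if k < c - i then (i + k, k + 3, 0) else (c, k + 3, 1)) 1"
  by (simp add: path_exp_def)

lemma lookup_path_exp:
  "lookup (path_exp k i c) (p, t, f) =
    (if 3 \<le> t \<and> t - 3 < k \<and> (if t - 3 < c - i then p = i + (t - 3) \<and> f = 0 else p = c \<and> f = 1) then 1 else 0)"
proof -
  have "lookup (path_exp k i c) (p, t, f) =
    (\<Sum>s<k. if t = s + 3 then (if (if s < c - i then p = i + s \<and> f = 0 else p = c \<and> f = 1) then 1 else 0) else 0)"
    unfolding path_exp_def lookup_sum by (intro sum.cong) (auto simp: lookup_single when_def)
  also have "\<dots> = (\<Sum>s<k. if s = t - 3 \<and> 3 \<le> t then (if (if t - 3 < c - i then p = i + (t - 3) \<and> f = 0 else p = c \<and> f = 1) then 1 else 0) else 0)"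
    by (intro sum.cong) auto
  also have "\<dots> = (if 3 \<le> t \<and> t - 3 < k \<and> (if t - 3 < c - i then p = i + (t - 3) \<and> f = 0 else p = c \<and> f = 1) then 1 else 0)"
    by (cases "3 \<le> t") (auto simp: sum.delta)
  finally show ?thesis .
qed

lemma texp_lessI:
  assumes "lookup u x < lookup v x" "\<And>y. y < x \<Longrightarrow> lookup u y = lookup v y"
  shows "u < (v :: texp)"
  unfolding less_poly_mapping.rep_eq less_fun_def using assms by blast

text \<open>The recursion of \<open>net\<close> reaches \<open>c\<close> in two ways, by staying
  there or by a last move from \<open>c - 1\<close>. The comparison shows that staying, which means
  having moved earlier, gives the larger exponent.\<close>

lemma path_exp_less:
  assumes c: "i < c" "c \<le> i + k"
  shows "path_exp k i (c - 1) + single (c - 1, k + 3, 0) 1 <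
    path_exp k i c + single (c, k + 3, 1) 1"
proof -
  obtain d where d: "c = Suc d" using c by (cases c) auto
  then have di: "i \<le> d" "d < i + k" using c by auto
  have "path_exp k i d + single (d, k + 3, 0) 1 <
    path_exp k i (Suc d) + single (Suc d, k + 3, 1) 1"
  \<comment> \<open>At this time the early path moves up from position \<open>d\<close> while the
    late one waits there; at every smaller variable the two agree.\<close>
  proof (rule texp_lessI[of _ "(d, d - i + 3, 0)"])
    have "lookup (path_exp k i d) (d, d - i + 3, 0) = 0" "lookup (path_exp k i (Suc d)) (d, d - i + 3, 0) = 1"
      using di by (simp_all add: lookup_path_exp Suc_diff_le, arith?)
    moreover have "lookup (single (d, k + 3, 0) (1::int)) (d, d - i + 3, 0) = 0"
      "lookup (single (Suc d, k + 3, 1) (1::int)) (d, d - i + 3, 0) = 0"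
      using di by (simp_all add: lookup_single when_def)
    ultimately show "lookup (path_exp k i d + single (d, k + 3, 0) 1) (d, d - i + 3, 0) <
      lookup (path_exp k i (Suc d) + single (Suc d, k + 3, 1) 1) (d, d - i + 3, 0)"
      by (simp add: lookup_add)
    fix y :: tvar assume y: "y < (d, d - i + 3, 0)"
    obtain p t f where ptf: "y = (p, t, f)" by (rule prod_cases3)
    have p: "p < d \<or> p = d \<and> t < d - i + 3" using y ptf by auto
    have "lookup (path_exp k i d) y = lookup (path_exp k i (Suc d)) y"
    proof (cases "t - 3 < d - i")
      case True
      then show ?thesis using di by (simp add: ptf lookup_path_exp Suc_diff_le)
    next
      case False
      then have "p < d \<or> t < 3" using p by auto
      then show ?thesis using di False by (auto simp add: ptf lookup_path_exp Suc_diff_le)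
    qed
    moreover have "y \<noteq> (d, k + 3, 0)" "y \<noteq> (Suc d, k + 3, 1)" using p ptf di by auto
    ultimately show "lookup (path_exp k i d + single (d, k + 3, 0) 1) y =
      lookup (path_exp k i (Suc d) + single (Suc d, k + 3, 1) 1) y"
      by (simp add: lookup_add lookup_single when_def)
  qed
  then show ?thesis by (simp add: d)
qed

text \<open>By \<open>path_exp_less\<close> the term that already stays at \<open>c\<close> leads;
  at the border \<open>c = Suc (i + k)\<close> only the other term is nonzero. The bounds express
  that a path never moves down and climbs at most one step at each time.\<close>

lemma lead_net:
  assumes q: "q \<noteq> 0"
  shows "(i \<le> c \<and> c \<le> i + k \<longrightarrow> lead (net q k i c) (path_exp k i c)) \<and>
    (\<not> (i \<le> c \<and> c \<le> i + k) \<longrightarrow> net q k i c = 0)"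
proof (induction k arbitrary: c)
  case 0
  then show ?case by (auto simp: path_exp_def lead_def)
next
  case (Suc k)
  have tm: "lead (tmon x 1) (single x 1)" for x
    unfolding tmon_def by (rule lead_single) simp
  consider "c < i" | "c = i" | "i < c" "c \<le> i + k" | "c = Suc (i + k)" | "Suc (i + k) < c" by linarith
  then show ?case
  proof cases
    case 1
    then show ?thesis using Suc.IH[of c] Suc.IH[of "c - 1"] by (simp add: torus_lr_distr)
  next
    case 2
    then have "lead (net q k i c \<otimes>\<^bsub>torus q\<^esub> tmon (c, k + 3, 1) 1) (path_exp k i c + single (c, k + 3, 1) 1)"
      using Suc.IH[of c] by (intro lead_mult[OF q _ tm]) simp
    moreover have "c = 0 \<or> net q k i (c - 1) = 0" using Suc.IH[of "c - 1"] 2 by auto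
    ultimately show ?thesis using 2 by (auto simp: path_exp_Suc torus_lr_distr)
  next
    case 3
    then have 1: "lead (net q k i c \<otimes>\<^bsub>torus q\<^esub> tmon (c, k + 3, 1) 1) (path_exp k i c + single (c, k + 3, 1) 1)"
      using Suc.IH[of c] by (intro lead_mult[OF q _ tm]) simp
    have 2: "lead (net q k i (c - 1) \<otimes>\<^bsub>torus q\<^esub> tmon (c - 1, k + 3, 0) 1)
        (path_exp k i (c - 1) + single (c - 1, k + 3, 0) 1)"
      using Suc.IH[of "c - 1"] 3 by (intro lead_mult[OF q _ tm]) auto
    have "lead (net q (Suc k) i c) (path_exp k i c + single (c, k + 3, 1) 1)"
    proof -
      have "v < path_exp k i c + single (c, k + 3, 1) 1"
        if "v \<in> keys (net q k i (c - 1) \<otimes>\<^bsub>torus q\<^esub> tmon (c - 1, k + 3, 0) 1)" for v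
        using 2 that path_exp_less[OF 3] unfolding lead_def by fastforce
      then show ?thesis using lead_add[OF 1] 3 by simp
    qed
    moreover have "path_exp (Suc k) i c = path_exp k i c + single (c, k + 3, 1) 1"
    proof -
      have "\<not> k < c - i" using 3 by linarith
      then show ?thesis by (simp add: path_exp_Suc)
    qed
    ultimately show ?thesis using 3 by (simp only:) auto
  next
    case 4
    have "lead (net q k i (c - 1) \<otimes>\<^bsub>torus q\<^esub> tmon (c - 1, k + 3, 0) 1)
        (path_exp k i (c - 1) + single (c - 1, k + 3, 0) 1)"
      using Suc.IH[of "c - 1"] 4 by (intro lead_mult[OF q _ tm]) auto
    moreover have "net q k i c = 0" using Suc.IH[of c] 4 by simp
    moreover have "path_exp (Suc k) i c = path_exp k i (c - 1) + single (c - 1, k + 3, 0) 1"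
      using 4 unfolding path_exp_Suc by (auto simp: path_exp_def)
    ultimately show ?thesis using 4 by (simp add: torus_lr_distr)
  next
    case 5
    then show ?thesis using Suc.IH[of c] Suc.IH[of "c - 1"] by (auto simp: torus_lr_distr)
  qed
qed


section \<open>Ordered monomials span the quantum matrix algebra\<close>

section \<open>Ordered monomials\<close>

definition col_word :: "nat list \<Rightarrow> (nat \<Rightarrow> nat) \<Rightarrow> nat list" where
  "col_word rs \<epsilon> = concat (map (\<lambda>r. replicate (\<epsilon> r) r) rs)"

lemma col_word_simps [simp]:
  "col_word [] \<epsilon> = []" "col_word (r # rs) \<epsilon> = replicate (\<epsilon> r) r @ col_word rs \<epsilon>"
  by (simp_all add: col_word_def)

lemma col_word_zero [simp]: "col_word rs (\<lambda>_. 0) = []"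
  by (induction rs) simp_all

lemma set_col_word: "set (col_word rs \<epsilon>) \<subseteq> set rs"
  by (auto simp: col_word_def)

lemma col_word_cong: "(\<And>r. r \<in> set rs \<Longrightarrow> \<epsilon> r = \<epsilon>' r) \<Longrightarrow> col_word rs \<epsilon> = col_word rs \<epsilon>'"
  unfolding col_word_def by (intro arg_cong[where f = concat] map_cong) auto

context kalg
begin

inductive_set vspan :: "'a set \<Rightarrow> 'a set" for X where
  zero: "\<zero> \<in> vspan X"
| step: "x \<in> X \<Longrightarrow> y \<in> vspan X \<Longrightarrow> c \<odot> x \<oplus> y \<in> vspan X"

lemma vspan_closed: "x \<in> vspan X \<Longrightarrow> X \<subseteq> carrier A \<Longrightarrow> x \<in> carrier A"
  by (induction rule: vspan.induct) auto

lemma vspan_base: "x \<in> X \<Longrightarrow> X \<subseteq> carrier A \<Longrightarrow> x \<in> vspan X"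
  using vspan.step[of x X \<zero> 1] vspan.zero by auto

lemma vspan_add: "x \<in> vspan X \<Longrightarrow> y \<in> vspan X \<Longrightarrow> X \<subseteq> carrier A \<Longrightarrow> x \<oplus> y \<in> vspan X"
proof (induction rule: vspan.induct)
  case zero
  then show ?case using vspan_closed by simp
next
  case (step x z c)
  then have "c \<odot> x \<oplus> z \<oplus> y = c \<odot> x \<oplus> (z \<oplus> y)" using vspan_closed by (intro a_assoc) auto
  then show ?case using step by (auto intro: vspan.step)
qed

lemma vspan_smult: "x \<in> vspan X \<Longrightarrow> X \<subseteq> carrier A \<Longrightarrow> c \<odot> x \<in> vspan X"
proof (induction rule: vspan.induct)
  case zero
  then show ?case by (simp add: vspan.zero)
next
  case (step x z d)
  then have "x \<in> carrier A" "z \<in> carrier A" using vspan_closed by auto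
  then have "c \<odot> (d \<odot> x \<oplus> z) = (c * d) \<odot> x \<oplus> c \<odot> z" by (simp add: smult_r_distr smult_assoc1)
  then show ?case using step by (auto intro: vspan.step)
qed

lemma vspan_mult_right:
  assumes "x \<in> vspan X" "X \<subseteq> carrier A" "y \<in> carrier A" "\<And>z. z \<in> X \<Longrightarrow> z \<otimes> y \<in> vspan Y" "Y \<subseteq> carrier A"
  shows "x \<otimes> y \<in> vspan Y"
  using assms(1)
proof (induction rule: vspan.induct)
  case zero
  then show ?case using assms by (simp add: vspan.zero)
next
  case (step x z c)
  then have "x \<in> carrier A" "z \<in> carrier A" using vspan_closed assms by auto
  then have "(c \<odot> x \<oplus> z) \<otimes> y = c \<odot> (x \<otimes> y) \<oplus> z \<otimes> y" using assms by (simp add: l_distr smult_mult_l)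
  then show ?case using step assms by (auto intro: vspan_add vspan_smult)
qed

lemma vspan_mult_left:
  assumes "x \<in> vspan X" "X \<subseteq> carrier A" "y \<in> carrier A" "\<And>z. z \<in> X \<Longrightarrow> y \<otimes> z \<in> vspan Y" "Y \<subseteq> carrier A"
  shows "y \<otimes> x \<in> vspan Y"
  using assms(1)
proof (induction rule: vspan.induct)
  case zero
  then show ?case using assms by (simp add: vspan.zero)
next
  case (step x z c)
  then have "x \<in> carrier A" "z \<in> carrier A" using vspan_closed assms by auto
  then have "y \<otimes> (c \<odot> x \<oplus> z) = c \<odot> (y \<otimes> x) \<oplus> y \<otimes> z" using assms by (simp add: r_distr smult_mult_r)
  then show ?case using step assms by (auto intro: vspan_add vspan_smult)
qed

lemma vspan_lin_ext:
  assumes "x \<in> vspan (g ` C)" "\<And>e. e \<in> C \<Longrightarrow> g e \<in> carrier A"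
  shows "\<exists>c. keys c \<subseteq> C \<and> x = lin_ext A g c"
  using assms(1)
proof (induction rule: vspan.induct)
  case zero
  then show ?case by (intro exI[of _ 0]) (simp add: lin_ext_def)
next
  case (step x z d)
  then obtain c e where c: "keys c \<subseteq> C" "z = lin_ext A g c" and e: "e \<in> C" "x = g e" by auto
  note l = lin_ext_add[of A C g, OF kalg_axioms assms(2)] lin_ext_single[of A C g, OF kalg_axioms assms(2)]
  have "keys (single e d + c) \<subseteq> C" using c e keys_add[of "single e d" c] by (auto split: if_splits)
  moreover have "d \<odot> x \<oplus> z = lin_ext A g (single e d + c)"
    using c e by (subst l(1)) (auto simp: l(2))
  ultimately show ?case by blast
qed

end

context qalg
begin

definition wprod :: "(nat \<Rightarrow> nat \<Rightarrow> 'a) \<Rightarrow> nat \<Rightarrow> nat list \<Rightarrow> 'a" where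
  "wprod Z j w = lprod (map (\<lambda>r. Z r j) w)"

text \<open>The row order \<open>rs\<close> is a parameter because spanning holds for any order.
  Later it is decreasing, so that in each column the factors of row i + 1 precede those of row
  i.\<close>

definition omon :: "(nat \<Rightarrow> nat \<Rightarrow> 'a) \<Rightarrow> nat list \<Rightarrow> nat list \<Rightarrow> (nat \<Rightarrow> nat \<Rightarrow> nat) \<Rightarrow> 'a" where
  "omon Z rs cs e = lprod (map (\<lambda>j. wprod Z j (col_word rs (\<lambda>r. e r j))) cs)"

lemma omon_simps [simp]:
  "omon Z rs [] e = \<one>"
  "omon Z rs (j # cs) e = wprod Z j (col_word rs (\<lambda>r. e r j)) \<otimes> omon Z rs cs e"
  by (simp_all add: omon_def)

lemma omon_cong:
  assumes "\<And>r j. r \<in> set rs \<Longrightarrow> j \<in> set cs \<Longrightarrow> e r j = e' r j"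
  shows "omon Z rs cs e = omon Z rs cs e'"
proof -
  have "col_word rs (\<lambda>r. e r j) = col_word rs (\<lambda>r. e' r j)" if "j \<in> set cs" for j
    using assms that by (intro col_word_cong) auto
  then show ?thesis unfolding omon_def by (metis (mono_tags, lifting) map_eq_conv)
qed

context
  fixes I J Z
  assumes Z: "qmat q I J R Z"
begin

lemma wprod_closed: "set w \<subseteq> I \<Longrightarrow> j \<in> J \<Longrightarrow> wprod Z j w \<in> carrier R"
  unfolding wprod_def using qmat_closed[OF Z] by (intro lprod_closed) auto

lemma wprod_simps [simp]:
  "wprod Z j [] = \<one>" "wprod Z j (r # w) = Z r j \<otimes> wprod Z j w"
  by (simp_all add: wprod_def)

lemma wprod_append:
  "set v \<subseteq> I \<Longrightarrow> set w \<subseteq> I \<Longrightarrow> j \<in> J \<Longrightarrow> wprod Z j (v @ w) = wprod Z j v \<otimes> wprod Z j w"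
  unfolding wprod_def map_append using qmat_closed[OF Z] by (intro lprod_append) auto

lemma omon_closed: "set rs \<subseteq> I \<Longrightarrow> set cs \<subseteq> J \<Longrightarrow> omon Z rs cs e \<in> carrier R"
  unfolding omon_def using set_col_word by (intro lprod_closed) (fastforce intro!: wprod_closed)

lemma col_q_commute:
  assumes "r \<in> I" "s \<in> I" "j \<in> J"
  shows "\<exists>c. Z r j \<otimes> Z s j = c \<odot> (Z s j \<otimes> Z r j)"
proof -
  consider "r = s" | "r < s" | "s < r" by linarith
  then show ?thesis
  proof cases
    case 1
    then show ?thesis using assms qmat_closed[OF Z] by (intro exI[of _ 1]) simp
  next
    case 2
    then show ?thesis using assms qmat_col[OF Z, of r s j] by blast
  next
    case 3
    then have "Z s j \<otimes> Z r j = q \<odot> (Z r j \<otimes> Z s j)" using assms by (intro qmat_col[OF Z])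
    then have "inverse q \<odot> (Z s j \<otimes> Z r j) = (inverse q * q) \<odot> (Z r j \<otimes> Z s j)"
      using assms qmat_closed[OF Z] by (simp add: smult_assoc1)
    then show ?thesis using q_nz assms qmat_closed[OF Z] by (intro exI[of _ "inverse q"]) simp
  qed
qed

lemma col_q_commute_replicate:
  assumes a: "r \<in> I" "s \<in> I" "j \<in> J"
  shows "\<exists>c. Z r j \<otimes> wprod Z j (replicate k s) = c \<odot> (wprod Z j (replicate k s) \<otimes> Z r j)"
proof (induction k)
  case 0
  then show ?case using a qmat_closed[OF Z] by (intro exI[of _ 1]) simp
next
  case (Suc k)
  have cl: "Z r j \<in> carrier R" "Z s j \<in> carrier R" "wprod Z j (replicate k s) \<in> carrier R"
    using a qmat_closed[OF Z] by (auto intro!: wprod_closed)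
  obtain c where c: "Z r j \<otimes> wprod Z j (replicate k s) = c \<odot> (wprod Z j (replicate k s) \<otimes> Z r j)"
    using Suc by blast
  obtain d where d: "Z r j \<otimes> Z s j = d \<odot> (Z s j \<otimes> Z r j)" using col_q_commute[OF a] by blast
  have "Z r j \<otimes> wprod Z j (replicate (Suc k) s) = (Z r j \<otimes> Z s j) \<otimes> wprod Z j (replicate k s)"
    using cl by (simp add: m_assoc)
  also have "\<dots> = d \<odot> (Z s j \<otimes> (Z r j \<otimes> wprod Z j (replicate k s)))"
    unfolding d using cl by (simp add: smult_mult_l m_assoc)
  also have "\<dots> = (d * c) \<odot> (wprod Z j (replicate (Suc k) s) \<otimes> Z r j)"
    unfolding c using cl by (simp add: smult_mult_r m_assoc smult_assoc1)
  finally show ?case by blast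
qed

text \<open>Entries of one column commute up to scalars, so a new factor can be moved to its place
  in the word.\<close>

lemma col_insert:
  assumes j: "j \<in> J" and "distinct rs" "set rs \<subseteq> I" "r \<in> set rs"
  shows "\<exists>c. Z r j \<otimes> wprod Z j (col_word rs \<epsilon>) = c \<odot> wprod Z j (col_word rs (\<epsilon>(r := Suc (\<epsilon> r))))"
  using assms(2-)
proof (induction rs)
  case (Cons s rs)
  have w: "set (col_word rs \<epsilon>) \<subseteq> I" for \<epsilon> using set_col_word[of rs \<epsilon>] Cons.prems by auto
  have cl: "Z r j \<in> carrier R" "Z s j \<in> carrier R" "wprod Z j (replicate k s) \<in> carrier R"
    "wprod Z j (col_word rs \<epsilon>) \<in> carrier R" for k \<epsilon>
    using Cons.prems j w qmat_closed[OF Z] by (auto intro!: wprod_closed)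
  have split: "wprod Z j (col_word (s # rs) \<epsilon>) = wprod Z j (replicate (\<epsilon> s) s) \<otimes> wprod Z j (col_word rs \<epsilon>)" for \<epsilon>
    unfolding col_word_simps using Cons.prems w j by (intro wprod_append) auto
  show ?case
  proof (cases "r = s")
    case True
    have "col_word rs (\<epsilon>(s := Suc (\<epsilon> s))) = col_word rs \<epsilon>"
      using Cons.prems by (intro col_word_cong) auto
    then have "Z r j \<otimes> wprod Z j (col_word (s # rs) \<epsilon>) = wprod Z j (col_word (s # rs) (\<epsilon>(r := Suc (\<epsilon> r))))"
      unfolding split using cl True by (simp add: m_assoc)
    then show ?thesis using True Cons.prems cl unfolding split by (intro exI[of _ 1]) simp
  next
    case False
    then have "\<exists>c. Z r j \<otimes> wprod Z j (col_word rs \<epsilon>) = c \<odot> wprod Z j (col_word rs (\<epsilon>(r := Suc (\<epsilon> r))))"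
      using Cons.prems by (intro Cons.IH) auto
    then obtain c where c: "Z r j \<otimes> wprod Z j (col_word rs \<epsilon>) = c \<odot> wprod Z j (col_word rs (\<epsilon>(r := Suc (\<epsilon> r))))" ..
    obtain d where d: "Z r j \<otimes> wprod Z j (replicate (\<epsilon> s) s) = d \<odot> (wprod Z j (replicate (\<epsilon> s) s) \<otimes> Z r j)"
      using col_q_commute_replicate[of r s j "\<epsilon> s"] Cons.prems j by auto
    have "Z r j \<otimes> wprod Z j (col_word (s # rs) \<epsilon>) =
      (Z r j \<otimes> wprod Z j (replicate (\<epsilon> s) s)) \<otimes> wprod Z j (col_word rs \<epsilon>)"
      unfolding split using cl by (simp add: m_assoc)
    also have "\<dots> = d \<odot> (wprod Z j (replicate (\<epsilon> s) s) \<otimes> (Z r j \<otimes> wprod Z j (col_word rs \<epsilon>)))"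
      unfolding d using cl by (simp add: m_assoc smult_mult_l)
    also have "\<dots> = (d * c) \<odot> wprod Z j (col_word (s # rs) (\<epsilon>(r := Suc (\<epsilon> r))))"
      unfolding c split using cl False by (simp add: smult_mult_r smult_assoc1)
    finally show ?thesis by blast
  qed
qed simp

lemma omon_base: "set rs \<subseteq> I \<Longrightarrow> set cs \<subseteq> J \<Longrightarrow> range (omon Z rs cs) \<subseteq> carrier R"
  using omon_closed by blast

text \<open>Moving an entry of a later column to the right past an entry of an earlier one costs at
  most a term in which their rows are exchanged. In either term exactly one entry of the later
  column remains, and it stands on the right.\<close>

lemma cross_column:
  assumes a: "k \<in> I" "r \<in> I" "l \<in> J" "j \<in> J" "l < j"
  shows "\<exists>c d. Z k j \<otimes> Z r l = c \<odot> (Z r l \<otimes> Z k j) \<oplus> d \<odot> (Z k l \<otimes> Z r j)"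
proof -
  note cl = qmat_closed[OF Z]
  consider "r = k" | "r < k" | "k < r" by linarith
  then show ?thesis
  proof cases
    case 1
    have "Z k l \<otimes> Z k j = q \<odot> (Z k j \<otimes> Z k l)" using a by (intro qmat_row[OF Z])
    then have "inverse q \<odot> (Z k l \<otimes> Z k j) = (inverse q * q) \<odot> (Z k j \<otimes> Z k l)"
      using a cl by (simp add: smult_assoc1)
    then show ?thesis using q_nz a cl 1 by (intro exI[of _ "inverse q"] exI[of _ 0]) simp
  next
    case 2
    have "Z r l \<otimes> Z k j = Z k j \<otimes> Z r l \<oplus> (q - inverse q) \<odot> (Z r j \<otimes> Z k l)"
      using a 2 by (intro qmat_diag[OF Z])
    moreover have "Z r j \<otimes> Z k l = Z k l \<otimes> Z r j" using a 2 by (intro qmat_anti[OF Z])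
    ultimately have "Z r l \<otimes> Z k j \<oplus> (- (q - inverse q)) \<odot> (Z k l \<otimes> Z r j) = Z k j \<otimes> Z r l"
      using a cl smult_lin[of "Z k l \<otimes> Z r j" "q - inverse q" "- (q - inverse q)"] by (simp add: a_assoc)
    then show ?thesis using a cl by (intro exI[of _ 1] exI[of _ "- (q - inverse q)"]) simp
  next
    case 3
    have "Z k j \<otimes> Z r l = Z r l \<otimes> Z k j" using a 3 by (intro qmat_anti[OF Z])
    then show ?thesis using a cl by (intro exI[of _ 1] exI[of _ 0]) simp
  qed
qed

text \<open>Iterates \<open>cross_column\<close> along the word: each term keeps the shape of a word
  in column \<open>l\<close> followed by one entry of column \<open>j\<close>, whose row may have
  changed.\<close>

lemma cross_column_word:
  assumes rs: "distinct rs" "set rs = I" and lj: "l \<in> J" "j \<in> J" "l < j"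
  shows "k \<in> I \<Longrightarrow> set w \<subseteq> I \<Longrightarrow>
    Z k j \<otimes> wprod Z l w \<in> vspan {wprod Z l (col_word rs \<epsilon>) \<otimes> Z s j | \<epsilon> s. s \<in> I}"
proof (induction w arbitrary: k)
  let ?Y = "{wprod Z l (col_word rs \<epsilon>) \<otimes> Z s j | \<epsilon> s. s \<in> I}"
  have cw: "wprod Z l (col_word rs \<epsilon>) \<in> carrier R" for \<epsilon>
    using set_col_word[of rs \<epsilon>] rs lj by (intro wprod_closed) auto
  note cl = qmat_closed[OF Z]
  have Y: "?Y \<subseteq> carrier R" using cw cl lj by auto
  {
    case Nil
    have "Z k j \<in> ?Y"
      using Nil lj cl by (intro CollectI exI[of _ "\<lambda>_. 0"] exI[of _ k]) simp
    then show ?case using Nil lj cl Y by (simp add: vspan_base)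
  next
    case (Cons r w)
    have rw: "r \<in> I" "set w \<subseteq> I" using Cons by auto
    have wc: "wprod Z l w \<in> carrier R" using rw lj by (intro wprod_closed)
    obtain c d where cd: "Z k j \<otimes> Z r l = c \<odot> (Z r l \<otimes> Z k j) \<oplus> d \<odot> (Z k l \<otimes> Z r j)"
      using cross_column[OF Cons.prems(1) rw(1) lj] by blast
    have push: "Z s l \<otimes> y \<in> vspan ?Y" if "s \<in> I" "y \<in> vspan ?Y" for s y
    proof (rule vspan_mult_left[OF that(2) Y _ _ Y])
      show "Z s l \<in> carrier R" using that lj cl by simp
      fix z assume "z \<in> ?Y"
      then obtain \<epsilon> u where z: "z = wprod Z l (col_word rs \<epsilon>) \<otimes> Z u j" "u \<in> I" by blast
      have "\<exists>c. Z s l \<otimes> wprod Z l (col_word rs \<epsilon>) = c \<odot> wprod Z l (col_word rs (\<epsilon>(s := Suc (\<epsilon> s))))"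
        using rs that by (intro col_insert lj) auto
      then obtain c where c: "Z s l \<otimes> wprod Z l (col_word rs \<epsilon>) = c \<odot> wprod Z l (col_word rs (\<epsilon>(s := Suc (\<epsilon> s))))" ..
      have eq: "Z s l \<otimes> z = c \<odot> (wprod Z l (col_word rs (\<epsilon>(s := Suc (\<epsilon> s)))) \<otimes> Z u j)"
        using z c cl lj cw that by (simp add: m_assoc[symmetric] smult_mult_l)
      have "wprod Z l (col_word rs (\<epsilon>(s := Suc (\<epsilon> s)))) \<otimes> Z u j \<in> ?Y" using z(2) by blast
      then show "Z s l \<otimes> z \<in> vspan ?Y" unfolding eq by (intro vspan_smult[OF vspan_base[OF _ Y] Y])
    qed
    have "Z k j \<otimes> wprod Z l (r # w) = (Z k j \<otimes> Z r l) \<otimes> wprod Z l w"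
      using rw lj Cons.prems cl wc by (simp add: m_assoc)
    also have "\<dots> = c \<odot> (Z r l \<otimes> (Z k j \<otimes> wprod Z l w)) \<oplus> d \<odot> (Z k l \<otimes> (Z r j \<otimes> wprod Z l w))"
      unfolding cd using rw lj Cons.prems cl wc by (simp add: l_distr smult_mult_l m_assoc)
    finally show ?case
      using push[OF rw(1) Cons.IH[OF Cons.prems(1) rw(2)]] push[OF Cons.prems(1) Cons.IH[OF rw]] Y
      by (auto intro!: vspan_add vspan_smult)
  }
qed

text \<open>Induction over the columns. A generator that has passed the first column never returns
  to it, so the rewriting needs no term order.\<close>

lemma gen_omon:
  assumes rs: "distinct rs" "set rs = I"
  shows "sorted_wrt (<) cs \<Longrightarrow> set cs \<subseteq> J \<Longrightarrow> k \<in> I \<Longrightarrow> j \<in> set cs \<Longrightarrow>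
    Z k j \<otimes> omon Z rs cs e \<in> vspan (range (omon Z rs cs))"
proof (induction cs arbitrary: k j e)
  case (Cons l cs)
  note cl = qmat_closed[OF Z]
  have lJ: "l \<in> J" and csJ: "set cs \<subseteq> J" and csl: "\<And>j. j \<in> set cs \<Longrightarrow> l < j" and scs: "sorted_wrt (<) cs"
    using Cons.prems by auto
  have cw: "wprod Z l (col_word rs \<epsilon>) \<in> carrier R" for \<epsilon>
    using set_col_word[of rs \<epsilon>] rs lJ by (intro wprod_closed) auto
  have oc: "omon Z rs cs e \<in> carrier R" for e using rs csJ by (intro omon_closed) auto
  have base: "range (omon Z rs (l # cs)) \<subseteq> carrier R" "range (omon Z rs cs) \<subseteq> carrier R"
    using rs lJ csJ by (intro omon_base; auto)+
  have glue: "wprod Z l (col_word rs \<epsilon>) \<otimes> omon Z rs cs e' \<in> range (omon Z rs (l # cs))" for \<epsilon> e'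
  proof -
    \<comment> \<open>\<open>l\<close> is not in \<open>cs\<close>, so a new exponent vector for
      column \<open>l\<close> can be combined with any exponents of the remaining columns.\<close>
    let ?e = "\<lambda>r j. if j = l then \<epsilon> r else e' r j"
    have "omon Z rs cs ?e = omon Z rs cs e'" using csl by (intro omon_cong) auto
    then have "wprod Z l (col_word rs \<epsilon>) \<otimes> omon Z rs cs e' = omon Z rs (l # cs) ?e" by simp
    then show ?thesis by blast
  qed
  show ?case
  proof (cases "j = l")
    case True
    have "\<exists>c. Z k l \<otimes> wprod Z l (col_word rs (\<lambda>r. e r l)) =
      c \<odot> wprod Z l (col_word rs ((\<lambda>r. e r l)(k := Suc (e k l))))"
      using rs Cons.prems by (intro col_insert lJ) auto
    then obtain c where c: "Z k l \<otimes> wprod Z l (col_word rs (\<lambda>r. e r l)) =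
      c \<odot> wprod Z l (col_word rs ((\<lambda>r. e r l)(k := Suc (e k l))))" ..
    have eq: "Z k j \<otimes> omon Z rs (l # cs) e =
      c \<odot> (wprod Z l (col_word rs ((\<lambda>r. e r l)(k := Suc (e k l)))) \<otimes> omon Z rs cs e)"
      using True c cl Cons.prems lJ cw oc by (simp add: m_assoc[symmetric] smult_mult_l)
    show ?thesis unfolding eq by (rule vspan_smult[OF vspan_base[OF glue base(1)] base(1)])
  next
    case False
    then have j: "j \<in> set cs" "j \<in> J" "l < j" using Cons.prems csl by auto
    have "Z k j \<otimes> wprod Z l (col_word rs (\<lambda>r. e r l)) \<in> vspan {wprod Z l (col_word rs \<epsilon>) \<otimes> Z s j | \<epsilon> s. s \<in> I}"
      using set_col_word[of rs] rs Cons.prems by (intro cross_column_word[OF rs lJ j(2,3)]) auto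
    then have "(Z k j \<otimes> wprod Z l (col_word rs (\<lambda>r. e r l))) \<otimes> omon Z rs cs e \<in> vspan (range (omon Z rs (l # cs)))"
    proof (rule vspan_mult_right[OF _ _ oc _ base(1)])
      show "{wprod Z l (col_word rs \<epsilon>) \<otimes> Z s j | \<epsilon> s. s \<in> I} \<subseteq> carrier R" using cw cl j by auto
      fix z assume "z \<in> {wprod Z l (col_word rs \<epsilon>) \<otimes> Z s j | \<epsilon> s. s \<in> I}"
      then obtain \<epsilon> s where z: "z = wprod Z l (col_word rs \<epsilon>) \<otimes> Z s j" "s \<in> I" by blast
      have "Z s j \<otimes> omon Z rs cs e \<in> vspan (range (omon Z rs cs))"
        by (rule Cons.IH[OF scs csJ z(2) j(1)])
      then have "wprod Z l (col_word rs \<epsilon>) \<otimes> (Z s j \<otimes> omon Z rs cs e) \<in> vspan (range (omon Z rs (l # cs)))"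
        by (rule vspan_mult_left[OF _ base(2) cw _ base(1)]) (use glue base in \<open>auto intro!: vspan_base\<close>)
      then show "z \<otimes> omon Z rs cs e \<in> vspan (range (omon Z rs (l # cs)))"
        using z cw cl j oc by (simp add: m_assoc)
    qed
    then show ?thesis using cl Cons.prems j cw oc by (simp add: m_assoc)
  qed
qed simp

end

end

definition expo :: "nat \<Rightarrow> nat \<Rightarrow> (nat \<Rightarrow> nat \<Rightarrow> nat) set" where
  "expo m n = {e. \<forall>i j. i \<notin> {1..m} \<or> j \<notin> {1..n} \<longrightarrow> e i j = 0}"

text \<open>The span of the ordered monomials contains 1 and is stable under left multiplication by
  generators, hence is everything. This is the rewriting half of the Poincare-Birkhoff-Witt theorem;
  independence will come from leading exponents.\<close>

theorem omon_spanning: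
  assumes R: "qalg R q" and Z: "qmat q {1..m} {1..n} R Z"
    and gen: "generates R {Z i j | i j. i \<in> {1..m} \<and> j \<in> {1..n}}"
    and rs: "distinct rs" "set rs = {1..m}" and x: "x \<in> carrier R"
  shows "\<exists>c. keys c \<subseteq> expo m n \<and> x = lin_ext R (qalg.omon R Z rs [1..<Suc n]) c"
proof -
  interpret R: qalg R q by fact
  let ?cs = "[1..<Suc n]"
  have cs: "sorted_wrt (<) ?cs" "set ?cs \<subseteq> {1..n}" by auto
  have base: "range (R.omon Z rs ?cs) \<subseteq> carrier R" using rs cs by (intro R.omon_base[OF Z]) auto
  let ?S = "R.vspan (range (R.omon Z rs ?cs))"
  have "\<forall>s\<in>?S. x \<otimes>\<^bsub>R\<^esub> s \<in> ?S"
    using R.kalg_axioms gen x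
  proof (induction rule: generates_induct)
    case (gen x)
    then obtain i j where ij: "x = Z i j" "i \<in> {1..m}" "j \<in> {1..n}" by blast
    show ?case
    proof
      fix s assume "s \<in> ?S"
      then show "x \<otimes>\<^bsub>R\<^esub> s \<in> ?S"
      proof (rule R.vspan_mult_left[OF _ base _ _ base])
        show "x \<in> carrier R" using ij qmat_closed[OF Z] by simp
        fix z assume "z \<in> range (R.omon Z rs ?cs)"
        then show "x \<otimes>\<^bsub>R\<^esub> z \<in> ?S" using R.gen_omon[OF Z rs cs ij(2), of j] ij by auto
      qed
    qed
  next
    case one
    then show ?case using R.vspan_closed[OF _ base] by simp
  next
    case (mult x y)
    then show ?case using R.vspan_closed[OF _ base] by (simp add: R.m_assoc)
  next
    case (add x y)
    then show ?case using R.vspan_closed[OF _ base] by (auto simp: R.l_distr intro!: R.vspan_add[OF _ _ base])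
  next
    case (smult c x)
    then show ?case using R.vspan_closed[OF _ base] by (auto simp: R.smult_mult_l intro!: R.vspan_smult[OF _ base])
  qed
  moreover have "\<one>\<^bsub>R\<^esub> \<in> ?S"
  proof -
    have "R.omon Z rs cs (\<lambda>_ _. 0) = \<one>\<^bsub>R\<^esub>" for cs
      by (induction cs) (simp_all add: R.wprod_simps[OF Z])
    then show ?thesis using R.vspan_base[OF _ base, of "\<one>\<^bsub>R\<^esub>"] by (metis rangeI)
  qed
  ultimately have "x \<in> ?S" using x by force
  moreover have "range (R.omon Z rs ?cs) = R.omon Z rs ?cs ` expo m n"
  proof (intro equalityI subsetI)
    fix z assume "z \<in> range (R.omon Z rs ?cs)"
    then obtain e where e: "z = R.omon Z rs ?cs e" by blast
    \<comment> \<open>Exponents outside the index range do not affect the monomial. Setting them to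
      0 makes the exponent matrix determined by its leading exponent.\<close>
    let ?e = "\<lambda>i j. if i \<in> {1..m} \<and> j \<in> {1..n} then e i j else 0"
    have "z = R.omon Z rs ?cs ?e" unfolding e using rs by (intro R.omon_cong) auto
    moreover have "?e \<in> expo m n" by (auto simp: expo_def)
    ultimately show "z \<in> R.omon Z rs ?cs ` expo m n" by blast
  qed auto
  ultimately have "x \<in> R.vspan (R.omon Z rs ?cs ` expo m n)" by simp
  then show ?thesis by (rule R.vspan_lin_ext) (use base in auto)
qed


lemma alg_hom_lprod:
  assumes R: "qalg R q" and S: "qalg S q'" and h: "h \<in> alg_hom R S" and xs: "set xs \<subseteq> carrier R"
  shows "h (qalg.lprod R xs) = qalg.lprod S (map h xs)"
proof -
  interpret R: qalg R q by fact
  interpret S: qalg S q' by fact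
  show ?thesis unfolding R.lprod_def S.lprod_def by (rule alg_hom_foldr[OF h R.kalg_axioms xs])
qed

lemma omon_alg_hom:
  assumes R: "qalg R q" and S: "qalg S q'" and h: "h \<in> alg_hom R S"
    and Z: "\<And>r j. r \<in> set rs \<Longrightarrow> j \<in> set cs \<Longrightarrow> Z r j \<in> carrier R"
  shows "h (qalg.omon R Z rs cs e) = qalg.omon S (\<lambda>r j. h (Z r j)) rs cs e"
proof -
  interpret R: qalg R q by fact
  interpret S: qalg S q' by fact
  have cl: "set (map (\<lambda>r. Z r j) (col_word rs (\<lambda>r. e r j))) \<subseteq> carrier R" if "j \<in> set cs" for j
    using that subsetD[OF set_col_word] by (auto intro!: Z)
  have w: "h (R.wprod Z j (col_word rs (\<lambda>r. e r j))) = S.wprod (\<lambda>r j. h (Z r j)) j (col_word rs (\<lambda>r. e r j))"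
    if "j \<in> set cs" for j
    unfolding R.wprod_def S.wprod_def alg_hom_lprod[OF R S h cl[OF that]] by (simp add: comp_def)
  have "set (map (\<lambda>j. R.wprod Z j (col_word rs (\<lambda>r. e r j))) cs) \<subseteq> carrier R"
    unfolding R.wprod_def set_map by (intro image_subsetI R.lprod_closed) (rule cl)
  from alg_hom_lprod[OF R S h this] w show ?thesis
    unfolding R.omon_def S.omon_def by (simp add: comp_def cong: map_cong)
qed

text \<open>\<open>U\<close> and \<open>\<phi>\<close> together define a morphism from the tensor
  product to \<open>R\<close>. Its composite with the coaction is \<open>\<Phi>\<close>, and its
  value at the tensor of 1 and \<open>f\<close> is \<open>\<phi> f\<close>. Coinvariance thus
  becomes an equation in \<open>R\<close> without tensor products.\<close>

lemma coinvariant_hom_eq: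
  fixes q :: "'k::field"
  assumes q: "q \<noteq> 0" and f: "f \<in> coinvariants (Oq_SL q m) (Oq_M q m n) (SL_coaction q m n)"
    and R: "qalg R q" and U: "qmat q {1..m} {1..m} R U" and det: "qalg.qminor R q m U (\<lambda>k. k) = \<one>\<^bsub>R\<^esub>"
    and \<phi>: "\<phi> \<in> alg_hom (Oq_M q m n) R" and \<Phi>: "\<Phi> \<in> alg_hom (Oq_M q m n) R"
    and comm: "\<And>i l r j. i \<in> {1..m} \<Longrightarrow> l \<in> {1..m} \<Longrightarrow> r \<in> {1..m} \<Longrightarrow> j \<in> {1..n} \<Longrightarrow>
      U i l \<otimes>\<^bsub>R\<^esub> \<phi> (Z_gen q m n r j) = \<phi> (Z_gen q m n r j) \<otimes>\<^bsub>R\<^esub> U i l"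
    and \<Phi>U: "\<And>i j. i \<in> {1..m} \<Longrightarrow> j \<in> {1..n} \<Longrightarrow>
      \<Phi> (Z_gen q m n i j) = (\<Oplus>\<^bsub>R\<^esub>l\<in>{1..m}. U i l \<otimes>\<^bsub>R\<^esub> \<phi> (Z_gen q m n l j))"
  shows "\<Phi> f = \<phi> f"
proof -
  let ?H = "Oq_SL q m" and ?A = "Oq_M q m n" and ?\<gamma> = "SL_coaction q m n"
  interpret R: qalg R q by fact
  interpret H: kalg ?H by (rule Oq_SL_kalg[OF q])
  have A: "kalg ?A" by (rule Oq_M_kalg)
  obtain \<pi> where \<pi>: "\<pi> \<in> alg_hom ?H R" "\<And>i j. i \<in> {1..m} \<Longrightarrow> j \<in> {1..m} \<Longrightarrow> \<pi> (U_gen q m i j) = U i j"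
    using Oq_SL_lift[OF q R U det] by blast
  have c: "\<pi> a \<otimes>\<^bsub>R\<^esub> \<phi> b = \<phi> b \<otimes>\<^bsub>R\<^esub> \<pi> a" if "a \<in> carrier ?H" "b \<in> carrier ?A" for a b
  proof (rule commute_from_generators[OF H.kalg_axioms A R.kalg_axioms Oq_SL_generates[OF q] Oq_M_generates \<pi>(1) \<phi> _ that])
    fix x y assume "x \<in> {U_gen q m i j |i j. i \<in> {1..m} \<and> j \<in> {1..m}}" "y \<in> {Z_gen q m n i j |i j. i \<in> {1..m} \<and> j \<in> {1..n}}"
    then obtain i l r j where "x = U_gen q m i l" "i \<in> {1..m}" "l \<in> {1..m}" "y = Z_gen q m n r j" "r \<in> {1..m}" "j \<in> {1..n}"
      by blast
    then show "\<pi> x \<otimes>\<^bsub>R\<^esub> \<phi> y = \<phi> y \<otimes>\<^bsub>R\<^esub> \<pi> x" using \<pi>(2) comm by simp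
  qed
  obtain h where h: "h \<in> alg_hom (tensor_algebra ?H ?A) R"
    "\<And>a b. a \<in> carrier ?H \<Longrightarrow> b \<in> carrier ?A \<Longrightarrow> h (pure_tensor ?H ?A a b) = \<pi> a \<otimes>\<^bsub>R\<^esub> \<phi> b"
    using tensor_lift[OF H.kalg_axioms A R.kalg_axioms \<pi>(1) \<phi> c] by blast
  have f': "f \<in> carrier ?A" "?\<gamma> f = pure_tensor ?H ?A \<one>\<^bsub>?H\<^esub> f" using f by (simp_all add: coinvariants_def)
  have "h (?\<gamma> f) = \<Phi> f"
  proof (rule Oq_M_hom_eqI[OF alg_hom_comp[OF SL_coaction_works(1)[OF q] h(1)] \<Phi> _ f'(1)])
    fix i j assume ij: "i \<in> {1..m}" "j \<in> {1..n}"
    let ?p = "\<lambda>l. pure_tensor ?H ?A (U_gen q m i l) (Z_gen q m n l j)"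
    have cl: "?p \<in> {1..m} \<rightarrow> carrier (tensor_algebra ?H ?A)"
      using ij by (auto intro!: pure_tensor_closed[OF H.kalg_axioms A] U_gen_closed[OF q] Z_gen_closed)
    have "h (?\<gamma> (Z_gen q m n i j)) = (\<Oplus>\<^bsub>R\<^esub>l\<in>{1..m}. h (?p l))"
      unfolding SL_coaction_works(2)[OF q ij]
      by (rule alg_hom_finsum[OF h(1) tensor_kalg[OF H.kalg_axioms A] R.kalg_axioms cl])
    also have "\<dots> = (\<Oplus>\<^bsub>R\<^esub>l\<in>{1..m}. U i l \<otimes>\<^bsub>R\<^esub> \<phi> (Z_gen q m n l j))"
      using ij by (intro R.finsum_cong' refl)
        (auto simp: h(2) \<pi>(2) U_gen_closed[OF q] Z_gen_closed qmat_closed[OF U] alg_homD(1)[OF \<phi>])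
    finally show "h (?\<gamma> (Z_gen q m n i j)) = \<Phi> (Z_gen q m n i j)" using \<Phi>U[OF ij] by simp
  qed
  moreover have "h (?\<gamma> f) = \<phi> f"
    using f' h(2)[OF H.one_closed f'(1)] alg_homD(4)[OF \<pi>(1)] alg_homD(1)[OF \<phi> f'(1)] by simp
  ultimately show ?thesis by simp
qed


section \<open>How leading exponents depend on the exponent matrix\<close>

section \<open>Leading exponents of monomials\<close>

text \<open>Row i enters at position i and column j leaves at position m + j. Every column thus lies
  above every row, m + n steps suffice for the longest path, and no entry vanishes. The variable
  \<open>(0, 1, 2)\<close> counts the factors.\<close>

definition wexp :: "nat \<Rightarrow> nat \<Rightarrow> nat \<Rightarrow> nat \<Rightarrow> texp" where
  "wexp m n i j = single (0, 1, 2) 1 + path_exp (m + n) i (m + j)"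

definition mexp :: "nat \<Rightarrow> nat \<Rightarrow> (nat \<Rightarrow> nat \<Rightarrow> nat) \<Rightarrow> texp" where
  "mexp m n e = (\<Sum>i\<in>{1..m}. \<Sum>j\<in>{1..n}. \<Sum>k<e i j. wexp m n i j)"

lemma lookup_mexp:
  "lookup (mexp m n e) x = (\<Sum>i\<in>{1..m}. \<Sum>j\<in>{1..n}. int (e i j) * lookup (wexp m n i j) x)"
  by (simp add: mexp_def lookup_sum)

lemma lookup_wexp:
  "lookup (wexp m n i j) (p, t, f) = (if p = 0 \<and> t = 1 \<and> f = 2 then 1
     else if 3 \<le> t \<and> t - 3 < m + n \<and> (f = 0 \<and> p = i + (t - 3) \<and> p < m + j \<or> f = 1 \<and> p = m + j \<and> m + j \<le> i + (t - 3))
     then 1 else 0)"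
  by (auto simp: wexp_def lookup_add lookup_path_exp lookup_single when_def)

lemma mexp_inj:
  assumes e: "e \<in> expo m n" "e' \<in> expo m n" and eq: "mexp m n e = mexp m n e'"
  shows "e = e'"
proof (intro ext)
  fix i j
  show "e i j = e' i j"
  proof (cases "i \<in> {1..m} \<and> j \<in> {1..n}")
    case True
    \<comment> \<open>At this time a path from row i waits at \<open>m + j\<close> exactly if
      \<open>r \<le> i\<close>, so the coefficient is a tail sum of column \<open>j\<close>, and
      differences of consecutive tail sums give the entries. \<open>Suc m\<close> is allowed for
      \<open>r\<close> because the last entry is compared with the empty tail.\<close>
    have tail: "lookup (mexp m n e) (m + j, m + j - r + 3, 1) = (\<Sum>i\<in>{1..m}. if r \<le> i then int (e i j) else 0)"
      if "1 \<le> r" "r \<le> Suc m" for r e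
    proof -
      have "lookup (mexp m n e) (m + j, m + j - r + 3, 1) =
        (\<Sum>i\<in>{1..m}. \<Sum>l\<in>{1..n}. if l = j then (if r \<le> i then int (e i l) else 0) else 0)"
        unfolding lookup_mexp using True that by (intro sum.cong refl) (auto simp: lookup_wexp)
      then show ?thesis using True by (simp add: sum.delta)
    qed
    have split: "(\<Sum>k\<in>{1..m}. if i \<le> k then int (e k j) else 0) =
      int (e i j) + (\<Sum>k\<in>{1..m}. if Suc i \<le> k then int (e k j) else 0)" for e :: "nat \<Rightarrow> nat \<Rightarrow> nat"
    proof -
      have "(\<Sum>k\<in>{1..m}. if i \<le> k then int (e k j) else 0) =
        (\<Sum>k\<in>{1..m}. (if k = i then int (e k j) else 0) + (if Suc i \<le> k then int (e k j) else 0))"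
        by (intro sum.cong) auto
      then show ?thesis using True by (simp add: sum.distrib sum.delta)
    qed
    have "int (e i j) = int (e' i j)"
      using tail[of i e] tail[of i e'] tail[of "Suc i" e] tail[of "Suc i" e'] True eq split[of e] split[of e'] by simp
    then show ?thesis by simp
  next
    case False
    then show ?thesis using e by (auto simp: expo_def)
  qed
qed

definition degree_of :: "nat \<Rightarrow> nat \<Rightarrow> (nat \<Rightarrow> nat \<Rightarrow> nat) \<Rightarrow> nat" where
  "degree_of m n e = (\<Sum>i\<in>{1..m}. \<Sum>j\<in>{1..n}. e i j)"

text \<open>The variable \<open>(0, 1, 2)\<close> precedes all path variables of these monomials,
  which have positive positions; so the degree is compared first.\<close>

lemma mexp_less_degree:
  assumes "degree_of m n e' < degree_of m n e"
  shows "mexp m n e' < mexp m n e"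
proof (rule texp_lessI[of _ "(0, 1, 2)"])
  have *: "lookup (mexp m n e) (0, 1, 2) = int (degree_of m n e)" for e
    unfolding lookup_mexp degree_of_def of_nat_sum by (intro sum.cong refl) (simp add: lookup_wexp)
  show "lookup (mexp m n e') (0, 1, 2) < lookup (mexp m n e) (0, 1, 2)" using assms unfolding * by simp
  fix y :: tvar assume "y < (0, 1, 2)"
  moreover obtain p t f where "y = (p, t, f)" by (rule prod_cases3)
  ultimately have "y = (0, t, f)" "t < 1 \<or> t = 1 \<and> f < 2" by auto
  then have "lookup (wexp m n i j) y = 0" for i j by (auto simp: lookup_wexp)
  then show "lookup (mexp m n e') y = lookup (mexp m n e) y" by (simp add: lookup_mexp)
qed

text \<open>For equal row sums, exponent matrices are read column by column from the left and from
  the last row upwards, and the smaller entry at the first difference gives the larger leading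
  exponent.\<close>

lemma mexp_less:
  assumes rows: "\<And>i. i \<in> {1..m} \<Longrightarrow> (\<Sum>j\<in>{1..n}. e i j) = (\<Sum>j\<in>{1..n}. e' i j)"
    and cols: "\<And>i j. i \<in> {1..m} \<Longrightarrow> 1 \<le> j \<Longrightarrow> j < l \<Longrightarrow> e i j = e' i j"
    and col: "\<And>i. i \<in> {1..m} \<Longrightarrow> r < i \<Longrightarrow> e i l = e' i l"
    and less: "e r l < e' r l" and rl: "r \<in> {1..m}" "l \<in> {1..n}"
  shows "mexp m n e' < mexp m n e"
\<comment> \<open>This variable is the move out of position \<open>m + l\<close> made by the paths
  from row \<open>r\<close>. Its coefficient counts the factors of row \<open>r\<close> in the
  columns beyond \<open>l\<close>, which is larger when fewer factors lie in columns up to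
  \<open>l\<close>.\<close>
proof (rule texp_lessI[of _ "(m + l, m + l - r + 3, 0)"])
  have split: "(\<Sum>j\<in>{1..n}. int (e i j)) =
    (\<Sum>j\<in>{1..n}. if j \<le> d then int (e i j) else 0) + (\<Sum>j\<in>{1..n}. if d < j then int (e i j) else 0)"
    for d i and e :: "nat \<Rightarrow> nat \<Rightarrow> nat"
    unfolding sum.distrib[symmetric] by (intro sum.cong) auto
  have rows': "(\<Sum>j\<in>{1..n}. int (e i j)) = (\<Sum>j\<in>{1..n}. int (e' i j))" if "i \<in> {1..m}" for i
    unfolding of_nat_sum[symmetric] using rows[OF that] by simp
  have tail: "(\<Sum>j\<in>{1..n}. if d < j then int (e i j) else 0) = (\<Sum>j\<in>{1..n}. if d < j then int (e' i j) else 0)"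
    if "i \<in> {1..m}" "\<And>j. 1 \<le> j \<Longrightarrow> j \<le> d \<Longrightarrow> e i j = e' i j" for i d
  proof -
    have "(\<Sum>j\<in>{1..n}. if j \<le> d then int (e i j) else 0) = (\<Sum>j\<in>{1..n}. if j \<le> d then int (e' i j) else 0)"
      using that by (intro sum.cong) auto
    then show ?thesis using split[where e = e and i = i and d = d] split[where e = e' and i = i and d = d] rows'[OF that(1)] by simp
  qed
  have lk: "lookup (mexp m n e) (m + l, m + l - r + 3, 0) = (\<Sum>j\<in>{1..n}. if l < j then int (e r j) else 0)"
    for e :: "nat \<Rightarrow> nat \<Rightarrow> nat"
  proof -
    have "lookup (mexp m n e) (m + l, m + l - r + 3, 0) =
      (\<Sum>i\<in>{1..m}. if i = r then (\<Sum>j\<in>{1..n}. if l < j then int (e i j) else 0) else 0)"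
      unfolding lookup_mexp
    proof (intro sum.cong refl)
      fix i assume "i \<in> {1..m}"
      show "(\<Sum>j\<in>{1..n}. int (e i j) * lookup (wexp m n i j) (m + l, m + l - r + 3, 0)) =
        (if i = r then (\<Sum>j\<in>{1..n}. if l < j then int (e i j) else 0) else 0)"
        using rl by (auto simp: lookup_wexp intro!: sum.cong sum.neutral)
    qed
    then show ?thesis using rl by (simp add: sum.delta)
  qed
  have "(\<Sum>j\<in>{1..n}. if j \<le> l then int (e r j) else 0) < (\<Sum>j\<in>{1..n}. if j \<le> l then int (e' r j) else 0)"
  proof (rule sum_strict_mono_ex1)
    show "\<forall>x\<in>{1..n}. (if x \<le> l then int (e r x) else 0) \<le> (if x \<le> l then int (e' r x) else 0)"
      using cols[OF rl(1)] less by (auto simp: le_less)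
    show "\<exists>a\<in>{1..n}. (if a \<le> l then int (e r a) else 0) < (if a \<le> l then int (e' r a) else 0)"
      using rl less by (intro bexI[of _ l]) auto
  qed simp
  then show "lookup (mexp m n e') (m + l, m + l - r + 3, 0) < lookup (mexp m n e) (m + l, m + l - r + 3, 0)"
    unfolding lk using split[where e = e and i = r and d = l] split[where e = e' and i = r and d = l] rows'[OF rl(1)] by simp
  fix y :: tvar assume y: "y < (m + l, m + l - r + 3, 0)"
  obtain p t f where ptf: "y = (p, t, f)" by (rule prod_cases3)
  have pt: "p < m + l \<or> p = m + l \<and> t < m + l - r + 3" using y ptf by auto
  show "lookup (mexp m n e') y = lookup (mexp m n e) y"
  proof (cases "3 \<le> t \<and> t - 3 < m + n")
    case False
    then have "lookup (wexp m n i j) y = (if y = (0, 1, 2) then 1 else 0)" for i j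
      by (auto simp: ptf lookup_wexp)
    moreover have "(\<Sum>j\<in>{1..n}. int (e' i j) * c) = (\<Sum>j\<in>{1..n}. int (e i j) * c)" if "i \<in> {1..m}" for i c
      unfolding sum_distrib_right[symmetric] using rows'[OF that] by simp
    ultimately show ?thesis unfolding lookup_mexp by (intro sum.cong[of "{1..m}"] refl) (simp only:)
  next
    case True
    show ?thesis unfolding lookup_mexp
    proof (rule sum.cong[OF refl])
      fix i assume i: "i \<in> {1..m}"
      consider "f = 0" "p = i + (t - 3)" | "f = 1" | "\<not> (f = 0 \<and> p = i + (t - 3))" "f \<noteq> 1" by blast
      then show "(\<Sum>j\<in>{1..n}. int (e' i j) * lookup (wexp m n i j) y) = (\<Sum>j\<in>{1..n}. int (e i j) * lookup (wexp m n i j) y)"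
      proof cases
        case 1
        have "(\<Sum>j\<in>{1..n}. int (e i j) * lookup (wexp m n i j) y) = (\<Sum>j\<in>{1..n}. if p - m < j then int (e i j) else 0)"
          if "m \<le> p" for e :: "nat \<Rightarrow> nat \<Rightarrow> nat"
          using True 1 that by (intro sum.cong refl) (auto simp: ptf lookup_wexp)
        moreover have "(\<Sum>j\<in>{1..n}. int (e i j) * lookup (wexp m n i j) y) = (\<Sum>j\<in>{1..n}. int (e i j))"
          if "p < m" for e :: "nat \<Rightarrow> nat \<Rightarrow> nat"
          using True 1 that by (intro sum.cong refl) (auto simp: ptf lookup_wexp)
        moreover have "(\<Sum>j\<in>{1..n}. if p - m < j then int (e i j) else 0) = (\<Sum>j\<in>{1..n}. if p - m < j then int (e' i j) else 0)"
          if "m \<le> p"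
        proof (rule tail[OF i])
          fix j assume j: "1 \<le> j" "j \<le> p - m"
          show "e i j = e' i j"
          proof (cases "j < l")
            case True
            then show ?thesis using cols[OF i j(1)] by simp
          next
            case False
            \<comment> \<open>At position \<open>m + l\<close> only earlier times remain, and a move
              at an earlier time belongs to a path from a row greater than \<open>r\<close>.\<close>
            then have "j = l" "p = m + l" using j pt that by auto
            moreover from this have "r < i" using pt 1 True rl by auto
            ultimately show ?thesis using col[OF i] by simp
          qed
        qed
        ultimately show ?thesis using rows'[OF i] by (cases "m \<le> p") simp_all
      next
        case 2
        show ?thesis
        proof (intro sum.cong refl)
          fix j assume j: "j \<in> {1..n}"
          show "int (e' i j) * lookup (wexp m n i j) y = int (e i j) * lookup (wexp m n i j) y"
          proof (cases "p = m + j \<and> m + j \<le> i + (t - 3)")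
            case True
            then have "j < l \<or> j = l \<and> r < i" using pt rl \<open>3 \<le> t \<and> t - 3 < m + n\<close> by auto
            then show ?thesis using cols[OF i, of j] col[OF i] j by auto
          next
            case False
            then have "lookup (wexp m n i j) y = 0" using 2 by (simp add: ptf lookup_wexp)
            then show ?thesis by simp
          qed
        qed
      next
        case 3
        then have "lookup (wexp m n i j) y = 0" for j using True by (auto simp: ptf lookup_wexp)
        then show ?thesis by simp
      qed
    qed
  qed
qed

context
  fixes q :: "'k::field"
  assumes q: "q \<noteq> 0"
begin

interpretation T: qalg "torus q" q by (rule torus_qalg[OF q])

lemma lead_lprod:
  "(\<And>z. z \<in> set zs \<Longrightarrow> lead (F z) (u z)) \<Longrightarrow> lead (T.lprod (map F zs)) (sum_list (map u zs))"
proof (induction zs)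
  case Nil
  then show ?case using lead_single[of "1::'k" 0] by simp
next
  case (Cons z zs)
  then show ?case using lead_mult[OF q, of "F z" "u z" "T.lprod (map F zs)"] by simp
qed

lemma sum_list_col_word:
  "distinct rs \<Longrightarrow> sum_list (map u (col_word rs \<epsilon>)) = (\<Sum>r\<in>set rs. \<Sum>k<\<epsilon> r. u r)" for u :: "nat \<Rightarrow> texp"
proof (induction rs)
  case (Cons r rs)
  have "sum_list (map u (replicate k r)) = (\<Sum>i<k. u r)" for k
    by (induction k) (simp_all add: add.commute)
  then show ?case using Cons by simp
qed simp

lemma lead_omon:
  assumes "distinct rs" "distinct cs"
    and X: "\<And>r j. r \<in> set rs \<Longrightarrow> j \<in> set cs \<Longrightarrow> lead (X r j) (w r j)"
  shows "lead (T.omon X rs cs e) (\<Sum>r\<in>set rs. \<Sum>j\<in>set cs. \<Sum>k<e r j. w r j)"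
proof -
  have "lead (T.wprod X j (col_word rs (\<lambda>r. e r j))) (\<Sum>r\<in>set rs. \<Sum>k<e r j. w r j)" if "j \<in> set cs" for j
    unfolding T.wprod_def sum_list_col_word[OF assms(1), symmetric]
    using set_col_word[of rs "\<lambda>r. e r j"] that by (intro lead_lprod X) auto
  then have "lead (T.omon X rs cs e) (sum_list (map (\<lambda>j. \<Sum>r\<in>set rs. \<Sum>k<e r j. w r j) cs))"
    unfolding T.omon_def by (intro lead_lprod)
  also have "sum_list (map (\<lambda>j. \<Sum>r\<in>set rs. \<Sum>k<e r j. w r j) cs) = (\<Sum>j\<in>set cs. \<Sum>r\<in>set rs. \<Sum>k<e r j. w r j)"
    using assms(2) by (rule sum_list_distinct_conv_sum_set)
  also have "\<dots> = (\<Sum>r\<in>set rs. \<Sum>j\<in>set cs. \<Sum>k<e r j. w r j)" by (rule sum.swap)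
  finally show ?thesis .
qed

end


section \<open>Torus representations related by row operations in two adjacent rows\<close>

section \<open>Representations by block matrices\<close>

lemma tsupp_one: "1 \<in> tsupp S"
  by (simp add: tsupp_def)

lemma tsupp_sum: "(\<And>x. x \<in> X \<Longrightarrow> F x \<in> tsupp S) \<Longrightarrow> sum F X \<in> tsupp S"
  by (induction X rule: infinite_finite_induct) (auto simp: tsupp_zero intro!: tsupp_add)

context qalg
begin

text \<open>The generic upper triangular element of the i-th copy of \<open>SL_2\<close>, acting in
  rows \<open>i\<close> and \<open>Suc i\<close>.\<close>

definition block :: "nat \<Rightarrow> 'a \<Rightarrow> 'a \<Rightarrow> 'a \<Rightarrow> nat \<Rightarrow> nat \<Rightarrow> 'a" where
  "block i x y x' r s = (if s = r then (if r = i then x else if r = Suc i then x' else \<one>)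
     else if s = Suc r then (if r = i then y else \<zero>) else \<zero>)"

lemma block_qmat:
  assumes [simp]: "x \<in> carrier R" "y \<in> carrier R" "x' \<in> carrier R"
    and [simp]: "x \<otimes> y = q \<odot> (y \<otimes> x)" "y \<otimes> x' = q \<odot> (x' \<otimes> y)" "x \<otimes> x' = x' \<otimes> x"
  shows "qmat q I J R (block i x y x')"
proof -
  have "qmat q I J R (\<lambda>r s. if s = r then (if r = i then x else if r = Suc i then x' else \<one>)
     else if s = Suc r then (if r = i then y else \<zero>) else \<zero>)"
    by (rule qmat_bidiagonal) auto
  then show ?thesis unfolding block_def[abs_def] .
qed

lemma lprod_ones: "(\<And>z. z \<in> set xs \<Longrightarrow> F z = \<one>) \<Longrightarrow> lprod (map F xs) = \<one>"
  by (induction xs) auto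

lemma block_qminor:
  assumes cl: "x \<in> carrier R" "y \<in> carrier R" "x' \<in> carrier R" and i: "1 \<le> i" "i < m" and one: "x \<otimes> x' = \<one>"
  shows "qminor m (block i x y x') (\<lambda>k. k) = \<one>"
proof -
  have "qminor m (block i x y x') (\<lambda>k. k) = lprod (map (\<lambda>r. block i x y x' r r) [1..<Suc m])"
    by (rule qminor_triangular) (auto simp: block_def cl)
  also have "\<dots> = lprod (map (\<lambda>r. block i x y x' r r) [1..<i]) \<otimes> (block i x y x' i i \<otimes> block i x y x' (Suc i) (Suc i)) \<otimes>
    lprod (map (\<lambda>r. block i x y x' r r) [Suc (Suc i)..<Suc m])"
    by (rule lprod_split_at[OF i]) (auto simp: block_def cl)
  also have "\<dots> = \<one>"
    using cl by (subst (1 2) lprod_ones) (auto simp: block_def one)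
  finally show ?thesis .
qed

end

definition path_mat :: "'k::field \<Rightarrow> nat \<Rightarrow> nat \<Rightarrow> nat \<Rightarrow> nat \<Rightarrow> (texp \<Rightarrow>\<^sub>0 'k)" where
  "path_mat q m n i j = tmon (0, 1, 2) 1 \<otimes>\<^bsub>torus q\<^esub> net q (m + n) i (m + j)"

text \<open>
  Row operations on a representation \<^term>\<open>path_mat\<close>: \<open>\<phi>\<close> multiplies it by a lower block matrix
  at time 0 and \<open>\<Phi>\<close> multiplies \<open>\<phi>\<close> by an upper block matrix at time 2.
\<close>

locale torus_reps =
  fixes q :: "'k::field" and m n i :: nat and \<theta> \<phi> \<Phi> :: "((nat \<times> nat) list \<Rightarrow>\<^sub>0 'k) set \<Rightarrow> texp \<Rightarrow>\<^sub>0 'k"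
  assumes q: "q \<noteq> 0" and i: "1 \<le> i" "i < m"
    and \<theta>: "\<theta> \<in> alg_hom (Oq_M q m n) (torus q)"
    and \<phi>: "\<phi> \<in> alg_hom (Oq_M q m n) (torus q)"
    and \<Phi>: "\<Phi> \<in> alg_hom (Oq_M q m n) (torus q)"
    and \<theta>_Z: "\<And>r j. r \<in> {1..m} \<Longrightarrow> j \<in> {1..n} \<Longrightarrow> \<theta> (Z_gen q m n r j) = path_mat q m n r j"
    and \<phi>_Z: "\<And>r j. r \<in> {1..m} \<Longrightarrow> j \<in> {1..n} \<Longrightarrow> \<phi> (Z_gen q m n r j) =
      (if r = i then tmon (0, 0, 1) (- 1) \<otimes>\<^bsub>torus q\<^esub> path_mat q m n i j
       else if r = Suc i then tmon (0, 0, 0) (- 1) \<otimes>\<^bsub>torus q\<^esub> path_mat q m n i j +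
         tmon (0, 0, 1) 1 \<otimes>\<^bsub>torus q\<^esub> path_mat q m n (Suc i) j
       else path_mat q m n r j)"
    and \<Phi>_Z: "\<And>r j. r \<in> {1..m} \<Longrightarrow> j \<in> {1..n} \<Longrightarrow> \<Phi> (Z_gen q m n r j) =
      (if r = i then tmon (0, 2, 1) 1 \<otimes>\<^bsub>torus q\<^esub> \<phi> (Z_gen q m n i j) +
         tmon (0, 2, 0) 1 \<otimes>\<^bsub>torus q\<^esub> \<phi> (Z_gen q m n (Suc i) j)
       else if r = Suc i then tmon (0, 2, 1) (- 1) \<otimes>\<^bsub>torus q\<^esub> \<phi> (Z_gen q m n (Suc i) j)
       else \<phi> (Z_gen q m n r j))"

context
  fixes q :: "'k::field" and m n :: nat
  assumes q: "q \<noteq> 0"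
begin

interpretation T: qalg "torus q" q by (rule torus_qalg[OF q])

text \<open>The degree variable has third component 2, on which \<open>vform\<close> vanishes, so it
  commutes with everything. It enters as a scalar diagonal matrix in front of the path
  network.\<close>

lemma path_mat_qmat: "qmat q {1..m} {1..n} (torus q) (path_mat q m n)"
proof -
  have N: "qmat q {1..m} {1..n} (torus q) (\<lambda>i j. net q (m + n) i (m + j))"
    by (rule qmat_reindex[OF net_qmat[OF q, of "m + n"], of "{1..m}" "\<lambda>i. i" "{1..n}" "\<lambda>j. m + j"])
      (auto simp: strict_mono_on_def)
  have D: "qmat q {1..m} {1..m} (torus q)
    (\<lambda>i j. if j = i then tmon (0, 1, 2) 1 else if j = Suc i then \<zero>\<^bsub>torus q\<^esub> else \<zero>\<^bsub>torus q\<^esub>)"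
    by (rule T.qmat_bidiagonal) (auto simp: torus_lr_distr)
  let ?W = "\<lambda>i j. \<Oplus>\<^bsub>torus q\<^esub>l\<in>{1..m}. (if l = i then tmon (0, 1, 2) 1 else if l = Suc i then \<zero>\<^bsub>torus q\<^esub> else \<zero>\<^bsub>torus q\<^esub>)
    \<otimes>\<^bsub>torus q\<^esub> net q (m + n) l (m + j)"
  have "qmat q {1..m} {1..n} (torus q) ?W"
  proof (rule T.qmat_product[OF D N])
    fix i a b j
    have "(if a = i then tmon (0, 1, 2) 1 else if a = Suc i then \<zero>\<^bsub>torus q\<^esub> else \<zero>\<^bsub>torus q\<^esub>) \<in> tsupp {1}"
      by (auto simp: tsupp_zero intro: tmon_tsupp)
    then show "(if a = i then tmon (0, 1, 2) 1 else if a = Suc i then \<zero>\<^bsub>torus q\<^esub> else \<zero>\<^bsub>torus q\<^esub>) \<otimes>\<^bsub>torus q\<^esub> net q (m + n) b (m + j) =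
      net q (m + n) b (m + j) \<otimes>\<^bsub>torus q\<^esub> (if a = i then tmon (0, 1, 2) 1 else if a = Suc i then \<zero>\<^bsub>torus q\<^esub> else \<zero>\<^bsub>torus q\<^esub>)"
      by (rule tsupp_commute[OF _ net_tsupp]) auto
  qed simp
  moreover have "?W i j = path_mat q m n i j" if "i \<in> {1..m}" for i j
  proof -
    have "?W i j = (\<Sum>l\<in>{1..m}. if l = i then path_mat q m n l j else 0)"
      unfolding torus_finsum[OF q] by (intro sum.cong refl) (auto simp: path_mat_def torus_lr_distr)
    then show ?thesis using that by (simp add: sum.delta)
  qed
  ultimately show ?thesis using qmat_cong[of "{1..m}" "{1..n}" ?W "path_mat q m n" q "torus q"] by blast
qed

lemma path_mat_tsupp: "path_mat q m n i j \<in> tsupp ({1} \<union> {3..})"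
  unfolding path_mat_def by (intro tsupp_mult tmon_tsupp tsupp_mono[OF _ net_tsupp]) auto

lemma lead_path_mat:
  assumes "i \<in> {1..m}" "j \<in> {1..n}"
  shows "lead (path_mat q m n i j) (wexp m n i j)"
  unfolding path_mat_def wexp_def
  using lead_net[OF q, of i "m + j" "m + n"] assms by (intro lead_mult[OF q]) (auto simp: tmon_def lead_single)

lemma block_sum:
  fixes X :: "nat \<Rightarrow> texp \<Rightarrow>\<^sub>0 'k"
  assumes i: "1 \<le> i" "i < m" and r: "r \<in> {1..m}"
  shows "(\<Oplus>\<^bsub>torus q\<^esub>s\<in>{1..m}. T.block i x y x' r s \<otimes>\<^bsub>torus q\<^esub> X s) =
      (if r = i then x \<otimes>\<^bsub>torus q\<^esub> X i + y \<otimes>\<^bsub>torus q\<^esub> X (Suc i)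
       else if r = Suc i then x' \<otimes>\<^bsub>torus q\<^esub> X (Suc i) else X r)" (is "?S = _")
    and "(\<Oplus>\<^bsub>torus q\<^esub>s\<in>{1..m}. T.block i x y x' s r \<otimes>\<^bsub>torus q\<^esub> X s) =
      (if r = i then x \<otimes>\<^bsub>torus q\<^esub> X i else if r = Suc i then y \<otimes>\<^bsub>torus q\<^esub> X i + x' \<otimes>\<^bsub>torus q\<^esub> X (Suc i) else X r)"
      (is "?S' = _")
proof -
  have one: "1 \<otimes>\<^bsub>torus q\<^esub> z = z" for z using T.l_one[of z] by simp
  have "?S = (\<Sum>s\<in>(if r = i then {i, Suc i} else {r}). T.block i x y x' r s \<otimes>\<^bsub>torus q\<^esub> X s)"
    unfolding torus_finsum[OF q] using i r
    by (intro sum.mono_neutral_right) (auto simp: T.block_def torus_lr_distr)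
  then show "?S = (if r = i then x \<otimes>\<^bsub>torus q\<^esub> X i + y \<otimes>\<^bsub>torus q\<^esub> X (Suc i)
       else if r = Suc i then x' \<otimes>\<^bsub>torus q\<^esub> X (Suc i) else X r)"
    by (auto simp: T.block_def one)
  have "?S' = (\<Sum>s\<in>(if r = Suc i then {i, Suc i} else {r}). T.block i x y x' s r \<otimes>\<^bsub>torus q\<^esub> X s)"
    unfolding torus_finsum[OF q] using i r
    by (intro sum.mono_neutral_right) (auto simp: T.block_def torus_lr_distr)
  then show "?S' = (if r = i then x \<otimes>\<^bsub>torus q\<^esub> X i
      else if r = Suc i then y \<otimes>\<^bsub>torus q\<^esub> X i + x' \<otimes>\<^bsub>torus q\<^esub> X (Suc i) else X r)"
    by (auto simp: T.block_def one)
qed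

text \<open>Inverting both variables preserves their q-commutation. The lower block uses exponent
  -1: its off-diagonal entry then has a negative power of \<open>(0, 0, 0)\<close>, the smallest
  variable, and cannot contribute to leading exponents.\<close>

lemma block_torus_qmat:
  assumes "c = 1 \<or> c = - 1"
  shows "qmat q I J (torus q) (T.block i (tmon (0, t, 1) c) (tmon (0, t, 0) c) (tmon (0, t, 1) (- c)))"
proof (rule T.block_qmat)
  show "tmon (0, t, 1) c \<otimes>\<^bsub>torus q\<^esub> tmon (0, t, 0) c = q \<odot>\<^bsub>torus q\<^esub> (tmon (0, t, 0) c \<otimes>\<^bsub>torus q\<^esub> tmon (0, t, 1) c)"
    using assms tmon_q_commute[OF q, of c c "(0, t, 1)" "(0, t, 0)" 1] by (auto simp: vform_def)
  show "tmon (0, t, 0) c \<otimes>\<^bsub>torus q\<^esub> tmon (0, t, 1) (- c) = q \<odot>\<^bsub>torus q\<^esub> (tmon (0, t, 1) (- c) \<otimes>\<^bsub>torus q\<^esub> tmon (0, t, 0) c)"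
    using assms tmon_q_commute[OF q, of c "- c" "(0, t, 0)" "(0, t, 1)" 1] by (auto simp: vform_def)
qed (auto intro!: tmon_commute)

lemma block_torus_tsupp: "T.block i (tmon (0, t, 1) c) (tmon (0, t, 0) c) (tmon (0, t, 1) (- c)) r s \<in> tsupp {t}"
  by (auto simp: T.block_def tsupp_zero tsupp_one intro!: tmon_tsupp)

lemma torus_rep_exists:
  obtains \<theta> where "\<theta> \<in> alg_hom (Oq_M q m n) (torus q)"
    "\<And>r j. r \<in> {1..m} \<Longrightarrow> j \<in> {1..n} \<Longrightarrow> \<theta> (Z_gen q m n r j) = path_mat q m n r j"
  using Oq_M_lift[OF T.qalg_axioms path_mat_qmat] by blast

text \<open>The lower block has time 0, the upper block time 2, and the path matrix time 1 and times
  from 3 on, so all these products are quantum matrices. The upper block has determinant 1 and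
  commutes with the values of \<open>\<phi>\<close>, as \<open>coinvariant_hom_eq\<close>
  requires.\<close>

lemma torus_reps_exist:
  assumes i: "1 \<le> i" "i < m" and \<theta>: "\<theta> \<in> alg_hom (Oq_M q m n) (torus q)"
    "\<And>r j. r \<in> {1..m} \<Longrightarrow> j \<in> {1..n} \<Longrightarrow> \<theta> (Z_gen q m n r j) = path_mat q m n r j"
  obtains \<phi> \<Phi> where "torus_reps q m n i \<theta> \<phi> \<Phi>"
    "\<And>f. f \<in> coinvariants (Oq_SL q m) (Oq_M q m n) (SL_coaction q m n) \<Longrightarrow> \<Phi> f = \<phi> f"
proof -
  let ?L = "T.block i (tmon (0, 0, 1) (- 1)) (tmon (0, 0, 0) (- 1)) (tmon (0, 0, 1) (- (- 1)))"
  let ?U = "T.block i (tmon (0, 2, 1) 1) (tmon (0, 2, 0) 1) (tmon (0, 2, 1) (- 1))"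
  let ?X = "\<lambda>r j. \<Oplus>\<^bsub>torus q\<^esub>s\<in>{1..m}. ?L s r \<otimes>\<^bsub>torus q\<^esub> path_mat q m n s j"
  let ?Y = "\<lambda>r j. \<Oplus>\<^bsub>torus q\<^esub>s\<in>{1..m}. ?U r s \<otimes>\<^bsub>torus q\<^esub> ?X s j"
  have L: "qmat q {1..m} {1..m} (torus q) (\<lambda>r s. ?L s r)"
    by (rule T.qmat_transpose[OF block_torus_qmat]) simp
  have X: "qmat q {1..m} {1..n} (torus q) ?X"
  proof (rule T.qmat_product[OF L path_mat_qmat])
    show "?L b a \<otimes>\<^bsub>torus q\<^esub> path_mat q m n c j = path_mat q m n c j \<otimes>\<^bsub>torus q\<^esub> ?L b a" for a b c j
      by (rule tsupp_commute[OF block_torus_tsupp path_mat_tsupp]) auto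
  qed simp
  have U: "qmat q {1..m} {1..m} (torus q) ?U" by (rule block_torus_qmat) simp
  have Xs: "?X r j \<in> tsupp ({0, 1} \<union> {3..})" for r j
    unfolding torus_finsum[OF q]
    by (intro tsupp_sum tsupp_mult tsupp_mono[OF _ block_torus_tsupp] tsupp_mono[OF _ path_mat_tsupp]) auto
  have UX: "?U a b \<otimes>\<^bsub>torus q\<^esub> ?X c j = ?X c j \<otimes>\<^bsub>torus q\<^esub> ?U a b" for a b c j
    by (rule tsupp_commute[OF block_torus_tsupp Xs]) auto
  have Y: "qmat q {1..m} {1..n} (torus q) ?Y"
    by (rule T.qmat_product[OF U X]) (simp_all only: UX finite_atLeastAtMost)
  obtain \<phi> where \<phi>: "\<phi> \<in> alg_hom (Oq_M q m n) (torus q)"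
    "\<And>r j. r \<in> {1..m} \<Longrightarrow> j \<in> {1..n} \<Longrightarrow> \<phi> (Z_gen q m n r j) = ?X r j"
    by (rule Oq_M_lift[OF T.qalg_axioms X]) (rule that)
  obtain \<Phi> where \<Phi>: "\<Phi> \<in> alg_hom (Oq_M q m n) (torus q)"
    "\<And>r j. r \<in> {1..m} \<Longrightarrow> j \<in> {1..n} \<Longrightarrow> \<Phi> (Z_gen q m n r j) = ?Y r j"
    by (rule Oq_M_lift[OF T.qalg_axioms Y]) (rule that)
  have \<Phi>U: "\<Phi> (Z_gen q m n r j) = (\<Oplus>\<^bsub>torus q\<^esub>s\<in>{1..m}. ?U r s \<otimes>\<^bsub>torus q\<^esub> \<phi> (Z_gen q m n s j))"
    if "r \<in> {1..m}" "j \<in> {1..n}" for r j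
    unfolding \<Phi>(2)[OF that] by (rule T.finsum_cong') (use \<phi>(2) that in auto)
  show ?thesis
  proof (rule that)
    show "torus_reps q m n i \<theta> \<phi> \<Phi>"
    proof
      fix r j assume rj: "r \<in> {1..m}" "j \<in> {1..n}"
      show "\<phi> (Z_gen q m n r j) = (if r = i then tmon (0, 0, 1) (- 1) \<otimes>\<^bsub>torus q\<^esub> path_mat q m n i j
        else if r = Suc i then tmon (0, 0, 0) (- 1) \<otimes>\<^bsub>torus q\<^esub> path_mat q m n i j +
          tmon (0, 0, 1) 1 \<otimes>\<^bsub>torus q\<^esub> path_mat q m n (Suc i) j
        else path_mat q m n r j)"
        unfolding \<phi>(2)[OF rj] block_sum(2)[OF i rj(1)] by simp
      show "\<Phi> (Z_gen q m n r j) = (if r = i then tmon (0, 2, 1) 1 \<otimes>\<^bsub>torus q\<^esub> \<phi> (Z_gen q m n i j) +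
         tmon (0, 2, 0) 1 \<otimes>\<^bsub>torus q\<^esub> \<phi> (Z_gen q m n (Suc i) j)
       else if r = Suc i then tmon (0, 2, 1) (- 1) \<otimes>\<^bsub>torus q\<^esub> \<phi> (Z_gen q m n (Suc i) j)
       else \<phi> (Z_gen q m n r j))"
        unfolding \<Phi>U[OF rj] by (rule block_sum(1)[OF i rj(1)])
    qed (use q i \<theta> \<phi>(1) \<Phi>(1) in auto)
    fix f assume f: "f \<in> coinvariants (Oq_SL q m) (Oq_M q m n) (SL_coaction q m n)"
    show "\<Phi> f = \<phi> f"
    proof (rule coinvariant_hom_eq[OF q f T.qalg_axioms U _ \<phi>(1) \<Phi>(1) _ \<Phi>U])
      show "T.qminor m ?U (\<lambda>k. k) = \<one>\<^bsub>torus q\<^esub>"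
        by (rule T.block_qminor[OF _ _ _ i]) (simp_all add: tmon_inverse)
      show "?U a b \<otimes>\<^bsub>torus q\<^esub> \<phi> (Z_gen q m n c j) = \<phi> (Z_gen q m n c j) \<otimes>\<^bsub>torus q\<^esub> ?U a b"
        if "c \<in> {1..m}" "j \<in> {1..n}" for a b c j
        unfolding \<phi>(2)[OF that] by (rule UX)
    qed
  qed
qed

end


section \<open>Positivity: the weight of a highest weight vector has only one possible sign\<close>

section \<open>Highest weight vectors\<close>

text \<open>Counts, in a term, the factors coming from the original row i minus those coming from
  the original row i + 1: the entries of the lower block in its first column have grade 1, the
  nonzero entry of its second column has grade -1.\<close>

definition grade :: "texp \<Rightarrow> int" where
  "grade u = - (lookup u (0, 0, 0) + lookup u (0, 0, 1))"

lemma grade_add [simp]: "grade (u + v) = grade u + grade v"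
  by (simp add: grade_def lookup_add)

definition tproj :: "int \<Rightarrow> (texp \<Rightarrow>\<^sub>0 'k::field) \<Rightarrow> (texp \<Rightarrow>\<^sub>0 'k)" where
  "tproj g f = (\<Sum>u\<in>{u\<in>keys f. grade u = g}. single u (lookup f u))"

lemma lookup_tproj [simp]: "lookup (tproj g f) u = (if grade u = g then lookup f u else 0)"
proof -
  have "lookup (tproj g f) u = (\<Sum>v\<in>{v\<in>keys f. grade v = g}. if v = u then lookup f v else 0)"
    unfolding tproj_def lookup_sum by (intro sum.cong) (auto simp: lookup_single when_def)
  then show ?thesis by (auto simp: sum.delta in_keys_iff)
qed

lemma tproj_add: "tproj g (f + f') = tproj g f + tproj g f'"
  by (rule poly_mapping_eqI) (simp add: lookup_add)

lemma tproj_scale: "tproj g (scale_pm c f) = scale_pm c (tproj g f)"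
  by (rule poly_mapping_eqI) simp

lemma tproj_zero [simp]: "tproj g 0 = 0"
  by (rule poly_mapping_eqI) simp

lemma tproj_id: "(\<And>u. u \<in> keys f \<Longrightarrow> grade u = g) \<Longrightarrow> tproj g f = f"
  by (rule poly_mapping_eqI) (auto simp: in_keys_iff)

lemma tproj_none: "(\<And>u. u \<in> keys f \<Longrightarrow> grade u \<noteq> g) \<Longrightarrow> tproj g f = 0"
  by (rule poly_mapping_eqI) (auto simp: in_keys_iff)

lemma tproj_mult:
  assumes x: "\<And>u. u \<in> keys x \<Longrightarrow> grade u = d"
  shows "tproj g (x \<otimes>\<^bsub>torus q\<^esub> y) = x \<otimes>\<^bsub>torus q\<^esub> tproj (g - d) y"
proof -
  let ?t = "tproj (g - d) y"
  have y: "y = ?t + (y - ?t)" by simp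
  have "tproj g (x \<otimes>\<^bsub>torus q\<^esub> ?t) = x \<otimes>\<^bsub>torus q\<^esub> ?t"
  proof (rule tproj_id)
    fix u assume "u \<in> keys (x \<otimes>\<^bsub>torus q\<^esub> ?t)"
    then obtain v w where "v \<in> keys x" "w \<in> keys ?t" "u = v + w" by (rule keys_torus_mult)
    then show "grade u = g" using x by (auto simp: in_keys_iff split: if_splits)
  qed
  moreover have "tproj g (x \<otimes>\<^bsub>torus q\<^esub> (y - ?t)) = 0"
  proof (rule tproj_none)
    fix u assume "u \<in> keys (x \<otimes>\<^bsub>torus q\<^esub> (y - ?t))"
    then obtain v w where "v \<in> keys x" "w \<in> keys (y - ?t)" "u = v + w" by (rule keys_torus_mult)
    then show "grade u \<noteq> g" using x by (auto simp: in_keys_iff lookup_minus split: if_splits)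
  qed
  ultimately show ?thesis by (subst y) (simp only: torus_lr_distr tproj_add add_0_right)
qed

lemma tsupp_lookup: "f \<in> tsupp S \<Longrightarrow> t \<notin> S \<Longrightarrow> u \<in> keys f \<Longrightarrow> lookup u (p, t, g) = 0"
  by (rule ccontr, drule in_keys_iff[THEN iffD2], unfold tsupp_def) fastforce

lemma tsupp_grade: "f \<in> tsupp S \<Longrightarrow> 0 \<notin> S \<Longrightarrow> u \<in> keys f \<Longrightarrow> grade u = 0"
  by (simp add: grade_def tsupp_lookup[of f S 0])

definition row_wt :: "nat \<Rightarrow> (nat \<times> nat) list \<Rightarrow> int" where
  "row_wt i w = (\<Sum>(r, j)\<leftarrow>w. if r = i then 1 else if r = Suc i then - 1 else 0)"

lemma row_wt_simps [simp]:
  "row_wt i [] = 0"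
  "row_wt i ((r, j) # w) = (if r = i then 1 else if r = Suc i then - 1 else 0) + row_wt i w"
  by (simp_all add: row_wt_def)

lemma row_wt_append [simp]: "row_wt i (v @ w) = row_wt i v + row_wt i w"
  by (simp add: row_wt_def)

context torus_reps
begin

sublocale T: qalg "torus q" q by (rule torus_qalg[OF q])
sublocale A: qalg "Oq_M q m n" q by (rule qalg_Oq_M[OF q])

abbreviation (input) "Z \<equiv> Z_gen q m n"
abbreviation (input) "P \<equiv> path_mat q m n"
abbreviation (input) tm :: "(texp \<Rightarrow>\<^sub>0 'k) \<Rightarrow> (texp \<Rightarrow>\<^sub>0 'k) \<Rightarrow> (texp \<Rightarrow>\<^sub>0 'k)" (infixl "\<boxtimes>" 70)
  where "x \<boxtimes> y \<equiv> x \<otimes>\<^bsub>torus q\<^esub> y"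

text \<open>
  The entries of the product of the upper and the lower block matrix.  The grade \<^const>\<open>grade\<close>
  is 1 on the first column and \<open>-1\<close> on the second one.
\<close>

definition "t11 = tmon (0, 2, 1) 1 \<boxtimes> tmon (0, 0, 1) (- 1) + tmon (0, 2, 0) 1 \<boxtimes> tmon (0, 0, 0) (- 1)"
definition "t12 = tmon (0, 2, 0) 1 \<boxtimes> tmon (0, 0, 1) 1"
definition "t21 = tmon (0, 2, 1) (- 1) \<boxtimes> tmon (0, 0, 0) (- 1)"
definition "t22 = tmon (0, 2, 1) (- 1) \<boxtimes> tmon (0, 0, 1) 1"

lemmas texpand = tmon_def torus_mult_single torus_lr_distr eform_add_left eform_add_right eform_single vform_def

lemma t12_t11: "t12 \<boxtimes> t11 = scale_pm (inverse q) (t11 \<boxtimes> t12)"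
  unfolding t12_def t11_def using q by (simp add: texpand ac_simps power_int_minus pm.scale_right_distrib)

lemma t21_t11: "t21 \<boxtimes> t11 = scale_pm (inverse q) (t11 \<boxtimes> t21)"
  unfolding t21_def t11_def using q by (simp add: texpand ac_simps power_int_minus pm.scale_right_distrib)

text \<open>The quantum determinant of the product of the two blocks is 1; this is that relation
  with \<open>t22\<close> and \<open>t11\<close> in the opposite order.\<close>

lemma t22_t11: "t22 \<boxtimes> t11 = single 0 1 + scale_pm (inverse q) (t12 \<boxtimes> t21)"
proof -
  have "single (0, 0, 1) 1 + (single (0, 0, 1) (- 1) +
    (single (0, 2, 1) 1 + single (0, 2, 1) (- 1))) = (0 :: texp)"
    by (rule poly_mapping_eqI) (simp add: lookup_add lookup_single when_def)
  then show ?thesis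
    unfolding t21_def t11_def t12_def t22_def using q
    by (simp add: texpand ac_simps power_int_minus pm.scale_right_distrib power2_eq_square)
qed

lemma t_grade:
  "u \<in> keys t11 \<Longrightarrow> grade u = 1" "u \<in> keys t12 \<Longrightarrow> grade u = - 1"
  "u \<in> keys t21 \<Longrightarrow> grade u = 1" "u \<in> keys t22 \<Longrightarrow> grade u = - 1"
proof -
  show "u \<in> keys t11 \<Longrightarrow> grade u = 1"
    unfolding t11_def using keys_add[of "tmon (0, 2, 1) 1 \<boxtimes> tmon (0, 0, 1) (- 1)" "tmon (0, 2, 0) 1 \<boxtimes> tmon (0, 0, 0) (- 1)"]
    by (auto simp: tmon_def torus_mult_single grade_def lookup_add lookup_single split: if_splits)
qed (auto simp: t12_def t21_def t22_def tmon_def torus_mult_single grade_def lookup_add lookup_single split: if_splits)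

lemma t_tsupp: "t11 \<in> tsupp {0, 2}" "t12 \<in> tsupp {0, 2}" "t21 \<in> tsupp {0, 2}" "t22 \<in> tsupp {0, 2}"
  unfolding t11_def t12_def t21_def t22_def by (intro tsupp_add tsupp_mult tmon_tsupp; simp)+

lemma P_commute: "x \<in> tsupp {0, 2} \<Longrightarrow> P r j \<boxtimes> x = x \<boxtimes> P r j"
  by (rule tsupp_commute[OF path_mat_tsupp[OF q]]) auto

text \<open>The right ideal generated by the k-th power of \<open>t11\<close>, in a form that splits
  off one factor at a time.\<close>

fun t11_multiples :: "nat \<Rightarrow> (texp \<Rightarrow>\<^sub>0 'k) set" where
  "t11_multiples 0 = UNIV"
| "t11_multiples (Suc k) = (\<lambda>y. t11 \<boxtimes> y) ` t11_multiples k"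

lemma t11_multiples_add: "x \<in> t11_multiples k \<Longrightarrow> y \<in> t11_multiples k \<Longrightarrow> x + y \<in> t11_multiples k"
proof (induction k arbitrary: x y)
  case (Suc k)
  then obtain x' y' where "x = t11 \<boxtimes> x'" "y = t11 \<boxtimes> y'" "x' \<in> t11_multiples k" "y' \<in> t11_multiples k" by auto
  then have "x + y = t11 \<boxtimes> (x' + y')" "x' + y' \<in> t11_multiples k" using Suc.IH by (simp_all only: torus_lr_distr)
  then show ?case by simp
qed simp

lemma t11_multiples_scale: "x \<in> t11_multiples k \<Longrightarrow> scale_pm c x \<in> t11_multiples k"
proof (induction k arbitrary: x)
  case (Suc k)
  then obtain x' where "x = t11 \<boxtimes> x'" "x' \<in> t11_multiples k" by auto
  then have "scale_pm c x = t11 \<boxtimes> scale_pm c x'" "scale_pm c x' \<in> t11_multiples k" using Suc.IH by (simp_all only: torus_lr_distr)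
  then show ?case by simp
qed simp

lemma t11_multiples_zero: "0 \<in> t11_multiples k"
  by (induction k) (auto simp: image_iff torus_lr_distr intro!: bexI[of _ 0])

lemma t11_multiples_mult:
  assumes z: "z \<boxtimes> t11 = scale_pm c (t11 \<boxtimes> z)"
  shows "x \<in> t11_multiples k \<Longrightarrow> z \<boxtimes> x \<in> t11_multiples k"
proof (induction k arbitrary: x)
  case (Suc k)
  then obtain y where y: "x = t11 \<boxtimes> y" "y \<in> t11_multiples k" by auto
  have "z \<boxtimes> x = (z \<boxtimes> t11) \<boxtimes> y" unfolding y(1) using T.m_assoc[of z t11 y] by simp
  also have "\<dots> = scale_pm c (t11 \<boxtimes> (z \<boxtimes> y))" unfolding z using T.m_assoc[of t11 z y] by (simp add: torus_lr_distr)
  finally have e: "z \<boxtimes> x = scale_pm c (t11 \<boxtimes> (z \<boxtimes> y))" .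
  have "t11 \<boxtimes> (z \<boxtimes> y) \<in> t11_multiples (Suc k)" using Suc.IH[OF y(2)] by simp
  then show ?case unfolding e by (rule t11_multiples_scale)
qed simp

text \<open>The determinant relation spends one factor \<open>t11\<close>. The remaining ones
  survive in both terms, since \<open>t12\<close> and \<open>t21\<close> commute with
  \<open>t11\<close> up to scalars.\<close>

lemma t22_multiples: "x \<in> t11_multiples (Suc k) \<Longrightarrow> t22 \<boxtimes> x \<in> t11_multiples k"
proof -
  assume "x \<in> t11_multiples (Suc k)"
  then obtain y where y: "x = t11 \<boxtimes> y" "y \<in> t11_multiples k" by auto
  have "t22 \<boxtimes> x = (t22 \<boxtimes> t11) \<boxtimes> y" unfolding y(1) using T.m_assoc[of t22 t11 y] by simp
  also have "\<dots> = y + scale_pm (inverse q) (t12 \<boxtimes> (t21 \<boxtimes> y))"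
    unfolding t22_t11 using T.l_one[of y] T.m_assoc[of t12 t21 y] by (simp add: torus_lr_distr)
  finally show ?thesis
    using t11_multiples_mult[OF t12_t11 t11_multiples_mult[OF t21_t11 y(2)]]
    by (simp add: t11_multiples_add t11_multiples_scale y(2))
qed

lemma P_multiples: "x \<in> t11_multiples k \<Longrightarrow> P r j \<boxtimes> x \<in> t11_multiples k"
  by (rule t11_multiples_mult[of _ 1]) (simp add: P_commute[OF t_tsupp(1)])

lemma P_grade: "u \<in> keys (P r j) \<Longrightarrow> grade u = 0"
  by (rule tsupp_grade[OF path_mat_tsupp[OF q]]) auto

lemma \<Phi>_row:
  assumes "j \<in> {1..n}"
  shows "\<Phi> (Z i j) = t11 \<boxtimes> P i j + t12 \<boxtimes> P (Suc i) j"
    and "\<Phi> (Z (Suc i) j) = t21 \<boxtimes> P i j + t22 \<boxtimes> P (Suc i) j"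
proof -
  have m: "x \<boxtimes> (y \<boxtimes> z) = x \<boxtimes> y \<boxtimes> z" for x y z using T.m_assoc[of x y z] by simp
  show "\<Phi> (Z i j) = t11 \<boxtimes> P i j + t12 \<boxtimes> P (Suc i) j" "\<Phi> (Z (Suc i) j) = t21 \<boxtimes> P i j + t22 \<boxtimes> P (Suc i) j"
    using assms i by (simp_all add: \<Phi>_Z \<phi>_Z t11_def t12_def t21_def t22_def torus_lr_distr m add.assoc)
qed

lemma \<Phi>_other: "r \<in> {1..m} \<Longrightarrow> j \<in> {1..n} \<Longrightarrow> r \<noteq> i \<Longrightarrow> r \<noteq> Suc i \<Longrightarrow> \<Phi> (Z r j) = P r j"
  by (simp add: \<Phi>_Z \<phi>_Z)

definition word :: "(nat \<times> nat) list \<Rightarrow> ((nat \<times> nat) list \<Rightarrow>\<^sub>0 'k) set" where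
  "word w = A.lprod (map (\<lambda>(r, j). Z r j) w)"

lemma word_closed: "set w \<subseteq> {1..m} \<times> {1..n} \<Longrightarrow> word w \<in> carrier (Oq_M q m n)"
  unfolding word_def by (intro A.lprod_closed) (auto intro!: Z_gen_closed)

lemma word_Cons: "word ((r, j) # w) = Z r j \<otimes>\<^bsub>Oq_M q m n\<^esub> word w"
  by (simp add: word_def)

lemma hom_word_Cons:
  assumes "h \<in> alg_hom (Oq_M q m n) (torus q)" "r \<in> {1..m}" "j \<in> {1..n}" "set w \<subseteq> {1..m} \<times> {1..n}"
  shows "h (word ((r, j) # w)) = h (Z r j) \<boxtimes> h (word w)"
  unfolding word_Cons by (rule alg_homD(2)[OF assms(1) Z_gen_closed[OF assms(2,3)] word_closed[OF assms(4)]])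

text \<open>In a term of grade \<open>g\<close>, row weight plus \<open>g\<close> is twice the
  number of factors \<open>t11\<close> minus twice the number of factors \<open>t22\<close>. Each
  \<open>t22\<close> uses up at most one \<open>t11\<close>, so at least \<open>k\<close> factors
  \<open>t11\<close> can be brought to the left.\<close>

lemma tproj_\<Phi>_word:
  "set w \<subseteq> {1..m} \<times> {1..n} \<Longrightarrow> 2 * int k \<le> row_wt i w + g \<Longrightarrow> tproj g (\<Phi> (word w)) \<in> t11_multiples k"
proof (induction w arbitrary: g k)
  case Nil
  have 1: "\<Phi> (word []) = 1" using alg_homD(4)[OF \<Phi>] by (simp add: word_def)
  have 0: "tproj g (1 :: texp \<Rightarrow>\<^sub>0 'k) = 0" if "g \<noteq> 0" using that by (intro tproj_none) (simp add: grade_def)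
  show ?case
  proof (cases k)
    case (Suc k')
    then have "g \<noteq> 0" using Nil by simp
    then show ?thesis unfolding 1 by (simp add: 0 t11_multiples_zero del: t11_multiples.simps)
  qed simp
next
  case (Cons x w)
  obtain r j where x: "x = (r, j)" by (cases x)
  have rj: "r \<in> {1..m}" "j \<in> {1..n}" and w: "set w \<subseteq> {1..m} \<times> {1..n}" using Cons.prems x by auto
  have m: "(y \<boxtimes> z) \<boxtimes> z' = y \<boxtimes> (z \<boxtimes> z')" for y z z' using T.m_assoc[of y z z'] by simp
  note hw = hom_word_Cons[OF \<Phi> rj w]
  consider "r = i" | "r = Suc i" | "r \<noteq> i" "r \<noteq> Suc i" by blast
  then show ?case
  proof cases
    case 1
    have eq: "tproj g (\<Phi> (word (x # w))) =
      t11 \<boxtimes> (P i j \<boxtimes> tproj (g - 1) (\<Phi> (word w))) + t12 \<boxtimes> (P (Suc i) j \<boxtimes> tproj (g + 1) (\<Phi> (word w)))"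
      unfolding x hw unfolding 1 \<Phi>_row(1)[OF rj(2)] torus_lr_distr m tproj_add
      by (simp add: tproj_mult[OF t_grade(1)] tproj_mult[OF t_grade(2)] tproj_mult[OF P_grade])
    have "t12 \<boxtimes> (P (Suc i) j \<boxtimes> tproj (g + 1) (\<Phi> (word w))) \<in> t11_multiples k"
      using Cons.prems x 1 by (intro t11_multiples_mult[OF t12_t11] P_multiples Cons.IH w) simp
    moreover have "t11 \<boxtimes> (P i j \<boxtimes> tproj (g - 1) (\<Phi> (word w))) \<in> t11_multiples k"
    proof (cases k)
      case (Suc k')
      have "P i j \<boxtimes> tproj (g - 1) (\<Phi> (word w)) \<in> t11_multiples k'"
        using Cons.prems x 1 Suc by (intro P_multiples Cons.IH w) simp
      then show ?thesis using Suc by simp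
    qed simp
    ultimately show ?thesis unfolding eq by (intro t11_multiples_add)
  next
    case 2
    have eq: "tproj g (\<Phi> (word (x # w))) =
      t21 \<boxtimes> (P i j \<boxtimes> tproj (g - 1) (\<Phi> (word w))) + t22 \<boxtimes> (P (Suc i) j \<boxtimes> tproj (g + 1) (\<Phi> (word w)))"
      unfolding x hw unfolding 2 \<Phi>_row(2)[OF rj(2)] torus_lr_distr m tproj_add
      by (simp add: tproj_mult[OF t_grade(3)] tproj_mult[OF t_grade(4)] tproj_mult[OF P_grade])
    have "t21 \<boxtimes> (P i j \<boxtimes> tproj (g - 1) (\<Phi> (word w))) \<in> t11_multiples k"
      using Cons.prems x 2 by (intro t11_multiples_mult[OF t21_t11] P_multiples Cons.IH w) simp
    moreover have "t22 \<boxtimes> (P (Suc i) j \<boxtimes> tproj (g + 1) (\<Phi> (word w))) \<in> t11_multiples k"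
      using Cons.prems x 2 by (intro t22_multiples P_multiples Cons.IH w) simp
    ultimately show ?thesis unfolding eq by (intro t11_multiples_add)
  next
    case 3
    have "tproj g (\<Phi> (word (x # w))) = P r j \<boxtimes> tproj g (\<Phi> (word w))"
      unfolding x hw unfolding \<Phi>_other[OF rj 3] by (simp add: tproj_mult[OF P_grade])
    then show ?thesis using Cons.prems x 3 by (simp add: P_multiples Cons.IH w)
  qed
qed

lemma tmon_grade:
  "u \<in> keys (tmon (0, 0, 1) c) \<Longrightarrow> grade u = - c" "u \<in> keys (tmon (0, 0, 0) c) \<Longrightarrow> grade u = - c"
  "t \<noteq> 0 \<Longrightarrow> u \<in> keys (tmon (p, t, f) c) \<Longrightarrow> grade u = 0"
  by (auto simp: tmon_def grade_def lookup_single split: if_splits)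

text \<open>A factor of row i has grade 1; one of row i + 1 has grade -1 in its diagonal term and 1
  in the other. So the row weight is the smallest grade, attained only by the diagonal terms, and
  these reproduce \<open>\<theta>\<close>.\<close>

lemma tproj_\<phi>_word:
  assumes "set w \<subseteq> {1..m} \<times> {1..n}"
  shows "(\<forall>g<row_wt i w. tproj g (\<phi> (word w)) = 0) \<and>
    tproj (row_wt i w) (\<phi> (word w)) = tmon (0, 0, 1) (- row_wt i w) \<boxtimes> \<theta> (word w)"
  using assms
proof (induction w)
  case Nil
  have 1: "\<phi> (word []) = 1" "\<theta> (word []) = 1" using alg_homD(4)[OF \<phi>] alg_homD(4)[OF \<theta>] by (simp_all add: word_def)
  have "tproj g (1 :: texp \<Rightarrow>\<^sub>0 'k) = (if g = 0 then 1 else 0)" for g by (auto intro: tproj_none tproj_id simp: grade_def)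
  then show ?case unfolding 1 using T.l_one[of 1] by (simp add: tmon_def)
next
  case (Cons x w)
  obtain r j where x: "x = (r, j)" by (cases x)
  have rj: "r \<in> {1..m}" "j \<in> {1..n}" and w: "set w \<subseteq> {1..m} \<times> {1..n}" using Cons.prems x by auto
  have m: "(y \<boxtimes> z) \<boxtimes> z' = y \<boxtimes> (z \<boxtimes> z')" for y z z' using T.m_assoc[of y z z'] by simp
  note hw = hom_word_Cons[OF \<phi> rj w]
  have \<theta>w: "\<theta> (word (x # w)) = P r j \<boxtimes> \<theta> (word w)"
    unfolding x hom_word_Cons[OF \<theta> rj w] \<theta>_Z[OF rj(1,2)] ..
  have IH: "\<And>g. g < row_wt i w \<Longrightarrow> tproj g (\<phi> (word w)) = 0"
    "tproj (row_wt i w) (\<phi> (word w)) = tmon (0, 0, 1) (- row_wt i w) \<boxtimes> \<theta> (word w)"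
    using Cons.IH[OF w] by blast+
  have cm: "P r j \<boxtimes> (tmon (0, 0, 1) c \<boxtimes> y) = tmon (0, 0, 1) c \<boxtimes> (P r j \<boxtimes> y)" for r c y
    unfolding m[symmetric] by (subst P_commute) (auto intro!: tmon_tsupp)
  have tt: "tmon (0, 0, 1) c \<boxtimes> (tmon (0, 0, 1) d \<boxtimes> y) = tmon (0, 0, 1) (c + d) \<boxtimes> y" for c d y
    unfolding m[symmetric] by (simp add: tmon_mult vform_def single_add[symmetric]) (simp add: tmon_def)
  consider "r = i" | "r = Suc i" | "r \<noteq> i" "r \<noteq> Suc i" by blast
  then show ?case
  proof cases
    case 1
    have eq: "tproj g (\<phi> (word (x # w))) = tmon (0, 0, 1) (- 1) \<boxtimes> (P i j \<boxtimes> tproj (g - 1) (\<phi> (word w)))" for g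
      unfolding x hw unfolding 1 using rj 1
      by (simp add: \<phi>_Z m tproj_mult[OF tmon_grade(1)] tproj_mult[OF P_grade])
    show ?thesis unfolding eq \<theta>w using IH rj 1 by (simp add: x torus_lr_distr cm tt m)
  next
    case 2
    have eq: "tproj g (\<phi> (word (x # w))) = tmon (0, 0, 0) (- 1) \<boxtimes> (P i j \<boxtimes> tproj (g - 1) (\<phi> (word w))) +
      tmon (0, 0, 1) 1 \<boxtimes> (P (Suc i) j \<boxtimes> tproj (g + 1) (\<phi> (word w)))" for g
      unfolding x hw unfolding 2 using rj 2
      by (simp add: \<phi>_Z m torus_lr_distr tproj_add tproj_mult[OF tmon_grade(1)] tproj_mult[OF tmon_grade(2)] tproj_mult[OF P_grade])
    show ?thesis unfolding eq \<theta>w using IH rj 2 by (simp add: x torus_lr_distr cm tt m)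
  next
    case 3
    have eq: "tproj g (\<phi> (word (x # w))) = P r j \<boxtimes> tproj g (\<phi> (word w))" for g
      unfolding x hw using rj 3 by (simp add: \<phi>_Z tproj_mult[OF P_grade])
    show ?thesis unfolding eq \<theta>w using IH rj 3 by (simp add: x torus_lr_distr cm tt m)
  qed
qed

text \<open>
  Multiplication by \<^term>\<open>t11\<close> does not change the largest exponent of the variable
  \<open>(0, 0, 0)\<close>, but lowers the smallest one.
\<close>

lemma t11_not_homogeneous:
  assumes nz: "t11 \<boxtimes> y \<noteq> 0" and C: "\<And>u. u \<in> keys (t11 \<boxtimes> y) \<Longrightarrow> lookup u (0, 0, 0) = 0"
  shows False
proof -
  let ?C = "\<lambda>u :: texp. lookup u (0, 0, 0)"
  let ?a = "single (0, 2, 1) 1 + single (0, 0, 1) (- 1) :: texp"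
  let ?b = "single (0, 2, 0) 1 + single (0, 0, 0) (- 1) :: texp"
  let ?A = "single ?a 1" and ?B = "single ?b 1"
  have t: "t11 \<boxtimes> y = ?A \<boxtimes> y + ?B \<boxtimes> y"
    unfolding t11_def torus_lr_distr(1)[symmetric] by (simp add: texpand)
  have Ca: "?C ?a = 0" "?C ?b = - 1" by (simp_all add: lookup_add lookup_single)
  have y: "finite (keys y)" "keys y \<noteq> {}" using nz by (auto simp: torus_lr_distr)
  have "Max (?C ` keys y) \<in> ?C ` keys y" "Min (?C ` keys y) \<in> ?C ` keys y" using y by (intro Max_in Min_in; simp)+
  then obtain y1 y0 where y1: "y1 \<in> keys y" "Max (?C ` keys y) = ?C y1" and y0: "y0 \<in> keys y" "Min (?C ` keys y) = ?C y0"
    by auto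
  have y1_max: "?C z \<le> ?C y1" and y0_min: "?C y0 \<le> ?C z" if "z \<in> keys y" for z
    using that y(1) unfolding y1(2)[symmetric] y0(2)[symmetric] by (intro Max_ge Min_le; simp)+
  have "lookup (?B \<boxtimes> y) (?a + y1) = 0"
  proof (rule ccontr)
    assume "lookup (?B \<boxtimes> y) (?a + y1) \<noteq> 0"
    then have "?a + y1 \<in> keys (?B \<boxtimes> y)" by (simp add: in_keys_iff)
    then obtain z where "z \<in> keys y" "?a + y1 = ?b + z" by (rule keys_torus_mult) auto
    then have "?C (?a + y1) = ?C (?b + z)" "z \<in> keys y" by simp_all
    then have "?C y1 = ?C z - 1" unfolding lookup_add[where f = ?a] lookup_add[where f = ?b] Ca by simp
    then show False using y1_max[OF \<open>z \<in> keys y\<close>] by simp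
  qed
  then have "?a + y1 \<in> keys (t11 \<boxtimes> y)"
    unfolding t using y1(1) q lookup_single_mult[OF q, of ?a 1 y y1] by (simp add: in_keys_iff lookup_add[where g = "?B \<boxtimes> y"])
  then have "0 + ?C y1 = 0" using C[of "?a + y1"] Ca by (simp only: lookup_add[where f = ?a])
  then have 1: "?C y1 = 0" by simp
  have "lookup (?A \<boxtimes> y) (?b + y0) = 0"
  proof (rule ccontr)
    assume "lookup (?A \<boxtimes> y) (?b + y0) \<noteq> 0"
    then have "?b + y0 \<in> keys (?A \<boxtimes> y)" by (simp add: in_keys_iff)
    then obtain z where "z \<in> keys y" "?b + y0 = ?a + z" by (rule keys_torus_mult) auto
    then have "?C (?b + y0) = ?C (?a + z)" "z \<in> keys y" by simp_all
    then have "?C y0 - 1 = ?C z" unfolding lookup_add[where f = ?a] lookup_add[where f = ?b] Ca by simp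
    then show False using y0_min[OF \<open>z \<in> keys y\<close>] by simp
  qed
  then have "?b + y0 \<in> keys (t11 \<boxtimes> y)"
    unfolding t using y0(1) q lookup_single_mult[OF q, of ?b 1 y y0] by (simp add: in_keys_iff lookup_add[where g = "?B \<boxtimes> y"])
  then have "- 1 + ?C y0 = 0" using C[of "?b + y0"] Ca by (simp only: lookup_add[where f = ?b])
  then show False using 1 y0_min[OF y1(1)] by simp
qed

text \<open>For positive \<open>v\<close>, the component of grade \<open>v\<close> of
  \<open>\<Phi> h\<close> is a multiple of \<open>t11\<close>, whereas that of the right-hand side
  of \<open>hw\<close> is a monomial times \<open>\<theta> h\<close> and does not involve
  \<open>(0, 0, 0)\<close>. Divisibility replaces the usual argument with divided powers and works
  for every nonzero \<open>q\<close>.\<close>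

theorem highest_weight_nonpos:
  assumes h: "h \<in> A.vspan {word w | w. set w \<subseteq> {1..m} \<times> {1..n} \<and> row_wt i w = v}"
    and nz: "\<theta> h \<noteq> 0" and hw: "\<Phi> h = tmon (0, 2, 1) v \<boxtimes> \<phi> h"
  shows "v \<le> 0"
proof (rule ccontr)
  assume "\<not> v \<le> 0"
  then have v: "1 \<le> v" by simp
  let ?W = "{word w | w. set w \<subseteq> {1..m} \<times> {1..n} \<and> row_wt i w = v}"
  have W: "?W \<subseteq> carrier (Oq_M q m n)" using word_closed by auto
  \<comment> \<open>\<open>2 * 1 \<le> v + v\<close> holds because \<open>v\<close> is positive;
    this yields one factor \<open>t11\<close> in grade \<open>v\<close>.\<close>
  have *: "tproj v (\<Phi> h) \<in> t11_multiples 1 \<and> tproj v (\<phi> h) = tmon (0, 0, 1) (- v) \<boxtimes> \<theta> h"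
    using h
  proof (induction rule: A.vspan.induct)
    case zero
    show ?case using alg_hom_zero[OF \<Phi> A.kalg_axioms T.kalg_axioms] alg_hom_zero[OF \<phi> A.kalg_axioms T.kalg_axioms]
        alg_hom_zero[OF \<theta> A.kalg_axioms T.kalg_axioms]
      by (simp add: t11_multiples_zero torus_lr_distr del: t11_multiples.simps)
  next
    case (step x y c)
    then obtain w where w: "x = word w" "set w \<subseteq> {1..m} \<times> {1..n}" "row_wt i w = v" by auto
    have cl: "x \<in> carrier (Oq_M q m n)" "y \<in> carrier (Oq_M q m n)"
      using step W A.vspan_closed[OF step(2) W] by auto
    have e: "g (c \<odot>\<^bsub>Oq_M q m n\<^esub> x \<oplus>\<^bsub>Oq_M q m n\<^esub> y) = scale_pm c (g x) + g y"
      if "g \<in> alg_hom (Oq_M q m n) (torus q)" for g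
      using cl alg_homD[OF that] by simp
    show ?case
      unfolding e[OF \<Phi>] e[OF \<phi>] e[OF \<theta>] tproj_add tproj_scale
      using step.IH tproj_\<Phi>_word[OF w(2), of 1 v] tproj_\<phi>_word[OF w(2)] w v
      by (simp add: t11_multiples_add t11_multiples_scale torus_lr_distr del: t11_multiples.simps)
  qed
  then obtain y where y: "tproj v (\<Phi> h) = t11 \<boxtimes> y" by (auto simp: One_nat_def)
  have "tproj v (tmon (0, 2, 1) v \<boxtimes> \<phi> h) = tmon (0, 2, 1) v \<boxtimes> tproj (v - 0) (\<phi> h)"
    by (rule tproj_mult) (rule tmon_grade(3)[of 2], simp_all)
  then have "tproj v (\<Phi> h) = tmon (0, 2, 1) v \<boxtimes> (tmon (0, 0, 1) (- v) \<boxtimes> \<theta> h)"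
    unfolding hw using * by simp
  then have eq: "t11 \<boxtimes> y = tmon (0, 2, 1) v \<boxtimes> (tmon (0, 0, 1) (- v) \<boxtimes> \<theta> h)" using y by simp
  have ne: "tmon x c \<noteq> (0 :: texp \<Rightarrow>\<^sub>0 'k)" for x c
    unfolding tmon_def by (metis lead_nonzero lead_single one_neq_zero)
  have \<theta>C: "lookup u (0, 0, 0) = 0" if u: "u \<in> keys (\<theta> h)" for u
  proof -
    have "\<theta> h \<in> tsupp ({1} \<union> {3..})"
      using h
    proof (induction rule: A.vspan.induct)
      case zero
      then show ?case using alg_hom_zero[OF \<theta> A.kalg_axioms T.kalg_axioms] by (simp add: tsupp_zero)
    next
      case (step x y c)
      then obtain w where w: "x = word w" "set w \<subseteq> {1..m} \<times> {1..n}" by auto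
      have cl: "x \<in> carrier (Oq_M q m n)" "y \<in> carrier (Oq_M q m n)"
        using step W A.vspan_closed[OF step(2) W] by auto
      have "\<theta> (word w) \<in> tsupp ({1} \<union> {3..})" using w(2)
      proof (induction w)
        case Nil
        then show ?case using alg_homD(4)[OF \<theta>] by (simp add: word_def tsupp_one)
      next
        case (Cons x w)
        obtain r j where x: "x = (r, j)" by (cases x)
        then have rj: "r \<in> {1..m}" "j \<in> {1..n}" "set w \<subseteq> {1..m} \<times> {1..n}" using Cons.prems by auto
        show ?case unfolding x hom_word_Cons[OF \<theta> rj] \<theta>_Z[OF rj(1,2)]
          using Cons.IH[OF rj(3)] by (intro tsupp_mult path_mat_tsupp[OF q])
      qed
      then show ?case using cl step.IH w(1) alg_homD[OF \<theta>] by (simp add: tsupp_add tsupp_scale)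
    qed
    then show ?thesis using u by (intro tsupp_lookup[of "\<theta> h" "{1} \<union> {3..}"]) simp_all
  qed
  show False
  proof (rule t11_not_homogeneous)
    show "t11 \<boxtimes> y \<noteq> 0" unfolding eq using nz ne torus_no_zero_divisors[OF q] by blast
    fix u assume "u \<in> keys (t11 \<boxtimes> y)"
    then have "u \<in> keys (tmon (0, 2, 1) v \<boxtimes> (tmon (0, 0, 1) (- v) \<boxtimes> \<theta> h))" unfolding eq .
    then obtain u1 u2 where 1: "u1 \<in> keys (tmon (0, 2, 1) v :: texp \<Rightarrow>\<^sub>0 'k)" "u2 \<in> keys (tmon (0, 0, 1) (- v) \<boxtimes> \<theta> h)" "u = u1 + u2"
      by (rule keys_torus_mult)
    from 1(2) obtain u3 u4 where 2: "u3 \<in> keys (tmon (0, 0, 1) (- v) :: texp \<Rightarrow>\<^sub>0 'k)" "u4 \<in> keys (\<theta> h)" "u2 = u3 + u4"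
      by (rule keys_torus_mult)
    show "lookup u (0, 0, 0) = 0"
      using 1 2 \<theta>C[OF 2(2)] by (auto simp: tmon_def lookup_add lookup_single split: if_splits)
  qed
qed

end


section \<open>Expansion of an upper row operation on ordered monomials\<close>

section \<open>Row operations on ordered monomials\<close>

definition row_shift :: "nat \<Rightarrow> (nat \<Rightarrow> nat) \<Rightarrow> (nat \<Rightarrow> nat) \<Rightarrow> bool" where
  "row_shift i u v \<longleftrightarrow> v i \<le> u i \<and> v i + v (Suc i) = u i + u (Suc i) \<and> (\<forall>r. r \<noteq> i \<longrightarrow> r \<noteq> Suc i \<longrightarrow> v r = u r)"

lemma row_shift_refl: "row_shift i u u"
  by (simp add: row_shift_def)

context torus_reps
begin

text \<open>All times except that of the upper block. These elements act as coefficients when powers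
  of the entries of the upper block are compared.\<close>

definition "reserved = tsupp ({0, 1} \<union> {3..})"

text \<open>Normal form with the variables of the upper block in front: \<open>s\<close> is the
  power of its off-diagonal entry, \<open>w\<close> that of its diagonal entry.\<close>

definition ba :: "int \<Rightarrow> int \<Rightarrow> (texp \<Rightarrow>\<^sub>0 'k) \<Rightarrow> (texp \<Rightarrow>\<^sub>0 'k)" where
  "ba s w y = tmon (0, 2, 0) s \<boxtimes> (tmon (0, 2, 1) w \<boxtimes> y)"

lemma T_assoc: "(x \<boxtimes> y) \<boxtimes> z = x \<boxtimes> (y \<boxtimes> z)"
  using T.m_assoc[of x y z] by simp

lemma tmon_0: "tmon x 0 \<boxtimes> y = y"
  using T.l_one[of y] by (simp add: tmon_def)

lemma reserved_commute: "y \<in> reserved \<Longrightarrow> y \<boxtimes> tmon (0, 2, g) c = tmon (0, 2, g) c \<boxtimes> y"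
  unfolding reserved_def by (rule tsupp_commute[OF _ tmon_tsupp[of _ "{2}"]]) auto

lemma tmon_same: "tmon x c \<boxtimes> tmon x d = tmon x (c + d)"
proof -
  have "vform x x = 0" by (auto simp: vform_def split: prod.splits)
  then show ?thesis by (simp add: tmon_mult single_add[symmetric]) (simp add: tmon_def)
qed

lemma ba_mult:
  assumes y: "y \<in> reserved"
  shows "ba s w y \<boxtimes> ba s' w' y' = scale_pm (q powi (w * s')) (ba (s + s') (w + w') (y \<boxtimes> y'))"
proof -
  let ?b = "tmon (0, 2, 0) :: int \<Rightarrow> texp \<Rightarrow>\<^sub>0 'k" and ?a = "tmon (0, 2, 1) :: int \<Rightarrow> texp \<Rightarrow>\<^sub>0 'k"
  have ab: "?a w \<boxtimes> ?b s' = scale_pm (q powi (w * s')) (?b s' \<boxtimes> ?a w)"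
    by (rule tmon_q_commute[OF q]) (simp add: vform_def)
  have "ba s w y \<boxtimes> ba s' w' y' = ?b s \<boxtimes> (?a w \<boxtimes> ((y \<boxtimes> ?b s') \<boxtimes> (?a w' \<boxtimes> y')))"
    by (simp only: ba_def T_assoc)
  also have "\<dots> = ?b s \<boxtimes> ((?a w \<boxtimes> ?b s') \<boxtimes> ((y \<boxtimes> ?a w') \<boxtimes> y'))"
    unfolding reserved_commute[OF y, of 0] by (simp only: T_assoc)
  also have "\<dots> = scale_pm (q powi (w * s')) (?b s \<boxtimes> (?b s' \<boxtimes> (?a w \<boxtimes> (?a w' \<boxtimes> (y \<boxtimes> y')))))"
    unfolding reserved_commute[OF y, of 1] ab by (simp only: T_assoc torus_lr_distr)
  also have "\<dots> = scale_pm (q powi (w * s')) ((?b s \<boxtimes> ?b s') \<boxtimes> ((?a w \<boxtimes> ?a w') \<boxtimes> (y \<boxtimes> y')))"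
    by (simp only: T_assoc)
  finally show ?thesis by (simp only: tmon_same ba_def)
qed

text \<open>The power \<open>w\<close> is left free. For most terms only the power of the
  off-diagonal variable and the factor at the other times have to be controlled.\<close>

definition "ba_span K = pm.span {ba s w y | s w y. (s, y) \<in> K}"

lemma ba_span_base: "(s, y) \<in> K \<Longrightarrow> ba s w y \<in> ba_span K"
  unfolding ba_span_def by (rule pm.span_base) blast

lemma ba_span_mono: "K \<subseteq> K' \<Longrightarrow> x \<in> ba_span K \<Longrightarrow> x \<in> ba_span K'"
  unfolding ba_span_def
  using pm.span_mono[of "{ba s w y | s w y. (s, y) \<in> K}" "{ba s w y | s w y. (s, y) \<in> K'}"] by blast

lemmas ba_span_closed =
  pm.span_zero[of "{ba s w y | s w y. (s, y) \<in> K}" for K, folded ba_span_def]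
  pm.span_add[of _ "{ba s w y | s w y. (s, y) \<in> K}" for K, folded ba_span_def]
  pm.span_scale[of _ "{ba s w y | s w y. (s, y) \<in> K}" for K, folded ba_span_def]
  pm.span_diff[of _ "{ba s w y | s w y. (s, y) \<in> K}" for K, folded ba_span_def]
  pm.span_sum[of _ _ "{ba s w y | s w y. (s, y) \<in> K}" for K, folded ba_span_def]

text \<open>Reduces products of spans to products of the factors in \<open>reserved\<close>; the
  powers of \<open>q\<close> that arise from reordering are absorbed by the span.\<close>

lemma ba_span_mult:
  assumes x: "x \<in> ba_span K" and x': "x' \<in> ba_span K'"
    and K: "\<And>s y. (s, y) \<in> K \<Longrightarrow> y \<in> reserved"
    and K'': "\<And>s y s' y'. (s, y) \<in> K \<Longrightarrow> (s', y') \<in> K' \<Longrightarrow> \<exists>c y''. y \<boxtimes> y' = scale_pm c y'' \<and> (s + s', y'') \<in> K''"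
  shows "x \<boxtimes> x' \<in> ba_span K''"
proof -
  have scale: "ba s w (scale_pm c y) = scale_pm c (ba s w y)" for s w c y
    by (simp add: ba_def torus_lr_distr)
  have 1: "ba s w y \<boxtimes> x' \<in> ba_span K''" if sy: "(s, y) \<in> K" for s w y
    using x' unfolding ba_span_def[of K']
  proof (induction rule: pm.span_induct_alt)
    case base
    then show ?case by (simp add: torus_lr_distr ba_span_closed)
  next
    case (step c x z)
    then obtain s' w' y' where x: "x = ba s' w' y'" "(s', y') \<in> K'" by blast
    obtain d y'' where d: "y \<boxtimes> y' = scale_pm d y''" "(s + s', y'') \<in> K''" using K''[OF sy x(2)] by blast
    have "ba s w y \<boxtimes> x \<in> ba_span K''"
      unfolding x(1) ba_mult[OF K[OF sy]] d(1) scale by (intro ba_span_closed(3) ba_span_base d(2))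
    then show ?case using step.IH by (simp add: torus_lr_distr ba_span_closed)
  qed
  show ?thesis
    using x unfolding ba_span_def[of K]
  proof (induction rule: pm.span_induct_alt)
    case base
    then show ?case by (simp add: torus_lr_distr ba_span_closed)
  next
    case (step c x z)
    then obtain s w y where "x = ba s w y" "(s, y) \<in> K" by blast
    then show ?case using step.IH 1 by (simp add: torus_lr_distr ba_span_closed)
  qed
qed

abbreviation (input) "X \<equiv> \<lambda>r j. \<phi> (Z r j)"
abbreviation (input) "X' \<equiv> \<lambda>r j. \<Phi> (Z r j)"

lemma X_qmat: "qmat q {1..m} {1..n} (torus q) X"
  by (rule qmat_alg_hom[OF Z_gen_qmat[OF q] A.kalg_axioms \<phi>])

lemma X_reserved:
  assumes "r \<in> {1..m}" "j \<in> {1..n}" shows "X r j \<in> reserved"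
proof -
  have "path_mat q m n r j \<in> tsupp ({0, 1} \<union> {3..})" for r j
    by (rule tsupp_mono[OF _ path_mat_tsupp[OF q]]) auto
  then show ?thesis
    unfolding \<phi>_Z[OF assms] reserved_def by (auto intro!: tsupp_add tsupp_mult tmon_tsupp)
qed

lemma wprod_Nil: "T.wprod Y j [] = 1"
  and wprod_Cons: "T.wprod Y j (r # w) = Y r j \<boxtimes> T.wprod Y j w"
  and wprod_app: "T.wprod Y j (v @ w) = T.wprod Y j v \<boxtimes> T.wprod Y j w"
  unfolding T.wprod_def by (simp_all add: T.lprod_append)

lemma lprod_reserved: "set zs \<subseteq> reserved \<Longrightarrow> T.lprod zs \<in> reserved"
  unfolding reserved_def by (induction zs) (auto intro!: tsupp_mult simp: tsupp_one)

lemma wprod_reserved: "set w \<subseteq> {1..m} \<Longrightarrow> j \<in> {1..n} \<Longrightarrow> T.wprod X j w \<in> reserved"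
  unfolding T.wprod_def by (intro lprod_reserved) (auto intro!: X_reserved)

lemma omon_reserved:
  assumes "set rs \<subseteq> {1..m}" "set cs \<subseteq> {1..n}"
  shows "T.omon X rs cs e \<in> reserved"
  unfolding T.omon_def
proof (intro lprod_reserved subsetI)
  fix x assume "x \<in> set (map (\<lambda>j. T.wprod X j (col_word rs (\<lambda>r. e r j))) cs)"
  then obtain j where j: "j \<in> set cs" "x = T.wprod X j (col_word rs (\<lambda>r. e r j))" by auto
  show "x \<in> reserved" unfolding j(2)
    by (rule wprod_reserved) (use assms j(1) set_col_word[of rs] in blast)+
qed

lemma X'_row:
  assumes "j \<in> {1..n}"
  shows "X' i j = ba 0 1 (X i j) + ba 1 0 (X (Suc i) j)"
    and "X' (Suc i) j = ba 0 (- 1) (X (Suc i) j)"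
    and "r \<in> {1..m} \<Longrightarrow> r \<noteq> i \<Longrightarrow> r \<noteq> Suc i \<Longrightarrow> X' r j = X r j"
  using assms i by (simp_all add: \<Phi>_Z ba_def tmon_0)

lemma X_past:
  assumes j: "j \<in> {1..n}"
  shows "X i j \<boxtimes> T.wprod X j (replicate k (Suc i) @ w) =
    scale_pm (q ^ k) (T.wprod X j (replicate k (Suc i) @ i # w))"
proof (induction k)
  case (Suc k)
  have XY: "X i j \<boxtimes> X (Suc i) j = scale_pm q (X (Suc i) j \<boxtimes> X i j)"
    using T.qmat_col[OF X_qmat, of i "Suc i" j] i j by simp
  have "X i j \<boxtimes> T.wprod X j (replicate (Suc k) (Suc i) @ w) =
    (X i j \<boxtimes> X (Suc i) j) \<boxtimes> T.wprod X j (replicate k (Suc i) @ w)"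
    by (simp add: wprod_Cons T_assoc)
  also have "\<dots> = scale_pm q (X (Suc i) j \<boxtimes> (X i j \<boxtimes> T.wprod X j (replicate k (Suc i) @ w)))"
    unfolding XY by (simp add: torus_lr_distr T_assoc)
  finally show ?case unfolding Suc.IH by (simp add: torus_lr_distr wprod_Cons)
qed (simp add: wprod_Cons)

lemma ba_1: "ba 0 0 y = y"
  by (simp add: ba_def tmon_0)

lemma ba_mult_0: "y \<in> reserved \<Longrightarrow> ba s w y \<boxtimes> ba 0 w' y' = ba s (w + w') (y \<boxtimes> y')"
  by (simp add: ba_mult)

text \<open>The coefficients are q-binomial, so they may vanish, except for the first one.\<close>

lemma \<Phi>_power:
  assumes j: "j \<in> {1..n}" and w: "set w \<subseteq> {1..m} - {i, Suc i}"
  shows "\<exists>z\<in>ba_span {(s, T.wprod X j (replicate k (Suc i) @ replicate (p - k) i @ w)) | s k. (0 :: int) < s \<and> 0 < k \<and> k \<le> p}.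
    T.wprod X' j (replicate p i @ w) = ba 0 (int p) (T.wprod X j (replicate p i @ w)) + z"
proof (induction p)
  case 0
  have "T.wprod X' j w = T.wprod X j w"
    unfolding T.wprod_def
    by (intro arg_cong[where f = T.lprod] map_cong refl) (rule X'_row(3)[OF j], use w in auto)
  then show ?case by (intro bexI[of _ 0]) (simp_all add: ba_1 ba_span_closed)
next
  case (Suc p)
  let ?K = "\<lambda>p. {(s, T.wprod X j (replicate k (Suc i) @ replicate (p - k) i @ w)) | s k. (0 :: int) < s \<and> 0 < k \<and> k \<le> p}"
  let ?M = "T.wprod X j (replicate p i @ w)"
  obtain z where z: "z \<in> ba_span (?K p)" "T.wprod X' j (replicate p i @ w) = ba 0 (int p) ?M + z"
    using Suc.IH by blast
  have res: "X i j \<in> reserved" "X (Suc i) j \<in> reserved" using i j by (auto intro!: X_reserved)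
  have 1: "ba 1 0 (X (Suc i) j) \<boxtimes> ba 0 (int p) ?M \<in> ba_span (?K (Suc p))"
    unfolding ba_mult_0[OF res(2)]
    by (rule ba_span_base) (auto intro!: exI[of _ 1] simp: wprod_Cons One_nat_def)
  have 2: "ba 0 1 (X i j) \<boxtimes> z \<in> ba_span (?K (Suc p))"
  proof (rule ba_span_mult[OF ba_span_base[of 0 "X i j" "{(0, X i j)}"] z(1)])
    fix s y s' y' assume "(s, y) \<in> {(0 :: int, X i j)}" "(s', y') \<in> ?K p"
    then obtain k where k: "s = 0" "y = X i j" "y' = T.wprod X j (replicate k (Suc i) @ replicate (p - k) i @ w)"
      "0 < s'" "0 < k" "k \<le> p" by blast
    show "\<exists>c y''. y \<boxtimes> y' = scale_pm c y'' \<and> (s + s', y'') \<in> ?K (Suc p)"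
      unfolding k(2,3) X_past[OF j] using k
      by (intro exI[of _ "q ^ k"] exI[of _ "T.wprod X j (replicate k (Suc i) @ replicate (Suc p - k) i @ w)"])
        (auto simp: Suc_diff_le intro!: exI[of _ k])
  qed (use res in auto)
  have 3: "ba 1 0 (X (Suc i) j) \<boxtimes> z \<in> ba_span (?K (Suc p))"
  proof (rule ba_span_mult[OF ba_span_base[of 1 "X (Suc i) j" "{(1, X (Suc i) j)}"] z(1)])
    fix s y s' y' assume "(s, y) \<in> {(1 :: int, X (Suc i) j)}" "(s', y') \<in> ?K p"
    then obtain k where k: "s = 1" "y = X (Suc i) j" "y' = T.wprod X j (replicate k (Suc i) @ replicate (p - k) i @ w)"
      "0 < s'" "0 < k" "k \<le> p" by blast
    show "\<exists>c y''. y \<boxtimes> y' = scale_pm c y'' \<and> (s + s', y'') \<in> ?K (Suc p)"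
      unfolding k(2,3) using k
      by (intro exI[of _ 1] exI[of _ "T.wprod X j (replicate (Suc k) (Suc i) @ replicate (Suc p - Suc k) i @ w)"])
        (auto simp: wprod_Cons intro!: exI[of _ "Suc k"])
  qed (use res in auto)
  have "T.wprod X' j (replicate (Suc p) i @ w) = ba 0 (int (Suc p)) (T.wprod X j (replicate (Suc p) i @ w)) +
    (ba 1 0 (X (Suc i) j) \<boxtimes> ba 0 (int p) ?M + (ba 0 1 (X i j) \<boxtimes> z + ba 1 0 (X (Suc i) j) \<boxtimes> z))"
    using z(2) by (simp add: wprod_Cons X'_row[OF j] torus_lr_distr ba_mult_0[OF res(1)] add_ac)
  then show ?case by (rule bexI[OF _ ba_span_closed(2)[OF 1 ba_span_closed(2)[OF 2 3]]])
qed

lemma \<Phi>_prefix: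
  assumes j: "j \<in> {1..n}" and v: "set v \<subseteq> {1..m} - {i}"
  shows "T.wprod X' j v = ba 0 (- int (length (filter ((=) (Suc i)) v))) (T.wprod X j v)"
  using v
proof (induction v)
  case (Cons r v)
  have res: "X r j \<in> reserved" using Cons.prems j by (auto intro!: X_reserved)
  have 1: "X' r j = ba 0 (if r = Suc i then - 1 else 0) (X r j)" using Cons.prems j by (auto simp: X'_row ba_1)
  show ?case unfolding wprod_Cons using Cons.IH Cons.prems by (auto simp: 1 ba_mult_0[OF res])
qed (simp add: wprod_Nil ba_1)

abbreviation (input) "rs \<equiv> rev [1..<Suc m]"

lemma rs_split: "rs = rev [Suc (Suc i)..<Suc m] @ Suc i # i # rev [1..<i]"
proof -
  have "[1..<Suc m] = [1..<i] @ [i, Suc i] @ [Suc (Suc i)..<Suc m]"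
    using i upt_add_eq_append[of 1 i "Suc m - i"] by (simp add: upt_conv_Cons)
  then show ?thesis by simp
qed

lemma col_word_append [simp]: "col_word (as @ bs) u = col_word as u @ col_word bs u"
  by (simp add: col_word_def)

text \<open>In decreasing row order a column consists of three parts: rows from i + 1 on, row i, and
  rows smaller than i. The first part only acquires a power of \<open>(0, 2, 1)\<close>, the second
  expands by \<open>\<Phi>_power\<close>, the third is unchanged.\<close>

lemma \<Phi>_column:
  assumes j: "j \<in> {1..n}"
  shows "\<exists>z\<in>ba_span {(s, T.wprod X j (col_word rs v)) | s v. (0 :: int) < s \<and> row_shift i u v \<and> v \<noteq> u}.
    T.wprod X' j (col_word rs u) = ba 0 (int (u i) - int (u (Suc i))) (T.wprod X j (col_word rs u)) + z"
proof -
  let ?V = "{(s, T.wprod X j (col_word rs v)) | s v. (0 :: int) < s \<and> row_shift i u v \<and> v \<noteq> u}"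
  let ?pre = "\<lambda>u. col_word (rev [Suc (Suc i)..<Suc m]) u @ replicate (u (Suc i)) (Suc i)"
  let ?S = "\<lambda>u. col_word (rev [1..<i]) u"
  let ?Q = "{(s, T.wprod X j (replicate k (Suc i) @ replicate (u i - k) i @ ?S u)) | s k. (0 :: int) < s \<and> 0 < k \<and> k \<le> u i}"
  have sp: "col_word rs u = ?pre u @ (replicate (u i) i @ ?S u)" for u by (simp only: rs_split col_word_append col_word_simps append_assoc)
  have S: "set (?S u) \<subseteq> {1..m} - {i, Suc i}" using set_col_word[of "rev [1..<i]" u] i by auto
  have pre: "set (?pre u) \<subseteq> {1..m} - {i}" using set_col_word[of "rev [Suc (Suc i)..<Suc m]" u] i by auto
  have "filter ((=) (Suc i)) (col_word (rev [Suc (Suc i)..<Suc m]) u) = []"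
    using set_col_word[of "rev [Suc (Suc i)..<Suc m]" u] by (auto simp: filter_empty_conv)
  then have len: "length (filter ((=) (Suc i)) (?pre u)) = u (Suc i)" by simp
  obtain z where z: "z \<in> ba_span ?Q" "T.wprod X' j (replicate (u i) i @ ?S u) =
      ba 0 (int (u i)) (T.wprod X j (replicate (u i) i @ ?S u)) + z"
    using \<Phi>_power[OF j S, of "u i"] by blast
  have res: "T.wprod X j (?pre u) \<in> reserved" using pre j by (intro wprod_reserved) auto
  have "T.wprod X' j (col_word rs u) = ba 0 (int (u i) - int (u (Suc i))) (T.wprod X j (col_word rs u)) +
    ba 0 (- int (u (Suc i))) (T.wprod X j (?pre u)) \<boxtimes> z"
    unfolding sp wprod_app[of _ _ "?pre u"] \<Phi>_prefix[OF j pre] z(2) len torus_lr_distr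
    by (simp add: ba_mult_0[OF res])
  moreover have "ba 0 (- int (u (Suc i))) (T.wprod X j (?pre u)) \<boxtimes> z \<in>
    ba_span ?V"
  proof (rule ba_span_mult[OF ba_span_base[of 0 _ "{(0, T.wprod X j (?pre u))}"] z(1)])
    fix s y s' y' assume "(s, y) \<in> {(0 :: int, T.wprod X j (?pre u))}" "(s', y') \<in> ?Q"
    then obtain k where k: "s = 0" "y = T.wprod X j (?pre u)"
      "y' = T.wprod X j (replicate k (Suc i) @ replicate (u i - k) i @ ?S u)" "0 < s'" "0 < k" "k \<le> u i" by blast
    let ?v = "\<lambda>r. if r = i then u i - k else if r = Suc i then u (Suc i) + k else u r"
    have "col_word (rev [Suc (Suc i)..<Suc m]) ?v = col_word (rev [Suc (Suc i)..<Suc m]) u" "?S ?v = ?S u"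
      using i by (auto intro!: col_word_cong)
    then have "col_word rs ?v = ?pre u @ (replicate k (Suc i) @ replicate (u i - k) i @ ?S u)"
      unfolding sp by (simp add: replicate_add)
    then have "y \<boxtimes> y' = scale_pm 1 (T.wprod X j (col_word rs ?v))" using k by (simp only: wprod_app[of _ _ "?pre u"]) simp
    moreover have "(s + s', T.wprod X j (col_word rs ?v)) \<in>
        ?V"
    proof -
      have "row_shift i u ?v" "?v \<noteq> u" "0 < s + s'" using k by (auto simp: row_shift_def fun_eq_iff)
      then show ?thesis by blast
    qed
    ultimately show "\<exists>c y''. y \<boxtimes> y' = scale_pm c y'' \<and>
        (s + s', y'') \<in> ?V"
      by blast
  qed (use res in auto)
  ultimately show ?thesis by blast
qed

definition shifts :: "(nat \<Rightarrow> nat \<Rightarrow> nat) \<Rightarrow> (nat \<Rightarrow> nat \<Rightarrow> nat) \<Rightarrow> bool" where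
  "shifts e \<epsilon> \<longleftrightarrow> (\<forall>j. row_shift i (\<lambda>r. e r j) (\<lambda>r. \<epsilon> r j))"

definition wt :: "nat list \<Rightarrow> (nat \<Rightarrow> nat \<Rightarrow> nat) \<Rightarrow> int" where
  "wt cs e = (\<Sum>j\<leftarrow>cs. int (e i j) - int (e (Suc i) j))"

text \<open>A column either keeps its exponents and contributes 0 to \<open>s\<close>, or is shifted
  and contributes a positive number. So there is a single term with \<open>s\<close> equal to 0,
  with coefficient 1, and its power of \<open>(0, 2, 1)\<close> is the weight.\<close>

lemma \<Phi>_omon:
  assumes "distinct cs" "set cs \<subseteq> {1..n}"
  shows "\<exists>z\<in>ba_span {(s, T.omon X rs cs \<epsilon>) | s \<epsilon>. (0 :: int) < s \<and> shifts e \<epsilon> \<and> (\<exists>j\<in>set cs. \<exists>r. \<epsilon> r j \<noteq> e r j)}.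
    T.omon X' rs cs e = ba 0 (wt cs e) (T.omon X rs cs e) + z"
  using assms
proof (induction cs)
  case Nil
  show ?case by (intro bexI[of _ 0]) (simp_all add: wt_def ba_1 ba_span_closed)
next
  case (Cons j cs)
  let ?K = "\<lambda>cs. {(s, T.omon X rs cs \<epsilon>) | s \<epsilon>. (0::int) < s \<and> shifts e \<epsilon> \<and> (\<exists>j\<in>set cs. \<exists>r. \<epsilon> r j \<noteq> e r j)}"
  let ?u = "\<lambda>r. e r j"
  let ?C = "{(s, T.wprod X j (col_word rs v)) | s v. (0::int) < s \<and> row_shift i ?u v \<and> v \<noteq> ?u}"
  let ?W = "T.wprod X j (col_word rs ?u)" and ?M = "T.omon X rs cs e"
  have j: "j \<in> {1..n}" "j \<notin> set cs" and cs: "set cs \<subseteq> {1..n}" using Cons.prems by auto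
  obtain z2 where z2: "z2 \<in> ba_span (?K cs)" "T.omon X' rs cs e = ba 0 (wt cs e) ?M + z2"
    using Cons by auto
  obtain z1 where z1: "z1 \<in> ba_span ?C"
    "T.wprod X' j (col_word rs ?u) = ba 0 (int (e i j) - int (e (Suc i) j)) ?W + z1"
    using \<Phi>_column[OF j(1), of ?u] by blast
  have res: "T.wprod X j (col_word rs v) \<in> reserved" for v
    using set_col_word[of rs v] j by (intro wprod_reserved) auto
  have glue: "\<exists>c y''. T.wprod X j (col_word rs v) \<boxtimes> T.omon X rs cs \<epsilon> = scale_pm c y'' \<and> (s, y'') \<in> ?K (j # cs)"
    if "row_shift i ?u v" "shifts e \<epsilon>" "0 < s" "v \<noteq> ?u \<or> (\<exists>j\<in>set cs. \<exists>r. \<epsilon> r j \<noteq> e r j)" for v \<epsilon> s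
  proof -
    let ?e = "\<lambda>r l. if l = j then v r else \<epsilon> r l"
    have "T.omon X rs cs \<epsilon> = T.omon X rs cs ?e" using j by (intro T.omon_cong) auto
    then have "T.wprod X j (col_word rs v) \<boxtimes> T.omon X rs cs \<epsilon> = scale_pm 1 (T.omon X rs (j # cs) ?e)" by simp
    moreover have "shifts e ?e"
      unfolding shifts_def
    proof
      fix l show "row_shift i (\<lambda>r. e r l) (\<lambda>r. ?e r l)"
        using that(1,2) by (cases "l = j") (simp_all add: shifts_def)
    qed
    moreover have "\<exists>l\<in>set (j # cs). \<exists>r. ?e r l \<noteq> e r l" using that(4) j by (auto simp: fun_eq_iff)
    ultimately show ?thesis using that(3) by blast
  qed
  have self: "shifts e e" "row_shift i ?u ?u" by (simp_all add: shifts_def row_shift_refl)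
  have 1: "z1 \<boxtimes> ba 0 (wt cs e) ?M \<in> ba_span (?K (j # cs))"
    by (rule ba_span_mult[OF z1(1) ba_span_base[of 0 ?M "{(0, ?M)}"]]) (use res glue self in auto)
  have 2: "ba 0 (int (e i j) - int (e (Suc i) j)) ?W \<boxtimes> z2 \<in> ba_span (?K (j # cs))"
  proof (rule ba_span_mult[OF ba_span_base[of 0 ?W "{(0, ?W)}"] z2(1)])
    fix s y s' y' assume "(s, y) \<in> {(0 :: int, ?W)}" "(s', y') \<in> ?K cs"
    then show "\<exists>c y''. y \<boxtimes> y' = scale_pm c y'' \<and> (s + s', y'') \<in> ?K (j # cs)"
      using glue[OF self(2)] by fastforce
  qed (use res in auto)
  have 3: "z1 \<boxtimes> z2 \<in> ba_span (?K (j # cs))"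
  proof (rule ba_span_mult[OF z1(1) z2(1)])
    fix s y s' y' assume "(s, y) \<in> ?C" "(s', y') \<in> ?K cs"
    then obtain v \<epsilon> where "y = T.wprod X j (col_word rs v)" "row_shift i ?u v" "v \<noteq> ?u" "0 < s"
      "y' = T.omon X rs cs \<epsilon>" "shifts e \<epsilon>" "0 < s'" by blast
    then show "\<exists>c y''. y \<boxtimes> y' = scale_pm c y'' \<and> (s + s', y'') \<in> ?K (j # cs)"
      using glue[of v \<epsilon> "s + s'"] by simp
  qed (use res in auto)
  have "T.omon X' rs (j # cs) e = ba 0 (wt (j # cs) e) (T.omon X rs (j # cs) e) +
      (z1 \<boxtimes> ba 0 (wt cs e) ?M + (ba 0 (int (e i j) - int (e (Suc i) j)) ?W \<boxtimes> z2 + z1 \<boxtimes> z2))"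
    by (simp add: z1(2) z2(2) torus_lr_distr ba_mult_0[OF res] wt_def add_ac)
  then show ?case by (rule bexI[OF _ ba_span_closed(2)[OF 1 ba_span_closed(2)[OF 2 3]]])
qed

lemma \<Phi>_omon_span:
  assumes "distinct cs" "set cs \<subseteq> {1..n}"
  shows "T.omon X' rs cs e \<in> ba_span {(s, T.omon X rs cs \<epsilon>) | s \<epsilon>. shifts e \<epsilon>}"
proof -
  let ?K = "{(s, T.omon X rs cs \<epsilon>) | s \<epsilon>. shifts e \<epsilon>}"
  obtain z where z: "z \<in> ba_span {(s, T.omon X rs cs \<epsilon>) | s \<epsilon>. (0 :: int) < s \<and> shifts e \<epsilon> \<and> (\<exists>j\<in>set cs. \<exists>r. \<epsilon> r j \<noteq> e r j)}"
    "T.omon X' rs cs e = ba 0 (wt cs e) (T.omon X rs cs e) + z" using \<Phi>_omon[OF assms] by blast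
  have "shifts e e" by (simp add: shifts_def row_shift_refl)
  then have "ba 0 (wt cs e) (T.omon X rs cs e) \<in> ba_span ?K"
    by (intro ba_span_base) blast
  moreover have "z \<in> ba_span ?K"
    by (rule ba_span_mono[OF _ z(1)]) blast
  ultimately show ?thesis unfolding z(2) by (rule ba_span_closed(2))
qed


subsection \<open>Independence\<close>

text \<open>The leading exponent of \<open>xmon\<close>. The variables added in front do not occur
  in \<open>mexp\<close>, so all three components can be recovered from it.\<close>

definition xexp :: "int \<times> int \<times> (nat \<Rightarrow> nat \<Rightarrow> nat) \<Rightarrow> texp" where
  "xexp = (\<lambda>(s, w, e). single (0, 2, 0) s + (single (0, 2, 1) w +
     (single (0, 0, 1) (\<Sum>r\<in>{1..m}. \<Sum>j\<in>{1..n}. \<Sum>k<e r j. if r = i then - 1 else if r = Suc i then 1 else 0) +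
      mexp m n e)))"

abbreviation (input) "ns \<equiv> [1..<Suc n]"

definition xmon :: "int \<times> int \<times> (nat \<Rightarrow> nat \<Rightarrow> nat) \<Rightarrow> (texp \<Rightarrow>\<^sub>0 'k)" where
  "xmon = (\<lambda>(s, w, e). ba s w (T.omon X rs ns e))"

lemma single_sum: "single x (sum h S) = (\<Sum>y\<in>S. single x (h y))"
  by (induction S rule: infinite_finite_induct) (simp_all add: single_add)

lemma lead_X:
  assumes rj: "r \<in> {1..m}" "j \<in> {1..n}"
  shows "lead (X r j) (single (0, 0, 1) (if r = i then - 1 else if r = Suc i then 1 else 0) + wexp m n r j)"
proof -
  have tm: "lead (tmon x c :: texp \<Rightarrow>\<^sub>0 'k) (single x c)" for x c
    unfolding tmon_def by (rule lead_single) simp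
  note lp = lead_path_mat[OF q]
  consider "r = i" | "r = Suc i" | "r \<noteq> i" "r \<noteq> Suc i" by blast
  then show ?thesis
  proof cases
    case 1
    then show ?thesis using lead_mult[OF q tm lp[OF rj]] rj by (simp add: \<phi>_Z)
  next
    case 2
    let ?u = "single (0, 0, 1) 1 + wexp m n (Suc i) j"
    have l: "lead (tmon (0, 0, 1) 1 \<boxtimes> P (Suc i) j) ?u" using 2 rj by (intro lead_mult[OF q tm lp]) auto
    have "v < ?u" if vk: "v \<in> keys (tmon (0, 0, 0) (- 1) \<boxtimes> P i j)" for v
    \<comment> \<open>\<open>(0, 0, 0)\<close> is the smallest variable of all, and its exponent -1
      puts the off-diagonal terms below the diagonal one.\<close>
    proof (rule texp_lessI[of _ "(0, 0, 0)"])
      obtain v1 v2 where v: "v1 \<in> keys (tmon (0, 0, 0) (- 1) :: texp \<Rightarrow>\<^sub>0 'k)" "v2 \<in> keys (P i j)" "v = v1 + v2"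
        using vk by (rule keys_torus_mult)
      have "lookup v2 (0, 0, 0) = 0"
        using v(2) by (intro tsupp_lookup[OF path_mat_tsupp[OF q]]) auto
      moreover have "v1 = single (0, 0, 0) (- 1)" using v(1) by (simp add: tmon_def)
      ultimately have "lookup v (0, 0, 0) = - 1" using v(3) by (simp add: lookup_add)
      then show "lookup v (0, 0, 0) < lookup ?u (0, 0, 0)" by (simp add: lookup_add lookup_single lookup_wexp)
      fix y :: tvar assume "y < (0, 0, 0)"
      then show "lookup v y = lookup ?u y" by (cases y) auto
    qed
    then have "lead (tmon (0, 0, 1) 1 \<boxtimes> P (Suc i) j + tmon (0, 0, 0) (- 1) \<boxtimes> P i j) ?u" by (rule lead_add[OF l])
    then show ?thesis using 2 rj i by (simp add: \<phi>_Z add.commute[of "tmon (0, 0, 0) (- 1) \<boxtimes> P i j"])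
  next
    case 3
    then show ?thesis using lp[OF rj] rj by (simp add: \<phi>_Z)
  qed
qed

lemma lead_xmon: "lead (xmon x) (xexp x)"
proof -
  obtain s w e where x: "x = (s, w, e)" by (rule prod_cases3)
  have tm: "lead (tmon x c :: texp \<Rightarrow>\<^sub>0 'k) (single x c)" for x c
    unfolding tmon_def by (rule lead_single) simp
  let ?c = "\<lambda>r. if r = i then - 1 else if r = Suc i then 1 else 0 :: int"
  have "lead (T.omon X rs ns e) (\<Sum>r\<in>{1..m}. \<Sum>j\<in>{1..n}. \<Sum>k<e r j. single (0, 0, 1) (?c r) + wexp m n r j)"
    using lead_omon[OF q, of rs ns X "\<lambda>r j. single (0, 0, 1) (?c r) + wexp m n r j" e] lead_X
    by (simp add: atLeastLessThanSuc_atLeastAtMost)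
  also have "(\<Sum>r\<in>{1..m}. \<Sum>j\<in>{1..n}. \<Sum>k<e r j. single (0, 0, 1) (?c r) + wexp m n r j) =
    single (0, 0, 1) (\<Sum>r\<in>{1..m}. \<Sum>j\<in>{1..n}. \<Sum>k<e r j. ?c r) + mexp m n e"
    unfolding mexp_def by (simp only: sum.distrib single_sum)
  finally show ?thesis unfolding x xmon_def xexp_def ba_def by (simp only: prod.case) (intro lead_mult[OF q] tm)
qed

lemma xexp_inj: "inj_on xexp (UNIV \<times> UNIV \<times> expo m n)"
proof (rule inj_onI)
  fix x y assume xy: "x \<in> UNIV \<times> UNIV \<times> expo m n" "y \<in> UNIV \<times> UNIV \<times> expo m n" and eq: "xexp x = xexp y"
  obtain s w e s' w' e' where x: "x = (s, w, e)" and y: "y = (s', w', e')" by (metis prod_cases3)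
  have e: "e \<in> expo m n" "e' \<in> expo m n" using xy x y by auto
  have lk: "lookup (xexp x) v = lookup (xexp y) v" for v by (simp add: eq)
  have m0: "lookup (mexp m n e) v = 0" if "v \<in> {(0, 2, 0), (0, 2, 1), (0, 0, 1)}" for e v
    using that by (auto simp: lookup_mexp lookup_wexp)
  have "mexp m n e = mexp m n e'"
  proof (rule poly_mapping_eqI)
    fix v
    show "lookup (mexp m n e) v = lookup (mexp m n e') v"
    proof (cases "v \<in> {(0, 2, 0), (0, 2, 1), (0, 0, 1)}")
      case False
      then show ?thesis using lk[of v] by (auto simp: x y xexp_def lookup_add lookup_single when_def)
    qed (simp add: m0)
  qed
  then have "e = e'" by (rule mexp_inj[OF e])
  moreover have "s = s'" "w = w'"
    using lk[of "(0, 2, 0)"] lk[of "(0, 2, 1)"] m0[of "(0, 2, 0)"] m0[of "(0, 2, 1)"]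
    by (simp_all add: x y xexp_def lookup_add lookup_single)
  ultimately show "x = y" by (simp add: x y)
qed

text \<open>Used for comparing coefficients in \<open>\<Phi> f = \<phi> f\<close>: the terms of
  interest are moved to one side, and all others are shown to involve different triples.\<close>

lemma xmon_disjoint:
  assumes "X1 \<subseteq> UNIV \<times> UNIV \<times> expo m n" "X2 \<subseteq> UNIV \<times> UNIV \<times> expo m n" "X1 \<inter> X2 = {}"
    and "x \<in> pm.span (xmon ` X1)" "x \<in> pm.span (xmon ` X2)"
  shows "x = 0"
  by (rule lead_span_disjoint[of X1 X2 xmon xexp, OF lead_xmon inj_on_subset[OF xexp_inj] assms(3-5) refl])
    (use assms(1,2) in blast)

lemma ba_span_xmon:
  "ba_span {(s, T.omon X rs ns \<epsilon>) | s \<epsilon>. S s \<and> \<epsilon> \<in> E} = pm.span (xmon ` {(s, w, \<epsilon>) | s w \<epsilon>. S s \<and> \<epsilon> \<in> E})"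
proof -
  have "{ba s w y | s w y. (s, y) \<in> {(s, T.omon X rs ns \<epsilon>) | s \<epsilon>. S s \<and> \<epsilon> \<in> E}} =
    xmon ` {(s, w, \<epsilon>) | s w \<epsilon>. S s \<and> \<epsilon> \<in> E}"
  proof (intro equalityI subsetI)
    fix x assume "x \<in> {ba s w y | s w y. (s, y) \<in> {(s, T.omon X rs ns \<epsilon>) | s \<epsilon>. S s \<and> \<epsilon> \<in> E}}"
    then obtain s w \<epsilon> where "x = ba s w (T.omon X rs ns \<epsilon>)" "S s" "\<epsilon> \<in> E" by blast
    then show "x \<in> xmon ` {(s, w, \<epsilon>) | s w \<epsilon>. S s \<and> \<epsilon> \<in> E}"
      by (intro image_eqI[of _ _ "(s, w, \<epsilon>)"]) (simp_all add: xmon_def)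
  next
    fix x assume "x \<in> xmon ` {(s, w, \<epsilon>) | s w \<epsilon>. S s \<and> \<epsilon> \<in> E}"
    then obtain s w \<epsilon> where "x = xmon (s, w, \<epsilon>)" "S s" "\<epsilon> \<in> E" by blast
    then show "x \<in> {ba s w y | s w y. (s, y) \<in> {(s, T.omon X rs ns \<epsilon>) | s \<epsilon>. S s \<and> \<epsilon> \<in> E}}"
      unfolding xmon_def prod.case by blast
  qed
  then show ?thesis by (simp only: ba_span_def)
qed

lemma shifts_expo: "shifts e \<epsilon> \<Longrightarrow> e \<in> expo m n \<Longrightarrow> \<epsilon> \<in> expo m n"
  unfolding expo_def
proof (intro CollectI allI impI)
  fix r j assume a: "shifts e \<epsilon>" "e \<in> {e. \<forall>i j. i \<notin> {1..m} \<or> j \<notin> {1..n} \<longrightarrow> e i j = 0}" "r \<notin> {1..m} \<or> j \<notin> {1..n}"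
  have e: "e k l = 0" if "k \<notin> {1..m} \<or> l \<notin> {1..n}" for k l using a(2) that by simp
  have s: "row_shift i (\<lambda>r. e r j) (\<lambda>r. \<epsilon> r j)" using a(1) by (simp add: shifts_def)
  show "\<epsilon> r j = 0"
  proof (cases "r = i \<or> r = Suc i")
    case True
    then have "j \<notin> {1..n}" using a(3) i by auto
    then have "e i j = 0" "e (Suc i) j = 0" by (simp_all add: e)
    then show ?thesis using True s by (auto simp: row_shift_def)
  next
    case False
    then have "\<epsilon> r j = e r j" using s by (simp add: row_shift_def)
    then show ?thesis using e[OF a(3)] by simp
  qed
qed

end


section \<open>The leading exponent of a coinvariant satisfies the tableau inequalities\<close>

section \<open>Leading exponents of coinvariants\<close>

lemma lead_sum_nonzero:
  assumes S: "finite S" "e \<in> S" "c e \<noteq> (0 :: 'k::field)"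
    and g: "\<And>e. e \<in> S \<Longrightarrow> lead (g e) (V e)" and V: "inj_on V S"
  shows "(\<Sum>e\<in>S. scale_pm (c e) (g e)) \<noteq> 0"
proof
  assume 0: "(\<Sum>e\<in>S. scale_pm (c e) (g e)) = 0"
  let ?x = "scale_pm (c e) (g e)"
  have eq: "?x = - (\<Sum>e\<in>S - {e}. scale_pm (c e) (g e))"
    using 0 S by (simp add: sum.remove[of S e] eq_neg_iff_add_eq_0)
  have "?x = 0"
  proof (rule lead_span_disjoint[of "{e}" "S - {e}" g V _ ?x])
    show "?x \<in> pm.span (g ` {e})" by (intro pm.span_scale pm.span_base) simp
    show "?x \<in> pm.span (g ` (S - {e}))"
      unfolding eq by (intro pm.span_neg pm.span_sum pm.span_scale pm.span_base) simp
  qed (use S g V in \<open>auto simp: insert_absorb dest: inj_onD[OF V]\<close>)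
  then show False using lead_nonzero[OF lead_scale[OF g[OF S(2)] S(3)]] by simp
qed

lemma torus_mult_sum:
  "x \<otimes>\<^bsub>torus q\<^esub> (\<Sum>e\<in>S. scale_pm (c e) (g e)) = (\<Sum>e\<in>S. scale_pm (c e) (x \<otimes>\<^bsub>torus q\<^esub> g e))"
  by (induction S rule: infinite_finite_induct) (simp_all add: torus_lr_distr)

lemma hom_sum_omon:
  fixes q :: "'k::field"
  assumes q: "q \<noteq> 0" and h: "h \<in> alg_hom (Oq_M q m n) (torus q)" and rs: "set rs \<subseteq> {1..m}" and cs: "set cs \<subseteq> {1..n}"
  shows "h (\<Oplus>\<^bsub>Oq_M q m n\<^esub>e\<in>S. c e \<odot>\<^bsub>Oq_M q m n\<^esub> qalg.omon (Oq_M q m n) (Z_gen q m n) rs cs (F e)) =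
    (\<Sum>e\<in>S. scale_pm (c e) (qalg.omon (torus q) (\<lambda>r j. h (Z_gen q m n r j)) rs cs (F e)))"
proof -
  interpret T: qalg "torus q" q by (rule torus_qalg[OF q])
  interpret A: qalg "Oq_M q m n" q by (rule qalg_Oq_M[OF q])
  have cl: "A.omon (Z_gen q m n) rs cs e \<in> carrier (Oq_M q m n)" for e
    using rs cs by (intro A.omon_closed[OF Z_gen_qmat[OF q]])
  have "h (\<Oplus>\<^bsub>Oq_M q m n\<^esub>e\<in>S. c e \<odot>\<^bsub>Oq_M q m n\<^esub> A.omon (Z_gen q m n) rs cs (F e)) =
    finsum (torus q) (\<lambda>e. h (c e \<odot>\<^bsub>Oq_M q m n\<^esub> A.omon (Z_gen q m n) rs cs (F e))) S"
    by (rule alg_hom_finsum[OF h A.kalg_axioms T.kalg_axioms]) (simp add: cl)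
  also have "\<dots> = (\<Sum>e\<in>S. scale_pm (c e) (h (A.omon (Z_gen q m n) rs cs (F e))))"
    unfolding torus_finsum[OF q] by (intro sum.cong refl) (simp add: alg_homD(5)[OF h cl])
  also have "\<dots> = (\<Sum>e\<in>S. scale_pm (c e) (T.omon (\<lambda>r j. h (Z_gen q m n r j)) rs cs (F e)))"
    using rs cs by (intro sum.cong refl arg_cong[where f = "scale_pm _"] omon_alg_hom[OF A.qalg_axioms T.qalg_axioms h])
      (auto intro!: Z_gen_closed)
  finally show ?thesis .
qed

context torus_reps
begin

lemma omon_append: "T.omon Y rs (as @ bs) e = T.omon Y rs as e \<boxtimes> T.omon Y rs bs e"
  unfolding T.omon_def by (simp add: T.lprod_append)

text \<open>Row i + 1 may occur in both words, at the end of the first and at the beginning of the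
  second. This overlap lets a column be cut between rows i + 1 and i and still be shifted
  afterwards.\<close>

lemma col_word_glue:
  assumes u: "\<And>r. r \<le> i \<Longrightarrow> u r = 0" and u': "\<And>r. Suc i < r \<Longrightarrow> u' r = 0"
  shows "col_word rs u @ col_word rs u' = col_word rs (\<lambda>r. u r + u' r)"
proof -
  have "col_word (rev [1..<i]) u = []" "col_word (rev [Suc (Suc i)..<Suc m]) u' = []"
    using u u' col_word_cong[of "rev [1..<i]" u "\<lambda>_. 0"] col_word_cong[of "rev [Suc (Suc i)..<Suc m]" u' "\<lambda>_. 0"]
    by (simp_all)
  moreover have "col_word (rev [1..<i]) u' = col_word (rev [1..<i]) (\<lambda>r. u r + u' r)"
    "col_word (rev [Suc (Suc i)..<Suc m]) u = col_word (rev [Suc (Suc i)..<Suc m]) (\<lambda>r. u r + u' r)"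
    using u u' by (auto intro!: col_word_cong)
  ultimately show ?thesis
    unfolding rs_split by (simp add: u u' replicate_add)
qed

lemma omon_glue:
  assumes l: "l \<in> {1..n}" and \<epsilon>: "\<And>r. r \<le> i \<Longrightarrow> \<epsilon> r l = 0" and \<epsilon>': "\<And>r. Suc i < r \<Longrightarrow> \<epsilon>' r l = 0"
  shows "T.omon Y rs [1..<Suc l] \<epsilon> \<boxtimes> T.omon Y rs [l..<Suc n] \<epsilon>' =
    T.omon Y rs ns (\<lambda>r j. if j < l then \<epsilon> r j else if j = l then \<epsilon> r l + \<epsilon>' r l else \<epsilon>' r j)" (is "_ = T.omon Y rs ns ?e")
proof -
  have c1: "[1..<Suc l] = [1..<l] @ [l]" and c2: "[l..<Suc n] = l # [Suc l..<Suc n]"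
    using l by (simp_all add: upt_conv_Cons upt_Suc)
  have ns: "ns = ([1..<l] @ [l]) @ [Suc l..<Suc n]"
    using l upt_add_eq_append[of 1 "Suc l" "Suc n - Suc l"] by (simp add: c1[symmetric])
  have eqs: "T.omon Y rs [1..<l] ?e = T.omon Y rs [1..<l] \<epsilon>" "T.omon Y rs [Suc l..<Suc n] ?e = T.omon Y rs [Suc l..<Suc n] \<epsilon>'"
    by (auto intro!: T.omon_cong)
  have "T.wprod Y l (col_word rs (\<lambda>r. \<epsilon> r l)) \<boxtimes> T.wprod Y l (col_word rs (\<lambda>r. \<epsilon>' r l)) =
    T.wprod Y l (col_word rs (\<lambda>r. ?e r l))"
    unfolding wprod_app[symmetric] using col_word_glue[of "\<lambda>r. \<epsilon> r l" "\<lambda>r. \<epsilon>' r l"] \<epsilon> \<epsilon>' by simp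
  then have "T.wprod Y l (col_word rs (\<lambda>r. \<epsilon> r l)) \<boxtimes> (T.wprod Y l (col_word rs (\<lambda>r. \<epsilon>' r l)) \<boxtimes> y) =
    T.wprod Y l (col_word rs (\<lambda>r. ?e r l)) \<boxtimes> y" for y
    by (simp only: T_assoc[symmetric])
  moreover have "T.omon Y rs [] e \<boxtimes> y = y" for e y
    using T.l_one[of y] by simp
  moreover have "T.wprod Y l w \<boxtimes> T.omon Y rs [] e = T.wprod Y l w" for e w
    using T.r_one[of "T.wprod Y l w"] by simp
  ultimately show ?thesis unfolding ns unfolding c1 c2 omon_append eqs T.omon_simps(2) by (simp only: T_assoc)
qed

definition omon_word :: "nat list \<Rightarrow> (nat \<Rightarrow> nat \<Rightarrow> nat) \<Rightarrow> (nat \<times> nat) list" where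
  "omon_word cs e = concat (map (\<lambda>j. map (\<lambda>r. (r, j)) (col_word rs (\<lambda>r. e r j))) cs)"

lemma omon_word_set: "set cs \<subseteq> {1..n} \<Longrightarrow> set (omon_word cs e) \<subseteq> {1..m} \<times> {1..n}"
  using set_col_word[of rs] by (fastforce simp: omon_word_def)

lemma omon_word:
  "set cs \<subseteq> {1..n} \<Longrightarrow> A.omon Z rs cs e = word (omon_word cs e)"
proof (induction cs)
  case Nil
  then show ?case by (simp add: omon_word_def word_def)
next
  case (Cons j cs)
  let ?w = "map (\<lambda>r. (r, j)) (col_word rs (\<lambda>r. e r j))"
  have w: "set ?w \<subseteq> {1..m} \<times> {1..n}" using set_col_word[of rs "\<lambda>r. e r j"] Cons.prems by auto
  have cl: "set (map (\<lambda>(r, j). Z r j) w) \<subseteq> carrier (Oq_M q m n)" if "set w \<subseteq> {1..m} \<times> {1..n}" for w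
    using that by (auto intro!: Z_gen_closed)
  have "word (omon_word (j # cs) e) = word ?w \<otimes>\<^bsub>Oq_M q m n\<^esub> word (omon_word cs e)"
    unfolding word_def using A.lprod_append[OF cl[OF w] cl[OF omon_word_set[of cs e]]] Cons.prems
    by (simp add: omon_word_def)
  moreover have "word ?w = A.wprod Z j (col_word rs (\<lambda>r. e r j))"
    unfolding word_def A.wprod_def by (simp add: comp_def)
  ultimately show ?case using Cons by simp
qed

lemma row_wt_omon_word: "row_wt i (omon_word cs e) = wt cs e"
proof (induction cs)
  case (Cons j cs)
  have 0: "row_wt i (map (\<lambda>r. (r, j)) w) = 0" if "i \<notin> set w" "Suc i \<notin> set w" for w
    using that by (induction w) auto
  have rep: "row_wt i (map (\<lambda>r. (r, j)) (replicate k r)) = int k * (if r = i then 1 else if r = Suc i then - 1 else 0)" for k r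
    by (induction k) (simp_all add: algebra_simps)
  have "row_wt i (map (\<lambda>r. (r, j)) (col_word rs u)) = int (u i) - int (u (Suc i))" for u
  proof -
    have "row_wt i (map (\<lambda>r. (r, j)) (col_word (rev [Suc (Suc i)..<Suc m]) u)) = 0"
      "row_wt i (map (\<lambda>r. (r, j)) (col_word (rev [1..<i]) u)) = 0"
      using set_col_word[of "rev [Suc (Suc i)..<Suc m]" u] set_col_word[of "rev [1..<i]" u] by (auto intro!: 0)
    then show ?thesis unfolding rs_split by (simp add: rep del: map_replicate upt_Suc)
  qed
  then show ?case using Cons.IH by (simp add: omon_word_def wt_def)
qed (simp add: omon_word_def wt_def)

lemma shifts_degree: "shifts e \<epsilon> \<Longrightarrow> degree_of m n \<epsilon> = degree_of m n e"
proof -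
  assume sh: "shifts e \<epsilon>"
  have "(\<Sum>r\<in>{1..m}. \<epsilon> r j) = (\<Sum>r\<in>{1..m}. e r j)" for j
  proof -
    have "{1..m} = {i, Suc i} \<union> ({1..m} - {i, Suc i})" using i by auto
    then have "(\<Sum>r\<in>{1..m}. u r) = u i + u (Suc i) + (\<Sum>r\<in>{1..m} - {i, Suc i}. u r)" for u :: "nat \<Rightarrow> nat"
      using sum.union_disjoint[of "{i, Suc i}" "{1..m} - {i, Suc i}" u] by simp
    moreover have "row_shift i (\<lambda>r. e r j) (\<lambda>r. \<epsilon> r j)" using sh by (simp add: shifts_def)
    ultimately show ?thesis by (simp add: row_shift_def)
  qed
  then show ?thesis unfolding degree_of_def by (subst (1 2) sum.swap) simp
qed

lemma wt_ns: "wt cs e = (\<Sum>j\<in>set cs. int (e i j) - int (e (Suc i) j))" if "distinct cs"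
  unfolding wt_def using that by (rule sum_list_distinct_conv_sum_set)

context
  fixes f :: "((nat \<times> nat) list \<Rightarrow>\<^sub>0 'k) set" and c :: "(nat \<Rightarrow> nat \<Rightarrow> nat) \<Rightarrow>\<^sub>0 'k"
  assumes \<Phi>f: "\<Phi> f = \<phi> f" and f: "f = lin_ext (Oq_M q m n) (A.omon Z rs ns) c" and cE: "keys c \<subseteq> expo m n"
begin

lemma hom_f:
  assumes "h \<in> alg_hom (Oq_M q m n) (torus q)"
  shows "h f = (\<Sum>e\<in>keys c. scale_pm (lookup c e) (T.omon (\<lambda>r j. h (Z r j)) rs ns e))"
  unfolding f lin_ext_def by (rule hom_sum_omon[OF q assms]) auto

text \<open>In \<open>\<phi> f\<close> the variables of the upper block do not occur. In
  \<open>\<Phi> f\<close> the monomial \<open>e1\<close> carries the power \<open>wt ns e1\<close>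
  of \<open>(0, 2, 1)\<close> and no power of \<open>(0, 2, 0)\<close>. With a nonzero weight
  nothing could cancel this term.\<close>

lemma wt_zero:
  assumes e1: "e1 \<in> keys c"
  shows "wt ns e1 = 0"
proof (rule ccontr)
  assume nz: "wt ns e1 \<noteq> 0"
  let ?K = "\<lambda>e. {(s, T.omon X rs ns \<epsilon>) | s \<epsilon>. (0 :: int) < s \<and> shifts e \<epsilon> \<and> (\<exists>j\<in>set ns. \<exists>r. \<epsilon> r j \<noteq> e r j)}"
  let ?t1 = "(0, wt ns e1, e1)"
  let ?X1 = "{?t1}" and ?X2 = "UNIV \<times> UNIV \<times> expo m n - {?t1}"
  have "\<forall>e. \<exists>z. z \<in> ba_span (?K e) \<and>
    T.omon X' rs ns e = ba 0 (wt ns e) (T.omon X rs ns e) + z"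
  proof
    have ns: "distinct ns" "set ns \<subseteq> {1..n}" by auto
    fix e
    show "\<exists>z. z \<in> ba_span (?K e) \<and>
      T.omon X' rs ns e = ba 0 (wt ns e) (T.omon X rs ns e) + z"
      using \<Phi>_omon[OF ns, of e] unfolding Bex_def[of "ba_span _"] .
  qed
  from choice[OF this] obtain z where zz: "\<forall>e. z e \<in> ba_span (?K e) \<and>
    T.omon X' rs ns e = ba 0 (wt ns e) (T.omon X rs ns e) + z e" ..
  have z: "z e \<in> ba_span (?K e)"
    "T.omon X' rs ns e = xmon (0, wt ns e, e) + z e" for e
  proof -
    show "z e \<in> ba_span (?K e)"
      using zz[THEN spec, of e] by (rule conjunct1)
    show "T.omon X' rs ns e = xmon (0, wt ns e, e) + z e"
      unfolding xmon_def prod.case using zz[THEN spec, of e] by (rule conjunct2)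
  qed
  have zX: "z e \<in> pm.span (xmon ` ?X2)" if "e \<in> expo m n" for e
  proof -
    have "z e \<in> ba_span {(s, T.omon X rs ns \<epsilon>) | s \<epsilon>. (0 :: int) < s \<and> \<epsilon> \<in> expo m n}"
      by (rule ba_span_mono[OF _ z(1)]) (use shifts_expo that in blast)
    then have "z e \<in> pm.span (xmon ` {(s, w, \<epsilon>) | s w \<epsilon>. 0 < s \<and> \<epsilon> \<in> expo m n})" unfolding ba_span_xmon .
    then show ?thesis by (rule subsetD[OF pm.span_mono, rotated]) auto
  qed
  let ?x = "scale_pm (lookup c e1) (xmon ?t1)"
  have M: "T.omon X rs ns e = xmon (0, 0, e)" for e by (simp add: xmon_def ba_1)
  have "(\<Sum>e\<in>keys c. scale_pm (lookup c e) (xmon (0, 0, e))) =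
      (\<Sum>e\<in>keys c. scale_pm (lookup c e) (xmon (0, wt ns e, e))) + (\<Sum>e\<in>keys c. scale_pm (lookup c e) (z e))"
    using \<Phi>f unfolding hom_f[OF \<Phi>] hom_f[OF \<phi>] z(2) M by (simp add: pm.scale_right_distrib sum.distrib)
  \<comment> \<open>The equation is solved for the single term at \<open>?t1\<close>; every other
    term lies over a different triple.\<close>
  then have x: "?x = (\<Sum>e\<in>keys c. scale_pm (lookup c e) (xmon (0, 0, e))) -
      (\<Sum>e\<in>keys c - {e1}. scale_pm (lookup c e) (xmon (0, wt ns e, e))) - (\<Sum>e\<in>keys c. scale_pm (lookup c e) (z e))"
    using e1 by (simp add: sum.remove[of "keys c" e1 "\<lambda>e. scale_pm (lookup c e) (xmon (0, wt ns e, e))"] algebra_simps)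
  have "?x = 0"
  proof (rule xmon_disjoint[of ?X1 ?X2])
    show "?x \<in> pm.span (xmon ` ?X1)" by (intro pm.span_scale pm.span_base) simp
    show "?x \<in> pm.span (xmon ` ?X2)"
      unfolding x
    proof (intro pm.span_diff pm.span_sum pm.span_scale)
      fix e assume "e \<in> keys c"
      then have e: "e \<in> expo m n" using cE by blast
      show "xmon (0, 0, e) \<in> pm.span (xmon ` ?X2)" using e nz by (intro pm.span_base imageI) auto
      show "z e \<in> pm.span (xmon ` ?X2)" by (rule zX[OF e])
    next
      fix e assume "e \<in> keys c - {e1}"
      then show "xmon (0, wt ns e, e) \<in> pm.span (xmon ` ?X2)" using cE by (intro pm.span_base imageI) auto
    qed
  qed (use e1 cE in auto)
  moreover have "lookup c e1 \<noteq> 0" using e1 by (simp add: in_keys_iff)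
  ultimately show False using lead_nonzero[OF lead_scale[OF lead_xmon]] by blast
qed

lemma wt_zero_rows:
  assumes "e \<in> keys c"
  shows "(\<Sum>j\<in>{1..n}. e i j) = (\<Sum>j\<in>{1..n}. e (Suc i) j)"
proof -
  have "int (\<Sum>j\<in>{1..n}. e i j) - int (\<Sum>j\<in>{1..n}. e (Suc i) j) = wt ns e"
    by (simp add: wt_ns atLeastLessThanSuc_atLeastAtMost sum_subtractf)
  then have "int (\<Sum>j\<in>{1..n}. e i j) = int (\<Sum>j\<in>{1..n}. e (Suc i) j)" using wt_zero[OF assms] by linarith
  then show ?thesis by (simp only: of_nat_eq_iff)
qed


context
  fixes e0 :: "nat \<Rightarrow> nat \<Rightarrow> nat" and l :: nat and d :: "(nat \<Rightarrow> nat \<Rightarrow> nat) \<Rightarrow> nat"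
  assumes e0: "e0 \<in> keys c" and max: "\<And>e. e \<in> keys c \<Longrightarrow> mexp m n e \<le> mexp m n e0"
    and rows: "\<And>e r. e \<in> keys c \<Longrightarrow> r \<in> {1..m} \<Longrightarrow> (\<Sum>j\<in>{1..n}. e r j) = d e" and l: "l \<in> {1..n}"
begin

abbreviation (input) "c1 \<equiv> [1..<Suc l]"
abbreviation (input) "c2 \<equiv> [l..<Suc n]"

text \<open>The part of \<open>e0\<close> in the columns before \<open>l\<close>, together with the
  rows from i + 1 on in column \<open>l\<close>. All occurring monomials in \<open>good\<close> have
  it as a left factor in the ordering by columns and decreasing rows; \<open>E2 e\<close> is the
  cofactor of \<open>e\<close>.\<close>

definition "E1 = (\<lambda>r j. if j < l then e0 r j else if Suc i \<le> r then e0 r j else 0)"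
text \<open>The difference in row i + 1 is one of natural numbers; by \<open>good_ge\<close> it is a
  true difference for the monomials concerned.\<close>

definition "E2 e = (\<lambda>r j. if j = l then (if Suc i < r then 0 else if r = Suc i then e r j - e0 r j else e r j) else e r j)"
definition glue :: "(nat \<Rightarrow> nat \<Rightarrow> nat) \<Rightarrow> (nat \<Rightarrow> nat \<Rightarrow> nat) \<Rightarrow> nat \<Rightarrow> nat \<Rightarrow> nat" where
  "glue \<epsilon> \<epsilon>' = (\<lambda>r j. if j < l then \<epsilon> r j else if j = l then \<epsilon> r l + \<epsilon>' r l else \<epsilon>' r j)"

text \<open>Monomials that agree with the maximal one up to column \<open>l\<close>, except in the
  two rows between which column \<open>l\<close> may be shifted. The degree is included because it
  fixes the row sums of the monomials of \<open>f\<close>, as \<open>mexp_less\<close>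
  requires.\<close>

definition "good = {\<epsilon> \<in> expo m n. degree_of m n \<epsilon> = degree_of m n e0 \<and>
  (\<forall>j r. j < l \<longrightarrow> \<epsilon> r j = e0 r j) \<and> (\<forall>r. r \<noteq> i \<longrightarrow> r \<noteq> Suc i \<longrightarrow> \<epsilon> r l = e0 r l)}"

lemma same_rows:
  assumes e: "e \<in> keys c" and deg: "degree_of m n e = degree_of m n e0" and r: "r \<in> {1..m}"
  shows "(\<Sum>j\<in>{1..n}. e r j) = (\<Sum>j\<in>{1..n}. e0 r j)"
proof -
  have "degree_of m n e = m * d e" if "e \<in> keys c" for e
    unfolding degree_of_def using rows[OF that] by simp
  then have "d e = d e0" using e e0 deg i by simp
  then show ?thesis using rows[OF e r] rows[OF e0 r] by simp
qed

text \<open>Take the first column before \<open>l\<close> where \<open>e\<close> differs from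
  \<open>e0\<close>. A shift that repairs it moves factors into row i + 1, so \<open>e\<close> has
  fewer of them there than \<open>e0\<close>, and by \<open>mexp_less\<close> its leading exponent
  would exceed the maximum. Without such a column, \<open>e\<close> would itself be in
  \<open>good\<close>.\<close>

lemma no_shift_into_good:
  assumes e: "e \<in> keys c - good" and sh: "shifts e \<epsilon>"
  shows "\<epsilon> \<notin> good"
proof
  assume g: "\<epsilon> \<in> good"
  have eE: "e \<in> expo m n" "e \<in> keys c" using e cE by auto
  have deg: "degree_of m n e = degree_of m n e0" using shifts_degree[OF sh] g by (simp add: good_def)
  have sj: "row_shift i (\<lambda>r. e r j) (\<lambda>r. \<epsilon> r j)" for j using sh by (simp add: shifts_def)
  show False
  proof (cases "\<exists>j<l. \<exists>r. e r j \<noteq> e0 r j")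
    case True
    let ?P = "\<lambda>j. j < l \<and> (\<exists>r. e r j \<noteq> e0 r j)"
    define j where "j = (LEAST j. ?P j)"
    have j: "?P j" unfolding j_def using True by (rule LeastI_ex)
    have before: "e r k = e0 r k" if "k < j" for r k
      using not_less_Least[of k ?P] that j unfolding j_def[symmetric] by auto
    have \<epsilon>j: "\<epsilon> r j = e0 r j" for r using g j by (simp add: good_def)
    have other: "e r j = e0 r j" if "r \<noteq> i" "r \<noteq> Suc i" for r using sj[of j] \<epsilon>j that by (simp add: row_shift_def)
    have less: "e (Suc i) j < e0 (Suc i) j"
    proof (rule ccontr)
      assume "\<not> e (Suc i) j < e0 (Suc i) j"
      then have "e i j = e0 i j" "e (Suc i) j = e0 (Suc i) j" using sj[of j] \<epsilon>j by (auto simp: row_shift_def)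
      then have "e r j = e0 r j" for r using other by (cases "r = i \<or> r = Suc i") auto
      then show False using j by blast
    qed
    have "j \<in> {1..n}"
    proof (rule ccontr)
      assume "j \<notin> {1..n}"
      then have "e0 (Suc i) j = 0" using e0 cE by (auto simp: expo_def)
      then show False using less by simp
    qed
    then have "mexp m n e0 < mexp m n e"
      using before other less i same_rows[OF eE(2) deg] by (intro mexp_less[where e = e and e' = e0 and l = j and r = "Suc i"]) auto
    then show False using max[OF eE(2)] by simp
  next
    case False
    have "e r l = e0 r l" if "r \<noteq> i" "r \<noteq> Suc i" for r
      using sj[of l] g that by (simp add: row_shift_def good_def)
    then have "e \<in> good" using False eE deg by (auto simp: good_def)
    then show False using e by blast
  qed
qed

text \<open>Otherwise \<open>mexp_less\<close>, applied in column \<open>l\<close>, would contradict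
  the maximality of \<open>e0\<close>.\<close>

lemma good_ge:
  assumes "e \<in> keys c \<inter> good" shows "e0 (Suc i) l \<le> e (Suc i) l"
proof (rule ccontr)
  assume "\<not> e0 (Suc i) l \<le> e (Suc i) l"
  then have "mexp m n e0 < mexp m n e"
    using assms l i same_rows[of e] by (intro mexp_less[where e = e and e' = e0 and l = l and r = "Suc i"]) (auto simp: good_def)
  then show False using max[of e] assms by simp
qed

lemma glue_E:
  assumes e: "e \<in> keys c \<inter> good" shows "glue E1 (E2 e) = e"
  using good_ge[OF e] e by (auto simp: glue_def E1_def E2_def good_def fun_eq_iff not_less_eq_eq le_Suc_eq)

text \<open>In \<open>E1\<close>, row i of column \<open>l\<close> is empty, so there is nothing to
  move.\<close>

lemma E1_shift: "shifts E1 \<epsilon> \<Longrightarrow> \<epsilon> r l = E1 r l"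
proof -
  assume "shifts E1 \<epsilon>"
  then have "row_shift i (\<lambda>r. E1 r l) (\<lambda>r. \<epsilon> r l)" by (simp add: shifts_def)
  then show ?thesis by (cases "r = i"; cases "r = Suc i") (auto simp: row_shift_def E1_def)
qed

lemma omon_glue':
  assumes "shifts E1 \<epsilon>" "shifts (E2 e) \<epsilon>'"
  shows "T.omon Y rs c1 \<epsilon> \<boxtimes> T.omon Y rs c2 \<epsilon>' = T.omon Y rs ns (glue \<epsilon> \<epsilon>')"
  unfolding glue_def
proof (rule omon_glue[OF l])
  show "\<epsilon> r l = 0" if "r \<le> i" for r using E1_shift[OF assms(1)] that by (simp add: E1_def)
  have "row_shift i (\<lambda>r. E2 e r l) (\<lambda>r. \<epsilon>' r l)" using assms(2) by (simp add: shifts_def)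
  then show "\<epsilon>' r l = 0" if "Suc i < r" for r using that by (simp add: row_shift_def E2_def)
qed

lemma shifts_glue:
  assumes e: "e \<in> keys c \<inter> good" and "shifts E1 \<epsilon>" "shifts (E2 e) \<epsilon>'"
  shows "shifts e (glue \<epsilon> \<epsilon>')"
  unfolding shifts_def
proof
  fix j
  have 1: "row_shift i (\<lambda>r. E1 r j) (\<lambda>r. \<epsilon> r j)" and 2: "row_shift i (\<lambda>r. E2 e r j) (\<lambda>r. \<epsilon>' r j)"
    using assms by (simp_all add: shifts_def)
  consider "j < l" | "j = l" | "l < j" by linarith
  then show "row_shift i (\<lambda>r. e r j) (\<lambda>r. glue \<epsilon> \<epsilon>' r j)"
  proof cases
    case 1
    then show ?thesis using \<open>row_shift i (\<lambda>r. E1 r j) (\<lambda>r. \<epsilon> r j)\<close> e by (simp add: glue_def E1_def good_def)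
  next
    case 2
    then show ?thesis
      using \<open>row_shift i (\<lambda>r. E2 e r j) (\<lambda>r. \<epsilon>' r j)\<close> E1_shift[OF assms(2)] good_ge[OF e] e
      by (auto simp: glue_def E1_def E2_def row_shift_def good_def)
  next
    case 3
    then show ?thesis using 2 by (simp add: glue_def E2_def)
  qed
qed

lemma glue_good:
  assumes e: "e \<in> keys c \<inter> good" and sh: "shifts E1 \<epsilon>" "shifts (E2 e) \<epsilon>'"
  shows "glue \<epsilon> \<epsilon>' \<in> expo m n" and "glue \<epsilon> \<epsilon>' \<in> good \<longleftrightarrow> (\<forall>j r. j < l \<longrightarrow> \<epsilon> r j = e0 r j)"
proof -
  note s = shifts_glue[OF e sh]
  show E: "glue \<epsilon> \<epsilon>' \<in> expo m n" using e cE by (intro shifts_expo[OF s]) auto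
  have "glue \<epsilon> \<epsilon>' r l = e0 r l" if "r \<noteq> i" "r \<noteq> Suc i" for r
  proof -
    have "row_shift i (\<lambda>r. e r l) (\<lambda>r. glue \<epsilon> \<epsilon>' r l)" using s by (simp add: shifts_def)
    then show ?thesis using that e by (simp add: row_shift_def good_def)
  qed
  moreover have "degree_of m n (glue \<epsilon> \<epsilon>') = degree_of m n e0" using shifts_degree[OF s] e by (simp add: good_def)
  ultimately show "glue \<epsilon> \<epsilon>' \<in> good \<longleftrightarrow> (\<forall>j r. j < l \<longrightarrow> \<epsilon> r j = e0 r j)"
    using E unfolding good_def by (simp add: glue_def)
qed

text \<open>Over \<open>good\<close>, \<open>f\<close> has a common left factor K and a cofactor h.
  On these monomials the equation \<open>\<Phi> f = \<phi> f\<close> says that the images of K and h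
  under \<open>\<phi>\<close> have the same product as the image of K under \<open>\<phi>\<close>,
  that of h under \<open>\<Phi>\<close>, and a power \<open>?w\<close> of \<open>(0, 2, 1)\<close>.
  The torus is a domain, so K cancels and h is a highest weight vector of weight
  \<open>- ?w\<close>.\<close>

theorem leading_exponent_dominated: "(\<Sum>j\<in>{1..l}. e0 (Suc i) j) \<le> (\<Sum>j\<in>{1..<l}. e0 i j)"
proof -
  let ?\<Omega> = "keys c \<inter> good" and ?\<Omega>' = "keys c - good"
  let ?K = "\<lambda>Y. T.omon Y rs c1 E1" and ?h = "\<lambda>Y. \<Sum>e\<in>?\<Omega>. scale_pm (lookup c e) (T.omon Y rs c2 (E2 e))"
  let ?w = "wt c1 E1"
  let ?G = "{(s, T.omon X rs ns \<epsilon>) | s \<epsilon>. True \<and> \<epsilon> \<in> good}" and ?B = "{(s, T.omon X rs ns \<epsilon>) | s \<epsilon>. True \<and> \<epsilon> \<in> expo m n - good}"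
  have self: "shifts e e" for e by (simp add: shifts_def row_shift_refl)
  have c1: "distinct c1" "set c1 \<subseteq> {1..n}" and c2: "distinct c2" "set c2 \<subseteq> {1..n}" using l by auto
  have ns: "distinct ns" "set ns \<subseteq> {1..n}" by auto
  have rsm: "set rs \<subseteq> {1..m}" by auto
  have e0g: "e0 \<in> ?\<Omega>" using e0 cE by (auto simp: good_def)
  have K\<Omega>: "?K Y \<boxtimes> ?h Y = (\<Sum>e\<in>?\<Omega>. scale_pm (lookup c e) (T.omon Y rs ns e))" for Y
  proof -
    have "?K Y \<boxtimes> ?h Y = (\<Sum>e\<in>?\<Omega>. scale_pm (lookup c e) (?K Y \<boxtimes> T.omon Y rs c2 (E2 e)))"
      by (rule torus_mult_sum)
    also have "\<dots> = (\<Sum>e\<in>?\<Omega>. scale_pm (lookup c e) (T.omon Y rs ns e))"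
      by (intro sum.cong refl) (simp only: omon_glue'[OF self self] glue_E)
    finally show ?thesis .
  qed
  have split: "(\<Sum>e\<in>keys c. F e) = (\<Sum>e\<in>?\<Omega>. F e) + (\<Sum>e\<in>?\<Omega>'. F e)" for F :: "_ \<Rightarrow> texp \<Rightarrow>\<^sub>0 'k"
    by (rule sum.Int_Diff) simp
  obtain z where z: "z \<in> ba_span {(s, T.omon X rs c1 \<epsilon>) | s \<epsilon>. (0 :: int) < s \<and> shifts E1 \<epsilon> \<and> (\<exists>j\<in>set c1. \<exists>r. \<epsilon> r j \<noteq> E1 r j)}"
    "?K X' = ba 0 ?w (?K X) + z"
    using \<Phi>_omon[OF c1, of E1] by blast
  have hX': "?h X' \<in> ba_span {(s, T.omon X rs c2 \<epsilon>') | s \<epsilon>'. \<exists>e\<in>?\<Omega>. shifts (E2 e) \<epsilon>'}"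
  proof (intro ba_span_closed(3,5))
    fix e assume e: "e \<in> ?\<Omega>"
    show "T.omon X' rs c2 (E2 e) \<in> ba_span {(s, T.omon X rs c2 \<epsilon>') | s \<epsilon>'. \<exists>e\<in>?\<Omega>. shifts (E2 e) \<epsilon>'}"
      by (rule ba_span_mono[OF _ \<Phi>_omon_span[OF c2]]) (use e in blast)
  qed
  \<comment> \<open>This difference is expressed in two ways, once by monomials in
    \<open>good\<close> and once by monomials outside \<open>good\<close>; hence it is 0.\<close>
  let ?D = "?K X \<boxtimes> ?h X - ba 0 ?w (?K X) \<boxtimes> ?h X'"
  have D: "?D = z \<boxtimes> ?h X' + (\<Sum>e\<in>?\<Omega>'. scale_pm (lookup c e) (T.omon X' rs ns e)) -
      (\<Sum>e\<in>?\<Omega>'. scale_pm (lookup c e) (T.omon X rs ns e))"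
  proof -
    have "?K X' \<boxtimes> ?h X' + (\<Sum>e\<in>?\<Omega>'. scale_pm (lookup c e) (T.omon X' rs ns e)) =
        ?K X \<boxtimes> ?h X + (\<Sum>e\<in>?\<Omega>'. scale_pm (lookup c e) (T.omon X rs ns e))"
      using \<Phi>f unfolding hom_f[OF \<Phi>] hom_f[OF \<phi>] split K\<Omega> .
    then show ?thesis unfolding z(2) torus_lr_distr by (simp add: algebra_simps)
  qed
  have K0: "?K X \<in> reserved" by (rule omon_reserved[OF rsm c1(2)])
  have "?D \<in> ba_span ?G"
  proof (rule ba_span_closed(4))
    show "?K X \<boxtimes> ?h X \<in> ba_span ?G"
      unfolding K\<Omega>
    proof (intro ba_span_closed(3,5))
      fix e assume "e \<in> ?\<Omega>"
      then show "T.omon X rs ns e \<in> ba_span ?G"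
        using ba_span_base[of 0 "T.omon X rs ns e" ?G 0] unfolding ba_1 by blast
    qed
    show "ba 0 ?w (?K X) \<boxtimes> ?h X' \<in> ba_span ?G"
    proof (rule ba_span_mult[OF ba_span_base[of 0 "?K X" "{(0, ?K X)}"] hX'])
      fix s y y' and s' :: int assume "(s, y) \<in> {(0 :: int, ?K X)}" "(s', y') \<in> {(s, T.omon X rs c2 \<epsilon>') | s \<epsilon>'. \<exists>e\<in>?\<Omega>. shifts (E2 e) \<epsilon>'}"
      then obtain e \<epsilon>' where *: "s = 0" "y = ?K X" "y' = T.omon X rs c2 \<epsilon>'" "e \<in> ?\<Omega>" "shifts (E2 e) \<epsilon>'" by blast
      have "glue E1 \<epsilon>' \<in> good" unfolding glue_good(2)[OF *(4) self *(5)] by (simp add: E1_def)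
      moreover have "y \<boxtimes> y' = scale_pm 1 (T.omon X rs ns (glue E1 \<epsilon>'))"
        unfolding *(2,3) omon_glue'[OF self *(5)] by simp
      ultimately show "\<exists>c y''. y \<boxtimes> y' = scale_pm c y'' \<and> (s + s', y'') \<in> ?G" by blast
    qed (use K0 in auto)
  qed
  moreover have "?D \<in> ba_span ?B"
    unfolding D
  proof (intro ba_span_closed(2,4))
    show "z \<boxtimes> ?h X' \<in> ba_span ?B"
    proof (rule ba_span_mult[OF z(1) hX'])
      fix y and s :: int assume "(s, y) \<in> {(s, T.omon X rs c1 \<epsilon>) | s \<epsilon>. (0 :: int) < s \<and> shifts E1 \<epsilon> \<and> (\<exists>j\<in>set c1. \<exists>r. \<epsilon> r j \<noteq> E1 r j)}"
      then obtain \<epsilon> where *: "y = T.omon X rs c1 \<epsilon>" "shifts E1 \<epsilon>" "\<exists>j\<in>set c1. \<exists>r. \<epsilon> r j \<noteq> E1 r j" by blast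
      show "y \<in> reserved" unfolding * by (rule omon_reserved[OF rsm c1(2)])
      fix y' and s' :: int assume "(s', y') \<in> {(s, T.omon X rs c2 \<epsilon>') | s \<epsilon>'. \<exists>e\<in>?\<Omega>. shifts (E2 e) \<epsilon>'}"
      then obtain e \<epsilon>' where **: "y' = T.omon X rs c2 \<epsilon>'" "e \<in> ?\<Omega>" "shifts (E2 e) \<epsilon>'" by blast
      obtain j r where j: "j \<in> set c1" "\<epsilon> r j \<noteq> E1 r j" using *(3) by blast
      \<comment> \<open>A shift of \<open>E1\<close> leaves column \<open>l\<close> alone, so the
        change made in \<open>z\<close> shows in an earlier column and leads out of
        \<open>good\<close>.\<close>
      have "j \<noteq> l" using j(2) E1_shift[OF *(2)] by blast
      then have "j < l" using j(1) by simp
      then have "glue \<epsilon> \<epsilon>' \<notin> good" unfolding glue_good(2)[OF **(2) *(2) **(3)] using j(2) by (auto simp: E1_def)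
      moreover have "y \<boxtimes> y' = scale_pm 1 (T.omon X rs ns (glue \<epsilon> \<epsilon>'))"
        unfolding *(1) **(1) omon_glue'[OF *(2) **(3)] by simp
      ultimately show "\<exists>c y''. y \<boxtimes> y' = scale_pm c y'' \<and> (s + s', y'') \<in> ?B"
        using glue_good(1)[OF **(2) *(2) **(3)] by blast
    qed
  next
    show "(\<Sum>e\<in>?\<Omega>'. scale_pm (lookup c e) (T.omon X' rs ns e)) \<in> ba_span ?B"
    proof (intro ba_span_closed(3,5))
      fix e assume e: "e \<in> ?\<Omega>'"
      show "T.omon X' rs ns e \<in> ba_span ?B"
      proof (rule ba_span_mono[OF _ \<Phi>_omon_span[OF ns]])
        have "\<epsilon> \<in> expo m n - good" if "shifts e \<epsilon>" for \<epsilon>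
          using no_shift_into_good[OF e that] shifts_expo[OF that] e cE by blast
        then show "{(s, T.omon X rs ns \<epsilon>) | s \<epsilon>. shifts e \<epsilon>} \<subseteq> ?B" by blast
      qed
    qed
    show "(\<Sum>e\<in>?\<Omega>'. scale_pm (lookup c e) (T.omon X rs ns e)) \<in> ba_span ?B"
    proof (intro ba_span_closed(3,5))
      fix e assume "e \<in> ?\<Omega>'"
      then have "(0, T.omon X rs ns e) \<in> ?B" using cE by blast
      then show "T.omon X rs ns e \<in> ba_span ?B" using ba_span_base[of 0 "T.omon X rs ns e" ?B 0] unfolding ba_1 by blast
    qed
  qed
  ultimately have "?D = 0"
    unfolding ba_span_xmon by (rule xmon_disjoint[rotated 3]) (auto simp: good_def)
  then have "?K X \<boxtimes> ?h X = ba 0 ?w (?K X) \<boxtimes> ?h X'" by simp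
  also have "\<dots> = (tmon (0, 2, 1) ?w \<boxtimes> ?K X) \<boxtimes> ?h X'" by (simp add: ba_def tmon_0)
  also have "\<dots> = ?K X \<boxtimes> (tmon (0, 2, 1) ?w \<boxtimes> ?h X')"
    unfolding reserved_commute[OF K0, symmetric] T_assoc ..
  finally have eq: "?K X \<boxtimes> ?h X = ?K X \<boxtimes> (tmon (0, 2, 1) ?w \<boxtimes> ?h X')" .
  \<comment> \<open>The common factor has a leading exponent, so it is nonzero and can be
    cancelled.\<close>
  have "lead (?K X) (\<Sum>r\<in>set rs. \<Sum>j\<in>set c1. \<Sum>k<E1 r j. single (0, 0, 1) (if r = i then - 1 else if r = Suc i then 1 else 0) + wexp m n r j)"
    using l by (intro lead_omon[OF q] lead_X) auto
  then have "?h X = tmon (0, 2, 1) ?w \<boxtimes> ?h X'" using torus_cancel[OF q lead_nonzero eq] by blast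
  then have "tmon (0, 2, 1) (- ?w) \<boxtimes> ?h X = (tmon (0, 2, 1) (- ?w) \<boxtimes> tmon (0, 2, 1) ?w) \<boxtimes> ?h X'" by (simp only: T_assoc)
  then have hX: "?h X' = tmon (0, 2, 1) (- ?w) \<boxtimes> ?h X" by (simp add: tmon_same tmon_0)
  let ?hA = "\<Oplus>\<^bsub>Oq_M q m n\<^esub>e\<in>?\<Omega>. lookup c e \<odot>\<^bsub>Oq_M q m n\<^esub> A.omon Z rs c2 (E2 e)"
  note him = hom_sum_omon[OF q _ rsm c2(2), where c = "lookup c" and F = E2 and S = ?\<Omega>]
  \<comment> \<open>The whole monomial has weight 0 by \<open>wt_zero\<close>, so the weight of the
    cofactor is opposite to that of the common factor.\<close>
  have wtE2: "wt c2 (E2 e) = - ?w" if e: "e \<in> ?\<Omega>" for e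
  proof -
    have "wt ns e = ?w + wt c2 (E2 e)"
    proof -
      have "wt c1 E1 = (\<Sum>j\<in>{1..<l}. int (e i j) - int (e (Suc i) j)) - int (e0 (Suc i) l)"
        using l e by (simp add: wt_def upt_Suc interv_sum_list_conv_sum_set_nat E1_def good_def)
      moreover have "wt c2 (E2 e) = int (e i l) - (int (e (Suc i) l) - int (e0 (Suc i) l)) + (\<Sum>j\<in>{Suc l..<Suc n}. int (e i j) - int (e (Suc i) j))"
        using l good_ge[OF e] by (simp add: wt_def upt_conv_Cons interv_sum_list_conv_sum_set_nat E2_def of_nat_diff)
      moreover have "wt ns e = (\<Sum>j\<in>{1..<l}. int (e i j) - int (e (Suc i) j)) + (int (e i l) - int (e (Suc i) l)) +
        (\<Sum>j\<in>{Suc l..<Suc n}. int (e i j) - int (e (Suc i) j))"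
      proof -
        have "{1..<Suc n} = {1..<l} \<union> ({l} \<union> {Suc l..<Suc n})" using l by auto
        then show ?thesis by (simp add: wt_ns sum.union_disjoint)
      qed
      ultimately show ?thesis by simp
    qed
    then show ?thesis using wt_zero[of e] e by simp
  qed
  have "- ?w \<le> 0"
  proof (rule highest_weight_nonpos[of ?hA])
    show "\<Phi> ?hA = tmon (0, 2, 1) (- ?w) \<boxtimes> \<phi> ?hA" unfolding him[OF \<Phi>] him[OF \<phi>] by (rule hX)
    \<comment> \<open>Multiplied by the common factor, the cofactor becomes a combination of ordered
      monomials with distinct leading exponents, in which \<open>e0\<close> occurs.\<close>
    show "\<theta> ?hA \<noteq> 0"
    proof
      assume "\<theta> ?hA = 0"
      then have "?K (\<lambda>r j. \<theta> (Z r j)) \<boxtimes> ?h (\<lambda>r j. \<theta> (Z r j)) = 0" unfolding him[OF \<theta>] by (simp add: torus_lr_distr)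
      moreover have "(\<Sum>e\<in>?\<Omega>. scale_pm (lookup c e) (T.omon (\<lambda>r j. \<theta> (Z r j)) rs ns e)) \<noteq> 0"
      proof (rule lead_sum_nonzero[where V = "mexp m n"])
        show "lead (T.omon (\<lambda>r j. \<theta> (Z r j)) rs ns e) (mexp m n e)" for e
          using lead_omon[OF q, of rs ns "\<lambda>r j. \<theta> (Z r j)" "wexp m n" e] lead_path_mat[OF q]
          by (simp add: \<theta>_Z mexp_def atLeastLessThanSuc_atLeastAtMost)
        show "inj_on (mexp m n) ?\<Omega>" using cE by (intro inj_onI mexp_inj) auto
      qed (use e0g in \<open>auto simp: in_keys_iff\<close>)
      ultimately show False unfolding K\<Omega> by blast
    qed
    have W: "{word w | w. set w \<subseteq> {1..m} \<times> {1..n} \<and> row_wt i w = - ?w} \<subseteq> carrier (Oq_M q m n)" using word_closed by auto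
    have fin: "(\<Oplus>\<^bsub>Oq_M q m n\<^esub>e\<in>S. lookup c e \<odot>\<^bsub>Oq_M q m n\<^esub> A.omon Z rs c2 (E2 e)) \<in>
      A.vspan {word w | w. set w \<subseteq> {1..m} \<times> {1..n} \<and> row_wt i w = - ?w}" if "finite S" "S \<subseteq> ?\<Omega>" for S
      using that
    proof (induction S rule: finite_induct)
      case empty
      then show ?case by (simp add: A.vspan.zero)
    next
      case (insert e S)
      have cl: "A.omon Z rs c2 e \<in> carrier (Oq_M q m n)" for e
        using c2 by (intro A.omon_closed[OF Z_gen_qmat[OF q]]) auto
      have "A.omon Z rs c2 (E2 e) \<in> {word w | w. set w \<subseteq> {1..m} \<times> {1..n} \<and> row_wt i w = - ?w}"
        unfolding omon_word[OF c2(2)]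
        by (rule CollectI, intro exI[of _ "omon_word c2 (E2 e)"] conjI refl omon_word_set c2(2))
          (use row_wt_omon_word wtE2 insert.prems in simp)
      note step = A.vspan.step[OF this insert.IH]
      have "(\<Oplus>\<^bsub>Oq_M q m n\<^esub>e\<in>insert e S. lookup c e \<odot>\<^bsub>Oq_M q m n\<^esub> A.omon Z rs c2 (E2 e)) =
        lookup c e \<odot>\<^bsub>Oq_M q m n\<^esub> A.omon Z rs c2 (E2 e) \<oplus>\<^bsub>Oq_M q m n\<^esub>
        (\<Oplus>\<^bsub>Oq_M q m n\<^esub>e\<in>S. lookup c e \<odot>\<^bsub>Oq_M q m n\<^esub> A.omon Z rs c2 (E2 e))"
        using insert.hyps by (intro A.finsum_insert) (simp_all add: cl)
      then show ?case using step insert.prems by simp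
    qed
    show "?hA \<in> A.vspan {word w | w. set w \<subseteq> {1..m} \<times> {1..n} \<and> row_wt i w = - ?w}" by (rule fin) auto
  qed
  \<comment> \<open>Column \<open>l\<close> enters the weight of \<open>E1\<close> only through row
    i + 1; this is the reason why the two ranges of summation in the claim differ by one.\<close>
  moreover have "?w = (\<Sum>j\<in>{1..<l}. int (e0 i j) - int (e0 (Suc i) j)) - int (e0 (Suc i) l)"
    using l by (simp add: wt_def upt_Suc interv_sum_list_conv_sum_set_nat E1_def)
  moreover have "int (\<Sum>j\<in>{1..l}. e0 (Suc i) j) = (\<Sum>j\<in>{1..<l}. int (e0 (Suc i) j)) + int (e0 (Suc i) l)"
  proof -
    have "{1..l} = insert l {1..<l}" using l by auto
    then show ?thesis by simp
  qed
  moreover have "int (\<Sum>j\<in>{1..<l}. e0 i j) = (\<Sum>j\<in>{1..<l}. int (e0 i j))" by simp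
  ultimately have "int (\<Sum>j\<in>{1..l}. e0 (Suc i) j) \<le> int (\<Sum>j\<in>{1..<l}. e0 i j)" by (simp add: sum_subtractf)
  then show ?thesis by (simp only: of_nat_le_iff)
qed

end

end

end


section \<open>Products of maximal minors realise the remaining leading exponents\<close>

section \<open>Standard monomials in the maximal minors\<close>

lemma generated_subalgebra_iff:
  "x \<in> generated_subalgebra R X \<longleftrightarrow> (\<forall>S. subalgebra R S \<longrightarrow> X \<subseteq> S \<longrightarrow> x \<in> S)"
  by (auto simp: generated_subalgebra_def hull_def subalgebra_def)

lemma generated_subalgebra_closed:
  fixes R :: "('k::field, 'a) module"
  shows "\<one>\<^bsub>R\<^esub> \<in> generated_subalgebra R X" "\<zero>\<^bsub>R\<^esub> \<in> generated_subalgebra R X" "x \<in> X \<Longrightarrow> x \<in> generated_subalgebra R X"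
    "x \<in> generated_subalgebra R X \<Longrightarrow> y \<in> generated_subalgebra R X \<Longrightarrow> x \<otimes>\<^bsub>R\<^esub> y \<in> generated_subalgebra R X"
    "x \<in> generated_subalgebra R X \<Longrightarrow> y \<in> generated_subalgebra R X \<Longrightarrow> x \<oplus>\<^bsub>R\<^esub> y \<in> generated_subalgebra R X"
    "x \<in> generated_subalgebra R X \<Longrightarrow> c \<odot>\<^bsub>R\<^esub> x \<in> generated_subalgebra R X"
proof -
  let ?G = "generated_subalgebra R X"
  have I: "z \<in> ?G" if "\<And>S. subring S R \<Longrightarrow> \<forall>c. \<forall>x\<in>S. c \<odot>\<^bsub>R\<^esub> x \<in> S \<Longrightarrow> ?G \<subseteq> S \<Longrightarrow> X \<subseteq> S \<Longrightarrow> z \<in> S" for z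
    unfolding generated_subalgebra_iff
  proof (intro allI impI)
    fix S assume S: "subalgebra R S" "X \<subseteq> S"
    then have "?G \<subseteq> S" by (intro subsetI) (simp add: generated_subalgebra_iff)
    then show "z \<in> S" using that[of S] S by (simp add: subalgebra_def)
  qed
  show "\<one>\<^bsub>R\<^esub> \<in> ?G" by (rule I) (rule subringE(3))
  show "\<zero>\<^bsub>R\<^esub> \<in> ?G" by (rule I) (rule subringE(2))
  show "x \<in> X \<Longrightarrow> x \<in> ?G" by (rule I) (rule subsetD)
  show "x \<in> ?G \<Longrightarrow> y \<in> ?G \<Longrightarrow> x \<otimes>\<^bsub>R\<^esub> y \<in> ?G" by (rule I) (rule subringE(6), assumption, (erule subsetD, assumption)+)
  show "x \<in> ?G \<Longrightarrow> y \<in> ?G \<Longrightarrow> x \<oplus>\<^bsub>R\<^esub> y \<in> ?G" by (rule I) (rule subringE(7), assumption, (erule subsetD, assumption)+)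
  show "x \<in> ?G \<Longrightarrow> c \<odot>\<^bsub>R\<^esub> x \<in> ?G" by (rule I) (drule spec, erule bspec, erule subsetD, assumption)
qed

lemma increasing_inj_on: "(\<And>i k. i \<in> S \<Longrightarrow> k \<in> S \<Longrightarrow> i < k \<Longrightarrow> c i < c k) \<Longrightarrow> inj_on c S"
  for c :: "nat \<Rightarrow> nat"
  by (rule linorder_inj_onI) (auto dest: less_imp_neq)

lemma mexp_add: "mexp m n (\<lambda>i j. e i j + e' i j) = mexp m n e + mexp m n e'"
proof -
  have "(\<Sum>k<a + b. x) = (\<Sum>k<a. x) + (\<Sum>k<b. x)" for a b :: nat and x :: texp
    by (induction b) (simp_all add: add_ac)
  then show ?thesis by (simp add: mexp_def sum.distrib)
qed

text \<open>The exponent matrix of one term of a maximal minor, a product with one factor from each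
  row.\<close>

definition unit_exp :: "nat \<Rightarrow> (nat \<Rightarrow> nat) \<Rightarrow> nat \<Rightarrow> nat \<Rightarrow> nat" where
  "unit_exp m d i j = (if i \<in> {1..m} \<and> j = d i then 1 else 0)"

lemma mexp_unit_exp:
  assumes "\<And>i. i \<in> {1..m} \<Longrightarrow> d i \<in> {1..n}"
  shows "mexp m n (unit_exp m d) = (\<Sum>i\<in>{1..m}. wexp m n i (d i))"
  unfolding mexp_def
proof (intro sum.cong refl)
  fix i assume i: "i \<in> {1..m}"
  have "(\<Sum>j\<in>{1..n}. \<Sum>k<unit_exp m d i j. wexp m n i j) = (\<Sum>j\<in>{1..n}. if j = d i then wexp m n i j else 0)"
    using i by (intro sum.cong refl) (auto simp: unit_exp_def lessThan_Suc One_nat_def)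
  then show "(\<Sum>j\<in>{1..n}. \<Sum>k<unit_exp m d i j. wexp m n i j) = wexp m n i (d i)"
    using assms[OF i] by (simp add: sum.delta)
qed

text \<open>The reason why the diagonal term leads in a maximal minor: the first \<open>k\<close>
  moved by \<open>\<sigma>\<close> is the value at some later row \<open>s\<close>, so column
  \<open>c k\<close> gets its factor in a later row, and \<open>mexp_less\<close> makes the exponent
  smaller.\<close>

lemma mexp_permuted_less:
  assumes c: "\<And>i. i \<in> {1..m} \<Longrightarrow> c i \<in> {1..n}" "\<And>i k. i \<in> {1..m} \<Longrightarrow> k \<in> {1..m} \<Longrightarrow> i < k \<Longrightarrow> c i < c k"
    and \<sigma>: "\<sigma> permutes {1..m}" "\<sigma> \<noteq> id"
  shows "mexp m n (unit_exp m (\<lambda>i. c (\<sigma> i))) < mexp m n (unit_exp m c)"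
proof -
  let ?P = "\<lambda>k. \<sigma> k \<noteq> k"
  have inj: "c a = c b \<longleftrightarrow> a = b" if "a \<in> {1..m}" "b \<in> {1..m}" for a b
    using c(2)[of a b] c(2)[of b a] that by (cases a b rule: linorder_cases) auto
  have mem: "\<sigma> a \<in> {1..m} \<longleftrightarrow> a \<in> {1..m}" for a using permutes_in_image[OF \<sigma>(1)] .
  define k where "k = (LEAST k. ?P k)"
  have "\<exists>k. ?P k" using \<sigma>(2) by (auto simp: fun_eq_iff)
  then have k: "\<sigma> k \<noteq> k" unfolding k_def by (rule LeastI_ex)
  have km: "k \<in> {1..m}" using k permutes_not_in[OF \<sigma>(1)] by blast
  have before: "\<sigma> a = a" if "a < k" for a using not_less_Least[of a ?P] that unfolding k_def by blast
  obtain s where s: "\<sigma> s = k" using permutes_surj[OF \<sigma>(1)] by (metis surjD)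
  \<comment> \<open>All numbers before \<open>k\<close> are fixed by \<open>\<sigma>\<close>, so the
    preimage of \<open>k\<close> cannot be among them.\<close>
  have sk: "k < s" using before[of s] k s by (cases s k rule: linorder_cases) auto
  have sm: "s \<in> {1..m}" using s km mem by blast
  show ?thesis
  proof (rule mexp_less[where l = "c k" and r = s])
    show "s \<in> {1..m}" "c k \<in> {1..n}" using sm c(1)[OF km] by auto
    have row: "(\<Sum>j\<in>{1..n}. unit_exp m d i j) = 1" if "i \<in> {1..m}" "d i \<in> {1..n}" for d i
      using that by (simp add: unit_exp_def sum.delta)
    show "(\<Sum>j\<in>{1..n}. unit_exp m c i j) = (\<Sum>j\<in>{1..n}. unit_exp m (\<lambda>i. c (\<sigma> i)) i j)" if "i \<in> {1..m}" for i
      using that mem c(1) by (simp add: row)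
    show "unit_exp m c s (c k) < unit_exp m (\<lambda>i. c (\<sigma> i)) s (c k)"
      using sm km sk s inj[OF km sm] by (simp add: unit_exp_def)
    show "unit_exp m c a (c k) = unit_exp m (\<lambda>i. c (\<sigma> i)) a (c k)" if "a \<in> {1..m}" "s < a" for a
    proof -
      have "\<sigma> a \<noteq> k" using s that permutes_inj[OF \<sigma>(1)] by (metis injD less_irrefl)
      then show ?thesis using that sk inj[OF km that(1)] inj[OF km, of "\<sigma> a"] mem[of a] by (simp add: unit_exp_def)
    qed
    show "unit_exp m c a j = unit_exp m (\<lambda>i. c (\<sigma> i)) a j" if "a \<in> {1..m}" "1 \<le> j" "j < c k" for a j
    proof -
      have lt: "b < k" if "b \<in> {1..m}" "c b < c k" for b
        using c(2)[OF km that(1)] that by (cases b k rule: linorder_cases) auto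
      have "j = c a \<longleftrightarrow> j = c (\<sigma> a)"
      proof
        assume "j = c a"
        then show "j = c (\<sigma> a)" using before[OF lt[OF that(1)]] that by simp
      next
        assume j: "j = c (\<sigma> a)"
        then have "\<sigma> a < k" using lt[of "\<sigma> a"] mem[of a] that by simp
        then have "\<sigma> (\<sigma> a) = \<sigma> a" by (rule before)
        then have "\<sigma> a = a" using permutes_inj[OF \<sigma>(1)] by (metis injD)
        then show "j = c a" using j by simp
      qed
      then show ?thesis by (simp add: unit_exp_def)
    qed
  qed
qed

lemma lead_sum:
  assumes S: "finite S" "s \<in> S" and s: "lead (g s) u" and less: "\<And>t v. t \<in> S - {s} \<Longrightarrow> v \<in> keys (g t) \<Longrightarrow> v < u"
  shows "lead (sum g S) u"
proof -
  have "lead (g s + sum g (S - {s})) u"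
  proof (rule lead_add[OF s])
    fix v assume "v \<in> keys (sum g (S - {s}))"
    then have "v \<in> (\<Union>t\<in>S - {s}. keys (g t))" using keys_sum_subset[of "S - {s}" g "\<Union>t\<in>S - {s}. keys (g t)"] by blast
    then show "v < u" using less by blast
  qed
  then show ?thesis using S by (simp add: sum.remove)
qed

context
  fixes q :: "'k::field" and m n :: nat and \<theta> :: "((nat \<times> nat) list \<Rightarrow>\<^sub>0 'k) set \<Rightarrow> texp \<Rightarrow>\<^sub>0 'k"
  assumes q: "q \<noteq> 0" and \<theta>: "\<theta> \<in> alg_hom (Oq_M q m n) (torus q)"
    and \<theta>_Z: "\<And>r j. r \<in> {1..m} \<Longrightarrow> j \<in> {1..n} \<Longrightarrow> \<theta> (Z_gen q m n r j) = path_mat q m n r j"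
begin

interpretation T: qalg "torus q" q by (rule torus_qalg[OF q])
interpretation A: qalg "Oq_M q m n" q by (rule qalg_Oq_M[OF q])

lemma lead_max_qminor:
  assumes c: "\<And>i. i \<in> {1..m} \<Longrightarrow> c i \<in> {1..n}" "\<And>i k. i \<in> {1..m} \<Longrightarrow> k \<in> {1..m} \<Longrightarrow> i < k \<Longrightarrow> c i < c k"
  shows "lead (\<theta> (max_qminor q m n (c ` {1..m}))) (mexp m n (unit_exp m c))"
proof -
  have sorted: "sorted_list_of_set (c ` {1..m}) = map c [1..<Suc m]"
  proof (rule sorted_list_of_set_unique[THEN iffD1])
    have "sorted_wrt (<) (map c [1..<Suc m])"
      unfolding sorted_wrt_map
      by (rule sorted_wrt_mono_rel[of _ "(<)"]) (use c(2) in \<open>auto\<close>)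
    moreover have "set (map c [1..<Suc m]) = c ` {1..m}" by auto
    moreover have "card (c ` {1..m}) = m"
      using increasing_inj_on[of "{1..m}" c, OF c(2)] by (subst card_image) auto
    ultimately show "sorted_wrt (<) (map c [1..<Suc m]) \<and> set (map c [1..<Suc m]) = c ` {1..m} \<and>
      length (map c [1..<Suc m]) = card (c ` {1..m})" by simp
  qed simp
  have ck: "sorted_list_of_set (c ` {1..m}) ! (k - 1) = c k" if "k \<in> {1..m}" for k
  proof -
    have "k - 1 < length [1..<Suc m]" "[1..<Suc m] ! (k - 1) = k" using that by (auto simp: nth_upt)
    then show ?thesis unfolding sorted by simp
  qed
  have "\<theta> (max_qminor q m n (c ` {1..m})) =
    T.qminor m (\<lambda>i j. \<theta> (Z_gen q m n i j)) (\<lambda>k. sorted_list_of_set (c ` {1..m}) ! (k - 1))"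
    unfolding max_qminor_qminor[OF q]
    by (rule qminor_alg_hom[OF A.qalg_axioms T.qalg_axioms \<theta>]) (intro Z_gen_closed, simp_all only: ck c(1))
  also have "\<dots> = T.qminor m (path_mat q m n) c"
    by (rule T.qminor_cong) (use ck c(1) \<theta>_Z in auto)
  also have "\<dots> = (\<Sum>\<sigma>\<in>{\<sigma>. \<sigma> permutes {1..m}}. scale_pm ((- q) ^ perm_length m \<sigma>)
      (T.lprod (map (\<lambda>i. path_mat q m n i (c (\<sigma> i))) [1..<Suc m])))"
    unfolding T.qminor_def torus_finsum[OF q] by simp
  finally have eq: "\<theta> (max_qminor q m n (c ` {1..m})) = (\<Sum>\<sigma>\<in>{\<sigma>. \<sigma> permutes {1..m}}. scale_pm ((- q) ^ perm_length m \<sigma>)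
      (T.lprod (map (\<lambda>i. path_mat q m n i (c (\<sigma> i))) [1..<Suc m])))" .
  have summand: "lead (scale_pm ((- q) ^ perm_length m \<sigma>) (T.lprod (map (\<lambda>i. path_mat q m n i (c (\<sigma> i))) [1..<Suc m])))
    (mexp m n (unit_exp m (\<lambda>i. c (\<sigma> i))))" if \<sigma>: "\<sigma> permutes {1..m}" for \<sigma>
  proof (rule lead_scale)
    have c\<sigma>: "c (\<sigma> i) \<in> {1..n}" if "i \<in> {1..m}" for i using c(1) permutes_in_image[OF \<sigma>] that by blast
    have m1: "mexp m n (unit_exp m (\<lambda>i. c (\<sigma> i))) = (\<Sum>i\<in>{1..m}. wexp m n i (c (\<sigma> i)))"
      by (rule mexp_unit_exp) (rule c\<sigma>)
    have "lead (T.lprod (map (\<lambda>i. path_mat q m n i (c (\<sigma> i))) [1..<Suc m]))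
      (sum_list (map (\<lambda>i. wexp m n i (c (\<sigma> i))) [1..<Suc m]))"
      by (rule lead_lprod[OF q]) (rule lead_path_mat[OF q], use c\<sigma> in auto)
    also have "sum_list (map (\<lambda>i. wexp m n i (c (\<sigma> i))) [1..<Suc m]) = mexp m n (unit_exp m (\<lambda>i. c (\<sigma> i)))"
      unfolding m1
      by (subst sum_list_distinct_conv_sum_set) (simp_all add: atLeastLessThanSuc_atLeastAtMost)
    finally show "lead (T.lprod (map (\<lambda>i. path_mat q m n i (c (\<sigma> i))) [1..<Suc m]))
      (mexp m n (unit_exp m (\<lambda>i. c (\<sigma> i))))" .
  qed (use q in simp)
  show ?thesis
    unfolding eq
  proof (rule lead_sum[of _ id])
    show "finite {\<sigma>. \<sigma> permutes {1..m}}" by (rule finite_permutations) simp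
    show "id \<in> {\<sigma>. \<sigma> permutes {1..m}}" by (simp add: permutes_id)
    show "lead (scale_pm ((- q) ^ perm_length m id) (T.lprod (map (\<lambda>i. path_mat q m n i (c (id i))) [1..<Suc m]))) (mexp m n (unit_exp m c))"
      using summand[OF permutes_id] by simp
    fix \<sigma> v assume \<sigma>: "\<sigma> \<in> {\<sigma>. \<sigma> permutes {1..m}} - {id}"
      and v: "v \<in> keys (scale_pm ((- q) ^ perm_length m \<sigma>) (T.lprod (map (\<lambda>i. path_mat q m n i (c (\<sigma> i))) [1..<Suc m])))"
    have "v \<le> mexp m n (unit_exp m (\<lambda>i. c (\<sigma> i)))" using summand[of \<sigma>] \<sigma> v by (simp add: lead_def)
    also have "\<dots> < mexp m n (unit_exp m c)" using \<sigma> c by (intro mexp_permuted_less) auto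
    finally show "v < mexp m n (unit_exp m c)" .
  qed
qed

text \<open>
  The exponents as in the hypotheses are semistandard tableaux of rectangular shape; the columns
  of the tableau are the maximal minors.
\<close>

lemma tableau_lead:
  assumes "e \<in> expo m n"
    and "\<And>i. i \<in> {1..m} \<Longrightarrow> (\<Sum>j\<in>{1..n}. e i j) = r"
    and "\<And>i l. 1 \<le> i \<Longrightarrow> i < m \<Longrightarrow> l \<in> {1..n} \<Longrightarrow> (\<Sum>j\<in>{1..l}. e (Suc i) j) \<le> (\<Sum>j\<in>{1..<l}. e i j)"
  shows "\<exists>p\<in>quantum_grassmannian q m n. lead (\<theta> p) (mexp m n e)"
  using assms
proof (induction r arbitrary: e)
  case 0
  have "e i j = 0" for i j
  proof (cases "i \<in> {1..m} \<and> j \<in> {1..n}")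
    case True
    then show ?thesis using 0(2)[of i] by simp
  next
    case False
    then show ?thesis using 0(1) by (simp add: expo_def)
  qed
  then have "mexp m n e = 0" by (simp add: mexp_def)
  moreover have "\<theta> \<one>\<^bsub>Oq_M q m n\<^esub> = 1" using alg_homD(4)[OF \<theta>] by simp
  ultimately show ?case unfolding quantum_grassmannian_def
    using lead_single[of "1 :: 'k" 0] by (intro bexI[OF _ generated_subalgebra_closed(1)]) simp
next
  case (Suc r)
  \<comment> \<open>The first column of the tableau: in each row the smallest column index that
    occurs.\<close>
  define c where "c i = (LEAST j. 0 < e i j)" for i
  have ex: "\<exists>j. 0 < e i j" if "i \<in> {1..m}" for i
  proof (rule ccontr)
    assume "\<not> (\<exists>j. 0 < e i j)"
    then have "(\<Sum>j\<in>{1..n}. e i j) = 0" by simp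
    then show False using Suc.prems(2)[OF that] by simp
  qed
  have pos: "0 < e i (c i)" if "i \<in> {1..m}" for i unfolding c_def using ex[OF that] by (rule LeastI_ex)
  have least: "e i j = 0" if "j < c i" for i j using not_less_Least[of j "\<lambda>j. 0 < e i j"] that unfolding c_def by simp
  have c1: "c i \<in> {1..n}" if "i \<in> {1..m}" for i
    using pos[OF that] Suc.prems(1) unfolding expo_def by (metis (mono_tags, lifting) less_irrefl mem_Collect_eq)
  have step: "c i < c (Suc i)" if i: "1 \<le> i" "i < m" for i
  proof -
    have Si: "Suc i \<in> {1..m}" using i by simp
    have "0 < e (Suc i) (c (Suc i))" by (rule pos[OF Si])
    also have "\<dots> \<le> (\<Sum>j\<in>{1..c (Suc i)}. e (Suc i) j)" using c1[OF Si] by (intro member_le_sum) auto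
    \<comment> \<open>The inequality at \<open>l = c (Suc i)\<close> forces row i to have a factor
      strictly before this column, so the tableau column is strictly increasing.\<close>
    also have "\<dots> \<le> (\<Sum>j\<in>{1..<c (Suc i)}. e i j)" by (rule Suc.prems(3)[OF i c1[OF Si]])
    finally obtain j where "j < c (Suc i)" "0 < e i j" by (metis atLeastLessThan_iff gr_zeroI less_irrefl sum.neutral)
    then show ?thesis using least[of j i] by (metis leI le_less_trans less_irrefl)
  qed
  have c2: "c i < c k" if "i \<in> {1..m}" "k \<in> {1..m}" "i < k" for i k
    using that
  proof (induction k)
    case (Suc k)
    then have k: "1 \<le> k" "k < m" by auto
    consider "i = k" | "i < k" using Suc.prems by linarith
    then show ?case
    proof cases
      case 2
      then have "c i < c k" using Suc k by simp
      then show ?thesis using step[OF k] by simp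
    qed (use step[OF k] in simp)
  qed simp
  define e' where "e' i j = e i j - unit_exp m c i j" for i j
  have e: "e i j = unit_exp m c i j + e' i j" for i j
    using pos[of i] by (auto simp: e'_def unit_exp_def)
  have "\<exists>p\<in>quantum_grassmannian q m n. lead (\<theta> p) (mexp m n e')"
  proof (rule Suc.IH)
    show "e' \<in> expo m n" using Suc.prems(1) by (auto simp: expo_def e'_def)
    have part: "(\<Sum>j\<in>S. e i j) = (if c i \<in> S then 1 else 0) + (\<Sum>j\<in>S. e' i j)" if "i \<in> {1..m}" "finite S" for i S
    proof -
      have "(\<Sum>j\<in>S. e i j) = (\<Sum>j\<in>S. (if j = c i then 1 else 0) + e' i j)"
        using that by (intro sum.cong refl) (simp add: e unit_exp_def)
      then show ?thesis using that by (simp add: sum.distrib sum.delta)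
    qed
    show "(\<Sum>j\<in>{1..n}. e' i j) = r" if "i \<in> {1..m}" for i
      using part[OF that, of "{1..n}"] c1[OF that] Suc.prems(2)[OF that] by simp
    fix i l assume i: "1 \<le> i" "i < m" and l: "l \<in> {1..n}"
    have im: "i \<in> {1..m}" "Suc i \<in> {1..m}" using i by auto
    show "(\<Sum>j\<in>{1..l}. e' (Suc i) j) \<le> (\<Sum>j\<in>{1..<l}. e' i j)"
    \<comment> \<open>If \<open>c (Suc i) \<le> l\<close>, both sums drop by 1, the right one
      because \<open>c i < c (Suc i)\<close>. Otherwise row i + 1 has no factor in the columns up to
      \<open>l\<close>.\<close>
    proof (cases "c (Suc i) \<le> l")
      case True
      then show ?thesis
        using part[OF im(1), of "{1..<l}"] part[OF im(2), of "{1..l}"] Suc.prems(3)[OF i l] step[OF i] c1[OF im(1)] c1[OF im(2)]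
        by simp
    next
      case False
      then have "(\<Sum>j\<in>{1..l}. e (Suc i) j) = 0" using least[of _ "Suc i"] by simp
      then show ?thesis using part[OF im(2), of "{1..l}"] by simp
    qed
  qed
  then obtain p where p: "p \<in> quantum_grassmannian q m n" "lead (\<theta> p) (mexp m n e')" by blast
  let ?M = "max_qminor q m n (c ` {1..m})"
  have J: "c ` {1..m} \<subseteq> {1..n}" "card (c ` {1..m}) = m"
    using c1 increasing_inj_on[of "{1..m}" c, OF c2] by (auto simp: card_image)
  have M: "?M \<in> quantum_grassmannian q m n"
    unfolding quantum_grassmannian_def using J by (intro generated_subalgebra_closed(3)) blast
  have cl: "?M \<in> carrier (Oq_M q m n)" "p \<in> carrier (Oq_M q m n)"
    using M p(1) quantum_grassmannian_subset[OF q] by (auto simp: coinvariants_def)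
  have "lead (\<theta> (?M \<otimes>\<^bsub>Oq_M q m n\<^esub> p)) (mexp m n (unit_exp m c) + mexp m n e')"
    unfolding alg_homD(2)[OF \<theta> cl] by (intro lead_mult[OF q] lead_max_qminor c1 c2 p)
  moreover have "mexp m n (unit_exp m c) + mexp m n e' = mexp m n e"
  proof -
    have "e = (\<lambda>i j. unit_exp m c i j + e' i j)" by (intro ext) (rule e)
    then show ?thesis by (metis mexp_add)
  qed
  moreover have "?M \<otimes>\<^bsub>Oq_M q m n\<^esub> p \<in> quantum_grassmannian q m n"
    using M p(1) unfolding quantum_grassmannian_def by (rule generated_subalgebra_closed(4))
  ultimately have "lead (\<theta> (?M \<otimes>\<^bsub>Oq_M q m n\<^esub> p)) (mexp m n e)" "?M \<otimes>\<^bsub>Oq_M q m n\<^esub> p \<in> quantum_grassmannian q m n"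
    by simp_all
  then show ?case by (rule bexI)
qed

text \<open>The degree is compared first and bounds every entry. The later induction counts exponent
  matrices, since infinitely many torus exponents lie below a given one.\<close>

lemma finite_expo_less: "finite {e \<in> expo m n. mexp m n e < mexp m n e0}"
proof -
  let ?D = "degree_of m n e0"
  have "e i j \<le> ?D" if "e \<in> expo m n" "mexp m n e < mexp m n e0" for e i j
  proof (cases "i \<in> {1..m} \<and> j \<in> {1..n}")
    case True
    have "e i j \<le> (\<Sum>j\<in>{1..n}. e i j)" using True by (intro member_le_sum) auto
    also have "\<dots> \<le> degree_of m n e" unfolding degree_of_def
      using True by (intro member_le_sum[where f = "\<lambda>i. \<Sum>j\<in>{1..n}. e i j"]) auto
    also have "\<dots> \<le> ?D" using mexp_less_degree[of m n e0 e] that(2) by (meson leI order_less_asym)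
    finally show ?thesis .
  qed (use that(1) in \<open>auto simp: expo_def\<close>)
  then have "case_prod ` {e \<in> expo m n. mexp m n e < mexp m n e0} \<subseteq>
    {f. \<forall>x. (x \<in> {1..m} \<times> {1..n} \<longrightarrow> f x \<in> {..?D}) \<and> (x \<notin> {1..m} \<times> {1..n} \<longrightarrow> f x = 0)}"
    by (auto simp: expo_def)
  moreover have "finite {f :: nat \<times> nat \<Rightarrow> nat. \<forall>x. (x \<in> {1..m} \<times> {1..n} \<longrightarrow> f x \<in> {..?D}) \<and> (x \<notin> {1..m} \<times> {1..n} \<longrightarrow> f x = 0)}"
    by (rule finite_set_of_finite_funs) auto
  ultimately have "finite (case_prod ` {e \<in> expo m n. mexp m n e < mexp m n e0})" by (rule finite_subset)
  then show ?thesis by (rule finite_imageD) (rule inj_onI, drule arg_cong[where f = curry], simp)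
qed

text \<open>The leading term is removed by an element of the quantum grassmannian. The difference is
  again coinvariant, because the quantum grassmannian consists of coinvariants; so the tableau
  inequalities apply to it as well and the process continues.\<close>

theorem coinvariant_standard:
  assumes m: "1 \<le> m" and f: "f \<in> coinvariants (Oq_SL q m) (Oq_M q m n) (SL_coaction q m n)"
  shows "f \<in> quantum_grassmannian q m n"
proof -
  let ?C = "coinvariants (Oq_SL q m) (Oq_M q m n) (SL_coaction q m n)" and ?G = "quantum_grassmannian q m n"
  let ?rs = "rev [1..<Suc m]" and ?ns = "[1..<Suc n]"
  let ?lin = "lin_ext (Oq_M q m n) (A.omon (Z_gen q m n) ?rs ?ns)"
  have rs: "distinct ?rs" "set ?rs = {1..m}" by auto
  have C: "subring ?C (Oq_M q m n)" "x \<in> ?C \<Longrightarrow> c \<odot>\<^bsub>Oq_M q m n\<^esub> x \<in> ?C" "x \<in> ?C \<Longrightarrow> x \<in> carrier (Oq_M q m n)" for x c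
    using coinvariants_subalgebra[OF q, of m n] by (auto simp: subalgebra_def coinvariants_def)
  have lin: "\<exists>c. keys c \<subseteq> expo m n \<and> f = ?lin c" if "f \<in> ?C" for f
    by (rule omon_spanning[OF A.qalg_axioms Z_gen_qmat[OF q] Oq_M_generates rs C(3)[OF that]])
  have leadf: "lead (\<theta> (?lin c)) (mexp m n e0)"
    if c: "keys c \<subseteq> expo m n" "e0 \<in> keys c" "\<forall>e\<in>keys c. mexp m n e \<le> mexp m n e0" for c e0
  proof -
    let ?g = "\<lambda>e. scale_pm (lookup c e) (T.omon (\<lambda>r j. \<theta> (Z_gen q m n r j)) ?rs ?ns e)"
    have g: "lead (?g e) (mexp m n e)" if "e \<in> keys c" for e
    proof (rule lead_scale)
      show "lead (T.omon (\<lambda>r j. \<theta> (Z_gen q m n r j)) ?rs ?ns e) (mexp m n e)"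
        using lead_omon[OF q, of ?rs ?ns "\<lambda>r j. \<theta> (Z_gen q m n r j)" "wexp m n" e] lead_path_mat[OF q]
        by (simp add: \<theta>_Z mexp_def atLeastLessThanSuc_atLeastAtMost)
    qed (use that in \<open>simp add: in_keys_iff\<close>)
    have "\<theta> (?lin c) = (\<Sum>e\<in>keys c. ?g e)"
      unfolding lin_ext_def by (rule hom_sum_omon[OF q \<theta>]) auto
    also have "lead (\<Sum>e\<in>keys c. ?g e) (mexp m n e0)"
    proof (rule lead_sum[where g = ?g and s = e0, OF _ c(2) g[OF c(2)]])
      fix t v assume t: "t \<in> keys c - {e0}" and v: "v \<in> keys (?g t)"
      have "v \<le> mexp m n t" using g[of t] t v by (simp add: lead_def)
      moreover have "mexp m n t \<noteq> mexp m n e0" using mexp_inj[of t m n e0] t c by auto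
      ultimately show "v < mexp m n e0" using c(3) t by (metis DiffD1 le_less_trans order_le_imp_less_or_eq)
    qed simp
    finally show ?thesis .
  qed
  \<comment> \<open>The induction carries an expansion of \<open>f\<close> along, since the row sums
    and the inequalities concern its exponents. It descends on the number of exponent matrices below
    the maximal one.\<close>
  have main: "f \<in> ?G" if "f \<in> ?C" "keys c \<subseteq> expo m n" "f = ?lin c" "e0 \<in> keys c" "\<forall>e\<in>keys c. mexp m n e \<le> mexp m n e0" for f c e0
    using that
  proof (induction "card {e \<in> expo m n. mexp m n e < mexp m n e0}" arbitrary: f c e0 rule: less_induct)
    case (less e0 f c)
    note max = less.prems(5)
    have reps: "\<exists>\<phi> \<Phi>. torus_reps q m n i \<theta> \<phi> \<Phi> \<and> \<Phi> f = \<phi> f" if i: "1 \<le> i" "i < m" for i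
    proof -
      obtain \<phi> \<Phi> where "torus_reps q m n i \<theta> \<phi> \<Phi>" "\<And>f. f \<in> ?C \<Longrightarrow> \<Phi> f = \<phi> f"
        using torus_reps_exist[OF q i \<theta> \<theta>_Z] by blast
      then show ?thesis using less.prems(1) by blast
    qed
    have row: "(\<Sum>j\<in>{1..n}. e (Suc i) j) = (\<Sum>j\<in>{1..n}. e i j)" if i: "1 \<le> i" "i < m" and e: "e \<in> keys c" for e i
    proof -
      obtain \<phi> \<Phi> where "torus_reps q m n i \<theta> \<phi> \<Phi>" "\<Phi> f = \<phi> f" using reps[OF i] by blast
      then show ?thesis using torus_reps.wt_zero_rows[OF _ _ less.prems(3,2) e] by simp
    qed
    \<comment> \<open>Each pair of adjacent rows has its own representations; chaining them gives
      one row sum for each monomial, with row 1 as reference.\<close>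
    have rows: "(\<Sum>j\<in>{1..n}. e r j) = (\<Sum>j\<in>{1..n}. e 1 j)" if e: "e \<in> keys c" and r: "r \<in> {1..m}" for e r
    proof -
      have "1 \<le> r" "r \<le> m" using r by auto
      then show ?thesis
      proof (induction r rule: dec_induct)
        case (step i)
        then show ?case using row[of i e] e by simp
      qed simp
    qed
    have dom: "(\<Sum>j\<in>{1..l}. e0 (Suc i) j) \<le> (\<Sum>j\<in>{1..<l}. e0 i j)" if i: "1 \<le> i" "i < m" and l: "l \<in> {1..n}" for i l
    proof -
      obtain \<phi> \<Phi> where r: "torus_reps q m n i \<theta> \<phi> \<Phi>" "\<Phi> f = \<phi> f" using reps[OF i] by blast
      show ?thesis
        by (rule torus_reps.leading_exponent_dominated[OF r less.prems(3,2,4) _ rows l]) (use max in blast)+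
    qed
    have e0: "e0 \<in> expo m n" using less.prems(2,4) by blast
    obtain p where p: "p \<in> ?G" "lead (\<theta> p) (mexp m n e0)"
      using tableau_lead[OF e0 rows[OF less.prems(4)] dom] by blast
    let ?u = "mexp m n e0"
    define \<kappa> where "\<kappa> = lookup (\<theta> f) ?u / lookup (\<theta> p) ?u"
    let ?f = "f \<oplus>\<^bsub>Oq_M q m n\<^esub> (- \<kappa>) \<odot>\<^bsub>Oq_M q m n\<^esub> p"
    have pC: "p \<in> ?C" using p(1) quantum_grassmannian_subset[OF q] by blast
    note cl = C(3)[OF less.prems(1)] C(3)[OF pC]
    have fC: "?f \<in> ?C" by (rule subringE(7)[OF C(1) less.prems(1) C(2)[OF pC]])
    have lf: "lead (\<theta> f) ?u" unfolding less.prems(3) by (rule leadf[OF less.prems(2,4,5)])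
    have "\<theta> ?f = \<theta> f + scale_pm (- \<kappa>) (\<theta> p)"
      using alg_homD(3)[OF \<theta>, of f "(- \<kappa>) \<odot>\<^bsub>Oq_M q m n\<^esub> p"] alg_homD(5)[OF \<theta>, of p "- \<kappa>"] cl by simp
    then have lk: "lookup (\<theta> ?f) v = lookup (\<theta> f) v - \<kappa> * lookup (\<theta> p) v" for v by (simp add: lookup_minus)
    have "lookup (\<theta> p) ?u \<noteq> 0" using p(2) by (simp add: lead_def in_keys_iff)
    then have u0: "lookup (\<theta> ?f) ?u = 0" unfolding lk by (simp add: \<kappa>_def)
    have above: "lookup (\<theta> ?f) v = 0" if "?u < v" for v
    proof -
      have "v \<notin> keys (\<theta> f)" "v \<notin> keys (\<theta> p)" using lf p(2) that by (auto simp: lead_def dest: leD)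
      then show ?thesis unfolding lk by (simp add: in_keys_iff)
    qed
    have "?f \<in> ?G"
    proof -
      obtain c' where c': "keys c' \<subseteq> expo m n" "?f = ?lin c'" using lin[OF fC] by blast
      show ?thesis
      proof (cases "keys c' = {}")
        case True
        then have "?f = \<zero>\<^bsub>Oq_M q m n\<^esub>" unfolding c'(2) lin_ext_def by simp
        then show ?thesis unfolding quantum_grassmannian_def using generated_subalgebra_closed(2) by simp
      next
        case False
        then have "Max (mexp m n ` keys c') \<in> mexp m n ` keys c'" by (intro Max_in) auto
        then obtain e1 where e1: "e1 \<in> keys c'" "Max (mexp m n ` keys c') = mexp m n e1" by auto
        have max': "\<forall>e\<in>keys c'. mexp m n e \<le> mexp m n e1" unfolding e1(2)[symmetric] by simp
        have "lead (\<theta> ?f) (mexp m n e1)" unfolding c'(2) by (rule leadf[OF c'(1) e1(1) max'])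
        then have "lookup (\<theta> ?f) (mexp m n e1) \<noteq> 0" by (simp add: lead_def in_keys_iff)
        \<comment> \<open>The coefficient at \<open>?u\<close> has been cancelled and none lies
          above it, so the new maximum is strictly smaller.\<close>
        then have lt: "mexp m n e1 < ?u" using u0 above by (metis linorder_cases)
        have "{e \<in> expo m n. mexp m n e < mexp m n e1} \<subset> {e \<in> expo m n. mexp m n e < ?u}"
        proof (rule psubsetI)
          show "{e \<in> expo m n. mexp m n e < mexp m n e1} \<subseteq> {e \<in> expo m n. mexp m n e < ?u}"
            using lt by (auto intro: less_trans)
          have "e1 \<in> {e \<in> expo m n. mexp m n e < ?u}" using lt c'(1) e1(1) by blast
          then show "{e \<in> expo m n. mexp m n e < mexp m n e1} \<noteq> {e \<in> expo m n. mexp m n e < ?u}" by blast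
        qed
        then have "card {e \<in> expo m n. mexp m n e < mexp m n e1} < card {e \<in> expo m n. mexp m n e < ?u}"
          by (rule psubset_card_mono[OF finite_expo_less])
        then show ?thesis by (rule less.hyps[OF _ fC c' e1(1) max'])
      qed
    qed
    moreover have "\<kappa> \<odot>\<^bsub>Oq_M q m n\<^esub> p \<in> ?G"
      using p(1) unfolding quantum_grassmannian_def by (rule generated_subalgebra_closed(6))
    ultimately have "?f \<oplus>\<^bsub>Oq_M q m n\<^esub> \<kappa> \<odot>\<^bsub>Oq_M q m n\<^esub> p \<in> ?G"
      unfolding quantum_grassmannian_def by (rule generated_subalgebra_closed(5))
    moreover have "?f \<oplus>\<^bsub>Oq_M q m n\<^esub> \<kappa> \<odot>\<^bsub>Oq_M q m n\<^esub> p = f"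
      using cl A.smult_l_distr[of p "- \<kappa>" \<kappa>] by (simp add: A.a_assoc)
    ultimately show ?case by simp
  qed
  obtain c where c: "keys c \<subseteq> expo m n" "f = ?lin c" using lin[OF f] by blast
  show ?thesis
  proof (cases "keys c = {}")
    case True
    then have "f = \<zero>\<^bsub>Oq_M q m n\<^esub>" unfolding c(2) lin_ext_def by simp
    then show ?thesis unfolding quantum_grassmannian_def using generated_subalgebra_closed(2) by simp
  next
    case False
    then have "Max (mexp m n ` keys c) \<in> mexp m n ` keys c" by (intro Max_in) auto
    then obtain e0 where e0: "e0 \<in> keys c" "Max (mexp m n ` keys c) = mexp m n e0" by auto
    then have "\<forall>e\<in>keys c. mexp m n e \<le> mexp m n e0" by (metis Max_ge finite_imageI finite_keys imageI)
    then show ?thesis by (rule main[OF f c e0(1)])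
  qed
qed

end

theorem theorem5p2:
  fixes q :: "'k::field" and m n :: nat
  assumes "q \<noteq> 0" and "1 \<le> m" and "m \<le> n"
  shows "left_comodule_algebra (Oq_SL q m) (SL_comult q m) (SL_counit q m)
           (Oq_M q m n) (SL_coaction q m n) \<and>
         coinvariants (Oq_SL q m) (Oq_M q m n) (SL_coaction q m n) = quantum_grassmannian q m n"
proof (intro conjI equalityI subsetI)
  show "left_comodule_algebra (Oq_SL q m) (SL_comult q m) (SL_counit q m) (Oq_M q m n) (SL_coaction q m n)"
    by (rule SL_comodule_algebra[OF assms(1)])
next
  fix f assume f: "f \<in> coinvariants (Oq_SL q m) (Oq_M q m n) (SL_coaction q m n)"
  obtain \<theta> where "\<theta> \<in> alg_hom (Oq_M q m n) (torus q)"
    "\<And>r j. r \<in> {1..m} \<Longrightarrow> j \<in> {1..n} \<Longrightarrow> \<theta> (Z_gen q m n r j) = path_mat q m n r j"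
    using torus_rep_exists[OF assms(1), of m n] by blast
  then show "f \<in> quantum_grassmannian q m n" by (rule coinvariant_standard[OF assms(1) _ _ assms(2) f])
next
  fix f assume "f \<in> quantum_grassmannian q m n"
  then show "f \<in> coinvariants (Oq_SL q m) (Oq_M q m n) (SL_coaction q m n)"
    using quantum_grassmannian_subset[OF assms(1)] by blast
qed

end
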